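(* Let $(R,\mathfrak n)$ be a Noetherian local ring with infinite residue field, let $I_1,\ldots,I_d$ be ideals of $R$, let $J$ be an $\mathfrak n$-primary ideal, and let $N$ be a finitely generated $R$-module such that $I=I_1\cdots I_d\not\subseteq\sqrt{\mathrm{Ann}\,N}$. Set $\overline N=N/(0_N:I^\infty)$ and $q=\dim\overline N$. Let $\Pi$ be the set of prime ideals $\mathfrak p$ of $R$ with $\mathfrak p\in\mathrm{Min}(R/\mathrm{Ann}\,\overline N)$ and $\dim R/\mathfrak p=\dim\overline N$. Then for all non-negative integers $k_0,k_1,\ldots,k_d$ with $k_0+k_1+\cdots+k_d=q-1$, $$e(J^{[k_0+1]},I_1^{[k_1]},\ldots,I_d^{[k_d]};N)=\sum_{\mathfrak p\in\Pi}\ell(N_{\mathfrak p})\,e(J^{[k_0+1]},I_1^{[k_1]},\ldots,I_d^{[k_d]};R/\mathfrak p).$$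
   Context: $0_N:I^\infty=\bigcup_{m\ge0}(0_N:I^m)$. For $\mathbf n=(n_1,\ldots,n_d)$ write $\mathbf I^{\mathbf n}=I_1^{n_1}\cdots I_d^{n_d}$. For a finitely generated $R$-module $L$ with $I\not\subseteq\sqrt{\mathrm{Ann}\,L}$, let $q_L=\dim L/(0_L:I^\infty)$; the function $(n_0,\mathbf n)\mapsto\ell\big(J^{n_0}\mathbf I^{\mathbf n}L/J^{n_0+1}\mathbf I^{\mathbf n}L\big)$ agrees, for all sufficiently large $n_0,n_1,\ldots,n_d$, with a polynomial of total degree $q_L-1$ whose terms of total degree $q_L-1$ are $\sum_{k_0+k_1+\cdots+k_d=q_L-1}e(J^{[k_0+1]},I_1^{[k_1]},\ldots,I_d^{[k_d]};L)\frac{n_0^{k_0}n_1^{k_1}\cdots n_d^{k_d}}{k_0!k_1!\cdots k_d!}$. These coefficients are the mixed multiplicities of $L$ with respect to $J,I_1,\ldots,I_d$ (equivalently, the mixed multiplicities of the $\mathbb N^{d+1}$-graded module $\bigoplus J^{n_0}\mathbf I^{\mathbf n}L/J^{n_0+1}\mathbf I^{\mathbf n}L$). $\ell(N_{\mathfrak p})$ is the length of $N_{\mathfrak p}$ over $R_{\mathfrak p}$. *)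

theory Defs
  imports Complex_Main "HOL-Library.Extended_Nat"
begin

definition ideal :: "'a::comm_ring_1 set \<Rightarrow> bool" where
  "ideal I \<longleftrightarrow> module.subspace (*) I"

definition prime_ideal :: "'a::comm_ring_1 set \<Rightarrow> bool" where
  "prime_ideal P \<longleftrightarrow> ideal P \<and> P \<noteq> UNIV \<and> (\<forall>a b. a * b \<in> P \<longrightarrow> a \<in> P \<or> b \<in> P)"

definition maximal_ideal :: "'a::comm_ring_1 set \<Rightarrow> bool" where
  "maximal_ideal M \<longleftrightarrow> ideal M \<and> M \<noteq> UNIV \<and>
     (\<forall>K. ideal K \<and> M \<subseteq> K \<and> K \<noteq> UNIV \<longrightarrow> K = M)"

definition radical :: "'a::comm_ring_1 set \<Rightarrow> 'a set" where
  "radical I = {x. \<exists>n. x ^ n \<in> I}"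

definition primary_ideal :: "'a::comm_ring_1 set \<Rightarrow> bool" where
  "primary_ideal Q \<longleftrightarrow> ideal Q \<and> Q \<noteq> UNIV \<and>
     (\<forall>a b. a * b \<in> Q \<longrightarrow> a \<notin> Q \<longrightarrow> b \<in> radical Q)"

definition primary_to :: "'a::comm_ring_1 set \<Rightarrow> 'a set \<Rightarrow> bool" where
  "primary_to Q M \<longleftrightarrow> primary_ideal Q \<and> radical Q = M"

definition noetherian_ring :: "'a::comm_ring_1 itself \<Rightarrow> bool" where
  "noetherian_ring _ \<longleftrightarrow>
     (\<forall>C :: nat \<Rightarrow> 'a set. (\<forall>i. ideal (C i)) \<and> incseq C \<longrightarrow> (\<exists>k. \<forall>i\<ge>k. C i = C k))"

definition local_ring_with_max :: "'a::comm_ring_1 set \<Rightarrow> bool" where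
  "local_ring_with_max M \<longleftrightarrow> (\<forall>K. maximal_ideal K \<longleftrightarrow> K = M)"

definition infinite_residue_field :: "'a::comm_ring_1 set \<Rightarrow> bool" where
  "infinite_residue_field M \<longleftrightarrow> infinite (UNIV // {(x, y). x - y \<in> M})"

definition ideal_mult :: "'a::comm_ring_1 set \<Rightarrow> 'a set \<Rightarrow> 'a set" where
  "ideal_mult I K = module.span (*) {a * b |a b. a \<in> I \<and> b \<in> K}"

fun ideal_pow :: "'a::comm_ring_1 set \<Rightarrow> nat \<Rightarrow> 'a set" where
  "ideal_pow I 0 = UNIV"
| "ideal_pow I (Suc n) = ideal_mult (ideal_pow I n) I"

fun ideal_prod_upto :: "(nat \<Rightarrow> 'a::comm_ring_1 set) \<Rightarrow> nat \<Rightarrow> 'a set" where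
  "ideal_prod_upto Is 0 = UNIV"
| "ideal_prod_upto Is (Suc m) = ideal_mult (ideal_prod_upto Is m) (Is (Suc m))"

definition multi_pow :: "(nat \<Rightarrow> 'a::comm_ring_1 set) \<Rightarrow> nat \<Rightarrow> (nat \<Rightarrow> nat) \<Rightarrow> 'a set" where
  "multi_pow Is d n = ideal_prod_upto (\<lambda>i. ideal_pow (Is i) (n i)) d"

section \<open>Modules, presented as subquotients A/B of an ambient R-module\<close>

definition ideal_smult :: "('a::comm_ring_1 \<Rightarrow> 'b::ab_group_add \<Rightarrow> 'b) \<Rightarrow> 'a set \<Rightarrow> 'b set \<Rightarrow> 'b set" where
  "ideal_smult scale I A = module.span scale {scale r a |r a. r \<in> I \<and> a \<in> A}"

definition ann :: "('a::comm_ring_1 \<Rightarrow> 'b::ab_group_add \<Rightarrow> 'b) \<Rightarrow> 'b set \<Rightarrow> 'b set \<Rightarrow> 'a set" where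
  "ann scale A B = {r. \<forall>a\<in>A. scale r a \<in> B}"

text \<open>For L = A/B, the submodule (0_L : I^\<infinity>) of L corresponds to the set
  (B :_A I^\<infinity>) = {a in A. I^m a \<subseteq> B for some m}; hence L/(0_L:I^\<infinity>) = A/(colon_inf).\<close>
definition colon_inf :: "('a::comm_ring_1 \<Rightarrow> 'b::ab_group_add \<Rightarrow> 'b) \<Rightarrow> 'a set \<Rightarrow> 'b set \<Rightarrow> 'b set \<Rightarrow> 'b set" where
  "colon_inf scale I A B = {a \<in> A. \<exists>m. \<forall>r\<in>ideal_pow I m. scale r a \<in> B}"

definition chain_len :: "('x set \<Rightarrow> bool) \<Rightarrow> enat" where
  "chain_len P = (SUP k \<in> {k. \<exists>C::nat \<Rightarrow> 'x set. (\<forall>i\<le>k. P (C i)) \<and> (\<forall>i<k. C i \<subset> C (Suc i))}. enat k)"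

definition mod_length :: "('a::comm_ring_1 \<Rightarrow> 'b::ab_group_add \<Rightarrow> 'b) \<Rightarrow> 'b set \<Rightarrow> 'b set \<Rightarrow> enat" where
  "mod_length scale A B = chain_len (\<lambda>X. module.subspace scale X \<and> B \<subseteq> X \<and> X \<subseteq> A)"

definition krull_dim_above :: "'a::comm_ring_1 set \<Rightarrow> enat" where
  "krull_dim_above X = chain_len (\<lambda>P. prime_ideal P \<and> X \<subseteq> P)"

definition mod_dim :: "('a::comm_ring_1 \<Rightarrow> 'b::ab_group_add \<Rightarrow> 'b) \<Rightarrow> 'b set \<Rightarrow> 'b set \<Rightarrow> enat" where
  "mod_dim scale A B = krull_dim_above (ann scale A B)"

definition minimal_prime_over :: "'a::comm_ring_1 set \<Rightarrow> 'a set \<Rightarrow> bool" where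
  "minimal_prime_over X P \<longleftrightarrow> prime_ideal P \<and> X \<subseteq> P \<and>
     (\<forall>P'. prime_ideal P' \<and> X \<subseteq> P' \<and> P' \<subseteq> P \<longrightarrow> P' = P)"

text \<open>Elements of (A/B)_p are classes of pairs (a, s), a in A, s not in p, under
  (a,s) ~ (a',s') iff u (s' a - s a') in B for some u not in p.
  An R_p-submodule of (A/B)_p is encoded by the (saturated) set of all representing pairs.\<close>
definition loc_rel :: "('a::comm_ring_1 \<Rightarrow> 'b::ab_group_add \<Rightarrow> 'b) \<Rightarrow> 'a set \<Rightarrow> 'b set \<Rightarrow> ('b \<times> 'a) \<Rightarrow> ('b \<times> 'a) \<Rightarrow> bool" where
  "loc_rel scale p B x y \<longleftrightarrow>
     (\<exists>u. u \<notin> p \<and> scale u (scale (snd y) (fst x) - scale (snd x) (fst y)) \<in> B)"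

definition loc_submodule :: "('a::comm_ring_1 \<Rightarrow> 'b::ab_group_add \<Rightarrow> 'b) \<Rightarrow> 'a set \<Rightarrow> 'b set \<Rightarrow> 'b set \<Rightarrow> ('b \<times> 'a) set \<Rightarrow> bool" where
  "loc_submodule scale p A B U \<longleftrightarrow>
     U \<subseteq> A \<times> (- p) \<and>
     (0, 1) \<in> U \<and>
     (\<forall>a s a' s'. (a, s) \<in> U \<and> (a', s') \<in> U \<longrightarrow> (scale s' a + scale s a', s * s') \<in> U) \<and>
     (\<forall>a s r t. (a, s) \<in> U \<and> t \<notin> p \<longrightarrow> (scale r a, t * s) \<in> U) \<and>
     (\<forall>x y. x \<in> U \<and> y \<in> A \<times> (- p) \<and> loc_rel scale p B x y \<longrightarrow> y \<in> U)"

definition loc_length :: "('a::comm_ring_1 \<Rightarrow> 'b::ab_group_add \<Rightarrow> 'b) \<Rightarrow> 'a set \<Rightarrow> 'b set \<Rightarrow> 'b set \<Rightarrow> enat" where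
  "loc_length scale p A B = chain_len (loc_submodule scale p A B)"

definition sum_sets :: "'b::ab_group_add set \<Rightarrow> 'b set \<Rightarrow> 'b set" where
  "sum_sets X Y = {x + y |x y. x \<in> X \<and> y \<in> Y}"

text \<open>Hilbert function (n0, n) \<mapsto> length(J^n0 I^n L / J^(n0+1) I^n L) for L = A/B,
  where J^n0 I^n L = (J^n0 I^n A + B)/B.\<close>
definition hilb :: "('a::comm_ring_1 \<Rightarrow> 'b::ab_group_add \<Rightarrow> 'b) \<Rightarrow> 'b set \<Rightarrow> 'b set \<Rightarrow>
    'a set \<Rightarrow> (nat \<Rightarrow> 'a set) \<Rightarrow> nat \<Rightarrow> nat \<Rightarrow> (nat \<Rightarrow> nat) \<Rightarrow> enat" where
  "hilb scale A B J Is d n0 n =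
     mod_length scale
       (sum_sets (ideal_smult scale (ideal_mult (ideal_pow J n0) (multi_pow Is d n)) A) B)
       (sum_sets (ideal_smult scale (ideal_mult (ideal_pow J (Suc n0)) (multi_pow Is d n)) A) B)"

definition mono_exps :: "nat \<Rightarrow> nat \<Rightarrow> (nat \<times> (nat \<Rightarrow> nat)) set" where
  "mono_exps d D = {(a0, a). (\<forall>i. i \<notin> {1..d} \<longrightarrow> a i = 0) \<and> a0 + (\<Sum>i=1..d. a i) \<le> D}"

definition poly_monos :: "nat \<Rightarrow> nat \<Rightarrow> (nat \<times> (nat \<Rightarrow> nat)) set" where
  "poly_monos d q = (if q = 0 then {} else mono_exps d (q - 1))"

definition eval_mpoly :: "nat \<Rightarrow> nat \<Rightarrow> (nat \<times> (nat \<Rightarrow> nat) \<Rightarrow> real) \<Rightarrow> nat \<Rightarrow> (nat \<Rightarrow> nat) \<Rightarrow> real" where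
  "eval_mpoly d q c n0 n =
     (\<Sum>\<alpha>\<in>poly_monos d q. c \<alpha> * real n0 ^ fst \<alpha> * (\<Prod>i=1..d. real (n i) ^ snd \<alpha> i))"

definition q_L :: "('a::comm_ring_1 \<Rightarrow> 'b::ab_group_add \<Rightarrow> 'b) \<Rightarrow> 'b set \<Rightarrow> 'b set \<Rightarrow> (nat \<Rightarrow> 'a set) \<Rightarrow> nat \<Rightarrow> nat" where
  "q_L scale A B Is d = the_enat (mod_dim scale A (colon_inf scale (ideal_prod_upto Is d) A B))"

text \<open>e(J^[k0+1], I_1^[k_1], ..., I_d^[k_d]; A/B): k0! k_1! ... k_d! times the coefficient of
  n0^k0 n_1^k_1 ... n_d^k_d in the polynomial of total degree q_L - 1 agreeing with the
  Hilbert function for all large n0, n_1, ..., n_d.\<close>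
definition mixed_mult :: "('a::comm_ring_1 \<Rightarrow> 'b::ab_group_add \<Rightarrow> 'b) \<Rightarrow> 'b set \<Rightarrow> 'b set \<Rightarrow>
    'a set \<Rightarrow> (nat \<Rightarrow> 'a set) \<Rightarrow> nat \<Rightarrow> nat \<Rightarrow> (nat \<Rightarrow> nat) \<Rightarrow> real" where
  "mixed_mult scale A B J Is d k0 k =
     (THE e. \<exists>c. (\<forall>\<alpha>. \<alpha> \<notin> poly_monos d (q_L scale A B Is d) \<longrightarrow> c \<alpha> = 0) \<and>
        (\<exists>M. \<forall>n0 n. M \<le> n0 \<and> (\<forall>i\<in>{1..d}. M \<le> n i) \<longrightarrow>
            hilb scale A B J Is d n0 n \<noteq> \<infinity> \<and>
            real (the_enat (hilb scale A B J Is d n0 n)) = eval_mpoly d (q_L scale A B Is d) c n0 n) \<and>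
        e = c (k0, (\<lambda>i. if i \<in> {1..d} then k i else 0)) * fact k0 * (\<Prod>i=1..d. fact (k i)))"

end

theory Submission
  imports Defs "HOL-Library.Function_Algebras"
begin

text \<open>
  Write \<open>I\<^sub>0 = J\<close> and \<open>h\<^sub>L\<close> for the Hilbert function of \<open>L\<close>. A graded module over the multi-Rees
  algebra is represented by a family \<open>(A\<^sub>n)\<close> of submodules of one ambient module with
  \<open>I\<^sub>i A\<^sub>n \<subseteq> A\<^bsub>n + e\<^sub>i\<^esub>\<close>, so that every length in sight is exactly additive. Families satisfy the ascending
  chain condition, which yields Artin--Rees and, by Noetherian induction, the polynomiality of
  Hilbert functions.

  The degree bound comes from a linear Artin--Rees estimate: \<open>J\<^bsup>s|n|+m\<^esup> L \<inter> I\<^sup>n L \<subseteq> J\<^sup>m I\<^sup>n L\<close> with \<open>s\<close>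
  independent of \<open>n\<close> and \<open>m\<close>. Sums of \<open>h\<^sub>L\<close> over a long ray in the direction \<open>e\<^sub>0\<close> are therefore bounded by
  the Hilbert--Samuel function of \<open>L\<close>, which grows like a power with exponent \<open>dim L\<close>. Additivity of \<open>h\<close>
  for \<open>L' \<subseteq> L\<close> up to lower degree compares the families \<open>G = (J\<^bsup>n\<^sub>0\<^esup> I\<^sup>n L')\<close> and
  \<open>E = (L' \<inter> J\<^bsup>n\<^sub>0\<^esup> I\<^sup>n L)\<close>: a shift of \<open>E\<close> lies in \<open>G\<close>, and both inclusions can only increase ray sums up
  to lower order, while shifting does not change the leading form. The formula then follows from a
  filtration of \<open>N\<close> with factors \<open>R/p\<close>, in which \<open>R/p\<close> occurs \<open>length N\<^sub>p\<close> times for every relevant \<open>p\<close>.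
\<close>

section \<open>Polynomial functions of several natural variables\<close>

text \<open>The filtration of L induces on a submodule L' the traces L' \<inter> J^n0 I^n L, not the
  modules J^n0 I^n L', and lengths of single layers of the two filtrations satisfy no inequality.
  Blocks of consecutive layers do, up to boundary layers, and a block is what a sum in the direction
  e_0 computes, J being the ideal that makes layers finite. Hence degrees are read off from sums
  along rays, by a criterion that also covers polynomials without a fixed sign. The ideals I_i may
  be arbitrary, which has two effects. The I-power torsion of N meets J^n0 I^n N trivially for large
  exponents, so degrees are governed by the dimension of N modulo torsion. And a factor R/p with I
  \<subseteq> p may occur in the filtration of N, but its Hilbert polynomial is zero. Dimension is
  defined by chains of primes. Two facts tie it to growth: a strict inclusion of primes lowers every
  exponent bounding a Hilbert-Samuel function, so dimensions are finite; conversely the dimension of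
  R/p is itself such an exponent.\<close>

definition monomial :: "nat \<Rightarrow> (nat \<Rightarrow> nat) \<Rightarrow> (nat \<Rightarrow> nat) \<Rightarrow> real" where
  "monomial d \<alpha> n = (\<Prod>i\<le>d. real (n i) ^ \<alpha> i)"

definition tdeg :: "nat \<Rightarrow> (nat \<Rightarrow> nat) \<Rightarrow> nat" where
  "tdeg d \<alpha> = (\<Sum>i\<le>d. \<alpha> i)"

text \<open>Only the coordinates up to \<open>d\<close> enter \<open>monomial\<close>. Requiring the
  other exponents to vanish is what makes the coefficients of a polynomial function unique.\<close>

definition poly_coeffs :: "nat \<Rightarrow> ((nat \<Rightarrow> nat) \<Rightarrow> real) \<Rightarrow> bool" where
  "poly_coeffs d c \<longleftrightarrow> finite {\<alpha>. c \<alpha> \<noteq> 0} \<and> (\<forall>\<alpha>. c \<alpha> \<noteq> 0 \<longrightarrow> (\<forall>i>d. \<alpha> i = 0))"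

definition peval :: "nat \<Rightarrow> ((nat \<Rightarrow> nat) \<Rightarrow> real) \<Rightarrow> (nat \<Rightarrow> nat) \<Rightarrow> real" where
  "peval d c n = (\<Sum>\<alpha> | c \<alpha> \<noteq> 0. c \<alpha> * monomial d \<alpha> n)"

text \<open>The strict bound avoids assigning a degree to zero: \<open>deg_less d c 0\<close> says
  that \<open>c\<close> vanishes, which is the correct bound in dimension 0.\<close>

definition deg_less :: "nat \<Rightarrow> ((nat \<Rightarrow> nat) \<Rightarrow> real) \<Rightarrow> nat \<Rightarrow> bool" where
  "deg_less d c k \<longleftrightarrow> (\<forall>\<alpha>. c \<alpha> \<noteq> 0 \<longrightarrow> tdeg d \<alpha> < k)"

lemma peval_superset:
  assumes "finite A" "\<And>\<alpha>. c \<alpha> \<noteq> 0 \<Longrightarrow> \<alpha> \<in> A"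
  shows "peval d c n = (\<Sum>\<alpha>\<in>A. c \<alpha> * monomial d \<alpha> n)"
  unfolding peval_def by (rule sum.mono_neutral_left) (use assms in auto)

lemma poly_coeffs_add:
  "poly_coeffs d b \<Longrightarrow> poly_coeffs d c \<Longrightarrow> poly_coeffs d (\<lambda>\<alpha>. b \<alpha> + c \<alpha>)"
  unfolding poly_coeffs_def
  by (intro conjI, rule finite_subset[of _ "{\<alpha>. b \<alpha> \<noteq> 0} \<union> {\<alpha>. c \<alpha> \<noteq> 0}"])
    (auto, metis add.right_neutral)

lemma poly_coeffs_scale: "poly_coeffs d c \<Longrightarrow> poly_coeffs d (\<lambda>\<alpha>. r * c \<alpha>)"
  unfolding poly_coeffs_def by (auto intro: finite_subset[of _ "{\<alpha>. c \<alpha> \<noteq> 0}"])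

lemma poly_coeffs_zero [simp]: "poly_coeffs d (\<lambda>\<alpha>. 0)"
  by (simp add: poly_coeffs_def)

lemma peval_zero [simp]: "peval d (\<lambda>\<alpha>. 0) n = 0"
  by (simp add: peval_def)

lemma peval_add:
  assumes "poly_coeffs d b" "poly_coeffs d c"
  shows "peval d (\<lambda>\<alpha>. b \<alpha> + c \<alpha>) n = peval d b n + peval d c n"
proof -
  let ?A = "{\<alpha>. b \<alpha> \<noteq> 0} \<union> {\<alpha>. c \<alpha> \<noteq> 0}"
  have fin: "finite ?A" using assms by (auto simp: poly_coeffs_def)
  have 1: "peval d (\<lambda>\<alpha>. b \<alpha> + c \<alpha>) n = (\<Sum>\<alpha>\<in>?A. (b \<alpha> + c \<alpha>) * monomial d \<alpha> n)"
    by (rule peval_superset[OF fin]) auto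
  have 2: "peval d b n = (\<Sum>\<alpha>\<in>?A. b \<alpha> * monomial d \<alpha> n)"
    by (rule peval_superset[OF fin]) auto
  have 3: "peval d c n = (\<Sum>\<alpha>\<in>?A. c \<alpha> * monomial d \<alpha> n)"
    by (rule peval_superset[OF fin]) auto
  show ?thesis unfolding 1 2 3 by (simp add: distrib_right sum.distrib)
qed

lemma peval_scale:
  assumes "poly_coeffs d c"
  shows "peval d (\<lambda>\<alpha>. r * c \<alpha>) n = r * peval d c n"
proof -
  have fin: "finite {\<alpha>. c \<alpha> \<noteq> 0}" using assms by (auto simp: poly_coeffs_def)
  have 1: "peval d (\<lambda>\<alpha>. r * c \<alpha>) n = (\<Sum>\<alpha> | c \<alpha> \<noteq> 0. r * c \<alpha> * monomial d \<alpha> n)"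
    by (rule peval_superset[OF fin]) auto
  show ?thesis unfolding 1 by (simp add: peval_def sum_distrib_left mult.assoc)
qed

lemma deg_less_add: "deg_less d b k \<Longrightarrow> deg_less d c k \<Longrightarrow> deg_less d (\<lambda>\<alpha>. b \<alpha> + c \<alpha>) k"
  unfolding deg_less_def by (metis add.right_neutral add_cancel_right_left)

text \<open>A description free of coefficients, convenient for closure under products, powers and
  partial sums; \<open>poly_fun_coeffs\<close> recovers the coefficients.\<close>

inductive poly_fun :: "nat \<Rightarrow> ((nat \<Rightarrow> nat) \<Rightarrow> real) \<Rightarrow> bool" for d where
  mono: "(\<forall>i>d. \<alpha> i = 0) \<Longrightarrow> poly_fun d (\<lambda>n. r * monomial d \<alpha> n)"
| add: "poly_fun d f \<Longrightarrow> poly_fun d g \<Longrightarrow> poly_fun d (\<lambda>n. f n + g n)"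

lemma poly_fun_const: "poly_fun d (\<lambda>n. r)"
  using poly_fun.mono[of d "\<lambda>_. 0" r] by (simp add: monomial_def)

lemma poly_fun_coord: assumes "i \<le> d" shows "poly_fun d (\<lambda>n. real (n i))"
proof -
  have "monomial d (\<lambda>j. if j = i then 1 else 0) n = real (n i)" for n
    unfolding monomial_def using assms
    by (subst prod.remove[of _ i]) (auto intro: prod.neutral)
  then show ?thesis
    using poly_fun.mono[of d "\<lambda>j. if j = i then 1 else 0" 1] assms by simp
qed

lemma poly_fun_mult:
  assumes "poly_fun d f" "poly_fun d g" shows "poly_fun d (\<lambda>n. f n * g n)"
  using assms(1)
proof induction
  case (mono \<alpha> r)
  show ?case using assms(2)
  proof induction
    case (mono \<beta> s)
    have "r * monomial d \<alpha> n * (s * monomial d \<beta> n) = (r * s) * monomial d (\<lambda>i. \<alpha> i + \<beta> i) n" for n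
      by (simp add: monomial_def power_add prod.distrib)
    then have "(\<lambda>n. r * monomial d \<alpha> n * (s * monomial d \<beta> n)) = (\<lambda>n. (r * s) * monomial d (\<lambda>i. \<alpha> i + \<beta> i) n)"
      by blast
    then show ?case
      using poly_fun.mono[of d "\<lambda>i. \<alpha> i + \<beta> i" "r * s"] mono \<open>\<forall>i>d. \<alpha> i = 0\<close> by (simp del: mult_eq_0_iff)
  next
    case (add f g)
    then show ?case using poly_fun.add[OF add.IH] by (simp add: distrib_left)
  qed
next
  case (add f g)
  then show ?case using poly_fun.add[OF add.IH] by (simp add: distrib_right)
qed

lemma poly_fun_sum: "(\<And>x. x \<in> A \<Longrightarrow> poly_fun d (f x)) \<Longrightarrow> poly_fun d (\<lambda>n. \<Sum>x\<in>A. f x n)"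
  by (induction A rule: infinite_finite_induct) (auto intro: poly_fun_const poly_fun.add)

lemma poly_fun_prod: "(\<And>x. x \<in> A \<Longrightarrow> poly_fun d (f x)) \<Longrightarrow> poly_fun d (\<lambda>n. \<Prod>x\<in>A. f x n)"
  by (induction A rule: infinite_finite_induct) (auto intro: poly_fun_const poly_fun_mult)

lemma poly_fun_power: "poly_fun d f \<Longrightarrow> poly_fun d (\<lambda>n. f n ^ k)"
  by (induction k) (auto intro: poly_fun_const poly_fun_mult)

lemma poly_fun_coeffs: "poly_fun d f \<Longrightarrow> \<exists>c. poly_coeffs d c \<and> f = peval d c"
proof (induction rule: poly_fun.induct)
  case (mono \<alpha> r)
  let ?c = "\<lambda>\<beta>. if \<beta> = \<alpha> then r else 0"
  have "poly_coeffs d ?c" using mono by (auto simp: poly_coeffs_def)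
  moreover have "peval d ?c n = r * monomial d \<alpha> n" for n
    by (subst peval_superset[of "{\<alpha>}"]) (auto split: if_splits)
  ultimately show ?case by (intro exI[of _ ?c]) auto
next
  case (add f g)
  then obtain b c where "poly_coeffs d b" "f = peval d b" "poly_coeffs d c" "g = peval d c" by blast
  then show ?case
    by (intro exI[of _ "\<lambda>\<alpha>. b \<alpha> + c \<alpha>"]) (auto simp: poly_coeffs_add peval_add)
qed

lemma peval_poly_fun: "poly_coeffs d c \<Longrightarrow> poly_fun d (peval d c)"
  unfolding peval_def[abs_def]
  by (rule poly_fun_sum, rule poly_fun.mono) (auto simp: poly_coeffs_def)

text \<open>The differences (j+1)^(k+1) - j^(k+1) telescope to n^(k+1). Their binomial expansion
  contains the k-th power sum with factor k+1 and otherwise lower power sums, known by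
  induction.\<close>

lemma power_sum_poly: "\<exists>b :: nat \<Rightarrow> real. \<forall>n. (\<Sum>j<n. real j ^ k) = (\<Sum>i\<le>Suc k. b i * real n ^ i)"
proof (induction k rule: less_induct)
  case (less k)
  then obtain b :: "nat \<Rightarrow> nat \<Rightarrow> real"
    where b: "\<And>l n. l < k \<Longrightarrow> (\<Sum>j<n. real j ^ l) = (\<Sum>i\<le>Suc l. b l i * real n ^ i)"
    by metis
  \<comment> \<open>Padding with zeros gives all lower power sums the common summation range up to
    \<open>Suc k\<close>.\<close>
  define B where "B l i = (if i \<le> Suc l then b l i else 0)" for l i
  have b': "(\<Sum>j<n. real j ^ l) = (\<Sum>i\<le>Suc k. B l i * real n ^ i)" if "l < k" for l n
    unfolding b[OF that] using that
    by (intro sum.mono_neutral_cong_left) (auto simp: B_def)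
  have binom: "real (Suc j) ^ Suc k - real j ^ Suc k
      = real (Suc k) * real j ^ k + (\<Sum>l<k. real (Suc k choose l) * real j ^ l)" for j
  proof -
    have "real (Suc j) ^ Suc k = (\<Sum>l\<le>Suc k. real (Suc k choose l) * real j ^ l)"
      using binomial_ring[of "real j" 1 "Suc k"] by (simp add: add.commute)
    also have "\<dots> = (\<Sum>l<k. real (Suc k choose l) * real j ^ l) + real (Suc k) * real j ^ k + real j ^ Suc k"
      by (simp add: lessThan_Suc_atMost[symmetric])
    finally show ?thesis by simp
  qed
  have "real n ^ Suc k = (\<Sum>j<n. real (Suc j) ^ Suc k - real j ^ Suc k)" for n
    by (subst sum_lessThan_telescope) simp
  then have tel: "real n ^ Suc k = real (Suc k) * (\<Sum>j<n. real j ^ k)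
      + (\<Sum>l<k. real (Suc k choose l) * (\<Sum>j<n. real j ^ l))" for n
    unfolding binom
    by (simp add: sum.distrib sum_distrib_left) (rule sum.swap)
  then have eq: "(\<Sum>j<n. real j ^ k)
      = (real n ^ Suc k - (\<Sum>l<k. real (Suc k choose l) * (\<Sum>i\<le>Suc k. B l i * real n ^ i))) / real (Suc k)" for n
  proof -
    have "(\<Sum>l<k. real (Suc k choose l) * (\<Sum>j<n. real j ^ l))
        = (\<Sum>l<k. real (Suc k choose l) * (\<Sum>i\<le>Suc k. B l i * real n ^ i))" (is "?X = ?Y")
      using b' by (intro sum.cong) auto
    moreover have "real n ^ Suc k = real (Suc k) * (\<Sum>j<n. real j ^ k) + ?X"
      using tel[of n] .
    ultimately have "(\<Sum>j<n. real j ^ k) * real (Suc k) = real n ^ Suc k - ?Y" by (simp only: mult.commute)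
    then show ?thesis
      by (subst nonzero_eq_divide_eq) (simp_all only: of_nat_eq_0_iff nat.distinct not_False_eq_True)
  qed
  define \<beta> where "\<beta> i = ((if i = Suc k then 1 else 0) - (\<Sum>l<k. real (Suc k choose l) * B l i)) / real (Suc k)" for i
  have "(\<Sum>j<n. real j ^ k) = (\<Sum>i\<le>Suc k. \<beta> i * real n ^ i)" for n
  proof -
    have 1: "(\<Sum>l<k. real (Suc k choose l) * (\<Sum>i\<le>Suc k. B l i * real n ^ i))
       = (\<Sum>i\<le>Suc k. (\<Sum>l<k. real (Suc k choose l) * B l i) * real n ^ i)"
      unfolding sum_distrib_left sum_distrib_right by (subst sum.swap) (simp add: mult.assoc)
    have 2: "real n ^ Suc k = (\<Sum>i\<le>Suc k. (if i = Suc k then 1 else 0) * real n ^ i)"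
      by (simp add: if_distrib[of "\<lambda>x. x * _"] cong: if_cong)
    have "(\<Sum>i\<le>Suc k. \<beta> i * real n ^ i) * real (Suc k)
      = (\<Sum>i\<le>Suc k. (if i = Suc k then 1 else 0) * real n ^ i - (\<Sum>l<k. real (Suc k choose l) * B l i) * real n ^ i)"
      unfolding sum_distrib_right[of "\<lambda>i. \<beta> i * real n ^ i"]
    proof (rule sum.cong[OF refl])
      fix i
      have "\<beta> i * real (Suc k) = (if i = Suc k then 1 else 0) - (\<Sum>l<k. real (Suc k choose l) * B l i)"
        unfolding \<beta>_def by (simp del: of_nat_Suc)
      moreover have "\<beta> i * real n ^ i * real (Suc k) = (\<beta> i * real (Suc k)) * real n ^ i"
        by (simp only: mult_ac)
      ultimately show "\<beta> i * real n ^ i * real (Suc k) = (if i = Suc k then 1 else 0) * real n ^ i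
          - (\<Sum>l<k. real (Suc k choose l) * B l i) * real n ^ i"
        by (simp only: left_diff_distrib)
    qed
    also have "\<dots> = real n ^ Suc k - (\<Sum>l<k. real (Suc k choose l) * (\<Sum>i\<le>Suc k. B l i * real n ^ i))"
      by (simp only: sum_subtractf 1 flip: 2)
    finally have "(\<Sum>i\<le>Suc k. \<beta> i * real n ^ i)
        = (real n ^ Suc k - (\<Sum>l<k. real (Suc k choose l) * (\<Sum>i\<le>Suc k. B l i * real n ^ i))) / real (Suc k)"
      by (subst nonzero_eq_divide_eq) (simp_all only: of_nat_eq_0_iff nat.distinct not_False_eq_True)
    with eq[of n] show ?thesis by (rule trans[OF _ sym])
  qed
  then show ?case by (intro exI[of _ \<beta>] allI)
qed

lemma poly_fun_power_sum: assumes "i \<le> d" shows "poly_fun d (\<lambda>n. \<Sum>j<n i. real j ^ k)"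
proof -
  obtain b :: "nat \<Rightarrow> real" where b: "\<And>n. (\<Sum>j<n. real j ^ k) = (\<Sum>i\<le>Suc k. b i * real n ^ i)"
    using power_sum_poly by metis
  show ?thesis unfolding b
    by (intro poly_fun_sum poly_fun_mult poly_fun_const poly_fun_power poly_fun_coord assms)
qed

text \<open>A corner of the box between \<open>(M,...,M)\<close> and \<open>n\<close>, for
  telescoping one coordinate at a time. With \<open>M = 0\<close> it truncates an exponent to the
  coordinates in \<open>S\<close>.\<close>

definition upd_on :: "nat set \<Rightarrow> nat \<Rightarrow> (nat \<Rightarrow> nat) \<Rightarrow> nat \<Rightarrow> nat" where
  "upd_on S M n = (\<lambda>i. if i \<in> S then n i else M)"

text \<open>A monomial factors into a power of coordinate \<open>i\<close>, whose sum is a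
  difference of two power sums, and a part free of \<open>i\<close>, in which the coordinates
  outside \<open>S\<close> are the constant \<open>M\<close>.\<close>

lemma poly_fun_partial_sum:
  assumes "poly_fun d f" "i \<le> d" "i \<notin> S"
  shows "\<exists>g. poly_fun d g \<and> (\<forall>n. M \<le> n i \<longrightarrow> (\<Sum>j=M..<n i. f ((upd_on S M n)(i := j))) = g n)"
  using assms(1)
proof induction
  case (mono \<alpha> r)
  define g where "g n = r * (\<Prod>l\<in>{..d}-{i}. (if l \<in> S then real (n l) else real M) ^ \<alpha> l)
     * ((\<Sum>j<n i. real j ^ \<alpha> i) + - (\<Sum>j<M. real j ^ \<alpha> i))" for n :: "nat \<Rightarrow> nat"
  have "poly_fun d (\<lambda>n. if l \<in> S then real (n l) else real M)" if "l \<in> {..d} - {i}" for l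
    using that by (cases "l \<in> S") (auto intro: poly_fun_coord poly_fun_const)
  moreover have "poly_fun d (\<lambda>n. (\<Sum>j<n i. real j ^ \<alpha> i) + - (\<Sum>j<M. real j ^ \<alpha> i))"
    by (intro poly_fun.add poly_fun_const poly_fun_power_sum assms(2))
  ultimately have "poly_fun d g"
    unfolding g_def[abs_def]
    by (intro poly_fun_mult poly_fun_const poly_fun_prod poly_fun_power)
  moreover have "(\<Sum>j=M..<n i. r * monomial d \<alpha> ((upd_on S M n)(i := j))) = g n" if "M \<le> n i" for n
  proof -
    have "monomial d \<alpha> ((upd_on S M n)(i := j))
        = real j ^ \<alpha> i * (\<Prod>l\<in>{..d}-{i}. (if l \<in> S then real (n l) else real M) ^ \<alpha> l)" for j
      unfolding monomial_def using assms(2)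
      by (subst prod.remove[of _ i]) (auto simp: upd_on_def if_distrib[of real] intro!: prod.cong)
    moreover have "(\<Sum>j=M..<n i. real j ^ \<alpha> i) = (\<Sum>j<n i. real j ^ \<alpha> i) - (\<Sum>j<M. real j ^ \<alpha> i)"
      using sum_diff_nat_ivl[of 0 M "n i" "\<lambda>j. real j ^ \<alpha> i"] that by (simp add: atLeast0LessThan)
    ultimately show ?thesis
      by (simp add: g_def sum_distrib_left[symmetric] sum_distrib_right[symmetric] mult.assoc)
  qed
  ultimately show ?case by blast
next
  case (add f g)
  then obtain f' g' where "poly_fun d f'" "poly_fun d g'"
    "\<forall>n. M \<le> n i \<longrightarrow> (\<Sum>j=M..<n i. f ((upd_on S M n)(i := j))) = f' n"
    "\<forall>n. M \<le> n i \<longrightarrow> (\<Sum>j=M..<n i. g ((upd_on S M n)(i := j))) = g' n" by blast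
  then show ?case
    by (intro exI[of _ "\<lambda>n. f' n + g' n"]) (simp del: fun_upd_apply add: sum.distrib poly_fun.add)
qed

section \<open>Recovering a polynomial from its differences\<close>

definition unit_exp :: "nat \<Rightarrow> nat \<Rightarrow> nat" where
  "unit_exp i = (\<lambda>j. if j = i then 1 else 0)"

definition eventually_poly :: "nat \<Rightarrow> ((nat \<Rightarrow> nat) \<Rightarrow> real) \<Rightarrow> ((nat \<Rightarrow> nat) \<Rightarrow> real) \<Rightarrow> bool" where
  "eventually_poly d f c \<longleftrightarrow> poly_coeffs d c \<and> (\<exists>M. \<forall>n. (\<forall>i\<le>d. M \<le> n i) \<longrightarrow> f n = peval d c n)"

text \<open>Telescoping from \<open>(M,\<dots>,M)\<close> one coordinate at a time recovers \<open>f\<close> from its differences.\<close>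

lemma eventually_poly_of_differences:
  assumes inv: "\<And>n m. (\<forall>i\<le>d. n i = m i) \<Longrightarrow> f n = f m"
    and diff: "\<And>i. i \<le> d \<Longrightarrow> \<exists>c. eventually_poly d (\<lambda>n. f (n + unit_exp i) - f n) c"
  shows "\<exists>c. eventually_poly d f c"
proof -
  obtain c M where c: "\<And>i. i \<le> d \<Longrightarrow> poly_coeffs d (c i)"
    and M: "\<And>i n. i \<le> d \<Longrightarrow> (\<forall>j\<le>d. M i \<le> n j) \<Longrightarrow> f (n + unit_exp i) - f n = peval d (c i) n"
    using diff unfolding eventually_poly_def by metis
  define K where "K = (\<Sum>i\<le>d. M i)"
  have K: "M i \<le> K" if "i \<le> d" for i
    unfolding K_def using that by (intro member_le_sum) auto
  have step: "\<exists>g. poly_fun d g \<and> (\<forall>n. (\<forall>i\<le>d. K \<le> n i) \<longrightarrow> f (upd_on S K n) = g n)"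
    if "finite S" "S \<subseteq> {..d}" for S
    using that
  proof (induction S rule: finite_induct)
    case empty
    have "upd_on {} K n = (\<lambda>_. K)" for n by (simp add: upd_on_def)
    then show ?case by (intro exI[of _ "\<lambda>n. f (\<lambda>_. K)"]) (auto intro: poly_fun_const)
  next
    case (insert i S)
    then obtain g where g: "poly_fun d g" "\<And>n. (\<forall>i\<le>d. K \<le> n i) \<Longrightarrow> f (upd_on S K n) = g n" by auto
    have i: "i \<le> d" using insert by auto
    obtain h where h: "poly_fun d h"
      "\<And>n. K \<le> n i \<Longrightarrow> (\<Sum>j=K..<n i. peval d (c i) ((upd_on S K n)(i := j))) = h n"
      using poly_fun_partial_sum[OF peval_poly_fun[OF c[OF i]] i insert(2), of K] by blast
    have "f (upd_on (insert i S) K n) = g n + h n" if n: "\<forall>i\<le>d. K \<le> n i" for n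
    proof -
      have "(\<Sum>j=K..<n i. peval d (c i) ((upd_on S K n)(i := j)))
          = (\<Sum>j=K..<n i. f ((upd_on S K n)(i := Suc j)) - f ((upd_on S K n)(i := j)))"
      proof (rule sum.cong[OF refl])
        fix j assume j: "j \<in> {K..<n i}"
        have "M i \<le> ((upd_on S K n)(i := j)) l" if "l \<le> d" for l
          using K[OF i] j n that by (auto simp: upd_on_def intro: order_trans)
        moreover have "(upd_on S K n)(i := j) + unit_exp i = (upd_on S K n)(i := Suc j)"
          by (auto simp: unit_exp_def fun_eq_iff)
        ultimately show "peval d (c i) ((upd_on S K n)(i := j))
            = f ((upd_on S K n)(i := Suc j)) - f ((upd_on S K n)(i := j))"
          using M[OF i, of "(upd_on S K n)(i := j)"] by simp
      qed
      also have "\<dots> = f ((upd_on S K n)(i := n i)) - f ((upd_on S K n)(i := K))"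
        using n i by (subst sum_Suc_diff') auto
      also have "(upd_on S K n)(i := n i) = upd_on (insert i S) K n"
        by (auto simp: upd_on_def fun_eq_iff)
      also have "(upd_on S K n)(i := K) = upd_on S K n"
        using insert(2) by (auto simp: upd_on_def fun_eq_iff)
      finally have "(\<Sum>j=K..<n i. peval d (c i) ((upd_on S K n)(i := j)))
          = f (upd_on (insert i S) K n) - f (upd_on S K n)" .
      then show ?thesis using g(2)[OF n] h(2)[of n] n i by simp
    qed
    then show ?case using poly_fun.add[OF g(1) h(1)] by blast
  qed
  obtain g where g: "poly_fun d g" "\<And>n. (\<forall>i\<le>d. K \<le> n i) \<Longrightarrow> f (upd_on {..d} K n) = g n"
    using step[of "{..d}"] by auto
  have "f n = g n" if "\<forall>i\<le>d. K \<le> n i" for n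
    using g(2)[OF that] inv[of n "upd_on {..d} K n"] by (simp add: upd_on_def)
  moreover obtain c where "poly_coeffs d c" "g = peval d c" using poly_fun_coeffs[OF g(1)] by blast
  ultimately show ?thesis unfolding eventually_poly_def by blast
qed

section \<open>Uniqueness of coefficients\<close>

lemma univariate_coeffs_zero:
  fixes b :: "nat \<Rightarrow> real"
  assumes "\<And>m. M \<le> m \<Longrightarrow> (\<Sum>j\<le>K. b j * real m ^ j) = 0" "j \<le> K"
  shows "b j = 0"
proof (rule ccontr)
  assume "b j \<noteq> 0"
  then have "finite {z. (\<Sum>i\<le>K. b i * z ^ i) = 0}"
    using polyfun_rootbound[of b j K] assms(2) by blast
  then have "finite (real ` {M..})"
    by (rule finite_subset[rotated]) (use assms(1) in auto)
  then show False by (simp add: finite_image_iff inj_on_def infinite_Ici)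
qed

text \<open>Induction on the variables: with the others fixed, the sum is a polynomial in the
  variable \<open>s\<close> with infinitely many zeros, so each slice of exponents with prescribed
  value at \<open>s\<close> gives an identity in the remaining variables. Exponents stay
  distinguishable inside a slice because they agree at \<open>s\<close>.\<close>

lemma polynomial_identity_on:
  assumes "finite S" "finite A" "inj_on (upd_on S 0) A"
    and "\<And>a. (\<forall>i. M \<le> a i) \<Longrightarrow> (\<Sum>\<alpha>\<in>A. c \<alpha> * (\<Prod>i\<in>S. real (a i) ^ \<alpha> i)) = 0"
    and "\<alpha> \<in> A"
  shows "c \<alpha> = (0::real)"
  using assms
proof (induction S arbitrary: A \<alpha> rule: finite_induct)
  case empty
  then have "A = {\<alpha>}" by (auto simp: inj_on_def upd_on_def)
  then show ?case using empty(3)[of "\<lambda>_. M"] by simp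
next
  case (insert s S)
  define K where "K = Max ((\<lambda>\<alpha>. \<alpha> s) ` A)"
  have K: "\<beta> s \<le> K" if "\<beta> \<in> A" for \<beta> unfolding K_def using that insert.prems(1) by auto
  define A' where "A' j = {\<beta>\<in>A. \<beta> s = j}" for j
  have main: "(\<Sum>\<beta>\<in>A' j. c \<beta> * (\<Prod>i\<in>S. real (a i) ^ \<beta> i)) = 0"
    if a: "\<forall>i. M \<le> a i" and j: "j \<le> K" for a j
  proof (rule univariate_coeffs_zero[OF _ j])
    fix m assume m: "M \<le> m"
    have "(\<Sum>\<beta>\<in>A. c \<beta> * (\<Prod>i\<in>insert s S. real ((a(s := m)) i) ^ \<beta> i)) = 0"
      using insert.prems(3)[of "a(s := m)"] a m by auto
    moreover have "(\<Prod>i\<in>insert s S. real ((a(s := m)) i) ^ \<beta> i) = real m ^ \<beta> s * (\<Prod>i\<in>S. real (a i) ^ \<beta> i)" for \<beta>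
      using insert(1,2) by (simp, intro disjI2 prod.cong) auto
    ultimately have "(\<Sum>\<beta>\<in>A. c \<beta> * (\<Prod>i\<in>S. real (a i) ^ \<beta> i) * real m ^ \<beta> s) = 0"
      by (simp add: mult_ac)
    also have "(\<Sum>\<beta>\<in>A. c \<beta> * (\<Prod>i\<in>S. real (a i) ^ \<beta> i) * real m ^ \<beta> s)
       = (\<Sum>j\<le>K. \<Sum>\<beta>\<in>A' j. c \<beta> * (\<Prod>i\<in>S. real (a i) ^ \<beta> i) * real m ^ \<beta> s)"
      unfolding A'_def using insert.prems(1) K by (subst sum.group) auto
    also have "\<dots> = (\<Sum>j\<le>K. (\<Sum>\<beta>\<in>A' j. c \<beta> * (\<Prod>i\<in>S. real (a i) ^ \<beta> i)) * real m ^ j)"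
      unfolding sum_distrib_right by (intro sum.cong) (auto simp: A'_def)
    finally show "(\<Sum>j\<le>K. (\<Sum>\<beta>\<in>A' j. c \<beta> * (\<Prod>i\<in>S. real (a i) ^ \<beta> i)) * real m ^ j) = 0" .
  qed
  have "inj_on (upd_on S 0) (A' (\<alpha> s))"
  proof (rule inj_onI)
    fix x y assume xy: "x \<in> A' (\<alpha> s)" "y \<in> A' (\<alpha> s)" "upd_on S 0 x = upd_on S 0 y"
    then have "upd_on (insert s S) 0 x = upd_on (insert s S) 0 y"
      by (auto simp: A'_def fun_eq_iff upd_on_def split: if_splits)
    then show "x = y" using xy insert.prems(2) by (auto simp: A'_def inj_on_def)
  qed
  then show ?case
    using insert.prems by (intro insert.IH[of "A' (\<alpha> s)"] main K) (auto simp: A'_def)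
qed

lemma peval_eq_zero:
  assumes c: "poly_coeffs d c" and z: "\<And>a. (\<forall>i. M \<le> a i) \<Longrightarrow> peval d c a = 0"
  shows "c \<alpha> = 0"
proof (rule ccontr)
  assume "c \<alpha> \<noteq> 0"
  moreover have "inj_on (upd_on {..d} 0) {\<alpha>. c \<alpha> \<noteq> 0}"
  proof (rule inj_onI)
    fix x y assume "x \<in> {\<alpha>. c \<alpha> \<noteq> 0}" "y \<in> {\<alpha>. c \<alpha> \<noteq> 0}" and eq: "upd_on {..d} 0 x = upd_on {..d} 0 y"
    then have "x i = 0 \<and> y i = 0" if "i > d" for i
      using c that unfolding poly_coeffs_def by blast
    moreover have "x i = y i" if "i \<le> d" for i
      using fun_cong[OF eq, of i] that by (simp add: upd_on_def)
    ultimately show "x = y" by (metis ext linorder_not_le)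
  qed
  ultimately have "c \<alpha> = 0"
    using c z by (intro polynomial_identity_on[of "{..d}" "{\<alpha>. c \<alpha> \<noteq> 0}" M c])
      (auto simp: poly_coeffs_def peval_def monomial_def)
  then show False using \<open>c \<alpha> \<noteq> 0\<close> by simp
qed

lemma eventually_poly_unique:
  assumes "eventually_poly d f b" "eventually_poly d f c" shows "b = c"
proof
  fix \<alpha>
  obtain M where M: "\<And>n. (\<forall>i\<le>d. M \<le> n i) \<Longrightarrow> f n = peval d b n"
    using assms(1) unfolding eventually_poly_def by blast
  obtain L where L: "\<And>n. (\<forall>i\<le>d. L \<le> n i) \<Longrightarrow> f n = peval d c n"
    using assms(2) unfolding eventually_poly_def by blast
  have bc: "poly_coeffs d b" "poly_coeffs d c" using assms by (auto simp: eventually_poly_def)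
  have "b \<alpha> + (-1) * c \<alpha> = 0"
  proof (rule peval_eq_zero[of d "\<lambda>\<alpha>. b \<alpha> + (-1) * c \<alpha>" "max M L"])
    show "poly_coeffs d (\<lambda>\<alpha>. b \<alpha> + (-1) * c \<alpha>)" by (intro poly_coeffs_add poly_coeffs_scale bc)
    fix a :: "nat \<Rightarrow> nat" assume a: "\<forall>i. max M L \<le> a i"
    have "peval d (\<lambda>\<alpha>. b \<alpha> + (-1) * c \<alpha>) a = peval d b a + (-1) * peval d c a"
      by (simp only: peval_add[OF bc(1) poly_coeffs_scale[OF bc(2)]] peval_scale[OF bc(2)])
    then show "peval d (\<lambda>\<alpha>. b \<alpha> + (-1) * c \<alpha>) a = 0" using M[of a] L[of a] a by simp
  qed
  then show "b \<alpha> = c \<alpha>" by simp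
qed

lemma eventually_poly_add:
  assumes "eventually_poly d f b" "eventually_poly d g c"
  shows "eventually_poly d (\<lambda>n. f n + g n) (\<lambda>\<alpha>. b \<alpha> + c \<alpha>)"
proof -
  obtain M where M: "\<And>n. (\<forall>i\<le>d. M \<le> n i) \<Longrightarrow> f n = peval d b n"
    using assms(1) unfolding eventually_poly_def by blast
  obtain L where L: "\<And>n. (\<forall>i\<le>d. L \<le> n i) \<Longrightarrow> g n = peval d c n"
    using assms(2) unfolding eventually_poly_def by blast
  have bc: "poly_coeffs d b" "poly_coeffs d c" using assms by (auto simp: eventually_poly_def)
  show ?thesis unfolding eventually_poly_def
    by (rule conjI[OF poly_coeffs_add[OF bc]], rule exI[of _ "max M L"]) (use M L in \<open>auto simp: peval_add[OF bc]\<close>)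
qed

lemma eventually_poly_scale:
  assumes "eventually_poly d f b"
  shows "eventually_poly d (\<lambda>n. r * f n) (\<lambda>\<alpha>. r * b \<alpha>)"
  using assms unfolding eventually_poly_def by (auto simp: poly_coeffs_scale peval_scale)

section \<open>Growth estimates in terms of the size of a multi-index\<close>

definition esize :: "nat \<Rightarrow> (nat \<Rightarrow> nat) \<Rightarrow> real" where
  "esize d n = 1 + (\<Sum>i\<le>d. real (n i))"

lemma esize_ge_1: "1 \<le> esize d n"
  unfolding esize_def by (simp add: sum_nonneg)

lemma coord_le_esize: "i \<le> d \<Longrightarrow> 1 + real (n i) \<le> esize d n"
  unfolding esize_def by (auto intro!: member_le_sum[of i "{..d}" "\<lambda>i. real (n i)", simplified])

lemma monomial_nonneg: "0 \<le> monomial d \<alpha> n"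
  unfolding monomial_def by (simp add: prod_nonneg)

lemma prod_power_le_esize:
  assumes "A \<subseteq> {..d}"
  shows "(\<Prod>i\<in>A. real (n i) ^ \<alpha> i) \<le> esize d n ^ (\<Sum>i\<in>A. \<alpha> i)"
proof -
  have "real (n i) ^ \<alpha> i \<le> esize d n ^ \<alpha> i" if "i \<in> A" for i
    using coord_le_esize[of i d n] assms that by (intro power_mono) auto
  then have "(\<Prod>i\<in>A. real (n i) ^ \<alpha> i) \<le> (\<Prod>i\<in>A. esize d n ^ \<alpha> i)"
    by (intro prod_mono) auto
  then show ?thesis by (simp add: power_sum)
qed

lemma monomial_le: "monomial d \<alpha> n \<le> esize d n ^ tdeg d \<alpha>"
  unfolding monomial_def tdeg_def by (rule prod_power_le_esize) simp

lemma sum_bound_coeffs: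
  fixes g :: "('x \<Rightarrow> nat) \<Rightarrow> 'y \<Rightarrow> real"
  assumes "finite A" "\<And>\<alpha>. \<alpha> \<in> A \<Longrightarrow> \<exists>C. \<forall>n. u n * \<bar>g \<alpha> n\<bar> \<le> C * v n" "\<And>n. 0 \<le> u n" "\<And>n. 0 \<le> v n"
  shows "\<exists>C\<ge>0. \<forall>n. u n * \<bar>\<Sum>\<alpha>\<in>A. c \<alpha> * g \<alpha> n\<bar> \<le> C * v n"
proof -
  obtain C where C: "\<And>\<alpha> n. \<alpha> \<in> A \<Longrightarrow> u n * \<bar>g \<alpha> n\<bar> \<le> C \<alpha> * v n" using assms(2) by metis
  define B where "B = (\<Sum>\<alpha>\<in>A. \<bar>c \<alpha>\<bar> * \<bar>C \<alpha>\<bar>)"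
  have "u n * \<bar>\<Sum>\<alpha>\<in>A. c \<alpha> * g \<alpha> n\<bar> \<le> B * v n" for n
  proof -
    have "u n * \<bar>\<Sum>\<alpha>\<in>A. c \<alpha> * g \<alpha> n\<bar> \<le> u n * (\<Sum>\<alpha>\<in>A. \<bar>c \<alpha> * g \<alpha> n\<bar>)"
      by (intro mult_left_mono sum_abs assms)
    also have "\<dots> = (\<Sum>\<alpha>\<in>A. \<bar>c \<alpha>\<bar> * (u n * \<bar>g \<alpha> n\<bar>))"
      by (simp add: sum_distrib_left abs_mult mult_ac)
    also have "\<dots> \<le> (\<Sum>\<alpha>\<in>A. \<bar>c \<alpha>\<bar> * (\<bar>C \<alpha>\<bar> * v n))"
    proof (intro sum_mono mult_left_mono)
      fix \<alpha> assume "\<alpha> \<in> A"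
      have "C \<alpha> * v n \<le> \<bar>C \<alpha>\<bar> * v n" using assms(4) by (intro mult_right_mono) auto
      with C[OF \<open>\<alpha> \<in> A\<close>] show "u n * \<bar>g \<alpha> n\<bar> \<le> \<bar>C \<alpha>\<bar> * v n" by (rule order_trans)
    qed auto
    also have "\<dots> = B * v n" unfolding B_def sum_distrib_right by (simp only: mult.assoc)
    finally show ?thesis .
  qed
  moreover have "0 \<le> B" unfolding B_def by (simp add: sum_nonneg)
  ultimately show ?thesis by blast
qed

text \<open>The factor \<open>esize\<close> on the left expresses growth of order k-1 without
  subtracting from \<open>k\<close>, so that \<open>k = 0\<close> is included. All later estimates
  have this shape.\<close>

lemma peval_bound:
  assumes "poly_coeffs d c" "deg_less d c k"
  shows "\<exists>C\<ge>0. \<forall>n. esize d n * \<bar>peval d c n\<bar> \<le> C * esize d n ^ k"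
  unfolding peval_def
proof (rule sum_bound_coeffs)
  fix \<alpha> assume "\<alpha> \<in> {\<alpha>. c \<alpha> \<noteq> 0}"
  then have "tdeg d \<alpha> < k" using assms(2) by (auto simp: deg_less_def)
  have "esize d n * \<bar>monomial d \<alpha> n\<bar> \<le> 1 * esize d n ^ k" for n
  proof -
    have "esize d n * \<bar>monomial d \<alpha> n\<bar> \<le> esize d n * esize d n ^ tdeg d \<alpha>"
      using esize_ge_1[of d n] monomial_le[of d \<alpha> n] monomial_nonneg[of d \<alpha> n] by (intro mult_left_mono) auto
    also have "\<dots> = esize d n ^ Suc (tdeg d \<alpha>)" by simp
    also have "\<dots> \<le> esize d n ^ k" using \<open>tdeg d \<alpha> < k\<close> by (intro power_increasing esize_ge_1) auto
    finally show ?thesis by simp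
  qed
  then show "\<exists>C. \<forall>n. esize d n * \<bar>monomial d \<alpha> n\<bar> \<le> C * esize d n ^ k" by blast
qed (use assms esize_ge_1 in \<open>auto simp: poly_coeffs_def intro: order_trans[OF zero_le_one] zero_le_power\<close>)

text \<open>Peeling off one factor, (x+m)^(a+1) - x^(a+1) = (x+m)((x+m)^a - x^a) + m x^a. The
  variable \<open>s\<close> stands for the size of a multi-index that has \<open>x\<close> as a
  coordinate.\<close>

lemma power_shift_bound:
  fixes x s m :: real
  shows "\<exists>C\<ge>0. \<forall>x s. 0 \<le> x \<and> 1 + x \<le> s \<longrightarrow> s * \<bar>(x + m) ^ a - x ^ a\<bar> \<le> C * s ^ a"
proof (induction a)
  case 0
  then show ?case by (intro exI[of _ 0]) auto
next
  case (Suc a)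
  then obtain C where C: "C \<ge> 0" "\<And>x s. 0 \<le> x \<Longrightarrow> 1 + x \<le> s \<Longrightarrow> s * \<bar>(x + m) ^ a - x ^ a\<bar> \<le> C * s ^ a" by blast
  have "s * \<bar>(x + m) ^ Suc a - x ^ Suc a\<bar> \<le> (C * (1 + \<bar>m\<bar>) + \<bar>m\<bar>) * s ^ Suc a" if x: "0 \<le> x" "1 + x \<le> s" for x s
  proof -
    have s: "1 \<le> s" using x by linarith
    have "(x + m) ^ Suc a - x ^ Suc a = (x + m) * ((x + m) ^ a - x ^ a) + m * x ^ a" by (simp add: algebra_simps)
    then have "\<bar>(x + m) ^ Suc a - x ^ Suc a\<bar> \<le> \<bar>x + m\<bar> * \<bar>(x + m) ^ a - x ^ a\<bar> + \<bar>m\<bar> * x ^ a"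
      by (metis abs_mult abs_triangle_ineq abs_of_nonneg x(1) zero_le_power)
    then have "s * \<bar>(x + m) ^ Suc a - x ^ Suc a\<bar> \<le> s * (\<bar>x + m\<bar> * \<bar>(x + m) ^ a - x ^ a\<bar> + \<bar>m\<bar> * x ^ a)"
      using s by (intro mult_left_mono) auto
    also have "\<dots> = \<bar>x + m\<bar> * (s * \<bar>(x + m) ^ a - x ^ a\<bar>) + \<bar>m\<bar> * (s * x ^ a)" by (simp add: algebra_simps)
    also have "\<dots> \<le> ((1 + \<bar>m\<bar>) * s) * (C * s ^ a) + \<bar>m\<bar> * (s * s ^ a)"
    proof (rule add_mono[OF mult_mono mult_left_mono[OF mult_left_mono]])
      have "\<bar>m\<bar> * 1 \<le> \<bar>m\<bar> * s" using s by (intro mult_left_mono) auto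
      then show "\<bar>x + m\<bar> \<le> (1 + \<bar>m\<bar>) * s" using x by (simp add: algebra_simps)
      show "s * \<bar>(x + m) ^ a - x ^ a\<bar> \<le> C * s ^ a" by (rule C(2)[OF x])
      show "x ^ a \<le> s ^ a" using x by (intro power_mono) auto
    qed (use s in auto)
    also have "\<dots> = (C * (1 + \<bar>m\<bar>) + \<bar>m\<bar>) * s ^ Suc a" by (simp add: algebra_simps)
    finally show ?thesis .
  qed
  then show ?case using C(1) by (intro exI[of _ "C * (1 + \<bar>m\<bar>) + \<bar>m\<bar>"]) auto
qed

text \<open>The factors are exchanged one at a time, and each exchange loses one degree by
  \<open>power_shift_bound\<close>.\<close>

lemma prod_shift_bound:
  assumes "finite A" "A \<subseteq> {..d}"
  shows "\<exists>C\<ge>0. \<forall>n. esize d n * \<bar>(\<Prod>i\<in>A. real (n i + m i) ^ \<alpha> i) - (\<Prod>i\<in>A. real (n i) ^ \<alpha> i)\<bar>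
      \<le> C * esize d n ^ (\<Sum>i\<in>A. \<alpha> i)"
  using assms
proof (induction A rule: finite_induct)
  case empty
  then show ?case by (intro exI[of _ 0]) auto
next
  case (insert i A)
  then obtain C where C: "C \<ge> 0" "\<And>n. esize d n * \<bar>(\<Prod>i\<in>A. real (n i + m i) ^ \<alpha> i) - (\<Prod>i\<in>A. real (n i) ^ \<alpha> i)\<bar>
      \<le> C * esize d n ^ (\<Sum>i\<in>A. \<alpha> i)" by auto
  obtain B where B: "B \<ge> 0" "\<And>x s. 0 \<le> x \<Longrightarrow> 1 + x \<le> s \<Longrightarrow> s * \<bar>(x + real (m i)) ^ \<alpha> i - x ^ \<alpha> i\<bar> \<le> B * s ^ \<alpha> i"
    using power_shift_bound[of "real (m i)" "\<alpha> i"] by blast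
  define K where "K = (1 + real (m i)) ^ \<alpha> i * C + B"
  have "esize d n * \<bar>(\<Prod>i\<in>insert i A. real (n i + m i) ^ \<alpha> i) - (\<Prod>i\<in>insert i A. real (n i) ^ \<alpha> i)\<bar>
      \<le> K * esize d n ^ (\<Sum>i\<in>insert i A. \<alpha> i)" for n
  proof -
    define s where "s = esize d n"
    define P' P where "P' = (\<Prod>i\<in>A. real (n i + m i) ^ \<alpha> i)" and "P = (\<Prod>i\<in>A. real (n i) ^ \<alpha> i)"
    define X' X where "X' = real (n i + m i) ^ \<alpha> i" and "X = real (n i) ^ \<alpha> i"
    define e where "e = (\<Sum>i\<in>A. \<alpha> i)"
    have s: "1 \<le> s" "1 + real (n i) \<le> s" using esize_ge_1 coord_le_esize insert.prems by (auto simp: s_def)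
    have P: "0 \<le> P" "P \<le> s ^ e" using prod_power_le_esize[of A d n \<alpha>] insert.prems
      by (auto simp: P_def s_def e_def intro: prod_nonneg)
    have "real (m i) \<le> real (m i) * s" using s by (simp add: mult_le_cancel_left1)
    then have "real (n i + m i) \<le> (1 + real (m i)) * s" using s by (simp add: algebra_simps)
    then have "X' \<le> ((1 + real (m i)) * s) ^ \<alpha> i" unfolding X'_def by (intro power_mono) auto
    then have X': "0 \<le> X'" "X' \<le> (1 + real (m i)) ^ \<alpha> i * s ^ \<alpha> i" by (auto simp: X'_def power_mult_distrib)
    have "X' * P' - X * P = X' * (P' - P) + (X' - X) * P" by (simp add: algebra_simps)
    then have "\<bar>X' * P' - X * P\<bar> \<le> X' * \<bar>P' - P\<bar> + \<bar>X' - X\<bar> * P"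
      using abs_triangle_ineq[of "X' * (P' - P)" "(X' - X) * P"] X' P by (simp add: abs_mult)
    then have "s * \<bar>X' * P' - X * P\<bar> \<le> s * (X' * \<bar>P' - P\<bar> + \<bar>X' - X\<bar> * P)" using s by (intro mult_left_mono) auto
    also have "\<dots> = X' * (s * \<bar>P' - P\<bar>) + (s * \<bar>X' - X\<bar>) * P" by (simp add: algebra_simps)
    also have "\<dots> \<le> ((1 + real (m i)) ^ \<alpha> i * s ^ \<alpha> i) * (C * s ^ e) + (B * s ^ \<alpha> i) * s ^ e"
    proof (rule add_mono[OF mult_mono mult_mono])
      show "s * \<bar>P' - P\<bar> \<le> C * s ^ e" using C(2)[of n] by (simp add: P_def P'_def s_def e_def)
      show "s * \<bar>X' - X\<bar> \<le> B * s ^ \<alpha> i" using B(2)[of "real (n i)" s] s by (simp add: X_def X'_def)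
    qed (use s X' P C(1) B(1) in auto)
    also have "\<dots> = K * s ^ (\<alpha> i + e)" by (simp add: K_def power_add algebra_simps)
    finally show ?thesis using insert(1,2) by (simp add: s_def P'_def P_def X_def X'_def e_def)
  qed
  moreover have "0 \<le> K" unfolding K_def using B C by auto
  ultimately show ?case by blast
qed

text \<open>This is what allows a family to be replaced by a shift of itself without affecting the
  top-degree part of its Hilbert polynomial.\<close>

lemma peval_shift_bound:
  assumes "poly_coeffs d c" "deg_less d c (Suc k)"
  shows "\<exists>C\<ge>0. \<forall>n. esize d n * \<bar>peval d c (n + m) - peval d c n\<bar> \<le> C * esize d n ^ k"
proof -
  have eq: "peval d c (n + m) - peval d c n
      = (\<Sum>\<alpha> | c \<alpha> \<noteq> 0. c \<alpha> * (monomial d \<alpha> (n + m) - monomial d \<alpha> n))" for n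
    unfolding peval_def by (simp add: sum_subtractf right_diff_distrib)
  show ?thesis unfolding eq
  proof (rule sum_bound_coeffs)
    fix \<alpha> assume "\<alpha> \<in> {\<alpha>. c \<alpha> \<noteq> 0}"
    then have le: "tdeg d \<alpha> \<le> k" using assms(2) by (auto simp: deg_less_def less_Suc_eq_le)
    obtain C where C: "C \<ge> 0" "\<And>n. esize d n * \<bar>monomial d \<alpha> (n + m) - monomial d \<alpha> n\<bar> \<le> C * esize d n ^ tdeg d \<alpha>"
      using prod_shift_bound[of "{..d}" d m \<alpha>] by (auto simp: monomial_def tdeg_def)
    have "C * esize d n ^ tdeg d \<alpha> \<le> C * esize d n ^ k" for n
      using C(1) le esize_ge_1 by (intro mult_left_mono power_increasing) auto
    then show "\<exists>C. \<forall>n. esize d n * \<bar>monomial d \<alpha> (n + m) - monomial d \<alpha> n\<bar> \<le> C * esize d n ^ k"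
      using C(2) order_trans by blast
  qed (use assms esize_ge_1 in \<open>auto simp: poly_coeffs_def intro: order_trans[OF zero_le_one] zero_le_power\<close>)
qed

section \<open>The degree of a polynomial from its sums along rays\<close>

lemma antiderivative_error:
  "\<exists>C\<ge>0. \<forall>x s. 0 \<le> x \<and> 1 + x \<le> s \<longrightarrow>
     s * \<bar>((x + 1) ^ Suc a - x ^ Suc a) - real (Suc a) * x ^ a\<bar> \<le> C * s ^ a"
proof (induction a)
  case 0
  then show ?case by (intro exI[of _ 0]) auto
next
  case (Suc a)
  then obtain C where C: "C \<ge> 0" "\<And>x s. 0 \<le> x \<Longrightarrow> 1 + x \<le> s \<Longrightarrow>
     s * \<bar>((x + 1) ^ Suc a - x ^ Suc a) - real (Suc a) * x ^ a\<bar> \<le> C * s ^ a" by blast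
  have "s * \<bar>((x + 1) ^ Suc (Suc a) - x ^ Suc (Suc a)) - real (Suc (Suc a)) * x ^ Suc a\<bar>
     \<le> (C + real (Suc a)) * s ^ Suc a" if x: "0 \<le> x" "1 + x \<le> s" for x s
  proof -
    define E where "E = ((x + 1) ^ Suc a - x ^ Suc a) - real (Suc a) * x ^ a"
    have "((x + 1) ^ Suc (Suc a) - x ^ Suc (Suc a)) - real (Suc (Suc a)) * x ^ Suc a
       = (x + 1) * E + real (Suc a) * x ^ a" by (simp add: E_def algebra_simps)
    then have "\<bar>((x + 1) ^ Suc (Suc a) - x ^ Suc (Suc a)) - real (Suc (Suc a)) * x ^ Suc a\<bar>
       \<le> (x + 1) * \<bar>E\<bar> + real (Suc a) * x ^ a"
      using x by (simp only:) (rule order_trans[OF abs_triangle_ineq], simp add: abs_mult)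
    then have "s * \<bar>((x + 1) ^ Suc (Suc a) - x ^ Suc (Suc a)) - real (Suc (Suc a)) * x ^ Suc a\<bar>
       \<le> s * ((x + 1) * \<bar>E\<bar> + real (Suc a) * x ^ a)" using x by (intro mult_left_mono) auto
    also have "\<dots> = (x + 1) * (s * \<bar>E\<bar>) + real (Suc a) * (s * x ^ a)" by (simp add: algebra_simps)
    also have "\<dots> \<le> s * (C * s ^ a) + real (Suc a) * (s * s ^ a)"
    proof (rule add_mono[OF mult_mono mult_left_mono[OF mult_left_mono]])
      show "s * \<bar>E\<bar> \<le> C * s ^ a" unfolding E_def by (rule C(2)[OF x])
      show "x ^ a \<le> s ^ a" using x by (intro power_mono) auto
    qed (use x in auto)
    also have "\<dots> = (C + real (Suc a)) * s ^ Suc a" by (simp add: algebra_simps)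
    finally show ?thesis .
  qed
  then show ?case using C(1) by (intro exI[of _ "C + real (Suc a)"]) auto
qed

text \<open>The starting point \<open>t * a\<close> moves with the number of steps, so for
  \<open>j\<close> up to \<open>t\<close> every point has size comparable to \<open>t\<close>, and a
  homogeneous form at the start of the ray is a power of \<open>t\<close> times its value at
  \<open>a\<close>.\<close>

definition ray :: "nat \<Rightarrow> (nat \<Rightarrow> nat) \<Rightarrow> nat \<Rightarrow> nat \<Rightarrow> nat" where
  "ray t a j = (\<lambda>i. t * a i + (if i = 0 then j else 0))"

lemma esize_ray_ge: "1 \<le> a 0 \<Longrightarrow> real t \<le> esize d (ray t a j)"
proof -
  assume "1 \<le> a 0"
  then have "real t * 1 \<le> real t * real (a 0)" by (intro mult_left_mono) auto
  then have "real t \<le> real (ray t a j 0)" by (simp add: ray_def)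
  also have "\<dots> \<le> esize d (ray t a j)" using coord_le_esize[of 0 d "ray t a j"] by auto
  finally show ?thesis .
qed

lemma esize_ray_le: "j \<le> t \<Longrightarrow> 1 \<le> t \<Longrightarrow> esize d (ray t a j) \<le> (esize d a + 1) * real t"
proof -
  assume "j \<le> t" "1 \<le> t"
  have "(\<Sum>i\<le>d. real (ray t a j i)) = (\<Sum>i\<le>d. real t * real (a i)) + real j"
    by (simp add: ray_def sum.distrib if_distrib[of real] cong: if_cong)
  then show ?thesis using \<open>j \<le> t\<close> \<open>1 \<le> t\<close>
    by (simp add: esize_def sum_distrib_left[symmetric] algebra_simps)
qed

text \<open>There are \<open>t\<close> summands, and the factor \<open>esize\<close> in the
  hypothesis is at least \<open>t\<close>, so it pays for the number of summands.\<close>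

lemma ray_sum_bound:
  assumes a: "1 \<le> a 0" and t: "1 \<le> t" and C: "0 \<le> C"
    and f: "\<And>j. j < t \<Longrightarrow> esize d (ray t a j) * \<bar>f j\<bar> \<le> C * esize d (ray t a j) ^ k"
  shows "\<bar>\<Sum>j<t. f j\<bar> \<le> C * (esize d a + 1) ^ k * real t ^ k"
proof -
  have "real t * \<bar>f j\<bar> \<le> C * ((esize d a + 1) ^ k * real t ^ k)" if "j < t" for j
  proof -
    have "real t * \<bar>f j\<bar> \<le> esize d (ray t a j) * \<bar>f j\<bar>"
      using esize_ray_ge[of a t d j] a by (intro mult_right_mono) auto
    also have "\<dots> \<le> C * esize d (ray t a j) ^ k" using f that by simp
    also have "\<dots> \<le> C * ((esize d a + 1) * real t) ^ k"
      using esize_ray_le[of j t d a] esize_ge_1[of d "ray t a j"] that t C by (intro mult_left_mono power_mono) auto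
    finally show ?thesis by (simp add: power_mult_distrib)
  qed
  then have "(\<Sum>j<t. real t * \<bar>f j\<bar>) \<le> (\<Sum>j<t. C * ((esize d a + 1) ^ k * real t ^ k))"
    by (intro sum_mono) auto
  then have "real t * (\<Sum>j<t. \<bar>f j\<bar>) \<le> real t * (C * ((esize d a + 1) ^ k * real t ^ k))"
    by (simp add: sum_distrib_left)
  then have "(\<Sum>j<t. \<bar>f j\<bar>) \<le> C * ((esize d a + 1) ^ k * real t ^ k)" using t by simp
  with sum_abs[of f "{..<t}"] show ?thesis unfolding mult.assoc by (rule order_trans)
qed

text \<open>The summed values determine, up to lower order, a discrete antiderivative \<open>Q\<close> of the top form in the
  variable of index \<open>0\<close>; the bound forces \<open>Q\<close> to be periodic, hence constant, in that variable.\<close>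

lemma deg_less_of_ray_sums:
  assumes c: "poly_coeffs d c"
    and bound: "\<And>a. (\<forall>i. 1 \<le> a i) \<Longrightarrow> \<exists>C T. \<forall>t\<ge>T. \<bar>\<Sum>j<t. peval d c (ray t a j)\<bar> \<le> C * real t ^ k"
  shows "deg_less d c k"
proof (rule ccontr)
  assume "\<not> deg_less d c k"
  then obtain \<gamma> where \<gamma>: "c \<gamma> \<noteq> 0" "k \<le> tdeg d \<gamma>" by (auto simp: deg_less_def not_less)
  have fin: "finite {\<alpha>. c \<alpha> \<noteq> 0}" using c by (simp add: poly_coeffs_def)
  define D where "D = Max (tdeg d ` {\<alpha>. c \<alpha> \<noteq> 0})"
  have D: "tdeg d \<alpha> \<le> D" if "c \<alpha> \<noteq> 0" for \<alpha> unfolding D_def using fin that by auto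
  have kD: "k \<le> D" using D[OF \<gamma>(1)] \<gamma>(2) by simp
  have "D \<in> tdeg d ` {\<alpha>. c \<alpha> \<noteq> 0}" unfolding D_def using fin \<gamma> by (intro Max_in) auto
  then obtain \<delta> where \<delta>: "c \<delta> \<noteq> 0" "tdeg d \<delta> = D" by auto
  define A where "A = {\<alpha>. c \<alpha> \<noteq> 0 \<and> tdeg d \<alpha> = D}"
  have finA: "finite A" unfolding A_def using fin by (rule rev_finite_subset) auto
  define cl where "cl \<alpha> = (if tdeg d \<alpha> = D then 0 else c \<alpha>)" for \<alpha>
  have cl: "poly_coeffs d cl" "deg_less d cl D"
    using c D fin unfolding poly_coeffs_def deg_less_def cl_def
    by (auto split: if_splits intro: finite_subset[OF _ fin]) (metis le_neq_implies_less)
  have split: "peval d c n = (\<Sum>\<alpha>\<in>A. c \<alpha> * monomial d \<alpha> n) + peval d cl n" for n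
  proof -
    have "peval d cl n = (\<Sum>\<alpha>\<in>{\<alpha>. c \<alpha> \<noteq> 0} - A. c \<alpha> * monomial d \<alpha> n)"
      unfolding peval_def by (rule sum.cong) (auto simp: cl_def A_def)
    moreover have "peval d c n = (\<Sum>\<alpha>\<in>{\<alpha>. c \<alpha> \<noteq> 0} - A. c \<alpha> * monomial d \<alpha> n) + (\<Sum>\<alpha>\<in>A. c \<alpha> * monomial d \<alpha> n)"
      unfolding peval_def by (rule sum.subset_diff) (auto simp: A_def fin)
    ultimately show ?thesis by simp
  qed
  define R where "R \<alpha> n = (\<Prod>i\<in>{1..d}. real (n i) ^ \<alpha> i)" for \<alpha> n :: "nat \<Rightarrow> nat"
  have mon: "monomial d \<alpha> n = real (n 0) ^ \<alpha> 0 * R \<alpha> n" for \<alpha> n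
  proof -
    have "{..d} - {0} = {1..d}" by auto
    then show ?thesis unfolding monomial_def R_def by (subst prod.remove[of _ 0]) auto
  qed
  have tdeg0: "tdeg d \<alpha> = \<alpha> 0 + (\<Sum>i\<in>{1..d}. \<alpha> i)" for \<alpha>
  proof -
    have "{..d} - {0} = {1..d}" by auto
    then show ?thesis unfolding tdeg_def by (subst sum.remove[of _ 0]) auto
  qed
  \<comment> \<open>The formal integral of the monomial in the variable 0. Its forward difference in
    that variable differs from the monomial only in lower degree.\<close>
  define q where "q \<alpha> n = real (n 0) ^ Suc (\<alpha> 0) * R \<alpha> n / real (Suc (\<alpha> 0))" for \<alpha> n :: "nat \<Rightarrow> nat"
  define Q where "Q n = (\<Sum>\<alpha>\<in>A. c \<alpha> * q \<alpha> n)" for n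
  have Rshift: "R \<alpha> (n + unit_exp 0) = R \<alpha> n" for \<alpha> n
    unfolding R_def by (rule prod.cong) (auto simp: unit_exp_def)
  have "\<exists>C\<ge>0. \<forall>n. esize d n * \<bar>\<Sum>\<alpha>\<in>A. c \<alpha> * (q \<alpha> (n + unit_exp 0) - q \<alpha> n - monomial d \<alpha> n)\<bar> \<le> C * esize d n ^ D"
  proof (rule sum_bound_coeffs)
    fix \<alpha> assume \<alpha>: "\<alpha> \<in> A"
    obtain C where C: "C \<ge> 0" "\<And>x s. 0 \<le> x \<Longrightarrow> 1 + x \<le> s \<Longrightarrow>
       s * \<bar>((x + 1) ^ Suc (\<alpha> 0) - x ^ Suc (\<alpha> 0)) - real (Suc (\<alpha> 0)) * x ^ \<alpha> 0\<bar> \<le> C * s ^ \<alpha> 0"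
      using antiderivative_error[of "\<alpha> 0"] by blast
    have "esize d n * \<bar>q \<alpha> (n + unit_exp 0) - q \<alpha> n - monomial d \<alpha> n\<bar> \<le> C * esize d n ^ D" for n
    proof -
      define x E where "x = real (n 0)" and "E = ((x + 1) ^ Suc (\<alpha> 0) - x ^ Suc (\<alpha> 0)) - real (Suc (\<alpha> 0)) * x ^ \<alpha> 0"
      have "real (Suc (\<alpha> 0)) * (q \<alpha> (n + unit_exp 0) - q \<alpha> n - monomial d \<alpha> n) = E * R \<alpha> n"
      proof -
        have "(n + unit_exp 0) 0 = n 0 + 1" by (simp add: unit_exp_def)
        then have "real ((n + unit_exp 0) 0) = x + 1" by (simp add: x_def)
        then show ?thesis
          unfolding q_def Rshift mon E_def x_def[symmetric]
          by (simp add: right_diff_distrib left_diff_distrib mult.assoc del: of_nat_Suc power_Suc)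
      qed
      then have "real (Suc (\<alpha> 0)) * \<bar>q \<alpha> (n + unit_exp 0) - q \<alpha> n - monomial d \<alpha> n\<bar> = \<bar>E\<bar> * \<bar>R \<alpha> n\<bar>"
        by (metis abs_mult abs_of_nat)
      moreover have "1 * \<bar>q \<alpha> (n + unit_exp 0) - q \<alpha> n - monomial d \<alpha> n\<bar>
          \<le> real (Suc (\<alpha> 0)) * \<bar>q \<alpha> (n + unit_exp 0) - q \<alpha> n - monomial d \<alpha> n\<bar>"
        by (intro mult_right_mono) auto
      moreover have "0 \<le> R \<alpha> n" unfolding R_def by (simp add: prod_nonneg)
      ultimately have "\<bar>q \<alpha> (n + unit_exp 0) - q \<alpha> n - monomial d \<alpha> n\<bar> \<le> \<bar>E\<bar> * R \<alpha> n" by simp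
      then have "esize d n * \<bar>q \<alpha> (n + unit_exp 0) - q \<alpha> n - monomial d \<alpha> n\<bar> \<le> esize d n * (\<bar>E\<bar> * R \<alpha> n)"
        using esize_ge_1[of d n] by (intro mult_left_mono) auto
      also have "\<dots> = (esize d n * \<bar>E\<bar>) * R \<alpha> n" by simp
      also have "\<dots> \<le> (C * esize d n ^ \<alpha> 0) * esize d n ^ (\<Sum>i\<in>{1..d}. \<alpha> i)"
      proof (rule mult_mono)
        show "esize d n * \<bar>E\<bar> \<le> C * esize d n ^ \<alpha> 0"
          unfolding E_def x_def using coord_le_esize[of 0 d n] by (intro C(2)) auto
        show "R \<alpha> n \<le> esize d n ^ (\<Sum>i\<in>{1..d}. \<alpha> i)"
          unfolding R_def by (rule prod_power_le_esize) auto
      qed (use esize_ge_1[of d n] C(1) \<open>0 \<le> R \<alpha> n\<close> in auto)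
      also have "\<dots> = C * esize d n ^ D" using \<alpha> by (simp add: A_def tdeg0 power_add[symmetric])
      finally show ?thesis .
    qed
    then show "\<exists>C. \<forall>n. esize d n * \<bar>q \<alpha> (n + unit_exp 0) - q \<alpha> n - monomial d \<alpha> n\<bar> \<le> C * esize d n ^ D" by blast
  qed (use finA esize_ge_1 in \<open>auto intro: order_trans[OF zero_le_one] zero_le_power\<close>)
  then obtain C1 where C1: "C1 \<ge> 0" "\<And>n. esize d n * \<bar>Q (n + unit_exp 0) - Q n - (\<Sum>\<alpha>\<in>A. c \<alpha> * monomial d \<alpha> n)\<bar> \<le> C1 * esize d n ^ D"
    unfolding Q_def by (auto simp: sum_subtractf right_diff_distrib)
  obtain C2 where C2: "C2 \<ge> 0" "\<And>n. esize d n * \<bar>peval d cl n\<bar> \<le> C2 * esize d n ^ D"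
    using peval_bound[OF cl] by blast
  \<comment> \<open>Telescoping along the ray compares \<open>Q\<close> at t(a + e_0) and at ta.
    Both scale like t^(D+1), whereas all errors are of order t^D.\<close>
  have Qhom: "Q (\<lambda>i. t * a i) = real t ^ Suc D * Q a" for t a
  proof -
    have "q \<alpha> (\<lambda>i. t * a i) = real t ^ Suc D * q \<alpha> a" if "\<alpha> \<in> A" for \<alpha>
    proof -
      have Rt: "R \<alpha> (\<lambda>i. t * a i) = real t ^ (\<Sum>i\<in>{1..d}. \<alpha> i) * R \<alpha> a"
        unfolding R_def by (simp add: power_mult_distrib prod.distrib power_sum)
      have "Suc D = Suc (\<alpha> 0) + (\<Sum>i\<in>{1..d}. \<alpha> i)" using that by (simp add: A_def tdeg0)
      then have "real t ^ Suc D = real t ^ Suc (\<alpha> 0) * real t ^ (\<Sum>i\<in>{1..d}. \<alpha> i)"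
        by (simp only: power_add)
      with Rt show ?thesis unfolding q_def
        by (simp add: power_mult_distrib mult_ac del: of_nat_Suc power_Suc)
    qed
    then show ?thesis unfolding Q_def by (simp add: sum_distrib_left mult_ac del: power_Suc)
  qed
  have periodic: "Q (a + unit_exp 0) = Q a" if a: "\<forall>i. 1 \<le> a i" for a
  proof -
    obtain C T where CT: "\<And>t. t \<ge> T \<Longrightarrow> \<bar>\<Sum>j<t. peval d c (ray t a j)\<bar> \<le> C * real t ^ k" using bound[OF a] by blast
    \<comment> \<open>After division by t^D the estimate reads t |Q(a + e_0) - Q(a)| \<le> K for all
      large t, which forces the difference to vanish.\<close>
    define K where "K = \<bar>C\<bar> + (C1 + C2) * (esize d a + 1) ^ D"
    have "real t * \<bar>Q (a + unit_exp 0) - Q a\<bar> \<le> K" if t: "t \<ge> max T 1" for t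
    proof -
      define err where "err j = Q (ray t a (Suc j)) - Q (ray t a j) - peval d c (ray t a j)" for j
      have ray_Suc: "ray t a (Suc j) = ray t a j + unit_exp 0" for j
        by (auto simp: ray_def unit_exp_def fun_eq_iff)
      have "\<bar>\<Sum>j<t. err j\<bar> \<le> (C1 + C2) * (esize d a + 1) ^ D * real t ^ D"
      proof (rule ray_sum_bound)
        fix j
        let ?n = "ray t a j"
        have "\<bar>err j\<bar> \<le> \<bar>Q (?n + unit_exp 0) - Q ?n - (\<Sum>\<alpha>\<in>A. c \<alpha> * monomial d \<alpha> ?n)\<bar> + \<bar>peval d cl ?n\<bar>"
          unfolding err_def ray_Suc split by linarith
        then have "esize d ?n * \<bar>err j\<bar> \<le> esize d ?n * (\<bar>Q (?n + unit_exp 0) - Q ?n - (\<Sum>\<alpha>\<in>A. c \<alpha> * monomial d \<alpha> ?n)\<bar> + \<bar>peval d cl ?n\<bar>)"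
          using esize_ge_1[of d ?n] by (intro mult_left_mono) auto
        also have "\<dots> \<le> (C1 + C2) * esize d ?n ^ D"
          using C1(2)[of ?n] C2(2)[of ?n] by (simp add: distrib_left distrib_right)
        finally show "esize d ?n * \<bar>err j\<bar> \<le> (C1 + C2) * esize d ?n ^ D" .
      qed (use a t C1 C2 in auto)
      moreover have "(\<Sum>j<t. err j) = Q (ray t a t) - Q (ray t a 0) - (\<Sum>j<t. peval d c (ray t a j))"
        unfolding err_def using sum_lessThan_telescope[of "\<lambda>j. Q (ray t a j)" t] by (simp add: sum_subtractf)
      moreover have "Q (ray t a t) = real t ^ Suc D * Q (a + unit_exp 0)"
        unfolding Qhom[symmetric] by (rule arg_cong[of _ _ Q]) (auto simp: ray_def unit_exp_def fun_eq_iff)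
      moreover have "Q (ray t a 0) = real t ^ Suc D * Q a"
        unfolding Qhom[symmetric] by (rule arg_cong[of _ _ Q]) (auto simp: ray_def fun_eq_iff)
      moreover have "\<bar>\<Sum>j<t. peval d c (ray t a j)\<bar> \<le> \<bar>C\<bar> * real t ^ D"
      proof -
        have "C * real t ^ k \<le> \<bar>C\<bar> * real t ^ D"
          using t kD by (intro mult_mono power_increasing) auto
        then show ?thesis using CT[of t] t by simp
      qed
      ultimately have "\<bar>real t ^ Suc D * Q (a + unit_exp 0) - real t ^ Suc D * Q a\<bar> \<le> K * real t ^ D"
        unfolding K_def distrib_right by linarith
      then have "real t ^ Suc D * \<bar>Q (a + unit_exp 0) - Q a\<bar> \<le> K * real t ^ D"
        by (simp only: right_diff_distrib[symmetric] abs_mult) simp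
      then have "real t ^ D * (real t * \<bar>Q (a + unit_exp 0) - Q a\<bar>) \<le> real t ^ D * K" by (simp add: mult_ac)
      then show ?thesis using t by (simp add: mult_le_cancel_left)
    qed
    note lim = this
    show ?thesis
    proof (rule ccontr)
      assume "Q (a + unit_exp 0) \<noteq> Q a"
      then have pos: "0 < \<bar>Q (a + unit_exp 0) - Q a\<bar>" by simp
      obtain N where N: "K / \<bar>Q (a + unit_exp 0) - Q a\<bar> < real N" using reals_Archimedean2 by blast
      then have "K < real N * \<bar>Q (a + unit_exp 0) - Q a\<bar>" using pos by (simp add: field_simps)
      also have "\<dots> \<le> real (max N (max T 1)) * \<bar>Q (a + unit_exp 0) - Q a\<bar>"
        by (intro mult_right_mono) auto
      also have "\<dots> \<le> K" by (rule lim) simp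
      finally show False by simp
    qed
  qed
  have const: "Q (a(0 := Suc m)) = Q (a(0 := 1))" if a: "\<forall>i. 1 \<le> a i" for a m
  proof (induction m)
    case (Suc m)
    have "a(0 := Suc (Suc m)) = a(0 := Suc m) + unit_exp 0" by (auto simp: unit_exp_def fun_eq_iff)
    moreover have "\<forall>i. 1 \<le> (a(0 := Suc m)) i" using a by simp
    ultimately show ?case using periodic[of "a(0 := Suc m)"] Suc by metis
  qed simp
  \<comment> \<open>The part of the top form in which the variable 0 has the exponent it has in
    \<delta>. Up to a scalar and a power of that variable it is a non-constant coefficient of
    \<open>Q\<close>, and \<open>Q\<close> is constant in the variable 0, so it vanishes
    identically.\<close>
  define cj where "cj \<alpha> = (if \<alpha> \<in> A \<and> \<alpha> 0 = \<delta> 0 then c \<alpha> else 0)" for \<alpha>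
  have "cj \<delta> = 0"
  proof (rule peval_eq_zero[of d cj 1])
    show "poly_coeffs d cj"
      using c unfolding poly_coeffs_def cj_def by (auto intro: finite_subset[OF _ fin])
    fix a :: "nat \<Rightarrow> nat" assume a: "\<forall>i. 1 \<le> a i"
    define b where "b j = (\<Sum>\<alpha>\<in>{\<alpha>\<in>A. \<alpha> 0 = j}. c \<alpha> * R \<alpha> a / real (Suc j))" for j
    \<comment> \<open>Integration raised every exponent of the variable 0 to at least 1, so the slot
      of index 0 is free for the constant value that is subtracted.\<close>
    define b' where "b' j = (case j of 0 \<Rightarrow> - Q (a(0 := 1)) | Suc j \<Rightarrow> b j)" for j
    have le: "\<alpha> 0 \<le> D" if "\<alpha> \<in> A" for \<alpha> using that by (auto simp: A_def tdeg0)
    have "b' (Suc (\<delta> 0)) = 0"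
    proof (rule univariate_coeffs_zero[where M = 1 and K = "Suc D" and b = b'])
      show "Suc (\<delta> 0) \<le> Suc D" using le[of \<delta>] \<delta> by (auto simp: A_def)
      fix m :: nat assume m: "1 \<le> m"
      have "R \<alpha> (a(0 := m)) = R \<alpha> a" for \<alpha> unfolding R_def by (rule prod.cong) auto
      then have "Q (a(0 := m)) = (\<Sum>\<alpha>\<in>A. c \<alpha> * R \<alpha> a / real (Suc (\<alpha> 0)) * real m ^ Suc (\<alpha> 0))"
        unfolding Q_def q_def by (intro sum.cong) (auto simp: mult_ac)
      also have "\<dots> = (\<Sum>j\<le>D. \<Sum>\<alpha>\<in>{\<alpha>\<in>A. \<alpha> 0 = j}. c \<alpha> * R \<alpha> a / real (Suc (\<alpha> 0)) * real m ^ Suc (\<alpha> 0))"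
        using finA le by (subst sum.group) auto
      also have "\<dots> = (\<Sum>j\<le>D. b j * real m ^ Suc j)"
        unfolding b_def sum_distrib_right by (intro sum.cong) auto
      finally have "(\<Sum>j\<le>D. b j * real m ^ Suc j) = Q (a(0 := 1))" using const[OF a, of "m - 1"] m by simp
      then show "(\<Sum>j\<le>Suc D. b' j * real m ^ j) = 0"
        by (subst sum.atMost_Suc_shift) (simp add: b'_def)
    qed
    then have "(\<Sum>\<alpha>\<in>{\<alpha>\<in>A. \<alpha> 0 = \<delta> 0}. c \<alpha> * R \<alpha> a) / real (Suc (\<delta> 0)) = 0"
      by (simp add: b'_def b_def sum_divide_distrib)
    then have z: "(\<Sum>\<alpha>\<in>{\<alpha>\<in>A. \<alpha> 0 = \<delta> 0}. c \<alpha> * R \<alpha> a) = 0" by simp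
    have "peval d cj a = (\<Sum>\<alpha>\<in>{\<alpha>\<in>A. \<alpha> 0 = \<delta> 0}. cj \<alpha> * monomial d \<alpha> a)"
      by (rule peval_superset) (use finA in \<open>auto simp: cj_def split: if_splits\<close>)
    also have "\<dots> = (\<Sum>\<alpha>\<in>{\<alpha>\<in>A. \<alpha> 0 = \<delta> 0}. real (a 0) ^ \<delta> 0 * (c \<alpha> * R \<alpha> a))"
      by (rule sum.cong) (auto simp: cj_def mon)
    finally show "peval d cj a = 0" using z by (simp add: sum_distrib_left[symmetric])
  qed
  then show False using \<delta> by (simp add: cj_def A_def)
qed

section \<open>Lengths of chains\<close>

lemma chain_len_ge:
  "(\<forall>i\<le>k. P (C i)) \<Longrightarrow> (\<forall>i<k. C i \<subset> C (Suc i)) \<Longrightarrow> enat k \<le> chain_len P"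
  unfolding chain_len_def by (rule SUP_upper) auto

lemma chain_len_leI:
  "(\<And>k C. (\<forall>i\<le>k. P (C i)) \<Longrightarrow> (\<forall>i<k. C i \<subset> C (Suc i)) \<Longrightarrow> enat k \<le> x) \<Longrightarrow> chain_len P \<le> x"
  unfolding chain_len_def by (rule SUP_least) auto

lemma chain_len_chain:
  assumes "enat k \<le> chain_len P" "P X"
  obtains C where "\<forall>i\<le>k. P (C i)" "\<forall>i<k. C i \<subset> C (Suc i)"
proof (cases k)
  case 0
  then show ?thesis using that[of "\<lambda>_. X"] assms by auto
next
  case (Suc j)
  have "\<not> chain_len P \<le> enat j" using assms(1) Suc
    by (metis enat_ord_simps(1) not_less_eq_eq order_refl order_trans)
  then obtain l C where C: "\<forall>i\<le>l. P (C i)" "\<forall>i<l. C i \<subset> C (Suc i)" "\<not> enat l \<le> enat j"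
    using chain_len_leI[of P "enat j"] by blast
  then have "k \<le> l" using Suc by simp
  then show ?thesis using that[of C] C by auto
qed

lemma chain_len_map:
  assumes "\<And>X. P X \<Longrightarrow> Q (f X)" "\<And>X Y. P X \<Longrightarrow> P Y \<Longrightarrow> X \<subset> Y \<Longrightarrow> f X \<subset> f Y"
  shows "chain_len P \<le> chain_len Q"
proof (rule chain_len_leI)
  fix k C assume "\<forall>i\<le>k. P (C i)" "\<forall>i<k. C i \<subset> C (Suc i)"
  then show "enat k \<le> chain_len Q"
    using assms by (intro chain_len_ge[of k Q "\<lambda>i. f (C i)"]) auto
qed

lemma chain_len_mono: "(\<And>X. P X \<Longrightarrow> Q X) \<Longrightarrow> chain_len P \<le> chain_len Q"
  by (rule chain_len_map[where f = id]) auto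

text \<open>Deleting repetitions leaves a strict chain. It is applied to chains obtained by
  intersecting or joining with a fixed submodule, where strictness may be lost.\<close>

lemma chain_len_weak_chain:
  assumes "\<forall>i\<le>k. P (D i)" "\<forall>i<k. D i \<subseteq> D (Suc i)"
  shows "enat (card {i. i < k \<and> D i \<noteq> D (Suc i)}) \<le> chain_len P"
proof -
  have "\<exists>E. (\<forall>i \<le> card {i. i < k \<and> D i \<noteq> D (Suc i)}. P (E i)) \<and>
      (\<forall>i < card {i. i < k \<and> D i \<noteq> D (Suc i)}. E i \<subset> E (Suc i)) \<and> E (card {i. i < k \<and> D i \<noteq> D (Suc i)}) = D k"
    using assms
  proof (induction k)
    case 0
    then show ?case by (intro exI[of _ "\<lambda>_. D 0"]) auto
  next
    case (Suc k)
    define c where "c = card {i. i < k \<and> D i \<noteq> D (Suc i)}"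
    obtain E where E: "\<forall>i\<le>c. P (E i)" "\<forall>i<c. E i \<subset> E (Suc i)" "E c = D k"
      using Suc unfolding c_def by auto
    show ?case
    proof (cases "D k = D (Suc k)")
      case True
      then have "{i. i < Suc k \<and> D i \<noteq> D (Suc i)} = {i. i < k \<and> D i \<noteq> D (Suc i)}"
        by (auto simp: less_Suc_eq)
      then show ?thesis using E True by (intro exI[of _ E]) (simp add: c_def)
    next
      case False
      then have "{i. i < Suc k \<and> D i \<noteq> D (Suc i)} = insert k {i. i < k \<and> D i \<noteq> D (Suc i)}"
        by (auto simp: less_Suc_eq)
      then have card: "card {i. i < Suc k \<and> D i \<noteq> D (Suc i)} = Suc c" by (simp add: c_def)
      have "D k \<subset> D (Suc k)" using False Suc.prems by auto
      then show ?thesis unfolding card using E Suc.prems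
        by (intro exI[of _ "\<lambda>i. if i \<le> c then E i else D (Suc k)"]) (auto simp: less_Suc_eq le_Suc_eq)
    qed
  qed
  then obtain E where "\<forall>i \<le> card {i. i < k \<and> D i \<noteq> D (Suc i)}. P (E i)"
      "\<forall>i < card {i. i < k \<and> D i \<noteq> D (Suc i)}. E i \<subset> E (Suc i)" by (elim exE conjE)
  then show ?thesis by (rule chain_len_ge)
qed

text \<open>Superadditivity of length can be tested on finite chains; this covers infinite lengths
  as well.\<close>

lemma enat_add_leI:
  assumes "\<And>i j. enat i \<le> a \<Longrightarrow> enat j \<le> b \<Longrightarrow> enat (i + j) \<le> c"
  shows "a + b \<le> (c::enat)"
proof (cases c)
  case (enat k)
  have "a \<noteq> \<infinity>"
  proof
    assume "a = \<infinity>"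
    then show False using assms[of "Suc k" 0] enat by (simp add: zero_enat_def[symmetric])
  qed
  moreover have "b \<noteq> \<infinity>"
  proof
    assume "b = \<infinity>"
    then show False using assms[of 0 "Suc k"] enat by (simp add: zero_enat_def[symmetric])
  qed
  ultimately obtain i j where "a = enat i" "b = enat j" by auto
  then show ?thesis using assms[of i j] by simp
qed simp

section \<open>Lengths of subquotients\<close>

notation sum_sets (infixl "\<oplus>" 65)

definition saturated :: "('a::comm_ring_1 \<Rightarrow> 'b::ab_group_add \<Rightarrow> 'b) \<Rightarrow> 'a set \<Rightarrow> 'b set \<Rightarrow> bool" where
  "saturated scale S X \<longleftrightarrow> (\<forall>s\<in>S. \<forall>a. scale s a \<in> X \<longrightarrow> a \<in> X)"

definition saturation :: "('a::comm_ring_1 \<Rightarrow> 'b::ab_group_add \<Rightarrow> 'b) \<Rightarrow> 'a set \<Rightarrow> 'b set \<Rightarrow> 'b set" where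
  "saturation scale S X = {a. \<exists>s\<in>S. scale s a \<in> X}"

text \<open>Submodules of a localization correspond to the saturated submodules, so this is the
  length of the localization of A/B when A and B are saturated. With \<open>S = {1}\<close> it is
  the ordinary length, and one additivity theorem serves both.\<close>

definition sat_length :: "('a::comm_ring_1 \<Rightarrow> 'b::ab_group_add \<Rightarrow> 'b) \<Rightarrow> 'a set \<Rightarrow> 'b set \<Rightarrow> 'b set \<Rightarrow> enat" where
  "sat_length scale S A B = chain_len (\<lambda>X. module.subspace scale X \<and> saturated scale S X \<and> B \<subseteq> X \<and> X \<subseteq> A)"

context module
begin

lemma subspace_sum_sets: "subspace X \<Longrightarrow> subspace Y \<Longrightarrow> subspace (X \<oplus> Y)"
  unfolding sum_sets_def
proof (rule subspaceI)
  assume X: "subspace X" and Y: "subspace Y"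
  show "0 \<in> {x + y |x y. x \<in> X \<and> y \<in> Y}" using subspace_0[OF X] subspace_0[OF Y] by force
  fix c v assume "v \<in> {x + y |x y. x \<in> X \<and> y \<in> Y}"
  then show "scale c v \<in> {x + y |x y. x \<in> X \<and> y \<in> Y}"
    using subspace_scale[OF X] subspace_scale[OF Y] by (auto simp: scale_right_distrib) blast
next
  assume X: "subspace X" and Y: "subspace Y"
  fix v w assume "v \<in> {x + y |x y. x \<in> X \<and> y \<in> Y}" "w \<in> {x + y |x y. x \<in> X \<and> y \<in> Y}"
  then obtain x y x' y' where "x \<in> X" "y \<in> Y" "v = x + y" "x' \<in> X" "y' \<in> Y" "w = x' + y'" by blast
  then have "v + w = (x + x') + (y + y')" "x + x' \<in> X" "y + y' \<in> Y"
    using subspace_add[OF X] subspace_add[OF Y] by (auto simp: algebra_simps)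
  then show "v + w \<in> {x + y |x y. x \<in> X \<and> y \<in> Y}" by blast
qed

lemma sum_sets_upper1: "subspace Y \<Longrightarrow> X \<subseteq> X \<oplus> Y"
  unfolding sum_sets_def using subspace_0 by force

lemma sum_sets_upper2: "subspace X \<Longrightarrow> Y \<subseteq> X \<oplus> Y"
  unfolding sum_sets_def using subspace_0 by force

lemma sum_sets_least: "subspace Z \<Longrightarrow> X \<subseteq> Z \<Longrightarrow> Y \<subseteq> Z \<Longrightarrow> X \<oplus> Y \<subseteq> Z"
  unfolding sum_sets_def by (auto intro: subspace_add)

lemma sum_sets_absorb1: "subspace Y \<Longrightarrow> X \<subseteq> Y \<Longrightarrow> subspace X \<Longrightarrow> X \<oplus> Y = Y"
  by (rule subset_antisym[OF sum_sets_least sum_sets_upper2]) auto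

lemma sum_sets_absorb2: "subspace X \<Longrightarrow> Y \<subseteq> X \<Longrightarrow> subspace Y \<Longrightarrow> X \<oplus> Y = X"
  by (rule subset_antisym[OF sum_sets_least sum_sets_upper1]) auto

end

lemma sum_sets_mono: "X \<subseteq> X' \<Longrightarrow> Y \<subseteq> Y' \<Longrightarrow> X \<oplus> Y \<subseteq> X' \<oplus> Y'"
  unfolding sum_sets_def by blast

lemma sum_sets_commute: "X \<oplus> Y = Y \<oplus> X"
  unfolding sum_sets_def by (auto intro: add.commute)

lemma sum_sets_assoc: "(X \<oplus> Y) \<oplus> Z = X \<oplus> (Y \<oplus> Z)"
proof (intro subset_antisym subsetI)
  fix v assume "v \<in> (X \<oplus> Y) \<oplus> Z"
  then obtain x y z where "x \<in> X" "y \<in> Y" "z \<in> Z" "v = x + (y + z)"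
    unfolding sum_sets_def by (auto simp: add.assoc)
  then show "v \<in> X \<oplus> (Y \<oplus> Z)" unfolding sum_sets_def by blast
next
  fix v assume "v \<in> X \<oplus> (Y \<oplus> Z)"
  then obtain x y z where "x \<in> X" "y \<in> Y" "z \<in> Z" "v = (x + y) + z"
    unfolding sum_sets_def by (auto simp: add.assoc)
  then show "v \<in> (X \<oplus> Y) \<oplus> Z" unfolding sum_sets_def by blast
qed

lemma sum_setsI: "x \<in> X \<Longrightarrow> y \<in> Y \<Longrightarrow> x + y \<in> X \<oplus> Y"
  unfolding sum_sets_def by blast

lemma sum_setsE:
  assumes "z \<in> X \<oplus> Y" obtains x y where "x \<in> X" "y \<in> Y" "z = x + y"
  using assms unfolding sum_sets_def by blast

lemma sum_sets_zero [simp]: "X \<oplus> {0} = X" "{0} \<oplus> X = X"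
  unfolding sum_sets_def by auto

definition mult_closed :: "'a::comm_ring_1 set \<Rightarrow> bool" where
  "mult_closed S \<longleftrightarrow> 1 \<in> S \<and> (\<forall>a\<in>S. \<forall>b\<in>S. a * b \<in> S)"

context module
begin

lemma saturation_superset: "mult_closed S \<Longrightarrow> X \<subseteq> saturation scale S X"
  unfolding mult_closed_def saturation_def by (auto intro: bexI[of _ 1])

lemma subspace_saturation:
  assumes "mult_closed S" "subspace X" shows "subspace (saturation scale S X)"
proof (rule subspaceI)
  show "0 \<in> saturation scale S X"
    using saturation_superset[OF assms(1), of X] subspace_0[OF assms(2)] by blast
  fix x y assume "x \<in> saturation scale S X" "y \<in> saturation scale S X"
  then obtain s t where st: "s \<in> S" "t \<in> S" "scale s x \<in> X" "scale t y \<in> X" by (auto simp: saturation_def)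
  have "scale (s * t) (x + y) = scale t (scale s x) + scale s (scale t y)"
    by (simp add: scale_right_distrib mult.commute)
  then have "scale (s * t) (x + y) \<in> X" using st assms(2) by (simp only: subspace_add subspace_scale)
  then show "x + y \<in> saturation scale S X"
    using st assms(1) unfolding saturation_def mult_closed_def by blast
next
  fix c x assume "x \<in> saturation scale S X"
  then obtain s where s: "s \<in> S" "scale s x \<in> X" by (auto simp: saturation_def)
  then have "scale s (scale c x) \<in> X" using subspace_scale[OF assms(2) s(2), of c] by (simp add: mult.commute)
  then show "scale c x \<in> saturation scale S X" using s unfolding saturation_def by blast
qed

lemma saturated_saturation: "mult_closed S \<Longrightarrow> saturated scale S (saturation scale S X)"
  unfolding saturated_def saturation_def mult_closed_def by auto

lemma saturation_least: "saturated scale S Y \<Longrightarrow> X \<subseteq> Y \<Longrightarrow> saturation scale S X \<subseteq> Y"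
  unfolding saturated_def saturation_def by auto

lemma saturation_mono: "X \<subseteq> Y \<Longrightarrow> saturation scale S X \<subseteq> saturation scale S Y"
  unfolding saturation_def by auto

lemma saturated_Int: "saturated scale S X \<Longrightarrow> saturated scale S Y \<Longrightarrow> saturated scale S (X \<inter> Y)"
  unfolding saturated_def by auto

text \<open>A strict step in a chain between \<open>B\<close> and \<open>A\<close> stays strict after intersecting with \<open>M\<close> or
  after joining with \<open>M\<close>.\<close>

lemma sat_length_add:
  assumes S: "mult_closed S" and sub: "subspace A" "subspace M" "subspace B"
    and sat: "saturated scale S A" "saturated scale S M" "saturated scale S B"
    and BM: "B \<subseteq> M" and MA: "M \<subseteq> A"
  shows "sat_length scale S A B = sat_length scale S A M + sat_length scale S M B"
proof (rule antisym)
  show "sat_length scale S A M + sat_length scale S M B \<le> sat_length scale S A B"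
    unfolding sat_length_def
  proof (rule enat_add_leI)
    fix i j
    assume i: "enat i \<le> chain_len (\<lambda>X. subspace X \<and> saturated scale S X \<and> M \<subseteq> X \<and> X \<subseteq> A)"
      and j: "enat j \<le> chain_len (\<lambda>X. subspace X \<and> saturated scale S X \<and> B \<subseteq> X \<and> X \<subseteq> M)"
    obtain C where C: "\<forall>k\<le>i. subspace (C k) \<and> saturated scale S (C k) \<and> M \<subseteq> C k \<and> C k \<subseteq> A" "\<forall>k<i. C k \<subset> C (Suc k)"
      using chain_len_chain[OF i, of A] sub sat MA by auto
    obtain D where D: "\<forall>k\<le>j. subspace (D k) \<and> saturated scale S (D k) \<and> B \<subseteq> D k \<and> D k \<subseteq> M" "\<forall>k<j. D k \<subset> D (Suc k)"
      using chain_len_chain[OF j, of M] sub sat BM by auto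
    show "enat (i + j) \<le> chain_len (\<lambda>X. subspace X \<and> saturated scale S X \<and> B \<subseteq> X \<and> X \<subseteq> A)"
    \<comment> \<open>The term \<open>C 0\<close> is skipped: \<open>D j\<close> and
      \<open>C 0\<close> may both equal \<open>M\<close>, while \<open>D j \<subset> C 1\<close>
      always holds.\<close>
    proof (rule chain_len_ge[where C = "\<lambda>k. if k \<le> j then D k else C (k - j)"]; intro allI impI)
      fix k assume "k \<le> i + j"
      then show "subspace (if k \<le> j then D k else C (k - j)) \<and> saturated scale S (if k \<le> j then D k else C (k - j))
          \<and> B \<subseteq> (if k \<le> j then D k else C (k - j)) \<and> (if k \<le> j then D k else C (k - j)) \<subseteq> A"
      proof (cases "k \<le> j")
        case True
        then show ?thesis using D(1)[rule_format, of k] MA by auto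
      next
        case False
        then have "k - j \<le> i" using \<open>k \<le> i + j\<close> by linarith
        then have "subspace (C (k - j)) \<and> saturated scale S (C (k - j)) \<and> M \<subseteq> C (k - j) \<and> C (k - j) \<subseteq> A"
          using C(1) by blast
        then show ?thesis using False BM by (simp only: if_False) blast
      qed
    next
      fix k assume k: "k < i + j"
      consider "k < j" | "k = j" | "j < k" by linarith
      then show "(if k \<le> j then D k else C (k - j)) \<subset> (if Suc k \<le> j then D (Suc k) else C (Suc k - j))"
      proof cases
        case 2
        then have "C 0 \<subset> C 1" "M \<subseteq> C 0" "D j \<subseteq> M" using C(1)[rule_format, of 0] C(2)[rule_format, of 0] D(1) k by auto
        then show ?thesis using 2 by auto
      next
        case 3
        then show ?thesis using C(2)[rule_format, of "k - j"] k by (auto simp: Suc_diff_le)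
      qed (use D(2) in auto)
    qed
  qed
next
  show "sat_length scale S A B \<le> sat_length scale S A M + sat_length scale S M B"
    unfolding sat_length_def[of _ _ A B]
  proof (rule chain_len_leI)
    fix k C
    assume C: "\<forall>i\<le>k. subspace (C i) \<and> saturated scale S (C i) \<and> B \<subseteq> C i \<and> C i \<subseteq> A" "\<forall>i<k. C i \<subset> C (Suc i)"
    define D where "D i = C i \<inter> M" for i
    \<comment> \<open>A sum of saturated submodules need not be saturated.\<close>
    define E where "E i = saturation scale S (C i \<oplus> M)" for i
    have D: "enat (card {i. i < k \<and> D i \<noteq> D (Suc i)}) \<le> sat_length scale S M B"
      unfolding sat_length_def
      by (rule chain_len_weak_chain) (use C sub sat BM in \<open>auto simp: D_def subspace_inter saturated_Int\<close>)
    have E: "enat (card {i. i < k \<and> E i \<noteq> E (Suc i)}) \<le> sat_length scale S A M"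
      unfolding sat_length_def
    proof (rule chain_len_weak_chain; intro allI impI)
      fix i assume "i \<le> k"
      then have Ci: "subspace (C i)" "C i \<subseteq> A" using C(1) by auto
      then have "M \<subseteq> E i" unfolding E_def
        using saturation_superset[OF S, of "C i \<oplus> M"] sum_sets_upper2[of "C i" M] by blast
      moreover have "E i \<subseteq> A" unfolding E_def
        by (intro saturation_least sat sum_sets_least sub Ci MA)
      ultimately show "subspace (E i) \<and> saturated scale S (E i) \<and> M \<subseteq> E i \<and> E i \<subseteq> A"
        unfolding E_def using subspace_saturation[OF S] saturated_saturation[OF S] subspace_sum_sets Ci sub by auto
    next
      fix i assume "i < k"
      then show "E i \<subseteq> E (Suc i)"
        unfolding E_def using C(2) by (intro saturation_mono sum_sets_mono) auto
    qed
    \<comment> \<open>No step of the chain can collapse both in the intersection with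
      \<open>M\<close> and in the saturated join: an element of the larger term, multiplied into the
      join, splits off a summand in \<open>M\<close> that lies in both intersections.\<close>
    have "{..<k} \<subseteq> {i. i < k \<and> D i \<noteq> D (Suc i)} \<union> {i. i < k \<and> E i \<noteq> E (Suc i)}"
    proof (rule subsetI, rule ccontr)
      fix i assume i: "i \<in> {..<k}" "i \<notin> {i. i < k \<and> D i \<noteq> D (Suc i)} \<union> {i. i < k \<and> E i \<noteq> E (Suc i)}"
      then have eq: "D i = D (Suc i)" "E i = E (Suc i)" and ik: "i < k" by auto
      have X: "subspace (C i)" "saturated scale S (C i)" "subspace (C (Suc i))" "C i \<subset> C (Suc i)"
        using C ik by auto
      have "C (Suc i) \<subseteq> C i"
      proof
        fix y assume y: "y \<in> C (Suc i)"
        then have "y \<in> C (Suc i) \<oplus> M" using sum_sets_upper1[OF sub(2)] by blast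
        then have "y \<in> saturation scale S (C (Suc i) \<oplus> M)" by (rule subsetD[OF saturation_superset[OF S]])
        then have "y \<in> E i" unfolding eq(2) by (simp only: E_def)
        then obtain s where s: "s \<in> S" "scale s y \<in> C i \<oplus> M" by (auto simp: E_def saturation_def)
        then obtain x m where xm: "x \<in> C i" "m \<in> M" "scale s y = x + m" by (auto elim: sum_setsE)
        then have "m = scale s y - x" by simp
        moreover have "x \<in> C (Suc i)" using X(4) xm(1) by blast
        ultimately have "m \<in> C (Suc i)"
          using subspace_diff[OF X(3) subspace_scale[OF X(3) y]] by simp
        then have "m \<in> C i" using eq(1) xm by (auto simp: D_def)
        then have "scale s y \<in> C i" unfolding xm(3) by (rule subspace_add[OF X(1) xm(1)])
        then show "y \<in> C i" using X(2) s by (auto simp: saturated_def)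
      qed
      then show False using X by auto
    qed
    then have "k \<le> card ({i. i < k \<and> D i \<noteq> D (Suc i)} \<union> {i. i < k \<and> E i \<noteq> E (Suc i)})"
      using card_mono[of "{i. i < k \<and> D i \<noteq> D (Suc i)} \<union> {i. i < k \<and> E i \<noteq> E (Suc i)}" "{..<k}"] by simp
    also have "\<dots> \<le> card {i. i < k \<and> E i \<noteq> E (Suc i)} + card {i. i < k \<and> D i \<noteq> D (Suc i)}"
      by (subst add.commute) (rule card_Un_le)
    finally have "enat k \<le> enat (card {i. i < k \<and> E i \<noteq> E (Suc i)}) + enat (card {i. i < k \<and> D i \<noteq> D (Suc i)})"
      by simp
    also have "\<dots> \<le> sat_length scale S A M + sat_length scale S M B" by (intro add_mono D E)
    finally show "enat k \<le> sat_length scale S A M + sat_length scale S M B" .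
  qed
qed

lemma mod_length_eq_sat_length: "mod_length scale A B = sat_length scale {1} A B"
  unfolding mod_length_def sat_length_def saturated_def by simp

lemma mod_length_add:
  "subspace A \<Longrightarrow> subspace M \<Longrightarrow> subspace B \<Longrightarrow> B \<subseteq> M \<Longrightarrow> M \<subseteq> A \<Longrightarrow>
    mod_length scale A B = mod_length scale A M + mod_length scale M B"
  unfolding mod_length_eq_sat_length
  by (rule sat_length_add) (auto simp: mult_closed_def saturated_def)

lemma mod_length_mono: "B \<subseteq> B' \<Longrightarrow> A' \<subseteq> A \<Longrightarrow> mod_length scale A' B' \<le> mod_length scale A B"
  unfolding mod_length_def by (rule chain_len_mono) auto

end

section \<open>Lengths under homomorphisms, and the isomorphism theorems\<close>

lemma chain_len_unique:
  assumes "\<And>X Y. P X \<Longrightarrow> P Y \<Longrightarrow> X = Y" shows "chain_len P = 0"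
proof -
  have "chain_len P \<le> 0"
  proof (rule chain_len_leI)
    fix k C assume "\<forall>i\<le>k. P (C i)" "\<forall>i<k. C i \<subset> C (Suc i)"
    then have "k = 0" using assms[of "C 0" "C 1"] by (cases k) force+
    then show "enat k \<le> 0" by (simp add: zero_enat_def)
  qed
  then show ?thesis by simp
qed

lemma mod_length_self [simp]: "mod_length scale A A = 0"
  unfolding mod_length_def by (rule chain_len_unique) auto

text \<open>The hypothesis \<open>ker\<close> makes the induced map of subquotients injective. Image
  plus \<open>C\<close> in one direction and preimage within \<open>A\<close> in the other are both
  strictly monotone, and this alone gives both inequalities.\<close>

lemma (in module_hom) mod_length_image:
  assumes A: "m1.subspace A" and B: "m1.subspace B" and C: "m2.subspace C" and BA: "B \<subseteq> A"
    and ker: "\<And>a. a \<in> A \<Longrightarrow> f a \<in> C \<Longrightarrow> a \<in> B"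
  shows "mod_length s2 (f ` A \<oplus> C) (f ` B \<oplus> C) = mod_length s1 A B"
  unfolding mod_length_def
proof (rule antisym; rule chain_len_map)
  fix X assume X: "m1.subspace X \<and> B \<subseteq> X \<and> X \<subseteq> A"
  then show "m2.subspace (f ` X \<oplus> C) \<and> f ` B \<oplus> C \<subseteq> f ` X \<oplus> C \<and> f ` X \<oplus> C \<subseteq> f ` A \<oplus> C"
    using C by (intro conjI m2.subspace_sum_sets subspace_image sum_sets_mono image_mono) auto
next
  fix X Y assume X: "m1.subspace X \<and> B \<subseteq> X \<and> X \<subseteq> A" and Y: "m1.subspace Y \<and> B \<subseteq> Y \<and> Y \<subseteq> A" and XY: "X \<subset> Y"
  obtain y where y: "y \<in> Y" "y \<notin> X" using XY by blast
  have "f y \<notin> f ` X \<oplus> C"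
  proof
    assume "f y \<in> f ` X \<oplus> C"
    then obtain x c where xc: "x \<in> X" "c \<in> C" "f y = f x + c" by (auto elim: sum_setsE)
    then have "f (y - x) \<in> C" by (simp add: diff)
    moreover have "y - x \<in> A" using xc X Y y A m1.subspace_diff by blast
    ultimately have "y - x \<in> X" using ker X by blast
    then show False using xc X y by (metis diff_add_cancel m1.subspace_add)
  qed
  moreover have "f y \<in> f ` Y \<oplus> C" using y m2.sum_sets_upper1[OF C] by blast
  ultimately show "f ` X \<oplus> C \<subset> f ` Y \<oplus> C"
    using sum_sets_mono[of "f ` X" "f ` Y" C C] XY by blast
next
  fix Y assume Y: "m2.subspace Y \<and> f ` B \<oplus> C \<subseteq> Y \<and> Y \<subseteq> f ` A \<oplus> C"
  have "f ` B \<subseteq> Y" using Y m2.sum_sets_upper1[OF C] by blast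
  moreover have "m1.subspace {a \<in> A. f a \<in> Y}"
    using A Y by (intro m1.subspaceI) (auto simp: add scale m1.subspace_0 m2.subspace_0 m1.subspace_add m2.subspace_add m1.subspace_scale m2.subspace_scale)
  ultimately show "m1.subspace {a \<in> A. f a \<in> Y} \<and> B \<subseteq> {a \<in> A. f a \<in> Y} \<and> {a \<in> A. f a \<in> Y} \<subseteq> A"
    using BA by auto
next
  fix Y Z assume Y: "m2.subspace Y \<and> f ` B \<oplus> C \<subseteq> Y \<and> Y \<subseteq> f ` A \<oplus> C"
    and Z: "m2.subspace Z \<and> f ` B \<oplus> C \<subseteq> Z \<and> Z \<subseteq> f ` A \<oplus> C" and YZ: "Y \<subset> Z"
  obtain z where z: "z \<in> Z" "z \<notin> Y" using YZ by blast
  then have "z \<in> f ` A \<oplus> C" using Z by blast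
  then obtain a c where ac: "a \<in> A" "c \<in> C" "z = f a + c" by (auto elim: sum_setsE)
  have CY: "C \<subseteq> Y" using Y m2.sum_sets_upper2[OF subspace_image[OF B]] by blast
  have "f a \<in> Z" using ac z CY YZ Z by (metis add_diff_cancel_right' m2.subspace_diff psubsetD subsetD)
  moreover have "f a \<notin> Y" using ac z CY Y m2.subspace_add by blast
  ultimately show "{a \<in> A. f a \<in> Y} \<subset> {a \<in> A. f a \<in> Z}" using ac YZ by blast
qed

lemma (in module_hom) mod_length_image_le:
  assumes A: "m1.subspace A" and B: "m1.subspace B" and C: "m2.subspace C" and BA: "B \<subseteq> A"
  shows "mod_length s2 (f ` A \<oplus> C) (f ` B \<oplus> C) \<le> mod_length s1 A B"
proof -
  define B' where "B' = {a \<in> A. f a \<in> f ` B \<oplus> C}"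
  have D: "m2.subspace (f ` B \<oplus> C)" by (intro m2.subspace_sum_sets subspace_image B C)
  have "m1.subspace B'"
    unfolding B'_def
    using A D by (intro m1.subspaceI) (auto simp: add scale m1.subspace_0 m2.subspace_0 m1.subspace_add m2.subspace_add m1.subspace_scale m2.subspace_scale)
  then have "mod_length s2 (f ` A \<oplus> (f ` B \<oplus> C)) (f ` B' \<oplus> (f ` B \<oplus> C)) = mod_length s1 A B'"
    by (intro mod_length_image A D) (auto simp: B'_def)
  moreover have "f ` B' \<oplus> (f ` B \<oplus> C) = f ` B \<oplus> C"
    using \<open>m1.subspace B'\<close> by (intro m2.sum_sets_absorb1 D subspace_image) (auto simp: B'_def)
  moreover have "f ` A \<oplus> (f ` B \<oplus> C) = f ` A \<oplus> C"
    unfolding sum_sets_assoc[symmetric]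
    using m2.sum_sets_absorb2[of "f ` A" "f ` B"] A B BA by (simp add: subspace_image image_mono)
  moreover have "mod_length s1 A B' \<le> mod_length s1 A B"
    by (intro m1.mod_length_mono) (use BA m2.sum_sets_upper1[OF C, of "f ` B"] in \<open>auto simp: B'_def\<close>)
  ultimately show ?thesis by simp
qed

context module
begin

lemma mod_length_second_iso:
  assumes "subspace P" "subspace Q"
  shows "mod_length scale (P \<oplus> Q) Q = mod_length scale P (P \<inter> Q)"
proof -
  interpret id: module_hom scale scale "\<lambda>x. x" by (rule module_hom_ident)
  have "mod_length scale ((\<lambda>x. x) ` P \<oplus> Q) ((\<lambda>x. x) ` (P \<inter> Q) \<oplus> Q) = mod_length scale P (P \<inter> Q)"
    using assms by (intro id.mod_length_image) (auto simp: subspace_inter)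
  moreover have "P \<inter> Q \<oplus> Q = Q" using assms by (intro sum_sets_absorb1) (auto simp: subspace_inter)
  ultimately show ?thesis by simp
qed

lemma modular_law:
  assumes "subspace A" "A' \<subseteq> A"
  shows "A \<inter> (A' \<oplus> X) = A' \<oplus> (A \<inter> X)"
proof
  show "A \<inter> (A' \<oplus> X) \<subseteq> A' \<oplus> (A \<inter> X)"
  proof
    fix z assume z: "z \<in> A \<inter> (A' \<oplus> X)"
    then obtain a x where ax: "a \<in> A'" "x \<in> X" "z = a + x" by (auto elim: sum_setsE)
    then have "x = z - a" by simp
    moreover have "z \<in> A" "a \<in> A" using z ax assms by auto
    ultimately have "x \<in> A" using subspace_diff[OF assms(1)] by blast
    then show "z \<in> A' \<oplus> (A \<inter> X)" using ax by (auto intro: sum_setsI)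
  qed
  show "A' \<oplus> (A \<inter> X) \<subseteq> A \<inter> (A' \<oplus> X)"
    using assms by (auto elim!: sum_setsE intro: sum_setsI subspace_add)
qed

text \<open>The module A' + (A \<inter> X) lies between A' and A; the second isomorphism theorem and
  the modular law identify the two parts as image modulo X and trace on X. For filtrations this
  gives exact additivity, but with the trace filtration on X.\<close>

lemma mod_length_split:
  assumes "subspace A" "subspace A'" "subspace X" "A' \<subseteq> A"
  shows "mod_length scale A A' = mod_length scale (A \<oplus> X) (A' \<oplus> X) + mod_length scale (A \<inter> X) (A' \<inter> X)"
proof -
  let ?M = "A' \<oplus> (A \<inter> X)"
  have sub: "subspace ?M" "subspace (A \<inter> X)" "subspace (A' \<oplus> X)"
    using assms by (auto simp: subspace_sum_sets subspace_inter)
  have "mod_length scale A A' = mod_length scale A ?M + mod_length scale ?M A'"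
    using assms sub by (intro mod_length_add sum_sets_upper1 sum_sets_least) auto
  also have "mod_length scale A ?M = mod_length scale (A \<oplus> X) (A' \<oplus> X)"
  proof -
    have "A \<oplus> (A' \<oplus> X) = A \<oplus> X"
      unfolding sum_sets_assoc[symmetric] using assms by (simp add: sum_sets_absorb2)
    then show ?thesis
      using mod_length_second_iso[OF assms(1) sub(3)] modular_law[OF assms(1,4)] by simp
  qed
  also have "mod_length scale ?M A' = mod_length scale (A \<inter> X) (A' \<inter> X)"
  proof -
    have "A \<inter> X \<inter> A' = A' \<inter> X" using assms by auto
    then show ?thesis using mod_length_second_iso[OF sub(2) assms(2)] by (simp add: sum_sets_commute)
  qed
  finally show ?thesis .
qed

end

section \<open>The monoid of ideals\<close>

interpretation ring: module "(*) :: 'a::comm_ring_1 \<Rightarrow> 'a \<Rightarrow> 'a"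
  by unfold_locales (simp_all add: algebra_simps)

text \<open>As a rewrite rule, \<open>ring.scale_scale\<close> is associativity from right to left.\<close>

declare ring.scale_scale [simp del]

text \<open>As a type, the ideals become a commutative monoid, so finite products and powers with
  their usual laws apply to them.\<close>

typedef (overloaded) 'a idl = "{I :: 'a::comm_ring_1 set. ideal I}"
  morphisms idl_set Abs_idl
  by (rule exI[of _ UNIV]) (simp add: ideal_def)

lemma subspace_idl_set [simp]: "ring.subspace (idl_set K)"
  using idl_set[of K] by (simp add: ideal_def)

lemma subspace_ideal_mult: "ring.subspace (ideal_mult K L)"
  unfolding ideal_mult_def by simp

lemma ideal_mult_eq: "ideal_mult K L = ideal_smult (*) K L"
  unfolding ideal_mult_def ideal_smult_def ..

context module
begin

lemma subspace_ideal_smult [simp]: "subspace (ideal_smult scale K A)"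
  unfolding ideal_smult_def by simp

lemma ideal_smultI: "r \<in> K \<Longrightarrow> a \<in> A \<Longrightarrow> scale r a \<in> ideal_smult scale K A"
  unfolding ideal_smult_def by (rule span_base) blast

lemma ideal_smult_leI: "subspace B \<Longrightarrow> (\<And>r a. r \<in> K \<Longrightarrow> a \<in> A \<Longrightarrow> scale r a \<in> B) \<Longrightarrow> ideal_smult scale K A \<subseteq> B"
  unfolding ideal_smult_def by (rule span_minimal) auto

text \<open>Over the ring as a module this is associativity of the product of ideals, which the
  monoid instance uses.\<close>

lemma ideal_smult_assoc:
  "ideal_smult scale (ideal_mult K L) A = ideal_smult scale K (ideal_smult scale L A)"
proof (intro subset_antisym ideal_smult_leI subspace_ideal_smult)
  fix r a assume r: "r \<in> ideal_mult K L" and a: "a \<in> A"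
  let ?T = "ideal_smult scale K (ideal_smult scale L A)"
  have "ideal_mult K L \<subseteq> {r. scale r a \<in> ?T}"
    unfolding ideal_mult_def
  proof (rule ring.span_minimal)
    show "ring.subspace {r. scale r a \<in> ?T}"
      by (rule ring.subspaceI)
        (auto simp: scale_left_distrib subspace_0 subspace_add subspace_scale scale_scale[symmetric] simp del: scale_scale)
    show "{k * l |k l. k \<in> K \<and> l \<in> L} \<subseteq> {r. scale r a \<in> ?T}"
    proof safe
      fix k l assume "k \<in> K" "l \<in> L"
      then have "scale k (scale l a) \<in> ?T" using a by (intro ideal_smultI)
      then show "scale (k * l) a \<in> ?T" by simp
    qed
  qed
  then show "scale r a \<in> ?T" using r by blast
next
  fix k b assume k: "k \<in> K" and b: "b \<in> ideal_smult scale L A"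
  let ?T = "ideal_smult scale (ideal_mult K L) A"
  have "ideal_smult scale L A \<subseteq> {b. scale k b \<in> ?T}"
  proof (rule ideal_smult_leI)
    show "subspace {b. scale k b \<in> ?T}"
    proof (rule subspaceI)
      fix c x assume "x \<in> {b. scale k b \<in> ?T}"
      then have "scale c (scale k x) \<in> ?T" by (simp add: subspace_scale del: scale_scale)
      then show "scale c x \<in> {b. scale k b \<in> ?T}" by (simp add: mult.commute)
    qed (auto simp: scale_right_distrib subspace_0 subspace_add)
    fix l a assume "l \<in> L" "a \<in> A"
    moreover have "k * l \<in> ideal_mult K L" if "l \<in> L"
      unfolding ideal_mult_def using k that by (intro ring.span_base) blast
    ultimately show "scale l a \<in> {b. scale k b \<in> ?T}" by (auto intro!: ideal_smultI)
  qed
  then show "scale k b \<in> ?T" using b by blast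
qed

end

instantiation idl :: (comm_ring_1) comm_monoid_mult
begin

definition "1 = Abs_idl UNIV"
definition "K * L = Abs_idl (ideal_mult (idl_set K) (idl_set L))"

lemma idl_set_mult: "idl_set (K * L) = ideal_mult (idl_set K) (idl_set L)"
  unfolding times_idl_def by (subst Abs_idl_inverse) (simp_all add: ideal_def subspace_ideal_mult)

lemma idl_set_one: "idl_set 1 = UNIV"
  unfolding one_idl_def by (subst Abs_idl_inverse) (simp_all add: ideal_def)

instance
proof
  fix K L M :: "'a idl"
  show "K * L * M = K * (L * M)"
    unfolding idl_set_inject[symmetric] idl_set_mult
    unfolding ideal_mult_eq[of "ideal_mult _ _"] ring.ideal_smult_assoc by (simp only: ideal_mult_eq)
  show "K * L = L * K"
    unfolding idl_set_inject[symmetric] idl_set_mult ideal_mult_def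
    by (rule arg_cong[of _ _ ring.span]) (auto, (metis mult.commute)+)
  show "1 * K = K"
    unfolding idl_set_inject[symmetric] idl_set_mult idl_set_one ideal_mult_eq
  proof (rule subset_antisym)
    show "ideal_smult (*) UNIV (idl_set K) \<subseteq> idl_set K"
      by (rule ring.ideal_smult_leI) (auto intro: ring.subspace_scale)
    show "idl_set K \<subseteq> ideal_smult (*) UNIV (idl_set K)"
      using ring.ideal_smultI[of 1 UNIV _ "idl_set K"] by auto
  qed
qed

end

context module
begin

definition act :: "'a idl \<Rightarrow> 'b set \<Rightarrow> 'b set" where
  "act K A = ideal_smult scale (idl_set K) A"

end

hide_const (open) real_vector.act

context module
begin

lemma subspace_act [simp]: "subspace (act K A)"
  unfolding act_def by simp

lemma actI: "r \<in> idl_set K \<Longrightarrow> a \<in> A \<Longrightarrow> scale r a \<in> act K A"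
  unfolding act_def by (rule ideal_smultI)

lemma act_leI: "subspace B \<Longrightarrow> (\<And>r a. r \<in> idl_set K \<Longrightarrow> a \<in> A \<Longrightarrow> scale r a \<in> B) \<Longrightarrow> act K A \<subseteq> B"
  unfolding act_def by (rule ideal_smult_leI)

lemma act_mono: "A \<subseteq> B \<Longrightarrow> act K A \<subseteq> act K B"
  by (rule act_leI) (auto intro: actI)

lemma act_subset: "subspace A \<Longrightarrow> act K A \<subseteq> A"
  by (rule act_leI) (auto intro: subspace_scale)

lemma act_mult: "act (K * L) A = act K (act L A)"
  unfolding act_def idl_set_mult by (rule ideal_smult_assoc)

lemma act_commute: "act K (act L A) = act L (act K A)"
  by (simp only: act_mult[symmetric] mult.commute)

lemma act_one: "subspace A \<Longrightarrow> act 1 A = A"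
  using act_subset[of A 1] actI[of 1 1 _ A] by (auto simp: idl_set_one)

lemma act_sum: "subspace A \<Longrightarrow> subspace B \<Longrightarrow> act K (A \<oplus> B) = act K A \<oplus> act K B"
proof (rule subset_antisym)
  assume AB: "subspace A" "subspace B"
  show "act K (A \<oplus> B) \<subseteq> act K A \<oplus> act K B"
    by (rule act_leI)
      (auto simp: subspace_sum_sets scale_right_distrib elim!: sum_setsE intro!: sum_setsI actI)
  show "act K A \<oplus> act K B \<subseteq> act K (A \<oplus> B)"
    by (intro sum_sets_least subspace_act act_mono sum_sets_upper1 sum_sets_upper2 AB)
qed

end

lemma (in module_hom) act_image: "m1.subspace A \<Longrightarrow> m2.act K (f ` A) = f ` m1.act K A"
proof (rule subset_antisym)
  assume A: "m1.subspace A"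
  show "m2.act K (f ` A) \<subseteq> f ` m1.act K A"
    by (rule m2.act_leI) (auto simp: scale[symmetric] subspace_image intro!: imageI m1.actI)
  have "m1.act K A \<subseteq> {a. f a \<in> m2.act K (f ` A)}"
    by (rule m1.act_leI)
      (auto simp: add scale m2.subspace_0 m2.subspace_add m2.subspace_scale intro!: m1.subspaceI m2.actI)
  then show "f ` m1.act K A \<subseteq> m2.act K (f ` A)" by blast
qed

section \<open>Noetherian modules\<close>

locale noetherian_module = module scale
  for scale :: "'a::comm_ring_1 \<Rightarrow> 'b::ab_group_add \<Rightarrow> 'b" +
  assumes acc: "\<And>C :: nat \<Rightarrow> 'b set. (\<And>i. subspace (C i)) \<Longrightarrow> incseq C \<Longrightarrow> \<exists>k. \<forall>i\<ge>k. C i = C k"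

text \<open>Along a chain in the span of \<open>insert s S\<close>, a submodule is determined by its
  trace on \<open>span S\<close> and by the ideal \<open>E i\<close> of coefficients of
  \<open>s\<close> occurring in it. The first is stationary by induction, the second by hypothesis
  on the ring.\<close>

lemma (in module) acc_finite_span:
  assumes noeth: "noetherian_ring TYPE('a)" and "finite S"
    and "\<And>i. subspace (C i)" "incseq C" "\<And>i. C i \<subseteq> span S"
  shows "\<exists>k. \<forall>i\<ge>k. C i = C (k::nat)"
  using assms(2-)
proof (induction S arbitrary: C rule: finite_induct)
  case empty
  then have "C i = {0}" for i using subspace_0 by fastforce
  then show ?case by blast
next
  case (insert s S)
  have mono: "C i \<subseteq> C j" if "i \<le> j" for i j using \<open>incseq C\<close> that by (rule monoD)
  define E where "E i = {r. \<exists>v\<in>span S. scale r s + v \<in> C i}" for i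
  have "ideal (E i)" for i
    unfolding ideal_def
  proof (rule ring.subspaceI)
    show "0 \<in> E i" unfolding E_def using subspace_0[OF insert.prems(1)] span_zero by force
    fix x y assume "x \<in> E i" "y \<in> E i"
    then obtain v w where vw: "v \<in> span S" "scale x s + v \<in> C i" "w \<in> span S" "scale y s + w \<in> C i"
      by (auto simp: E_def)
    have "scale (x + y) s + (v + w) = (scale x s + v) + (scale y s + w)" by (simp add: algebra_simps)
    then have "scale (x + y) s + (v + w) \<in> C i"
      using subspace_add[OF insert.prems(1) vw(2,4)] by (simp only:)
    then show "x + y \<in> E i" unfolding E_def using vw span_add by blast
  next
    fix c x assume "x \<in> E i"
    then obtain v where v: "v \<in> span S" "scale x s + v \<in> C i" by (auto simp: E_def)
    have "scale (c * x) s + scale c v = scale c (scale x s + v)" by (simp add: scale_right_distrib)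
    then have "scale (c * x) s + scale c v \<in> C i" using v subspace_scale[OF insert.prems(1)] by simp
    then show "c * x \<in> E i" unfolding E_def using v span_scale by blast
  qed
  moreover have "incseq E" unfolding E_def by (rule monoI) (use mono in blast)
  ultimately obtain k1 where k1: "\<And>i. i \<ge> k1 \<Longrightarrow> E i = E k1"
    using noeth unfolding noetherian_ring_def by blast
  have "incseq (\<lambda>i. C i \<inter> span S)" by (rule monoI) (use mono in blast)
  then obtain k2 where k2: "\<And>i. i \<ge> k2 \<Longrightarrow> C i \<inter> span S = C k2 \<inter> span S"
    using insert.IH[of "\<lambda>i. C i \<inter> span S"] insert.prems by (auto simp: subspace_inter)
  define k where "k = max k1 k2"
  have "C i = C k" if i: "i \<ge> k" for i
  proof (rule subset_antisym[OF _ mono[OF i]], rule subsetI)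
    fix x assume x: "x \<in> C i"
    then obtain r where r: "x - scale r s \<in> span S"
      using insert.prems(3)[of i] span_breakdown_eq[of x s S] by blast
    have "r \<in> E i" unfolding E_def
      using r x by (intro CollectI bexI[of _ "x - scale r s"]) auto
    also have "E i = E k" using k1[of i] k1[of k] i by (simp add: k_def)
    finally obtain v where v: "v \<in> span S" "scale r s + v \<in> C k" by (auto simp: E_def)
    have "x - (scale r s + v) = (x - scale r s) - v" by simp
    also have "\<dots> \<in> span S" by (rule span_diff[OF r v(1)])
    finally have "x - (scale r s + v) \<in> C i \<inter> span S"
      using subspace_diff[OF insert.prems(1) x, of "scale r s + v"] v(2) mono[OF i] by blast
    also have "C i \<inter> span S = C k \<inter> span S" using k2[of i] k2[of k] i by (simp add: k_def)
    finally have "(x - (scale r s + v)) + (scale r s + v) \<in> C k"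
      using v(2) subspace_add[OF insert.prems(1)] by blast
    then show "x \<in> C k" by simp
  qed
  then show ?case by blast
qed

lemma (in module) noetherian_module_finite_span:
  assumes "noetherian_ring TYPE('a)" "finite S" "span S = UNIV"
  shows "noetherian_module scale"
  by unfold_locales (rule acc_finite_span[OF assms(1,2)], use assms(3) in auto)

lemma noetherian_module_ring:
  assumes "noetherian_ring TYPE('a::comm_ring_1)"
  shows "noetherian_module ((*) :: 'a \<Rightarrow> 'a \<Rightarrow> 'a)"
  by unfold_locales (use assms in \<open>simp add: noetherian_ring_def ideal_def\<close>)

context noetherian_module
begin

lemma wf_subspaces: "wf {(Y, X). subspace X \<and> subspace Y \<and> X \<subset> Y}"
  unfolding wf_iff_no_infinite_down_chain
proof
  assume "\<exists>f. \<forall>i. (f (Suc i), f i) \<in> {(Y, X). subspace X \<and> subspace Y \<and> X \<subset> Y}"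
  then obtain f where "\<forall>i. (f (Suc i), f i) \<in> {(Y, X). subspace X \<and> subspace Y \<and> X \<subset> Y}" by blast
  then have f: "\<And>i. subspace (f i)" "\<And>i. f i \<subset> f (Suc i)" by auto
  have "incseq f" by (rule incseq_SucI) (use f in auto)
  with acc[of f] f(1) obtain k where "\<forall>i\<ge>k. f i = f k" by blast
  then have "f (Suc k) = f k" using le_SucI[OF order_refl] by (elim allE impE)
  then show False using f(2)[of k] by simp
qed

lemma maximal_subspace:
  assumes "P X" "\<And>X. P X \<Longrightarrow> subspace X"
  obtains Y where "P Y" "\<And>Z. P Z \<Longrightarrow> Y \<subseteq> Z \<Longrightarrow> Z = Y"
proof -
  obtain Y where "P Y" "\<And>Z. (Z, Y) \<in> {(Y, X). subspace X \<and> subspace Y \<and> X \<subset> Y} \<Longrightarrow> \<not> P Z"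
    using wfE_min[OF wf_subspaces, of X "Collect P"] assms(1) by auto
  then show ?thesis using that[of Y] assms(2) by blast
qed

lemma finite_generators:
  assumes X: "subspace X" obtains G where "finite G" "G \<subseteq> X" "span G = X"
proof -
  obtain Y where Y: "\<exists>G. finite G \<and> G \<subseteq> X \<and> Y = span G"
    "\<And>Z. \<exists>G. finite G \<and> G \<subseteq> X \<and> Z = span G \<Longrightarrow> Y \<subseteq> Z \<Longrightarrow> Z = Y"
    using maximal_subspace[of "\<lambda>Y. \<exists>G. finite G \<and> G \<subseteq> X \<and> Y = span G" "span {}"] by blast
  then obtain G where G: "finite G" "G \<subseteq> X" "Y = span G" by blast
  have "X \<subseteq> span G"
  proof
    fix x assume "x \<in> X"
    then have "span (insert x G) = Y" using G by (intro Y(2)) (auto intro!: span_mono)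
    then show "x \<in> span G" using span_base[of x "insert x G"] G by simp
  qed
  then show ?thesis using that[OF G(1,2)] G X span_subspace by blast
qed

end

section \<open>A Hilbert basis theorem for commuting operators\<close>

text \<open>Submodules over the ring generated by the operators, without constructing that ring.
  Differences and 0 describe a subgroup.\<close>

definition op_closed :: "('w::ab_group_add \<Rightarrow> 'w) set \<Rightarrow> 'w set \<Rightarrow> bool" where
  "op_closed Op X \<longleftrightarrow> 0 \<in> X \<and> (\<forall>x\<in>X. \<forall>y\<in>X. x - y \<in> X) \<and> (\<forall>h\<in>Op. \<forall>x\<in>X. h x \<in> X)"

definition op_noetherian :: "('w::ab_group_add \<Rightarrow> 'w) set \<Rightarrow> 'w set \<Rightarrow> bool" where
  "op_noetherian Op W \<longleftrightarrow> op_closed Op W \<and>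
     (\<forall>C :: nat \<Rightarrow> 'w set. (\<forall>i. op_closed Op (C i) \<and> C i \<subseteq> W) \<and> incseq C \<longrightarrow> (\<exists>k. \<forall>i\<ge>k. C i = C k))"

lemma op_closed_add: "op_closed Op X \<Longrightarrow> x \<in> X \<Longrightarrow> y \<in> X \<Longrightarrow> x + y \<in> X"
  unfolding op_closed_def by (metis diff_0 diff_minus_eq_add)

lemma op_closed_diff: "op_closed Op X \<Longrightarrow> x \<in> X \<Longrightarrow> y \<in> X \<Longrightarrow> x - y \<in> X"
  unfolding op_closed_def by blast

lemma op_closed_op: "op_closed Op X \<Longrightarrow> h \<in> Op \<Longrightarrow> x \<in> X \<Longrightarrow> h x \<in> X"
  unfolding op_closed_def by blast

text \<open>The analogue of polynomials of degree less than \<open>k\<close> in the operator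
  \<open>x\<close> with coefficients in \<open>W\<close>. The representation need not be
  unique.\<close>

fun poly_part :: "('w::ab_group_add \<Rightarrow> 'w) \<Rightarrow> 'w set \<Rightarrow> nat \<Rightarrow> 'w set" where
  "poly_part x W 0 = {0}"
| "poly_part x W (Suc k) = {y + (x ^^ k) w |y w. y \<in> poly_part x W k \<and> w \<in> W}"

text \<open>Ideals of leading coefficients, with the powers of one operator \<open>x\<close> playing the role of the powers
  of a variable.\<close>

lemma op_noetherian_step:
  assumes noeth: "op_noetherian Op W"
    and addx: "additive x" and addOp: "\<And>h. h \<in> Op \<Longrightarrow> additive h"
    and comm: "\<And>h v. h \<in> Op \<Longrightarrow> h (x v) = x (h v)"
  shows "op_noetherian (insert x Op) (\<Union>k. poly_part x W k)"
proof -
  have W: "op_closed Op W" using noeth by (simp add: op_noetherian_def)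
  have W0: "0 \<in> W" using W by (simp add: op_closed_def)
  have x_diff: "(x ^^ k) (v - w) = (x ^^ k) v - (x ^^ k) w" for k v w
    by (induction k) (simp_all add: additive.diff[OF addx])
  have x_zero: "(x ^^ k) 0 = 0" for k
    by (induction k) (simp_all add: additive.zero[OF addx])
  have comm_pow: "h ((x ^^ k) v) = (x ^^ k) (h v)" if "h \<in> Op" for h k v
    using that by (induction k) (simp_all add: comm)
  have part: "op_closed Op (poly_part x W k)" for k
  proof (induction k)
    case 0
    then show ?case by (auto simp: op_closed_def additive.zero[OF addOp])
  next
    case (Suc k)
    have "0 \<in> poly_part x W (Suc k)"
      using Suc W0 x_zero[of k] by (simp add: op_closed_def) (metis add.right_neutral)
    moreover have "v - w \<in> poly_part x W (Suc k)" if vw: "v \<in> poly_part x W (Suc k)" "w \<in> poly_part x W (Suc k)" for v w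
    proof -
      obtain y a z b where "v = y + (x ^^ k) a" "w = z + (x ^^ k) b" "y \<in> poly_part x W k" "a \<in> W" "z \<in> poly_part x W k" "b \<in> W"
        using vw by auto
      moreover from this have "v - w = (y - z) + (x ^^ k) (a - b)" by (simp add: x_diff algebra_simps)
      moreover have "v - w = (y - z) + (x ^^ k) (a - b) \<Longrightarrow> y - z \<in> poly_part x W k \<Longrightarrow> a - b \<in> W \<Longrightarrow> ?thesis"
        by (subst poly_part.simps(2)) blast
      ultimately show ?thesis using op_closed_diff[OF Suc, of y z] op_closed_diff[OF W, of a b] by blast
    qed
    moreover have "h v \<in> poly_part x W (Suc k)" if v: "v \<in> poly_part x W (Suc k)" and h: "h \<in> Op" for h v
    proof -
      obtain y a where "v = y + (x ^^ k) a" "y \<in> poly_part x W k" "a \<in> W" using v by auto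
      moreover from this have "h v = h y + (x ^^ k) (h a)"
        using comm_pow[OF h] additive.add[OF addOp[OF h]] by simp
      ultimately show ?thesis using op_closed_op[OF Suc h, of y] op_closed_op[OF W h, of a]
        by (subst poly_part.simps(2)) blast
    qed
    ultimately show ?case unfolding op_closed_def by blast
  qed
  have part_Suc: "poly_part x W k \<subseteq> poly_part x W (Suc k)" for k
  proof
    fix y assume "y \<in> poly_part x W k"
    then show "y \<in> poly_part x W (Suc k)" using W0 x_zero[of k]
      by simp (metis add.right_neutral)
  qed
  have part_mono: "poly_part x W k \<subseteq> poly_part x W l" if "k \<le> l" for k l
    using lift_Suc_mono_le[of "poly_part x W", OF part_Suc that] .
  have part_x: "x y \<in> poly_part x W (Suc k)" if "y \<in> poly_part x W k" for y k
    using that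
  proof (induction k arbitrary: y)
    case 0
    then show ?case using subsetD[OF part_Suc[of 0], of 0] by (simp add: additive.zero[OF addx])
  next
    case (Suc k)
    then obtain z a where "y = z + (x ^^ k) a" "z \<in> poly_part x W k" "a \<in> W" by auto
    moreover from this have "x y = x z + (x ^^ Suc k) a" by (simp add: additive.add[OF addx])
    ultimately show ?case using Suc.IH[of z] by (subst poly_part.simps(2)) blast
  qed
  define V where "V = (\<Union>k. poly_part x W k)"
  have V: "op_closed (insert x Op) V"
    unfolding op_closed_def
  proof (intro conjI ballI)
    show "0 \<in> V" unfolding V_def by (rule UN_I[of 0]) auto
    fix v w assume "v \<in> V" "w \<in> V"
    then obtain k l where "v \<in> poly_part x W k" "w \<in> poly_part x W l" by (auto simp: V_def)
    then have "v \<in> poly_part x W (max k l)" "w \<in> poly_part x W (max k l)"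
      using part_mono[of k "max k l"] part_mono[of l "max k l"] by auto
    then have "v - w \<in> poly_part x W (max k l)" by (rule op_closed_diff[OF part])
    then show "v - w \<in> V" unfolding V_def by blast
  next
    fix h v assume h: "h \<in> insert x Op" and "v \<in> V"
    then obtain k where k: "v \<in> poly_part x W k" by (auto simp: V_def)
    have "h v \<in> poly_part x W (Suc k)"
    proof (cases "h = x")
      case True
      then show ?thesis using part_x[OF k] by simp
    next
      case False
      then show ?thesis using h op_closed_op[OF part _ k, of h] part_Suc[of k] by auto
    qed
    then show "h v \<in> V" unfolding V_def by blast
  qed
  \<comment> \<open>Possible leading coefficients, at the power \<open>k\<close> of
    \<open>x\<close>, of elements of \<open>A\<close>.\<close>
  define LT where "LT k A = {w \<in> W. \<exists>y\<in>poly_part x W k. y + (x ^^ k) w \<in> A}" for k A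
  have LT_closed: "op_closed Op (LT k A)" if A: "op_closed (insert x Op) A" for k A
    unfolding op_closed_def
  proof (intro conjI ballI)
    have "0 \<in> A" "0 \<in> poly_part x W k" using A part[of k] by (auto simp: op_closed_def)
    then show "0 \<in> LT k A" unfolding LT_def using W0 x_zero[of k]
      by (intro CollectI conjI bexI[of _ 0]) auto
    fix v w assume "v \<in> LT k A" "w \<in> LT k A"
    then obtain y z where yz: "v \<in> W" "w \<in> W" "y \<in> poly_part x W k" "z \<in> poly_part x W k"
      "y + (x ^^ k) v \<in> A" "z + (x ^^ k) w \<in> A" by (auto simp: LT_def)
    have "(y - z) + (x ^^ k) (v - w) = (y + (x ^^ k) v) - (z + (x ^^ k) w)" by (simp add: x_diff algebra_simps)
    then have "(y - z) + (x ^^ k) (v - w) \<in> A" using op_closed_diff[OF A yz(5,6)] by (simp only:)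
    then show "v - w \<in> LT k A" unfolding LT_def using yz op_closed_diff[OF part] op_closed_diff[OF W] by blast
  next
    fix h v assume h: "h \<in> Op" and "v \<in> LT k A"
    then obtain y where y: "v \<in> W" "y \<in> poly_part x W k" "y + (x ^^ k) v \<in> A" by (auto simp: LT_def)
    have "h y + (x ^^ k) (h v) = h (y + (x ^^ k) v)" by (simp add: comm_pow[OF h] additive.add[OF addOp[OF h]])
    then have "h y + (x ^^ k) (h v) \<in> A" using op_closed_op[OF A, of h, OF _ y(3)] h by (simp only: insertI2)
    then show "h v \<in> LT k A" unfolding LT_def using y h op_closed_op[OF part] op_closed_op[OF W] by blast
  qed
  have LT_sub: "LT k A \<subseteq> W" for k A by (auto simp: LT_def)
  have LT_mono: "LT k A \<subseteq> LT k B" if "A \<subseteq> B" for k A B using that by (auto simp: LT_def)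
  have LT_Suc: "LT k A \<subseteq> LT (Suc k) A" if A: "op_closed (insert x Op) A" for k A
  proof
    fix v assume "v \<in> LT k A"
    then obtain y where y: "v \<in> W" "y \<in> poly_part x W k" "y + (x ^^ k) v \<in> A" by (auto simp: LT_def)
    have "x y + (x ^^ Suc k) v = x (y + (x ^^ k) v)" by (simp add: additive.add[OF addx])
    then have "x y + (x ^^ Suc k) v \<in> A" using y op_closed_op[OF A, of x] by simp
    then show "v \<in> LT (Suc k) A" unfolding LT_def using y part_x[of y k] by blast
  qed
  have LT_le: "LT k A \<subseteq> LT l A" if "op_closed (insert x Op) A" "k \<le> l" for k l A
    using lift_Suc_mono_le[of "\<lambda>k. LT k A", OF LT_Suc[OF that(1)] that(2)] .
  have stable: "\<exists>k. \<forall>i\<ge>k. C i = C k" if "\<And>i. op_closed Op (C i)" "\<And>i. C i \<subseteq> W" "incseq C" for C :: "nat \<Rightarrow> _"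
    using noeth that unfolding op_noetherian_def by blast
  show ?thesis unfolding op_noetherian_def V_def[symmetric]
  proof (intro conjI allI impI V)
    fix C :: "nat \<Rightarrow> 'a set" assume "(\<forall>i. op_closed (insert x Op) (C i) \<and> C i \<subseteq> V) \<and> incseq C"
    then have C: "\<And>i. op_closed (insert x Op) (C i)" "\<And>i. C i \<subseteq> V" "\<And>i j. i \<le> j \<Longrightarrow> C i \<subseteq> C j"
      by (auto dest: incseqD)
    \<comment> \<open>The diagonal chain controls all degrees from \<open>K\<close> on at once;
      below \<open>K\<close> only finitely many chains of leading coefficients remain.\<close>
    have "incseq (\<lambda>k. LT k (C k))"
    proof (rule incseq_SucI)
      fix k
      show "LT k (C k) \<subseteq> LT (Suc k) (C (Suc k))"
        using LT_Suc[OF C(1), of k k] LT_mono[OF C(3), of k "Suc k" "Suc k"] by auto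
    qed
    then obtain K where K: "\<And>k. k \<ge> K \<Longrightarrow> LT k (C k) = LT K (C K)"
      using stable[of "\<lambda>k. LT k (C k)"] LT_closed[OF C(1)] LT_sub by blast
    have "incseq (\<lambda>j. LT k (C j))" for k by (rule monoI) (rule LT_mono[OF C(3)])
    then have "\<exists>J. \<forall>j\<ge>J. LT k (C j) = LT k (C J)" for k
      by (intro stable LT_closed C(1) LT_sub)
    then obtain J where J: "\<And>k j. j \<ge> J k \<Longrightarrow> LT k (C j) = LT k (C (J k))" by metis
    define j0 where "j0 = K + (\<Sum>k<K. J k)"
    have J_le: "J k \<le> j0" if "k < K" for k
      using member_le_sum[of k "{..<K}" J] that by (simp add: j0_def)
    have LT_eq: "LT k (C j) \<subseteq> LT k (C j0)" if j: "j \<ge> j0" for k j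
    proof (cases "k < K")
      case True
      then show ?thesis using J[of k j] J[of k j0] J_le[OF True] j by simp
    next
      case False
      have "LT k (C j) \<subseteq> LT (max k j) (C (max k j))"
        using LT_le[OF C(1), of k "max k j" j] LT_mono[OF C(3), of j "max k j" "max k j"] by auto
      also have "\<dots> = LT K (C K)" using False by (intro K) auto
      also have "\<dots> \<subseteq> LT K (C j0)" by (intro LT_mono C(3)) (simp add: j0_def)
      also have "\<dots> \<subseteq> LT k (C j0)" using False by (intro LT_le C) auto
      finally show ?thesis .
    qed
    \<comment> \<open>Subtracting an element of \<open>C j0\<close> with the same leading
      coefficient lowers the degree and stays in \<open>C j\<close>, so induction on the degree
      applies.\<close>
    have "C j \<subseteq> C j0" if j: "j \<ge> j0" for j
    proof -
      have "a \<in> C j0" if "a \<in> C j" "a \<in> poly_part x W m" for a m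
        using that
      proof (induction m arbitrary: a)
        case 0
        then show ?case using C(1)[of j0] by (simp add: op_closed_def)
      next
        case (Suc m)
        then obtain y w where yw: "a = y + (x ^^ m) w" "y \<in> poly_part x W m" "w \<in> W" by auto
        then have "w \<in> LT m (C j)" using Suc.prems(1) unfolding LT_def by blast
        then have "w \<in> LT m (C j0)" using LT_eq[OF j] by blast
        then obtain z where z: "z \<in> poly_part x W m" "z + (x ^^ m) w \<in> C j0" by (auto simp: LT_def)
        have "a - (z + (x ^^ m) w) \<in> C j" using z C(3)[OF j] Suc.prems by (intro op_closed_diff[OF C(1)]) auto
        moreover have eq: "a - (z + (x ^^ m) w) = y - z" using yw by simp
        ultimately have "y - z \<in> C j0" using Suc.IH[of "y - z"] op_closed_diff[OF part yw(2) z(1)] by simp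
        then have "(y - z) + (z + (x ^^ m) w) \<in> C j0" by (rule op_closed_add[OF C(1) _ z(2)])
        then show ?case using yw by simp
      qed
      then show ?thesis using C(2)[of j] by (auto simp: V_def)
    qed
    then show "\<exists>k. \<forall>i\<ge>k. C i = C k" using C(3) by blast
  qed
qed

lemma op_noetherian_list:
  assumes "op_noetherian Op W"
    and "\<And>h. h \<in> Op \<union> set xs \<Longrightarrow> additive h"
    and "\<And>h x v. h \<in> Op \<union> set xs \<Longrightarrow> x \<in> set xs \<Longrightarrow> h (x v) = x (h v)"
  shows "\<exists>V. W \<subseteq> V \<and> op_noetherian (set xs \<union> Op) V"
  using assms(2,3)
proof (induction xs)
  case Nil
  then show ?case using assms(1) by auto
next
  case (Cons x xs)
  have "\<exists>V. W \<subseteq> V \<and> op_noetherian (set xs \<union> Op) V"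
    by (rule Cons.IH) (use Cons.prems in auto)
  then obtain V where V: "W \<subseteq> V" "op_noetherian (set xs \<union> Op) V" by blast
  have "op_noetherian (insert x (set xs \<union> Op)) (\<Union>k. poly_part x V k)"
    using Cons.prems by (intro op_noetherian_step V) auto
  moreover have "V \<subseteq> poly_part x V (Suc 0)" by simp
  then have "W \<subseteq> (\<Union>k. poly_part x V k)" using V(1) by blast
  ultimately show ?case by auto
qed

section \<open>Multigraded families of submodules\<close>

definition mpow :: "(nat \<Rightarrow> 'a::comm_ring_1 idl) \<Rightarrow> nat \<Rightarrow> (nat \<Rightarrow> nat) \<Rightarrow> 'a idl" where
  "mpow I d n = (\<Prod>i\<le>d. I i ^ n i)"

lemma mpow_add: "mpow I d (n + m) = mpow I d n * mpow I d m"
  unfolding mpow_def by (simp add: power_add prod.distrib)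

lemma mpow_zero [simp]: "mpow I d 0 = 1"
  unfolding mpow_def by simp

lemma mpow_unit: "i \<le> d \<Longrightarrow> mpow I d (unit_exp i) = I i"
proof -
  assume "i \<le> d"
  then have "mpow I d (unit_exp i) = I i ^ unit_exp i i * (\<Prod>j\<in>{..d} - {i}. I j ^ unit_exp i j)"
    unfolding mpow_def by (intro prod.remove) auto
  also have "(\<Prod>j\<in>{..d} - {i}. I j ^ unit_exp i j) = 1"
    by (rule prod.neutral) (auto simp: unit_exp_def)
  finally show ?thesis by (simp add: unit_exp_def)
qed

lemma mpow_Suc: "i \<le> d \<Longrightarrow> mpow I d (n + unit_exp i) = I i * mpow I d n"
  by (simp add: mpow_add mpow_unit mult.commute)

lemma mpow_cong: "(\<forall>i\<le>d. n i = m i) \<Longrightarrow> mpow I d n = mpow I d m"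
  unfolding mpow_def by (rule prod.cong) auto

locale ideal_family = noetherian_module scale
  for scale :: "'a::comm_ring_1 \<Rightarrow> 'b::ab_group_add \<Rightarrow> 'b" +
  fixes I :: "nat \<Rightarrow> 'a idl" and d :: nat
  assumes noeth_ring: "noetherian_ring TYPE('a)"
begin

text \<open>A multigraded module over the multi-Rees algebra of \<open>I 0, \<dots>, I d\<close>, all of whose components are
  submodules of the one ambient module, is recorded by its components.\<close>

definition graded :: "((nat \<Rightarrow> nat) \<Rightarrow> 'b set) \<Rightarrow> bool" where
  "graded A \<longleftrightarrow> (\<forall>n. subspace (A n)) \<and> (\<forall>n i. i \<le> d \<longrightarrow> act (I i) (A n) \<subseteq> A (n + unit_exp i)) \<and>
     (\<forall>n m. (\<forall>i\<le>d. n i = m i) \<longrightarrow> A n = A m)"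

definition rees :: "'b set \<Rightarrow> (nat \<Rightarrow> nat) \<Rightarrow> 'b set" where
  "rees L n = act (mpow I d n) L"

lemma subspace_graded: "graded A \<Longrightarrow> subspace (A n)"
  by (simp add: graded_def)

lemma graded_step: "graded A \<Longrightarrow> i \<le> d \<Longrightarrow> act (I i) (A n) \<subseteq> A (n + unit_exp i)"
  by (simp add: graded_def)

lemma graded_elem: "graded A \<Longrightarrow> i \<le> d \<Longrightarrow> x \<in> idl_set (I i) \<Longrightarrow> a \<in> A n \<Longrightarrow> scale x a \<in> A (n + unit_exp i)"
  using graded_step actI by blast

lemma graded_cong: "graded A \<Longrightarrow> (\<forall>i\<le>d. n i = m i) \<Longrightarrow> A n = A m"
  by (simp add: graded_def)

lemma gradedI:
  assumes "\<And>n. subspace (A n)" "\<And>n i x a. i \<le> d \<Longrightarrow> x \<in> idl_set (I i) \<Longrightarrow> a \<in> A n \<Longrightarrow> scale x a \<in> A (n + unit_exp i)"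
    "\<And>n m. (\<forall>i\<le>d. n i = m i) \<Longrightarrow> A n = A m"
  shows "graded A"
  unfolding graded_def by (intro conjI allI impI act_leI assms) blast+

lemma subspace_rees [simp]: "subspace (rees L n)"
  by (simp add: rees_def)

lemma rees_Suc: "i \<le> d \<Longrightarrow> rees L (n + unit_exp i) = act (I i) (rees L n)"
  by (simp add: rees_def mpow_Suc act_mult)

lemma rees_add: "rees L (n + m) = act (mpow I d n) (rees L m)"
  by (simp add: rees_def mpow_add act_mult)

lemma rees_zero: "subspace L \<Longrightarrow> rees L 0 = L"
  by (simp add: rees_def act_one)

lemma rees_cong: "(\<forall>i\<le>d. n i = m i) \<Longrightarrow> rees L n = rees L m"
  unfolding rees_def by (simp add: mpow_cong[of d n m])

lemma rees_mono: "L \<subseteq> M \<Longrightarrow> rees L n \<subseteq> rees M n"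
  unfolding rees_def by (rule act_mono)

lemma rees_subset: "subspace L \<Longrightarrow> rees L n \<subseteq> L"
  unfolding rees_def by (rule act_subset)

lemma rees_antimono: "rees L (n + m) \<subseteq> rees L m"
  unfolding rees_add by (rule act_subset) simp

lemma graded_rees: "graded (rees L)"
  unfolding graded_def by (auto simp: rees_Suc dest: rees_cong[where L = L])

lemma graded_const: "subspace X \<Longrightarrow> graded (\<lambda>n. X)"
  unfolding graded_def by (auto dest: act_subset)

lemma graded_Int: "graded A \<Longrightarrow> graded B \<Longrightarrow> graded (\<lambda>n. A n \<inter> B n)"
  by (rule gradedI) (auto simp: subspace_graded subspace_inter graded_elem dest: graded_cong)

lemma graded_sum: "graded A \<Longrightarrow> graded B \<Longrightarrow> graded (\<lambda>n. A n \<oplus> B n)"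
proof (rule gradedI)
  assume A: "graded A" and B: "graded B"
  show "subspace (A n \<oplus> B n)" for n by (simp add: subspace_sum_sets subspace_graded A B)
  show "A n \<oplus> B n = A m \<oplus> B m" if "\<forall>i\<le>d. n i = m i" for n m
    using graded_cong[OF A that] graded_cong[OF B that] by simp
  fix n i x a assume "i \<le> d" "x \<in> idl_set (I i)" "a \<in> A n \<oplus> B n"
  then show "scale x a \<in> A (n + unit_exp i) \<oplus> B (n + unit_exp i)"
    using graded_elem[OF A] graded_elem[OF B]
    by (auto elim!: sum_setsE simp: scale_right_distrib intro!: sum_setsI)
qed

lemma graded_shift: "graded A \<Longrightarrow> graded (\<lambda>n. A (n + m))"
proof (rule gradedI)
  assume A: "graded A"
  show "subspace (A (n + m))" for n by (simp add: subspace_graded A)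
  show "A (n + m) = A (n' + m)" if "\<forall>i\<le>d. n i = n' i" for n n'
    using graded_cong[OF A, of "n + m" "n' + m"] that by simp
  fix n i x a assume "i \<le> d" "x \<in> idl_set (I i)" "a \<in> A (n + m)"
  then have "scale x a \<in> A (n + m + unit_exp i)" by (rule graded_elem[OF A])
  moreover have "n + m + unit_exp i = n + unit_exp i + m" by (simp add: add.assoc add.commute[of m])
  ultimately show "scale x a \<in> A (n + unit_exp i + m)" by simp
qed

text \<open>Graded submodules of the Rees module of the whole ambient module. This common finitely
  generated bound is what makes the ascending chain condition hold.\<close>

definition family :: "((nat \<Rightarrow> nat) \<Rightarrow> 'b set) \<Rightarrow> bool" where
  "family A \<longleftrightarrow> graded A \<and> (\<forall>n. A n \<subseteq> rees UNIV n)"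

lemma family_rees: "subspace L \<Longrightarrow> family (rees L)"
  unfolding family_def by (auto simp: graded_rees dest: rees_mono[THEN subsetD, rotated])

lemma family_graded: "family A \<Longrightarrow> graded A"
  by (simp add: family_def)

lemma subspace_family: "family A \<Longrightarrow> subspace (A n)"
  by (simp add: family_def graded_def)

lemma family_le: "family A \<Longrightarrow> graded B \<Longrightarrow> (\<And>n. B n \<subseteq> A n) \<Longrightarrow> family B"
  unfolding family_def by blast

text \<open>Homogeneous elements are modelled by functions on multi-indices with one non-zero value.
  Multiplication by a generator of \<open>I i\<close> placed in degree e_i becomes a shift operator.
  Starting from the degree-0 component, the basis theorem for commuting operators yields a
  Noetherian \<open>V\<close> containing all homogeneous elements of the Rees module, and families
  are compared through subsets of \<open>V\<close>.\<close>

lemma family_acc: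
  assumes C: "\<And>j :: nat. family (C j)" and inc: "\<And>j n. C j n \<subseteq> C (Suc j) n"
  shows "\<exists>k. \<forall>j\<ge>k. C j = C k"
proof -
  \<comment> \<open>The element \<open>x\<close> of \<open>I i\<close>, seen in degree e_i of the
    Rees algebra, shifts the index by e_i and multiplies by \<open>x\<close>. The value 0 at
    \<open>n i = 0\<close> reflects that nothing is shifted there.\<close>
  define S :: "nat \<times> 'a \<Rightarrow> ((nat \<Rightarrow> nat) \<Rightarrow> 'b) \<Rightarrow> (nat \<Rightarrow> nat) \<Rightarrow> 'b"
    where "S = (\<lambda>(i, x) f n. if n i = 0 then 0 else scale x (f (n(i := n i - 1))))"
  define s where "s i x = S (i, x)" for i x
  have s: "s i x f n = (if n i = 0 then 0 else scale x (f (n(i := n i - 1))))" for i x f n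
    by (simp add: s_def S_def)
  define h where "h r f = (\<lambda>n. scale r (f n))" for r and f :: "(nat \<Rightarrow> nat) \<Rightarrow> 'b"
  define single where "single n v = (\<lambda>m. if m = n then v else 0)" for n :: "nat \<Rightarrow> nat" and v :: 'b
  define W0 where "W0 = {f :: (nat \<Rightarrow> nat) \<Rightarrow> 'b. \<forall>n. n \<noteq> 0 \<longrightarrow> f n = 0}"
  have add_h: "additive (h r)" for r by (rule additive.intro) (auto simp: h_def scale_right_distrib)
  have add_s: "additive (s i x)" for i x by (rule additive.intro) (auto simp: s scale_right_distrib)
  have hs: "h r (s i x f) = s i x (h r f)" for r i x f
    by (auto simp: h_def s fun_eq_iff mult.commute)
  have ss: "s i x (s j y f) = s j y (s i x f)" for i x j y f
  proof
    fix n
    show "s i x (s j y f) n = s j y (s i x f) n"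
      by (cases "i = j") (auto simp: s mult.commute fun_upd_twist)
  qed
  obtain G where G: "\<And>i. finite (G i)" "\<And>i. ring.span (G i) = idl_set (I i)"
  proof -
    interpret R: noetherian_module "(*) :: 'a \<Rightarrow> 'a \<Rightarrow> 'a" by (rule noetherian_module_ring[OF noeth_ring])
    have "\<exists>G. finite G \<and> ring.span G = idl_set (I i)" for i
      using R.finite_generators[OF subspace_idl_set[of "I i"]] by metis
    then show ?thesis using that by metis
  qed
  have "finite (SIGMA i:{..d}. G i)" using G by auto
  then obtain xs where xs: "set xs = (SIGMA i:{..d}. G i)" using finite_list by blast
  \<comment> \<open>Functions supported at 0 are a copy of the ambient module, and closure under all
    \<open>h r\<close> means being a submodule of it.\<close>
  have W0_noeth: "op_noetherian (range h) W0"
    unfolding op_noetherian_def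
  proof (intro conjI allI impI)
    show "op_closed (range h) W0" by (auto simp: op_closed_def W0_def h_def)
    fix C :: "nat \<Rightarrow> ((nat \<Rightarrow> nat) \<Rightarrow> 'b) set"
    assume "(\<forall>i. op_closed (range h) (C i) \<and> C i \<subseteq> W0) \<and> incseq C"
    then have C: "\<And>i. op_closed (range h) (C i)" "\<And>i. C i \<subseteq> W0" "\<And>i j. i \<le> j \<Longrightarrow> C i \<subseteq> C j"
      by (auto dest: incseqD)
    define D where "D i = {v. single 0 v \<in> C i}" for i
    have sub: "subspace (D i)" for i
    proof (rule subspaceI)
      have "single 0 0 = 0" by (auto simp: single_def fun_eq_iff)
      then show "0 \<in> D i" using C(1)[of i] by (simp add: D_def op_closed_def)
      fix v w assume "v \<in> D i" "w \<in> D i"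
      moreover have "single 0 (v + w) = single 0 v + single 0 w" by (auto simp: single_def fun_eq_iff)
      ultimately show "v + w \<in> D i" using op_closed_add[OF C(1)] by (simp add: D_def)
    next
      fix c v assume "v \<in> D i"
      moreover have "single 0 (scale c v) = h c (single 0 v)" by (auto simp: single_def h_def fun_eq_iff)
      ultimately show "scale c v \<in> D i" using op_closed_op[OF C(1), of "h c"] by (simp add: D_def)
    qed
    have "incseq D" by (rule monoI) (use C(3) in \<open>auto simp: D_def\<close>)
    from acc[OF sub this] obtain k where k: "\<forall>i\<ge>k. D i = D k" ..
    have "C i = C k" if "i \<ge> k" for i
    proof (rule subset_antisym[OF subsetI C(3)[OF that]])
      fix f assume f: "f \<in> C i"
      have eq: "f = single 0 (f 0)"
      proof
        fix n
        show "f n = single 0 (f 0) n"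
        proof (cases "n = 0")
          case True
          then show ?thesis by (simp add: single_def del: zero_fun_apply)
        next
          case False
          have "f \<in> W0" using f C(2) by blast
          then have "f n = 0" using False unfolding W0_def by blast
          then show ?thesis using False by (simp only: single_def if_False)
        qed
      qed
      then have "f 0 \<in> D i" using f by (simp only: D_def mem_Collect_eq)
      then have "f 0 \<in> D k" using k that by blast
      then show "f \<in> C k" using eq by (simp only: D_def mem_Collect_eq)
    qed
    then show "\<exists>k. \<forall>i\<ge>k. C i = C k" by blast
  qed
  have "\<exists>V. W0 \<subseteq> V \<and> op_noetherian (set (map S xs) \<union> range h) V"
  proof (rule op_noetherian_list[OF W0_noeth])
    fix g assume "g \<in> range h \<union> set (map S xs)"
    then show "additive g" using add_h add_s by (auto simp: s_def)
  next
    fix g x v assume "g \<in> range h \<union> set (map S xs)" "x \<in> set (map S xs)"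
    then obtain j y where x: "x = s j y" by (auto simp: s_def)
    from \<open>g \<in> _\<close> consider r where "g = h r" | i z where "g = s i z" by (auto simp: s_def)
    then show "g (x v) = x (g v)" by cases (simp_all add: x hs ss)
  qed
  then obtain V where V: "W0 \<subseteq> V" "op_noetherian (set (map S xs) \<union> range h) V" by blast
  have Vc: "op_closed (set (map S xs) \<union> range h) V" using V(2) by (simp add: op_noetherian_def)
  have sV: "s i x f \<in> V" if "i \<le> d" "x \<in> G i" "f \<in> V" for i x f
    using op_closed_op[OF Vc _ that(3), of "s i x"] that xs by (auto simp: s_def)
  \<comment> \<open>The degree-\<open>n\<close> elements present in \<open>V\<close>. Only closure
    of \<open>V\<close> under generators of the \<open>I i\<close> is known, so the step to all of
    \<open>I i\<close> passes through spans.\<close>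
  define D where "D n = {v. single n v \<in> V}" for n
  have D_sub: "subspace (D n)" for n
  proof (rule subspaceI)
    have "single n 0 = 0" by (auto simp: single_def fun_eq_iff)
    then show "0 \<in> D n" using Vc by (simp add: D_def op_closed_def)
    fix v w assume "v \<in> D n" "w \<in> D n"
    moreover have "single n (v + w) = single n v + single n w" by (auto simp: single_def fun_eq_iff)
    ultimately show "v + w \<in> D n" using op_closed_add[OF Vc] by (simp add: D_def)
  next
    fix c v assume "v \<in> D n"
    moreover have "single n (scale c v) = h c (single n v)" by (auto simp: single_def h_def fun_eq_iff)
    ultimately show "scale c v \<in> D n" using op_closed_op[OF Vc, of "h c"] by (simp add: D_def)
  qed
  have D_step: "act (I i) (D n) \<subseteq> D (n + unit_exp i)" if i: "i \<le> d" for i n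
  proof (rule act_leI[OF D_sub])
    fix r v assume r: "r \<in> idl_set (I i)" and v: "v \<in> D n"
    have "ring.span (G i) \<subseteq> {r. scale r v \<in> D (n + unit_exp i)}"
    proof (rule ring.span_minimal)
      show "ring.subspace {r. scale r v \<in> D (n + unit_exp i)}"
        by (rule ring.subspaceI)
          (auto simp: scale_left_distrib subspace_0[OF D_sub] subspace_add[OF D_sub]
            scale_scale[symmetric] subspace_scale[OF D_sub] simp del: scale_scale)
      show "G i \<subseteq> {r. scale r v \<in> D (n + unit_exp i)}"
      proof
        fix x assume x: "x \<in> G i"
        have "s i x (single n v) = single (n + unit_exp i) (scale x v)"
        proof
          fix m
          show "s i x (single n v) m = single (n + unit_exp i) (scale x v) m"
          proof (cases "m i = 0")
            case True
            then have "m \<noteq> n + unit_exp i" by (auto simp: unit_exp_def fun_eq_iff)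
            then show ?thesis using True by (simp add: s single_def)
          next
            case False
            then have "m(i := m i - 1) = n \<longleftrightarrow> m = n + unit_exp i"
              by (auto simp: unit_exp_def fun_eq_iff)
            then show ?thesis using False by (simp add: s single_def)
          qed
        qed
        then show "x \<in> {r. scale r v \<in> D (n + unit_exp i)}"
          using sV[OF i x, of "single n v"] v by (simp add: D_def)
      qed
    qed
    then show "scale r v \<in> D (n + unit_exp i)" using r G(2) by blast
  qed
  have D_rees: "rees UNIV n \<subseteq> D n" if "\<forall>i>d. n i = 0" for n
    using that
  proof (induction "tdeg d n" arbitrary: n)
    case 0
    then have "n i = 0" for i by (cases "i \<le> d") (auto simp: tdeg_def)
    then have "n = 0" by auto
    moreover have "D 0 = UNIV" using V(1) by (auto simp: D_def W0_def single_def)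
    ultimately show ?case by (simp only: subset_UNIV)
  next
    case (Suc k)
    have "\<exists>i\<le>d. n i \<noteq> 0"
    proof (rule ccontr)
      assume "\<not> ?thesis"
      then have "tdeg d n = 0" by (auto simp: tdeg_def)
      then show False using Suc by simp
    qed
    then obtain i where i: "i \<le> d" "n i \<noteq> 0" by blast
    define m where "m = n(i := n i - 1)"
    have n: "n = m + unit_exp i" using i by (auto simp: m_def unit_exp_def fun_eq_iff)
    have "tdeg d (unit_exp i) = 1" using i by (simp add: tdeg_def unit_exp_def)
    then have "k = tdeg d m" using Suc(2) by (simp add: n tdeg_def sum.distrib)
    then have "rees UNIV m \<subseteq> D m" using Suc by (intro Suc.hyps(1)) (auto simp: m_def)
    then show ?case unfolding n rees_Suc[OF i(1)] using D_step[OF i(1), of m] act_mono by blast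
  qed
  \<comment> \<open>A family is recovered from \<open>B j\<close> on multi-indices supported in
    \<open>{..d}\<close>, because the one-point functions with value in \<open>C j n\<close> belong
    to \<open>B j\<close>.\<close>
  define B where "B j = {f \<in> V. \<forall>n. (\<forall>i>d. n i = 0) \<longrightarrow> f n \<in> C j n}" for j
  have B_closed: "op_closed (set (map S xs) \<union> range h) (B j)" for j
    unfolding op_closed_def
  proof (intro conjI ballI)
    have sub: "subspace (C j n)" for n using C subspace_family by blast
    show "0 \<in> B j" using Vc subspace_0[OF sub] by (auto simp: B_def op_closed_def)
    fix f g assume "f \<in> B j" "g \<in> B j"
    then show "f - g \<in> B j" using op_closed_diff[OF Vc] subspace_diff[OF sub] by (auto simp: B_def)
  next
    have sub: "subspace (C j n)" for n using C subspace_family by blast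
    fix g f assume g: "g \<in> set (map S xs) \<union> range h" and f: "f \<in> B j"
    have "g f \<in> V" using op_closed_op[OF Vc g] f by (simp add: B_def)
    moreover have "g f n \<in> C j n" if n: "\<forall>i>d. n i = 0" for n
    proof (cases "g \<in> range h")
      case True
      then show ?thesis using f n subspace_scale[OF sub] by (auto simp: B_def h_def)
    next
      case False
      then obtain i x where ix: "i \<le> d" "x \<in> G i" "g = s i x" using g xs by (auto simp: s_def)
      show ?thesis
      proof (cases "n i = 0")
        case True
        then show ?thesis using ix subspace_0[OF sub] by (simp add: s)
      next
        case False
        have "x \<in> idl_set (I i)" using ix(2) G(2) ring.span_base by blast
        moreover have "f (n(i := n i - 1)) \<in> C j (n(i := n i - 1))" using f n ix(1) by (auto simp: B_def)
        ultimately have "scale x (f (n(i := n i - 1))) \<in> C j (n(i := n i - 1) + unit_exp i)"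
          by (rule graded_elem[OF family_graded[OF C] ix(1)])
        moreover have "n(i := n i - 1) + unit_exp i = n" using False by (auto simp: unit_exp_def fun_eq_iff)
        ultimately show ?thesis using ix False by (simp add: s)
      qed
    qed
    ultimately show "g f \<in> B j" by (simp add: B_def)
  qed
  have "incseq B" by (rule incseq_SucI) (use inc in \<open>auto simp: B_def\<close>)
  moreover have "\<forall>j. op_closed (set (map S xs) \<union> range h) (B j) \<and> B j \<subseteq> V"
    using B_closed by (simp add: B_def)
  ultimately have "\<exists>k. \<forall>j\<ge>k. B j = B k" using V(2) unfolding op_noetherian_def by simp
  then obtain k where "\<forall>j\<ge>k. B j = B k" ..
  then have k: "\<And>j. j \<ge> k \<Longrightarrow> B j = B k" by (elim allE impE)
  have mono: "C i n \<subseteq> C j n" if "i \<le> j" for i j n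
    using lift_Suc_mono_le[of "\<lambda>j. C j n", OF inc that] .
  have "C j n = C k n" if j: "j \<ge> k" for j n
  proof (rule subset_antisym[OF _ mono[OF j]])
    \<comment> \<open>Coordinates beyond \<open>d\<close> do not affect a graded family, but
      elements of \<open>V\<close> are only understood where those coordinates vanish.\<close>
    define m where "m = (\<lambda>i. if i \<le> d then n i else 0)"
    have m: "C i n = C i m" for i using graded_cong[OF family_graded[OF C]] by (simp add: m_def)
    have "C j m \<subseteq> C k m"
    proof
      fix v assume v: "v \<in> C j m"
      then have "v \<in> rees UNIV m" using C[of j] by (auto simp: family_def)
      then have "single m v \<in> V" using D_rees[of m] by (auto simp: m_def D_def)
      moreover have "0 \<in> C j l" for l using C subspace_family subspace_0 by blast
      ultimately have "single m v \<in> B j" using v by (auto simp: B_def single_def)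
      then have "single m v \<in> B k" using k[OF j] by simp
      then have "single m v m \<in> C k m" by (simp add: B_def m_def)
      then show "v \<in> C k m" by (simp add: single_def)
    qed
    then show "C j n \<subseteq> C k n" unfolding m .
  qed
  then show ?thesis by blast
qed

lemma wf_families: "wf {(B, A). family A \<and> family B \<and> A < B}"
  unfolding wf_iff_no_infinite_down_chain
proof
  assume "\<exists>f. \<forall>i. (f (Suc i), f i) \<in> {(B, A). family A \<and> family B \<and> A < B}"
  then obtain f where "\<forall>i. (f (Suc i), f i) \<in> {(B, A). family A \<and> family B \<and> A < B}" by blast
  then have f: "\<And>i. family (f i)" "\<And>i. f i < f (Suc i)" by auto
  then have "f i n \<subseteq> f (Suc i) n" for i n using f(2)[of i] by (simp add: less_fun_def le_fun_def)
  from family_acc[of f, OF f(1) this] obtain k where k: "\<forall>i\<ge>k. f i = f k" ..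
  then have "f (Suc k) = f k" using le_SucI[OF order_refl] by (elim allE impE)
  then show False using f(2)[of k] by simp
qed

text \<open>\<open>C j\<close> is the subfamily of \<open>A\<close> generated by its components with
  all coordinates at most \<open>j\<close>. These subfamilies increase and exhaust \<open>A\<close>,
  so the chain condition gives \<open>A = C c\<close>; and beyond \<open>c\<close>, raising
  coordinate \<open>i\<close> in \<open>C c\<close> is multiplication by \<open>I i\<close>. The
  bound is uniform in all other coordinates.\<close>

lemma artin_rees:
  assumes A: "family A"
  shows "\<exists>c. \<forall>n i. i \<le> d \<and> c \<le> n i \<longrightarrow> A (n + unit_exp i) = act (I i) (A n)"
proof -
  define C where "C j n = act (mpow I d (\<lambda>i. n i - j)) (A (\<lambda>i. min (n i) j))" for j :: nat and n
  have gA: "graded A" by (rule family_graded[OF A])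
  have step: "act (mpow I d m) (A n) \<subseteq> A (n + m)" if "\<forall>i>d. m i = 0" for n m
    using that
  proof (induction "tdeg d m" arbitrary: m)
    case 0
    then have "m i = 0" for i by (cases "i \<le> d") (auto simp: tdeg_def)
    then have "m = 0" by auto
    then show ?case using act_one[OF subspace_family[OF A]] by (simp only: mpow_zero add_0_right order_refl)
  next
    case (Suc k)
    have "\<exists>i\<le>d. m i \<noteq> 0"
    proof (rule ccontr)
      assume "\<not> ?thesis"
      then have "tdeg d m = 0" by (auto simp: tdeg_def)
      then show False using Suc by simp
    qed
    then obtain i where i: "i \<le> d" "m i \<noteq> 0" by blast
    define l where "l = m(i := m i - 1)"
    have m: "m = l + unit_exp i" using i by (auto simp: l_def unit_exp_def fun_eq_iff)
    have "tdeg d (unit_exp i) = 1" using i by (simp add: tdeg_def unit_exp_def)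
    then have "k = tdeg d l" using Suc(2) by (simp add: m tdeg_def sum.distrib)
    then have "act (mpow I d l) (A n) \<subseteq> A (n + l)" using Suc by (intro Suc.hyps(1)) (auto simp: l_def)
    then have "act (I i) (act (mpow I d l) (A n)) \<subseteq> act (I i) (A (n + l))" by (rule act_mono)
    also have "\<dots> \<subseteq> A (n + l + unit_exp i)" by (rule graded_step[OF gA i(1)])
    finally show ?case by (simp add: m mpow_Suc[OF i(1)] act_mult add.assoc)
  qed
  have step': "act (mpow I d m) (A n) \<subseteq> A (n + m)" for n m
  proof -
    define l where "l = (\<lambda>i. if i \<le> d then m i else 0)"
    have "mpow I d m = mpow I d l" by (rule mpow_cong) (simp add: l_def)
    moreover have "A (n + m) = A (n + l)" by (rule graded_cong[OF gA]) (simp add: l_def)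
    ultimately show ?thesis using step[of l n] by (simp add: l_def)
  qed
  have C_le: "C j n \<subseteq> A n" for j n
  proof -
    have "(\<lambda>i. min (n i) j) + (\<lambda>i. n i - j) = n" by (auto simp: fun_eq_iff)
    then show ?thesis unfolding C_def using step'[of "\<lambda>i. n i - j" "\<lambda>i. min (n i) j"] by simp
  qed
  have gC: "graded (C j)" for j
  proof (rule gradedI)
    show "subspace (C j n)" for n by (simp add: C_def)
    show "C j n = C j m" if "\<forall>i\<le>d. n i = m i" for n m
    proof -
      have "mpow I d (\<lambda>i. n i - j) = mpow I d (\<lambda>i. m i - j)" using that by (intro mpow_cong) auto
      moreover have "A (\<lambda>i. min (n i) j) = A (\<lambda>i. min (m i) j)" using that by (intro graded_cong[OF gA]) auto
      ultimately show ?thesis by (simp add: C_def)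
    qed
    fix n i x a assume i: "i \<le> d" and x: "x \<in> idl_set (I i)" and a: "a \<in> C j n"
    then have xa: "scale x a \<in> act (I i) (C j n)" by (intro actI)
    have "act (I i) (C j n) \<subseteq> C j (n + unit_exp i)"
    proof (cases "n i < j")
      case True
      then have "(\<lambda>l. (n + unit_exp i) l - j) = (\<lambda>l. n l - j)"
        and eq: "(\<lambda>l. min ((n + unit_exp i) l) j) = (\<lambda>l. min (n l) j) + unit_exp i"
        by (auto simp: unit_exp_def fun_eq_iff)
      then have "C j (n + unit_exp i) = act (mpow I d (\<lambda>l. n l - j)) (A ((\<lambda>l. min (n l) j) + unit_exp i))"
        by (simp only: C_def)
      moreover have "act (I i) (C j n) = act (mpow I d (\<lambda>l. n l - j)) (act (I i) (A (\<lambda>l. min (n l) j)))"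
        unfolding C_def by (rule act_commute)
      ultimately show ?thesis using act_mono[OF graded_step[OF gA i]] by simp
    next
      case False
      then have "(\<lambda>l. (n + unit_exp i) l - j) = (\<lambda>l. n l - j) + unit_exp i"
        and "(\<lambda>l. min ((n + unit_exp i) l) j) = (\<lambda>l. min (n l) j)"
        by (auto simp: unit_exp_def fun_eq_iff)
      then have "C j (n + unit_exp i) = act (mpow I d ((\<lambda>l. n l - j) + unit_exp i)) (A (\<lambda>l. min (n l) j))"
        by (simp only: C_def)
      also have "\<dots> = act (I i) (C j n)" unfolding C_def mpow_Suc[OF i] by (rule act_mult)
      finally show ?thesis by simp
    qed
    then show "scale x a \<in> C j (n + unit_exp i)" using xa by blast
  qed
  have fC: "family (C j)" for j by (rule family_le[OF A gC C_le])
  have "C j n \<subseteq> C (Suc j) n" for j n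
  proof -
    define e where "e = (\<lambda>i. if j < n i then 1 else 0 :: nat)"
    have "(\<lambda>i. n i - j) = (\<lambda>i. n i - Suc j) + e" by (auto simp: e_def fun_eq_iff)
    then have "C j n = act (mpow I d (\<lambda>i. n i - Suc j)) (act (mpow I d e) (A (\<lambda>i. min (n i) j)))"
      by (simp only: C_def mpow_add act_mult)
    moreover have "(\<lambda>i. min (n i) (Suc j)) = (\<lambda>i. min (n i) j) + e" by (auto simp: e_def fun_eq_iff)
    then have "act (mpow I d e) (A (\<lambda>i. min (n i) j)) \<subseteq> A (\<lambda>i. min (n i) (Suc j))"
      using step'[of e "\<lambda>i. min (n i) j"] by simp
    ultimately show ?thesis unfolding C_def[of "Suc j"] using act_mono by simp
  qed
  from family_acc[of C, OF fC this] obtain c where c: "\<forall>j\<ge>c. C j = C c" ..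
  have AC: "A n = C c n" for n
  proof -
    \<comment> \<open>Large enough that truncation at \<open>j\<close> leaves all relevant
      coordinates of \<open>n\<close> unchanged, and at least \<open>c\<close> so that
      \<open>C j = C c\<close>.\<close>
    define j where "j = max c (\<Sum>i\<le>d. n i)"
    have le: "n i \<le> j" if "i \<le> d" for i
      using member_le_sum[of i "{..d}" n] that by (simp add: j_def)
    have "mpow I d (\<lambda>i. n i - j) = mpow I d 0" using le by (intro mpow_cong) auto
    moreover have "A (\<lambda>i. min (n i) j) = A n" using le by (intro graded_cong[OF gA]) auto
    ultimately have "C j n = A n" using act_one[OF subspace_family[OF A]] by (simp add: C_def)
    moreover have "c \<le> j" by (simp add: j_def)
    note c[rule_format, OF this]
    ultimately show ?thesis by simp
  qed
  have "A (n + unit_exp i) = act (I i) (A n)" if i: "i \<le> d" "c \<le> n i" for n i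
  proof -
    have "(\<lambda>l. (n + unit_exp i) l - c) = (\<lambda>l. n l - c) + unit_exp i"
      and "(\<lambda>l. min ((n + unit_exp i) l) c) = (\<lambda>l. min (n l) c)"
      using i by (auto simp: unit_exp_def fun_eq_iff)
    then have "C c (n + unit_exp i) = act (I i) (C c n)"
      unfolding C_def by (simp only: mpow_Suc[OF i(1)] act_mult)
    then show ?thesis by (simp add: AC)
  qed
  then show ?thesis by blast
qed

end

section \<open>Filtrations with prime factors\<close>

declare plus_fun_apply [simp del] zero_fun_apply [simp del]

lemma prime_idealD: "prime_ideal p \<Longrightarrow> ring.subspace p" "prime_ideal p \<Longrightarrow> 1 \<notin> p"
  "prime_ideal p \<Longrightarrow> a * b \<in> p \<Longrightarrow> a \<in> p \<or> b \<in> p"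
proof -
  assume p: "prime_ideal p"
  show sub: "ring.subspace p" using p by (simp add: prime_ideal_def ideal_def)
  show "1 \<notin> p"
  proof
    assume "1 \<in> p"
    then have "r \<in> p" for r using ring.subspace_scale[OF sub, of 1 r] by simp
    then show False using p by (auto simp: prime_ideal_def)
  qed
  show "a * b \<in> p \<Longrightarrow> a \<in> p \<or> b \<in> p" using p by (auto simp: prime_ideal_def)
qed

lemma prime_ideal_power: "prime_ideal p \<Longrightarrow> x ^ m \<in> p \<Longrightarrow> x \<in> p"
  by (induction m) (auto dest: prime_idealD)

lemma power_mem_idl: "x \<in> idl_set K \<Longrightarrow> x ^ m \<in> idl_set (K ^ m)"
proof (induction m)
  case (Suc m)
  then show ?case unfolding power_Suc idl_set_mult ideal_mult_def by (intro ring.span_base) auto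
qed (simp add: idl_set_one)

lemma idl_mult_mem: "x \<in> idl_set K \<Longrightarrow> y \<in> idl_set L \<Longrightarrow> x * y \<in> idl_set (K * L)"
  unfolding idl_set_mult ideal_mult_def by (intro ring.span_base) auto

context module
begin

lemma subspace_range_scale: "subspace (range (\<lambda>r. scale r a))"
  using subspace_span[of "{a}"] by (simp only: span_singleton)

lemma subspace_conductor: "subspace M \<Longrightarrow> ring.subspace {r. scale r a \<in> M}"
  by (rule ring.subspaceI)
    (auto simp: subspace_0 scale_left_distrib subspace_add scale_scale[symmetric] subspace_scale simp del: scale_scale)

lemma module_hom_orbit: "module_hom (*) scale (\<lambda>r. scale r a)"
  by unfold_locales (simp_all add: algebra_simps)

text \<open>With p the conductor of \<open>a\<close> into M, the quotient (M + Ra)/M is R/p, so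
  lengths in it are computed in the ring.\<close>

lemma mod_length_cyclic:
  assumes M: "subspace M" and X: "ring.subspace X" and Y: "ring.subspace Y" and YX: "Y \<subseteq> X"
  shows "mod_length scale ((\<lambda>r. scale r a) ` X \<oplus> M) ((\<lambda>r. scale r a) ` Y \<oplus> M)
    = mod_length (*) (X \<oplus> {r. scale r a \<in> M}) (Y \<oplus> {r. scale r a \<in> M})"
proof -
  let ?p = "{r. scale r a \<in> M}"
  interpret h: module_hom "(*)" scale "\<lambda>r. scale r a" by (rule module_hom_orbit)
  note p = subspace_conductor[OF M, of a]
  have eq: "(\<lambda>r. scale r a) ` (Z \<oplus> ?p) \<oplus> M = (\<lambda>r. scale r a) ` Z \<oplus> M" if Z: "ring.subspace Z" for Z
  proof (intro subset_antisym sum_sets_least subspace_sum_sets h.subspace_image M Z)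
    show "(\<lambda>r. scale r a) ` (Z \<oplus> ?p) \<subseteq> (\<lambda>r. scale r a) ` Z \<oplus> M"
      by (auto elim!: sum_setsE simp: scale_left_distrib intro!: sum_setsI)
    show "M \<subseteq> (\<lambda>r. scale r a) ` Z \<oplus> M" by (intro sum_sets_upper2 h.subspace_image Z)
    show "ring.subspace (Z \<oplus> ?p)" by (intro ring.subspace_sum_sets Z p)
    have "Z \<subseteq> Z \<oplus> ?p" by (rule ring.sum_sets_upper1[OF p])
    then show "(\<lambda>r. scale r a) ` Z \<subseteq> (\<lambda>r. scale r a) ` (Z \<oplus> ?p) \<oplus> M"
      using sum_sets_upper1[OF M, of "(\<lambda>r. scale r a) ` (Z \<oplus> ?p)"] by blast
    show "M \<subseteq> (\<lambda>r. scale r a) ` (Z \<oplus> ?p) \<oplus> M"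
      by (intro sum_sets_upper2 h.subspace_image ring.subspace_sum_sets Z p)
  qed
  have "mod_length scale ((\<lambda>r. scale r a) ` (X \<oplus> ?p) \<oplus> M) ((\<lambda>r. scale r a) ` (Y \<oplus> ?p) \<oplus> M)
      = mod_length (*) (X \<oplus> ?p) (Y \<oplus> ?p)"
    using ring.sum_sets_upper2[OF Y, of ?p]
    by (intro h.mod_length_image ring.subspace_sum_sets X Y p M sum_sets_mono YX) auto
  then show ?thesis by (simp only: eq[OF X] eq[OF Y])
qed

lemma mod_length_cyclic_quotient:
  assumes M: "subspace M"
  shows "mod_length scale (M \<oplus> range (\<lambda>r. scale r a)) M = mod_length (*) UNIV {r. scale r a \<in> M}"
proof -
  have "UNIV \<oplus> {r. scale r a \<in> M} = UNIV"
    by (intro ring.sum_sets_absorb2 subspace_conductor M) auto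
  moreover have "{0} \<oplus> {r. scale r a \<in> M} = {r. scale r a \<in> M}" by simp
  ultimately show ?thesis
    using mod_length_cyclic[OF M, of UNIV "{0}" a] by (simp add: sum_sets_commute)
qed

end

text \<open>Filtrations with factors R/p in the form of an induction principle. If a maximal
  submodule with \<open>Q\<close> were not \<open>A\<close>, an associated prime of the quotient
  would permit one more step.\<close>

lemma (in noetherian_module) prime_devissage:
  assumes noeth: "noetherian_ring TYPE('a)" and A: "subspace A" and B: "subspace B" "B \<subseteq> A" "Q B"
    and step: "\<And>M a p. subspace M \<Longrightarrow> B \<subseteq> M \<Longrightarrow> M \<subseteq> A \<Longrightarrow> a \<in> A \<Longrightarrow> a \<notin> M \<Longrightarrow> prime_ideal p \<Longrightarrow>
        p = {r. scale r a \<in> M} \<Longrightarrow> Q M \<Longrightarrow> Q (M \<oplus> range (\<lambda>r. scale r a))"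
  shows "Q A"
proof -
  interpret R: noetherian_module "(*) :: 'a \<Rightarrow> 'a \<Rightarrow> 'a" by (rule noetherian_module_ring[OF noeth])
  obtain Y where Y: "subspace Y \<and> B \<subseteq> Y \<and> Y \<subseteq> A \<and> Q Y"
    and max: "\<And>Z. subspace Z \<and> B \<subseteq> Z \<and> Z \<subseteq> A \<and> Q Z \<Longrightarrow> Y \<subseteq> Z \<Longrightarrow> Z = Y"
    using maximal_subspace[of "\<lambda>X. subspace X \<and> B \<subseteq> X \<and> X \<subseteq> A \<and> Q X" B] B by auto
  have sY: "subspace Y" using Y by simp
  have "Y = A"
  proof (rule ccontr)
    assume "Y \<noteq> A"
    then obtain b where b: "b \<in> A" "b \<notin> Y" using Y by blast
    \<comment> \<open>Among the conductors of elements outside \<open>Y\<close>, a maximal one is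
      prime: if \<open>y\<close> is not in \<open>p\<close>, then the conductor of
      \<open>scale y a\<close> contains \<open>p\<close>, hence equals it.\<close>
    define P where "P p \<longleftrightarrow> (\<exists>a\<in>A - Y. p = {r. scale r a \<in> Y})" for p
    have "P {r. scale r b \<in> Y}" using b by (auto simp: P_def)
    moreover have "ring.subspace p" if "P p" for p
      using that subspace_conductor[OF sY] by (auto simp: P_def)
    ultimately obtain p where "P p" and pmax: "\<And>q. P q \<Longrightarrow> p \<subseteq> q \<Longrightarrow> q = p"
      using R.maximal_subspace[of P "{r. scale r b \<in> Y}"] by metis
    then have p: "\<exists>a\<in>A - Y. p = {r. scale r a \<in> Y}" by (simp add: P_def)
    then obtain a where a: "a \<in> A" "a \<notin> Y" "p = {r. scale r a \<in> Y}" by blast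
    have "prime_ideal p" unfolding prime_ideal_def
    proof (intro conjI allI impI)
      show "ideal p" unfolding ideal_def a(3) by (rule subspace_conductor[OF sY])
      show "p \<noteq> UNIV" using a by (metis UNIV_I mem_Collect_eq scale_one)
      fix x y assume xy: "x * y \<in> p"
      show "x \<in> p \<or> y \<in> p"
      proof (cases "y \<in> p")
        case False
        have "scale y a \<in> A - Y" using False a subspace_scale[OF A] by auto
        moreover have "p \<subseteq> {r. scale r (scale y a) \<in> Y}"
        proof
          fix r assume "r \<in> p"
          then have "scale y (scale r a) \<in> Y" using a(3) subspace_scale[OF sY] by blast
          then show "r \<in> {r. scale r (scale y a) \<in> Y}" by (simp add: mult.commute)
        qed
        ultimately have "{r. scale r (scale y a) \<in> Y} = p"
          by (intro pmax) (auto simp only: P_def)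
        then show ?thesis using xy a(3) by auto
      qed simp
    qed
    then have "Q (Y \<oplus> range (\<lambda>r. scale r a))" using step[of Y a p] Y a by blast
    moreover have "Y \<oplus> range (\<lambda>r. scale r a) \<subseteq> A"
      using Y a subspace_scale[OF A] by (intro sum_sets_least A) auto
    moreover have "Y \<subseteq> Y \<oplus> range (\<lambda>r. scale r a)" by (intro sum_sets_upper1 subspace_range_scale)
    ultimately have "Y \<oplus> range (\<lambda>r. scale r a) = Y"
      using Y by (intro max) (auto simp: subspace_sum_sets subspace_range_scale)
    moreover have "a \<in> Y \<oplus> range (\<lambda>r. scale r a)"
      using sum_setsI[OF subspace_0[OF sY] rangeI, of "\<lambda>r. scale r a" 1] by simp
    ultimately show False using a by simp
  qed
  then show ?thesis using Y by simp
qed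

section \<open>Local rings and finite length\<close>

text \<open>Real values allow subtraction and comparison with polynomials. An infinite length
  carries no information here, so addition and monotonicity laws come with finiteness
  conditions.\<close>

definition rlength :: "('a::comm_ring_1 \<Rightarrow> 'b::ab_group_add \<Rightarrow> 'b) \<Rightarrow> 'b set \<Rightarrow> 'b set \<Rightarrow> real" where
  "rlength scale A B = real (the_enat (mod_length scale A B))"

lemma rlength_nonneg [simp]: "0 \<le> rlength scale A B"
  by (simp add: rlength_def)

lemma rlength_self [simp]: "rlength scale A A = 0"
  by (simp add: rlength_def zero_enat_def)

lemma rlength_add_enat:
  assumes "mod_length s A B = mod_length s' A' B' + mod_length s'' A'' B''" "mod_length s A B \<noteq> \<infinity>"
  shows "rlength s A B = rlength s' A' B' + rlength s'' A'' B''"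
  using assms by (auto simp: rlength_def plus_enat_def split: enat.splits)

lemma rlength_mono_enat:
  assumes "mod_length s A B \<le> mod_length s' A' B'" "mod_length s' A' B' \<noteq> \<infinity>"
  shows "rlength s A B \<le> rlength s' A' B'"
  using assms by (cases "mod_length s A B"; cases "mod_length s' A' B'") (auto simp: rlength_def)

lemma mod_length_maximal:
  assumes "maximal_ideal M" shows "mod_length (*) UNIV M \<le> 1"
  unfolding mod_length_def
proof (rule chain_len_leI)
  fix k C
  assume C: "\<forall>i\<le>k. ring.subspace (C i) \<and> M \<subseteq> C i \<and> C i \<subseteq> UNIV" "\<forall>i<k. C i \<subset> C (Suc i)"
  have "\<not> 2 \<le> k"
  proof
    assume "2 \<le> k"
    then have "C 0 \<subset> C 1" "C 1 \<subset> C 2" "ring.subspace (C 1)" "M \<subseteq> C 0" "M \<subseteq> C 1"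
      using C(1) C(2)[rule_format, of 0] C(2)[rule_format, of 1] by (auto simp: numeral_2_eq_2)
    moreover from this have "C 1 = M" using assms unfolding maximal_ideal_def ideal_def by blast
    ultimately show False by blast
  qed
  then have "k \<le> 1" by linarith
  then show "enat k \<le> 1" by (simp add: one_enat_def)
qed

locale local_family = ideal_family scale I d
  for scale :: "'a::comm_ring_1 \<Rightarrow> 'b::ab_group_add \<Rightarrow> 'b" and I :: "nat \<Rightarrow> 'a idl" and d :: nat +
  fixes \<nn> :: "'a set"
  assumes local: "local_ring_with_max \<nn>" and primary: "primary_to (idl_set (I 0)) \<nn>"
begin

lemma maximal: "maximal_ideal \<nn>"
  using local by (simp add: local_ring_with_max_def)

lemma proper_ideal_le:
  assumes K: "ideal K" "K \<noteq> UNIV" shows "K \<subseteq> \<nn>"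
proof -
  interpret R: noetherian_module "(*) :: 'a \<Rightarrow> 'a \<Rightarrow> 'a" by (rule noetherian_module_ring[OF noeth_ring])
  obtain M where M: "ideal M \<and> K \<subseteq> M \<and> M \<noteq> UNIV"
    "\<And>L. ideal L \<and> K \<subseteq> L \<and> L \<noteq> UNIV \<Longrightarrow> M \<subseteq> L \<Longrightarrow> L = M"
    using R.maximal_subspace[of "\<lambda>L. ideal L \<and> K \<subseteq> L \<and> L \<noteq> UNIV" K] K by (auto simp: ideal_def)
  then have "maximal_ideal M" unfolding maximal_ideal_def by blast
  then have "M = \<nn>" using local by (simp add: local_ring_with_max_def)
  then show ?thesis using M by simp
qed

lemma ideal_max: "ring.subspace \<nn>" "\<nn> \<noteq> UNIV"
  using maximal by (auto simp: maximal_ideal_def ideal_def)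

lemma prime_le_max: "prime_ideal p \<Longrightarrow> p \<subseteq> \<nn>"
  using proper_ideal_le by (simp add: prime_ideal_def)

lemma I0_le_max: "idl_set (I 0) \<subseteq> \<nn>"
  using primary power_one_right unfolding primary_to_def radical_def by (metis (mono_tags, lifting) mem_Collect_eq subsetI)

lemma prime_over_I0: "prime_ideal p \<Longrightarrow> idl_set (I 0) \<subseteq> p \<Longrightarrow> p = \<nn>"
proof (rule subset_antisym)
  assume p: "prime_ideal p" "idl_set (I 0) \<subseteq> p"
  show "p \<subseteq> \<nn>" by (rule prime_le_max[OF p(1)])
  show "\<nn> \<subseteq> p"
  proof
    fix x assume "x \<in> \<nn>"
    then have "x \<in> radical (idl_set (I 0))" using primary by (simp add: primary_to_def)
    then obtain m where "x ^ m \<in> p" using p(2) by (auto simp: radical_def)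
    then show "x \<in> p" by (rule prime_ideal_power[OF p(1)])
  qed
qed

text \<open>A prime occurring in a filtration between B and A contains the m-th powers of the
  elements of \<open>I 0\<close>, so it is the maximal ideal, and each step adds length at most
  1.\<close>

lemma finite_length:
  assumes A: "subspace A" and B: "subspace B" "B \<subseteq> A" and ann: "act (I 0 ^ m) A \<subseteq> B"
  shows "mod_length scale A B \<noteq> \<infinity>"
proof (rule prime_devissage[OF noeth_ring A B, of "\<lambda>M. mod_length scale M B \<noteq> \<infinity>"])
  fix M a p
  assume M: "subspace M" "B \<subseteq> M" and a: "a \<in> A" and p: "prime_ideal p" "p = {r. scale r a \<in> M}"
    and fin: "mod_length scale M B \<noteq> \<infinity>"
  have "idl_set (I 0) \<subseteq> p"
  proof
    fix x assume "x \<in> idl_set (I 0)"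
    then have "scale (x ^ m) a \<in> M" using ann M(2) actI[OF power_mem_idl a] by blast
    then show "x \<in> p" using prime_ideal_power[OF p(1), of x m] p(2) by simp
  qed
  then have "p = \<nn>" by (rule prime_over_I0[OF p(1)])
  then have "mod_length scale (M \<oplus> range (\<lambda>r. scale r a)) M \<le> 1"
    unfolding mod_length_cyclic_quotient[OF M(1)] p(2)[symmetric] using mod_length_maximal[OF maximal] by simp
  moreover have "mod_length scale (M \<oplus> range (\<lambda>r. scale r a)) B
      = mod_length scale (M \<oplus> range (\<lambda>r. scale r a)) M + mod_length scale M B"
    using M B by (intro mod_length_add subspace_sum_sets subspace_range_scale sum_sets_upper1)
  ultimately show "mod_length scale (M \<oplus> range (\<lambda>r. scale r a)) B \<noteq> \<infinity>"
    using fin enat_ile[of _ 1] by (auto simp: one_enat_def plus_eq_infty_iff_enat)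
qed simp

end

section \<open>Hilbert functions of graded families are eventually polynomial\<close>

lemma poly_fun_shift: "poly_fun d f \<Longrightarrow> poly_fun d (\<lambda>n. f (n + m))"
proof (induction rule: poly_fun.induct)
  case (mono \<alpha> r)
  have "poly_fun d (\<lambda>n. r * (\<Prod>i\<in>{..d}. (real (n i) + real (m i)) ^ \<alpha> i))"
    by (intro poly_fun_mult poly_fun_const poly_fun_prod poly_fun_power poly_fun.add poly_fun_coord) auto
  then show ?case by (simp add: monomial_def plus_fun_apply)
next
  case (add f g)
  then show ?case by (intro poly_fun.add)
qed

lemma eventually_poly_shift:
  assumes "eventually_poly d f c" shows "\<exists>c'. eventually_poly d (\<lambda>n. f (n + m)) c'"
proof -
  obtain M where M: "\<And>n. (\<forall>i\<le>d. M \<le> n i) \<Longrightarrow> f n = peval d c n" and c: "poly_coeffs d c"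
    using assms unfolding eventually_poly_def by blast
  obtain c' where c': "poly_coeffs d c'" "(\<lambda>n. peval d c (n + m)) = peval d c'"
    using poly_fun_coeffs[OF poly_fun_shift[OF peval_poly_fun[OF c]], of m] by blast
  have "f (n + m) = peval d c' n" if "\<forall>i\<le>d. M \<le> n i" for n
    using M[of "n + m"] that fun_cong[OF c'(2), of n] by (simp add: trans_le_add1 plus_fun_apply)
  then show ?thesis unfolding eventually_poly_def using c'(1) by blast
qed

context ideal_family
begin

lemma graded_colon: "graded B \<Longrightarrow> graded (\<lambda>n. {a. scale x a \<in> B (n + unit_exp i)})"
proof (rule gradedI)
  assume B: "graded B"
  note sB = subspace_graded[OF B]
  show "subspace {a. scale x a \<in> B (n + unit_exp i)}" for n
  proof (rule subspaceI)
    fix c a assume "a \<in> {a. scale x a \<in> B (n + unit_exp i)}"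
    then have "scale c (scale x a) \<in> B (n + unit_exp i)" using subspace_scale[OF sB] by blast
    then show "scale c a \<in> {a. scale x a \<in> B (n + unit_exp i)}" by (simp add: mult.commute)
  qed (auto simp: subspace_0[OF sB] scale_right_distrib subspace_add[OF sB])
  show "{a. scale x a \<in> B (n + unit_exp i)} = {a. scale x a \<in> B (m + unit_exp i)}" if "\<forall>i\<le>d. n i = m i" for n m
    using graded_cong[OF B, of "n + unit_exp i" "m + unit_exp i"] that by (simp add: plus_fun_apply)
  fix n j y a assume "j \<le> d" "y \<in> idl_set (I j)" "a \<in> {a. scale x a \<in> B (n + unit_exp i)}"
  then have "scale y (scale x a) \<in> B (n + unit_exp i + unit_exp j)" using graded_elem[OF B] by blast
  moreover have "n + unit_exp i + unit_exp j = n + unit_exp j + unit_exp i"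
    by (simp only: add.assoc add.commute[of "unit_exp i"])
  ultimately show "scale y a \<in> {a. scale x a \<in> B (n + unit_exp j + unit_exp i)}" by (simp add: mult.commute)
qed

text \<open>The image of \<open>A\<close> under multiplication by \<open>x\<close>, regarded as a
  graded map of degree e_i.\<close>

lemma graded_translate:
  assumes A: "graded A" and i: "i \<le> d" and x: "x \<in> idl_set (I i)"
  shows "graded (\<lambda>n. if n i = 0 then {0} else scale x ` A (n(i := n i - 1)))" (is "graded ?T")
proof (rule gradedI)
  interpret h: module_hom scale scale "scale x" by (rule module_hom_scale_self)
  show "subspace (?T n)" for n using h.subspace_image[OF subspace_graded[OF A]] by simp
  show "?T n = ?T m" if "\<forall>i\<le>d. n i = m i" for n m
    using that i graded_cong[OF A, of "n(i := n i - 1)" "m(i := m i - 1)"] by simp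
  fix n j y a assume j: "j \<le> d" and y: "y \<in> idl_set (I j)" and a: "a \<in> ?T n"
  show "scale y a \<in> ?T (n + unit_exp j)"
  proof (cases "n i = 0")
    case True
    then have "a = 0" using a by simp
    have "0 \<in> scale x ` A m" for m
      using subspace_0[OF subspace_graded[OF A], of m] by (metis imageI scale_zero_right)
    then show ?thesis using \<open>a = 0\<close> by simp
  next
    case False
    then obtain b where b: "b \<in> A (n(i := n i - 1))" "a = scale x b" using a by auto
    have "scale y b \<in> A (n(i := n i - 1) + unit_exp j)" using graded_elem[OF A j y] b(1) by blast
    moreover have "(n + unit_exp j)(i := (n + unit_exp j) i - 1) = n(i := n i - 1) + unit_exp j"
      using False by (auto simp: fun_eq_iff unit_exp_def plus_fun_apply)
    ultimately have "scale y b \<in> A ((n + unit_exp j)(i := (n + unit_exp j) i - 1))"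
      by (simp only:)
    then have "scale x (scale y b) \<in> scale x ` A ((n + unit_exp j)(i := (n + unit_exp j) i - 1))"
      by (rule imageI)
    moreover have "scale y a = scale x (scale y b)" by (simp add: b(2) mult.commute)
    moreover have "(n + unit_exp j) i \<noteq> 0" using False by (simp add: plus_fun_apply)
    ultimately show ?thesis by (simp only: if_False)
  qed
qed

text \<open>A graded substitute for passing to an associated prime: on A'/B every listed generator
  acts injectively or as zero. If injectivity of one generator fails, A' is replaced by its kernel,
  which is still larger than B; both alternatives are inherited by smaller families.\<close>

lemma nice_subfamily:
  assumes "finite X" and B: "family B" and "family A" "B < A"
    and X: "\<And>i x. (i, x) \<in> X \<Longrightarrow> i \<le> d \<and> x \<in> idl_set (I i)"
  shows "\<exists>A'. family A' \<and> B < A' \<and> A' \<le> A \<and> (\<forall>(i, x)\<in>X.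
      (\<forall>n a. a \<in> A' n \<longrightarrow> scale x a \<in> B (n + unit_exp i) \<longrightarrow> a \<in> B n) \<or>
      (\<forall>n a. a \<in> A' n \<longrightarrow> scale x a \<in> B (n + unit_exp i)))"
  using assms(1) X
proof (induction X rule: finite_induct)
  case empty
  then show ?case using assms by auto
next
  case (insert ix X)
  obtain i x where ix: "ix = (i, x)" by fastforce
  then have i: "i \<le> d" "x \<in> idl_set (I i)" using insert.prems by auto
  have "\<exists>A'. family A' \<and> B < A' \<and> A' \<le> A \<and> (\<forall>(i, x)\<in>X.
      (\<forall>n a. a \<in> A' n \<longrightarrow> scale x a \<in> B (n + unit_exp i) \<longrightarrow> a \<in> B n) \<or>
      (\<forall>n a. a \<in> A' n \<longrightarrow> scale x a \<in> B (n + unit_exp i)))"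
    by (rule insert.IH) (use insert.prems in auto)
  then obtain A' where A': "family A'" "B < A'" "A' \<le> A"
    and nice: "\<And>i x. (i, x) \<in> X \<Longrightarrow> (\<forall>n a. a \<in> A' n \<longrightarrow> scale x a \<in> B (n + unit_exp i) \<longrightarrow> a \<in> B n) \<or>
      (\<forall>n a. a \<in> A' n \<longrightarrow> scale x a \<in> B (n + unit_exp i))" by blast
  show ?case
  proof (cases "\<forall>n a. a \<in> A' n \<longrightarrow> scale x a \<in> B (n + unit_exp i) \<longrightarrow> a \<in> B n")
    case True
    then have "(\<forall>n a. a \<in> A' n \<longrightarrow> scale y a \<in> B (n + unit_exp j) \<longrightarrow> a \<in> B n) \<or>
        (\<forall>n a. a \<in> A' n \<longrightarrow> scale y a \<in> B (n + unit_exp j))" if "(j, y) \<in> insert ix X" for j y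
      using that nice[of j y] ix by (cases "(j, y) \<in> X") (simp, metis insert_iff prod.inject)
    then show ?thesis using A' by (intro exI[of _ A'] conjI ballI) (auto split: prod.splits)
  next
    case False
    define K where "K n = A' n \<inter> {a. scale x a \<in> B (n + unit_exp i)}" for n
    have gK: "graded K" unfolding K_def
      by (intro graded_Int graded_colon family_graded A' B)
    have fK: "family K" by (rule family_le[OF A'(1) gK]) (auto simp: K_def)
    have "B \<le> K" using A'(2) graded_elem[OF family_graded[OF B] i]
      by (auto simp: le_fun_def K_def less_fun_def)
    moreover have "K \<noteq> B"
    proof -
      obtain n a where "a \<in> A' n" "scale x a \<in> B (n + unit_exp i)" "a \<notin> B n" using False by blast
      then have "a \<in> K n" "a \<notin> B n" by (auto simp: K_def)
      then show ?thesis by blast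
    qed
    ultimately have "B < K" by simp
    moreover have KA: "K \<le> A'" by (auto simp: le_fun_def K_def)
    moreover have "(\<forall>n a. a \<in> K n \<longrightarrow> scale y a \<in> B (n + unit_exp j) \<longrightarrow> a \<in> B n) \<or>
        (\<forall>n a. a \<in> K n \<longrightarrow> scale y a \<in> B (n + unit_exp j))" if "(j, y) \<in> insert ix X" for j y
    proof (cases "(j, y) \<in> X")
      case True
      have "a \<in> A' n" if "a \<in> K n" for a n using that by (simp add: K_def)
      then show ?thesis using nice[OF True] by blast
    next
      case False
      then have "j = i" "y = x" using that ix by auto
      then show ?thesis by (auto simp: K_def)
    qed
    ultimately show ?thesis using fK A'(3)
      by (intro exI[of _ K] conjI ballI order_trans[OF KA]) (auto split: prod.splits)
  qed
qed

end

context local_family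
begin

text \<open>Noetherian induction in which larger \<open>B\<close> come first. The part A/A' is
  covered by induction since \<open>B < A'\<close>. On the nice part A'/B, either some
  \<open>I i\<close> acts as zero and the components eventually vanish, or each direction has an
  injective generator and the differences of the length function are covered by induction.\<close>

theorem family_length_poly:
  assumes "family A" "family B" "B \<le> A" "\<And>n. act (I 0 ^ m) (A n) \<subseteq> B n"
  shows "\<exists>c. eventually_poly d (\<lambda>n. rlength scale (A n) (B n)) c"
  using assms(2,1,3,4)
proof (induction B arbitrary: A rule: wf_induct_rule[OF wf_families])
  case (1 B)
  note B = \<open>family B\<close> and A = \<open>family A\<close> and BA = \<open>B \<le> A\<close> and ann = 1(5)
  have BA': "B n \<subseteq> A n" for n using BA by (simp add: le_fun_def)
  show ?case
  proof (cases "A = B")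
    case True
    then show ?thesis by (intro exI[of _ "\<lambda>_. 0"]) (simp add: eventually_poly_def)
  next
    case False
    then have "B < A" using BA by simp
    obtain G where G: "\<And>i. finite (G i)" "\<And>i. ring.span (G i) = idl_set (I i)"
    proof -
      interpret R: noetherian_module "(*) :: 'a \<Rightarrow> 'a \<Rightarrow> 'a" by (rule noetherian_module_ring[OF noeth_ring])
      have "\<exists>G. finite G \<and> ring.span G = idl_set (I i)" for i
        using R.finite_generators[OF subspace_idl_set[of "I i"]] by metis
      then show ?thesis using that by metis
    qed
    have GI: "x \<in> idl_set (I i)" if "x \<in> G i" for i x using G(2) ring.span_base that by blast
    have "finite (SIGMA i:{..d}. G i)" using G by auto
    from nice_subfamily[OF this B A \<open>B < A\<close>] GI obtain A' where A': "family A'" "B < A'" "A' \<le> A"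
      and nice: "\<And>i x. i \<le> d \<Longrightarrow> x \<in> G i \<Longrightarrow>
        (\<forall>n a. a \<in> A' n \<longrightarrow> scale x a \<in> B (n + unit_exp i) \<longrightarrow> a \<in> B n) \<or>
        (\<forall>n a. a \<in> A' n \<longrightarrow> scale x a \<in> B (n + unit_exp i))" by fastforce
    note subs = subspace_family[OF A] subspace_family[OF B] subspace_family[OF A'(1)]
    have A'A: "A' n \<subseteq> A n" and BA1: "B n \<subseteq> A' n" for n
      using A' by (auto simp: le_fun_def less_fun_def)
    have finA: "mod_length scale (A n) (C n) \<noteq> \<infinity>" if "family C" "B \<le> C" "C \<le> A" for n C
    proof (rule finite_length[of _ _ m])
      show "act (I 0 ^ m) (A n) \<subseteq> C n" using ann[of n] that(2) by (auto simp: le_fun_def)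
    qed (use subs(1) subspace_family[OF that(1)] that in \<open>auto simp: le_fun_def\<close>)
    have finA': "mod_length scale (A' n) (C n) \<noteq> \<infinity>" if "family C" "B \<le> C" "C \<le> A'" for n C
      using act_mono[OF A'A[of n], of "I 0 ^ m"] ann[of n] that
      by (intro finite_length[of _ _ m]) (auto simp: subs(3) subspace_family le_fun_def)
    have "\<exists>c. eventually_poly d (\<lambda>n. rlength scale (A n) (A' n)) c"
      by (rule 1(1)[of A' A]) (use A A' B ann BA1 in \<open>auto dest!: subsetD[OF ann] subsetD[OF BA1]\<close>)
    moreover have "\<exists>c. eventually_poly d (\<lambda>n. rlength scale (A' n) (B n)) c"
    \<comment> \<open>If no generator of some \<open>I i\<close> is injective on A'/B, all of them
      are zero on it. Then \<open>I i\<close> maps A' into B, while by Artin-Rees it generates A' in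
      large degrees, so A' and B agree there.\<close>
    proof (cases "\<forall>i\<le>d. \<exists>x\<in>G i. \<forall>n a. a \<in> A' n \<longrightarrow> scale x a \<in> B (n + unit_exp i) \<longrightarrow> a \<in> B n")
      case False
      then obtain i where i: "i \<le> d" and
        zero: "\<And>x n a. x \<in> G i \<Longrightarrow> a \<in> A' n \<Longrightarrow> scale x a \<in> B (n + unit_exp i)"
        using nice by blast
      have IA: "act (I i) (A' n) \<subseteq> B (n + unit_exp i)" for n
      proof (rule act_leI[OF subs(2)])
        fix r a assume r: "r \<in> idl_set (I i)" and a: "a \<in> A' n"
        have "ring.span (G i) \<subseteq> {r. scale r a \<in> B (n + unit_exp i)}"
          by (rule ring.span_minimal[OF _ subspace_conductor[OF subs(2)]]) (use zero a in auto)
        then show "scale r a \<in> B (n + unit_exp i)" using r G(2) by blast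
      qed
      obtain c where c: "\<And>n. c \<le> n i \<Longrightarrow> A' (n + unit_exp i) = act (I i) (A' n)"
        using artin_rees[OF A'(1)] i by blast
      have "rlength scale (A' n) (B n) = 0" if "\<forall>i\<le>d. Suc c \<le> n i" for n
      proof -
        define k where "k = n(i := n i - 1)"
        have "n i \<noteq> 0" using that i by auto
        then have n: "n = k + unit_exp i" by (auto simp: k_def unit_exp_def fun_eq_iff plus_fun_apply)
        have "c \<le> k i" using that i by (auto simp: k_def)
        then have "A' n \<subseteq> B n" unfolding n using c IA by simp
        then show ?thesis using BA1[of n] by (metis rlength_self subset_antisym)
      qed
      then show ?thesis unfolding eventually_poly_def
        by (intro exI[of _ "\<lambda>_. 0"] conjI exI[of _ "Suc c"]) auto
    next
      case True
      show ?thesis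
      proof (rule eventually_poly_of_differences)
        fix n k :: "nat \<Rightarrow> nat" assume "\<forall>i\<le>d. n i = k i"
        then show "rlength scale (A' n) (B n) = rlength scale (A' k) (B k)"
          using graded_cong[OF family_graded[OF A'(1)], of n k] graded_cong[OF family_graded[OF B], of n k] by simp
      next
        fix i assume i: "i \<le> d"
        then obtain x where x: "x \<in> G i"
          and inj: "\<And>n a. a \<in> A' n \<Longrightarrow> scale x a \<in> B (n + unit_exp i) \<Longrightarrow> a \<in> B n" using True by blast
        interpret h: module_hom scale scale "scale x" by (rule module_hom_scale_self)
        \<comment> \<open>The shifted family xA'. The difference of the length function in direction
          \<open>i\<close> is the length function of A'/(B + xA'), itself shifted by e_i.\<close>
        define T where "T n = (if n i = 0 then {0} else scale x ` A' (n(i := n i - 1)))" for n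
        define B' where "B' n = B n \<oplus> T n" for n
        have gT: "graded T" unfolding T_def[abs_def]
          by (rule graded_translate[OF family_graded[OF A'(1)] i GI[OF x]])
        have TA: "T n \<subseteq> A' n" for n
        proof (cases "n i = 0")
          case True
          then show ?thesis using subspace_0[OF subs(3)] by (simp add: T_def)
        next
          case False
          then have "n(i := n i - 1) + unit_exp i = n" by (auto simp: unit_exp_def fun_eq_iff plus_fun_apply)
          then show ?thesis using False graded_elem[OF family_graded[OF A'(1)] i GI[OF x], of _ "n(i := n i - 1)"]
            by (auto simp: T_def)
        qed
        have B'A': "B' n \<subseteq> A' n" for n
          unfolding B'_def by (rule sum_sets_least[OF subs(3) BA1 TA])
        have BB': "B n \<subseteq> B' n" for n
          unfolding B'_def by (rule sum_sets_upper1[OF subspace_graded[OF gT]])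
        have fB': "family B'" unfolding B'_def
          by (rule family_le[OF A'(1)], rule graded_sum[OF family_graded[OF B] gT])
            (use B'A' in \<open>simp add: B'_def\<close>)
        have T_unit: "T (n + unit_exp i) = scale x ` A' n" for n
        proof -
          have "(n + unit_exp i)(i := (n + unit_exp i) i - 1) = n" by (auto simp: unit_exp_def fun_eq_iff plus_fun_apply)
          moreover have "(n + unit_exp i) i \<noteq> 0" by (simp add: unit_exp_def plus_fun_apply)
          ultimately show ?thesis by (simp only: T_def if_False)
        qed
        \<comment> \<open>Injectivity is used here: an element of A' outside B is moved by
          \<open>x\<close> to one outside B, so B' is strictly larger and the induction hypothesis
          applies.\<close>
        have "B' \<noteq> B"
        proof
          assume eq: "B' = B"
          obtain n a where na: "a \<in> A' n" "a \<notin> B n"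
            using A'(2) by (auto simp: less_fun_def le_fun_def)
          have "scale x a \<in> B' (n + unit_exp i)"
            unfolding B'_def T_unit using na sum_sets_upper2[OF subs(2), of "scale x ` A' n"] by blast
          then show False using inj na eq by simp
        qed
        then have "B < B'" using BB' by (simp add: less_fun_def le_fun_def less_le_not_le) (metis BB' subset_antisym ext)
        have "act (I 0 ^ m) (A' n) \<subseteq> B' n" for n
          using act_mono[OF A'A[of n], of "I 0 ^ m"] ann[of n] BB'[of n] by blast
        then have "\<exists>c. eventually_poly d (\<lambda>n. rlength scale (A' n) (B' n)) c"
          using \<open>B < B'\<close> fB' B A'(1) B'A' by (intro 1(1)) (auto simp: le_fun_def)
        then obtain c' where c': "eventually_poly d (\<lambda>n. rlength scale (A' (n + unit_exp i)) (B' (n + unit_exp i))) c'"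
          using eventually_poly_shift[of d "\<lambda>n. rlength scale (A' n) (B' n)"] by blast
        have "rlength scale (A' (n + unit_exp i)) (B (n + unit_exp i)) - rlength scale (A' n) (B n)
            = rlength scale (A' (n + unit_exp i)) (B' (n + unit_exp i))" for n
        proof -
          let ?n = "n + unit_exp i"
          have "mod_length scale (A' ?n) (B ?n) = mod_length scale (A' ?n) (B' ?n) + mod_length scale (B' ?n) (B ?n)"
            by (rule mod_length_add[OF subs(3) subspace_family[OF fB'] subs(2) BB' B'A'])
          \<comment> \<open>Multiplication by \<open>x\<close> is an isomorphism from A'/B in degree
            \<open>n\<close> to (xA' + B)/B in degree n + e_i.\<close>
          moreover have "mod_length scale (B' ?n) (B ?n) = mod_length scale (A' n) (B n)"
          proof -
            have "mod_length scale (scale x ` A' n \<oplus> B ?n) (scale x ` B n \<oplus> B ?n) = mod_length scale (A' n) (B n)"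
              by (rule h.mod_length_image[OF subs(3) subs(2) subs(2) BA1 inj])
            moreover have "scale x ` B n \<oplus> B ?n = B ?n"
              using graded_elem[OF family_graded[OF B] i GI[OF x]]
              by (intro sum_sets_absorb1 subs(2) h.subspace_image) auto
            moreover have "scale x ` A' n \<oplus> B ?n = B' ?n"
              unfolding B'_def T_unit by (rule sum_sets_commute)
            ultimately show ?thesis by simp
          qed
          moreover have "mod_length scale (A' ?n) (B ?n) \<noteq> \<infinity>" using finA'[OF B] A'(2) by simp
          ultimately show ?thesis using rlength_add_enat by fastforce
        qed
        then show "\<exists>c. eventually_poly d (\<lambda>n. rlength scale (A' (n + unit_exp i)) (B (n + unit_exp i)) - rlength scale (A' n) (B n)) c"
          using c' by auto
      qed
    qed
    moreover have "rlength scale (A n) (B n) = rlength scale (A n) (A' n) + rlength scale (A' n) (B n)" for n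
      by (rule rlength_add_enat[OF mod_length_add finA]) (use subs A'A BA1 BA B in auto)
    ultimately show ?thesis using eventually_poly_add[of d] by (metis (no_types, lifting) ext)
  qed
qed

end

section \<open>Hilbert--Samuel functions and dimension\<close>

lemma ring_act_UNIV: "ring.act K UNIV = idl_set K"
proof (rule subset_antisym)
  show "ring.act K UNIV \<subseteq> idl_set K"
  proof (rule ring.act_leI)
    fix r a assume "r \<in> idl_set K"
    then have "a * r \<in> idl_set K" by (intro ring.subspace_scale) simp
    then show "r * a \<in> idl_set K" by (simp only: mult.commute)
  qed simp
  show "idl_set K \<subseteq> ring.act K UNIV"
    using ring.actI[of _ K 1 UNIV] by auto
qed

context local_family
begin

lemma ring_local_family: "local_family (*) I \<nn>"
  by (intro local_family.intro ideal_family.intro noetherian_module_ring ideal_family_axioms.intro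
      local_family_axioms.intro noeth_ring local primary)

interpretation R: local_family "(*)" I d \<nn>
  by (rule ring_local_family)

text \<open>The exponent \<open>k\<close> bounds the growth of the Hilbert-Samuel function of R/p
  with respect to \<open>I 0\<close>.\<close>

definition samuel_bound :: "'a set \<Rightarrow> nat \<Rightarrow> bool" where
  "samuel_bound p k \<longleftrightarrow> (\<exists>C. \<forall>m. rlength (*) UNIV (idl_set (I 0 ^ m) \<oplus> p) \<le> C * real (Suc m) ^ k)"

lemma samuel_boundD:
  assumes "samuel_bound p k"
  obtains C where "0 \<le> C" "\<And>m. rlength (*) UNIV (idl_set (I 0 ^ m) \<oplus> p) \<le> C * real (Suc m) ^ k"
proof -
  obtain C where C: "\<And>m. rlength (*) UNIV (idl_set (I 0 ^ m) \<oplus> p) \<le> C * real (Suc m) ^ k"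
    using assms unfolding samuel_bound_def by blast
  have "0 \<le> rlength (*) UNIV (idl_set (I 0 ^ 0) \<oplus> p)" by (rule rlength_nonneg)
  also have "\<dots> \<le> C * real (Suc 0) ^ k" by (rule C)
  finally have "0 \<le> C" by simp
  then show ?thesis using C by (rule that)
qed

lemma ring_finite_length: "ring.subspace p \<Longrightarrow> mod_length (*) UNIV (idl_set (I 0 ^ m) \<oplus> p) \<noteq> \<infinity>"
  by (rule R.finite_length[of _ _ m])
    (auto simp: ring_act_UNIV ring.subspace_sum_sets dest: subsetD[OF ring.sum_sets_upper1])

lemma samuel_finite_length:
  assumes "subspace A" "subspace B" "B \<subseteq> A"
  shows "mod_length scale A (act (I 0 ^ m) A \<oplus> B) \<noteq> \<infinity>"
  by (rule finite_length[of _ _ m])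
    (use assms in \<open>auto simp: subspace_sum_sets dest: subsetD[OF sum_sets_upper1] subsetD[OF sum_sets_least[OF _ act_subset]]\<close>)

text \<open>Adding a factor R/p to M adds at most the Samuel function of R/p: the trace on M of the
  power of \<open>I 0\<close> times the larger module contains that power times M. The set
  \<open>K\<close> of admissible exponents is either everything, for mere existence, or a singleton,
  for a prescribed exponent.\<close>

lemma samuel_devissage:
  assumes A: "subspace A" and B: "subspace B" "B \<subseteq> A" and ann: "\<And>r a. r \<in> \<aa> \<Longrightarrow> a \<in> A \<Longrightarrow> scale r a \<in> B"
    and K: "K \<noteq> {}" "\<And>a b. a \<in> K \<Longrightarrow> b \<in> K \<Longrightarrow> max a b \<in> K"
    and primes: "\<And>p. prime_ideal p \<Longrightarrow> \<aa> \<subseteq> p \<Longrightarrow> \<exists>k\<in>K. samuel_bound p k"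
  shows "\<exists>k\<in>K. \<exists>C\<ge>0. \<forall>m. rlength scale A (act (I 0 ^ m) A \<oplus> B) \<le> C * real (Suc m) ^ k"
proof (rule prime_devissage[OF noeth_ring A B(1,2),
      of "\<lambda>M. \<exists>k\<in>K. \<exists>C\<ge>0. \<forall>m. rlength scale M (act (I 0 ^ m) M \<oplus> B) \<le> C * real (Suc m) ^ k"])
  have "act (I 0 ^ m) B \<oplus> B = B" for m
    using B by (intro sum_sets_absorb1 act_subset) auto
  then show "\<exists>k\<in>K. \<exists>C\<ge>0. \<forall>m. rlength scale B (act (I 0 ^ m) B \<oplus> B) \<le> C * real (Suc m) ^ k"
    using K(1) by (auto intro: exI[of _ 0])
next
  fix M a p
  assume M: "subspace M" "B \<subseteq> M" "M \<subseteq> A" and a: "a \<in> A" and p: "prime_ideal p" "p = {r. scale r a \<in> M}"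
    and "\<exists>k\<in>K. \<exists>C\<ge>0. \<forall>m. rlength scale M (act (I 0 ^ m) M \<oplus> B) \<le> C * real (Suc m) ^ k"
  then obtain k1 C1 where C1: "k1 \<in> K" "0 \<le> C1" "\<And>m. rlength scale M (act (I 0 ^ m) M \<oplus> B) \<le> C1 * real (Suc m) ^ k1"
    by blast
  have "\<aa> \<subseteq> p" using ann[OF _ a] M(2) p(2) by auto
  then obtain k2 where "k2 \<in> K" "samuel_bound p k2" using primes p(1) by blast
  then obtain C2 where C2: "k2 \<in> K" "0 \<le> C2" "\<And>m. rlength (*) UNIV (idl_set (I 0 ^ m) \<oplus> p) \<le> C2 * real (Suc m) ^ k2"
    by (metis samuel_boundD)
  define T where "T = range (\<lambda>r. scale r a)"
  have T: "subspace T" unfolding T_def by (rule subspace_range_scale)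
  interpret h: module_hom "(*)" scale "\<lambda>r. scale r a" by (rule module_hom_orbit)
  have bound: "rlength scale (M \<oplus> T) (act (I 0 ^ m) (M \<oplus> T) \<oplus> B) \<le> (C1 + C2) * real (Suc m) ^ max k1 k2" for m
  proof -
    define N where "N = act (I 0 ^ m) (M \<oplus> T) \<oplus> B"
    have MT: "subspace (M \<oplus> T)" by (intro subspace_sum_sets M T)
    have N: "subspace N" unfolding N_def using B by (intro subspace_sum_sets) auto
    have BMT: "B \<subseteq> M \<oplus> T" using M(2) sum_sets_upper1[OF T, of M] by blast
    have NMT: "N \<subseteq> M \<oplus> T" unfolding N_def
      using BMT by (intro sum_sets_least MT act_subset)
    have eq: "mod_length scale (M \<oplus> T) N = mod_length scale (M \<oplus> T) (M \<oplus> N) + mod_length scale (M \<oplus> N) N"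
      by (intro mod_length_add MT N subspace_sum_sets M sum_sets_upper2 sum_sets_least NMT sum_sets_upper1 T)
    have fin: "mod_length scale (M \<oplus> T) N \<noteq> \<infinity>"
      unfolding N_def by (rule samuel_finite_length[OF MT B(1) BMT])
    have MN: "M \<oplus> N = (\<lambda>r. scale r a) ` idl_set (I 0 ^ m) \<oplus> M"
    proof -
      have 1: "act (I 0 ^ m) T = (\<lambda>r. scale r a) ` idl_set (I 0 ^ m)"
        unfolding T_def using h.act_image[of UNIV "I 0 ^ m"] by (simp add: ring_act_UNIV)
      have "M \<oplus> N = (M \<oplus> act (I 0 ^ m) M) \<oplus> act (I 0 ^ m) T \<oplus> B"
        unfolding N_def act_sum[OF M(1) T] by (simp only: sum_sets_assoc)
      also have "M \<oplus> act (I 0 ^ m) M = M" by (intro sum_sets_absorb2 M(1) act_subset) simp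
      also have "M \<oplus> act (I 0 ^ m) T \<oplus> B = (M \<oplus> B) \<oplus> act (I 0 ^ m) T"
        by (simp only: sum_sets_assoc sum_sets_commute[of B])
      also have "M \<oplus> B = M" by (rule sum_sets_absorb2[OF M(1) M(2) B(1)])
      finally show ?thesis unfolding 1 by (simp only: sum_sets_commute)
    qed
    have "M \<oplus> T = (\<lambda>r. scale r a) ` UNIV \<oplus> M" unfolding T_def by (rule sum_sets_commute)
    then have "mod_length scale (M \<oplus> T) (M \<oplus> N) = mod_length (*) (UNIV \<oplus> p) (idl_set (I 0 ^ m) \<oplus> p)"
      unfolding MN p(2) by (simp only: mod_length_cyclic[OF M(1) ring.subspace_UNIV subspace_idl_set subset_UNIV])
    also have "UNIV \<oplus> p = UNIV"
      by (rule ring.sum_sets_absorb2[OF ring.subspace_UNIV subset_UNIV prime_idealD(1)[OF p(1)]])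
    finally have first: "mod_length scale (M \<oplus> T) (M \<oplus> N) = mod_length (*) UNIV (idl_set (I 0 ^ m) \<oplus> p)" .
    have "act (I 0 ^ m) M \<subseteq> act (I 0 ^ m) (M \<oplus> T)" by (intro act_mono sum_sets_upper1 T)
    then have "act (I 0 ^ m) M \<oplus> B \<subseteq> N" unfolding N_def by (intro sum_sets_mono) auto
    moreover have "act (I 0 ^ m) M \<oplus> B \<subseteq> M" by (intro sum_sets_least M act_subset)
    ultimately have "mod_length scale M (M \<inter> N) \<le> mod_length scale M (act (I 0 ^ m) M \<oplus> B)"
      by (intro mod_length_mono) auto
    then have second: "mod_length scale (M \<oplus> N) N \<le> mod_length scale M (act (I 0 ^ m) M \<oplus> B)"
      by (simp only: mod_length_second_iso[OF M(1) N])
    have "rlength scale (M \<oplus> T) N = rlength scale (M \<oplus> T) (M \<oplus> N) + rlength scale (M \<oplus> N) N"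
      by (rule rlength_add_enat[OF eq fin])
    also have "rlength scale (M \<oplus> T) (M \<oplus> N) = rlength (*) UNIV (idl_set (I 0 ^ m) \<oplus> p)"
      unfolding rlength_def first ..
    also have "\<dots> + rlength scale (M \<oplus> N) N \<le> C2 * real (Suc m) ^ k2 + rlength scale M (act (I 0 ^ m) M \<oplus> B)"
      by (intro add_mono C2 rlength_mono_enat[OF second] samuel_finite_length M B)
    also have "\<dots> \<le> C2 * real (Suc m) ^ k2 + C1 * real (Suc m) ^ k1"
      by (intro add_mono C1 order_refl)
    also have "\<dots> \<le> C2 * real (Suc m) ^ max k1 k2 + C1 * real (Suc m) ^ max k1 k2"
      by (intro add_mono mult_left_mono power_increasing C1 C2) auto
    finally show ?thesis unfolding N_def by (simp add: algebra_simps)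
  qed
  show "\<exists>k\<in>K. \<exists>C\<ge>0. \<forall>m. rlength scale (M \<oplus> range (\<lambda>r. scale r a)) (act (I 0 ^ m) (M \<oplus> range (\<lambda>r. scale r a)) \<oplus> B)
      \<le> C * real (Suc m) ^ k"
    using bound C1(1,2) C2(1,2) K(2)[OF C1(1) C2(1)] unfolding T_def
    by (intro bexI[of _ "max k1 k2"] exI[of _ "C1 + C2"]) auto
qed

end

section \<open>Samuel exponents and Krull dimension\<close>

context local_family
begin

interpretation R: local_family "(*)" I d \<nn>
  by (rule ring_local_family)

lemma samuel_bound_maximal: "samuel_bound \<nn> 0"
  unfolding samuel_bound_def
proof (intro exI[of _ 1] allI)
  fix m
  have "mod_length (*) UNIV (idl_set (I 0 ^ m) \<oplus> \<nn>) \<le> mod_length (*) UNIV \<nn>"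
    by (intro ring.mod_length_mono ring.sum_sets_upper2) auto
  also have "\<dots> \<le> 1" by (rule mod_length_maximal[OF maximal])
  finally show "rlength (*) UNIV (idl_set (I 0 ^ m) \<oplus> \<nn>) \<le> 1 * real (Suc m) ^ 0"
    by (cases "mod_length (*) UNIV (idl_set (I 0 ^ m) \<oplus> \<nn>)") (auto simp: rlength_def one_enat_def)
qed

lemma ring_range_mult: "ring.subspace (range (\<lambda>r. x * r :: 'a))"
  using ring.subspace_range_scale[of x] by (simp only: mult.commute)

text \<open>Multiplication by \<open>x\<close> sends the m-th power of \<open>I 0\<close> into the
  next one, so the length of R modulo \<open>I 0 ^ Suc m\<close> and p exceeds that for
  \<open>m\<close> by at most a Samuel value of R/(p + xR). The latter is filtered by primes
  strictly above p, and summing over \<open>m\<close> raises the exponent by one.\<close>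

lemma samuel_bound_step:
  assumes p: "prime_ideal p" and x: "x \<in> idl_set (I 0)" "x \<notin> p"
    and K: "K \<noteq> {}" "\<And>a b. a \<in> K \<Longrightarrow> b \<in> K \<Longrightarrow> max a b \<in> K"
    and primes: "\<And>q. prime_ideal q \<Longrightarrow> p \<subset> q \<Longrightarrow> \<exists>k\<in>K. samuel_bound q k"
  shows "\<exists>k\<in>K. samuel_bound p (Suc k)"
proof -
  define X where "X = range (\<lambda>r. x * r)"
  have X: "ring.subspace X" unfolding X_def by (rule ring_range_mult)
  note sp = prime_idealD(1)[OF p]
  have xX: "x \<in> X" unfolding X_def by (rule range_eqI[of _ _ 1]) simp
  have pX: "ring.subspace (p \<oplus> X)" by (intro ring.subspace_sum_sets sp X)
  have "\<exists>k\<in>K. \<exists>C\<ge>0. \<forall>m. rlength (*) UNIV (ring.act (I 0 ^ m) UNIV \<oplus> (p \<oplus> X)) \<le> C * real (Suc m) ^ k"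
  proof (rule R.samuel_devissage[OF ring.subspace_UNIV pX subset_UNIV _ K])
    show "r * a \<in> p \<oplus> X" if "r \<in> p \<oplus> X" for r a
      using ring.subspace_scale[OF pX that, of a] by (simp add: mult.commute)
    fix q assume q: "prime_ideal q" "p \<oplus> X \<subseteq> q"
    then have "p \<subseteq> q" "x \<in> q" using ring.sum_sets_upper1[OF X, of p] ring.sum_sets_upper2[OF sp, of X] xX by auto
    then have "p \<subset> q" using x by auto
    then show "\<exists>k\<in>K. R.samuel_bound q k" using primes[OF q(1)] unfolding R.samuel_bound_def samuel_bound_def by blast
  qed
  then obtain k C where kC: "k \<in> K" "C \<ge> 0"
    "\<And>m. rlength (*) UNIV (idl_set (I 0 ^ m) \<oplus> (p \<oplus> X)) \<le> C * real (Suc m) ^ k"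
    by (auto simp: ring_act_UNIV)
  define g where "g m = rlength (*) UNIV (idl_set (I 0 ^ m) \<oplus> p)" for m
  interpret h: module_hom "(*)" "(*)" "\<lambda>r. x * r" by (rule ring.module_hom_scale_self)
  have step: "g (Suc m) \<le> C * real (Suc (Suc m)) ^ k + g m" for m
  proof -
    let ?D = "idl_set (I 0 ^ Suc m) \<oplus> p"
    have D: "ring.subspace ?D" by (intro ring.subspace_sum_sets sp) simp
    have eq: "mod_length (*) UNIV ?D = mod_length (*) UNIV (X \<oplus> ?D) + mod_length (*) (X \<oplus> ?D) ?D"
      by (intro ring.mod_length_add ring.subspace_UNIV ring.subspace_sum_sets X D ring.sum_sets_upper2) auto
    have D': "ring.subspace (idl_set (I 0 ^ m) \<oplus> p)" by (intro ring.subspace_sum_sets sp) simp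
    have "mod_length (*) ((\<lambda>r. x * r) ` UNIV \<oplus> ?D) ((\<lambda>r. x * r) ` (idl_set (I 0 ^ m) \<oplus> p) \<oplus> ?D)
        \<le> mod_length (*) UNIV (idl_set (I 0 ^ m) \<oplus> p)"
      by (intro h.mod_length_image_le D D') auto
    moreover have "(\<lambda>r. x * r) ` (idl_set (I 0 ^ m) \<oplus> p) \<oplus> ?D = ?D"
    proof (intro ring.sum_sets_absorb1 D h.subspace_image D' subsetI)
      fix z assume "z \<in> (\<lambda>r. x * r) ` (idl_set (I 0 ^ m) \<oplus> p)"
      then obtain u v where "u \<in> idl_set (I 0 ^ m)" "v \<in> p" "z = x * u + x * v"
        by (auto elim!: sum_setsE simp: algebra_simps)
      moreover from this have "x * u \<in> idl_set (I 0 ^ Suc m)" using idl_mult_mem[OF x(1)] by simp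
      ultimately show "z \<in> ?D" using ring.subspace_scale[OF sp] by (auto intro!: sum_setsI)
    qed
    ultimately have le: "mod_length (*) (X \<oplus> ?D) ?D \<le> mod_length (*) UNIV (idl_set (I 0 ^ m) \<oplus> p)"
      by (simp add: X_def)
    have "g (Suc m) = rlength (*) UNIV (X \<oplus> ?D) + rlength (*) (X \<oplus> ?D) ?D"
      unfolding g_def by (rule rlength_add_enat[OF eq ring_finite_length[OF sp]])
    also have "X \<oplus> ?D = idl_set (I 0 ^ Suc m) \<oplus> (p \<oplus> X)"
      by (simp only: sum_sets_assoc sum_sets_commute[of X])
    finally show ?thesis
      using kC(3)[of "Suc m"] rlength_mono_enat[OF le ring_finite_length[OF sp]]
      unfolding g_def \<open>X \<oplus> ?D = _\<close> by linarith
  qed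
  have "g m \<le> C * real m * real (Suc m) ^ k" for m
  proof (induction m)
    case 0
    have "UNIV \<oplus> p = UNIV" by (intro ring.sum_sets_absorb2 sp) auto
    then show ?case by (simp add: g_def idl_set_one)
  next
    case (Suc m)
    have "g (Suc m) \<le> C * real (Suc (Suc m)) ^ k + C * real m * real (Suc m) ^ k"
      using step[of m] Suc by linarith
    also have "\<dots> \<le> C * real (Suc (Suc m)) ^ k + C * real m * real (Suc (Suc m)) ^ k"
      using kC(2) by (intro add_mono mult_left_mono power_mono) auto
    also have "\<dots> = C * real (Suc m) * real (Suc (Suc m)) ^ k" by (simp add: algebra_simps)
    finally show ?case .
  qed
  moreover have "C * real m * real (Suc m) ^ k \<le> C * real (Suc m) ^ Suc k" for m
  proof -
    have "C * real m * real (Suc m) ^ k \<le> C * real (Suc m) * real (Suc m) ^ k"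
      using kC(2) by (intro mult_right_mono mult_left_mono) auto
    then show ?thesis by (simp add: mult.assoc)
  qed
  ultimately have "samuel_bound p (Suc k)"
    unfolding samuel_bound_def g_def using order_trans by blast
  then show ?thesis using kC(1) by blast
qed

lemma nonmaximal_prime_witness:
  assumes "prime_ideal p" "p \<noteq> \<nn>" obtains x where "x \<in> idl_set (I 0)" "x \<notin> p"
  using prime_over_I0[OF assms(1)] assms(2) by blast

lemma samuel_bound_exists: "prime_ideal p \<Longrightarrow> \<exists>k. samuel_bound p k"
proof (induction p rule: wf_induct_rule[OF R.wf_subspaces])
  case (1 p)
  show ?case
  proof (cases "p = \<nn>")
    case False
    then obtain x where x: "x \<in> idl_set (I 0)" "x \<notin> p" using nonmaximal_prime_witness[OF 1(2)] by blast
    have "\<exists>k\<in>UNIV. samuel_bound p (Suc k)"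
      by (rule samuel_bound_step[OF 1(2) x]) (use 1 prime_idealD(1) in auto)
    then show ?thesis by blast
  qed (use samuel_bound_maximal in blast)
qed

text \<open>An exponent valid for R itself is valid for every R/p, since R/p is a quotient of R. It
  bounds all chains of primes.\<close>

lemma samuel_bound_uniform: "\<exists>k. \<forall>p. prime_ideal p \<longrightarrow> samuel_bound p k"
proof -
  have "\<exists>k\<in>UNIV. \<exists>C\<ge>0. \<forall>m. rlength (*) UNIV (ring.act (I 0 ^ m) UNIV \<oplus> {0}) \<le> C * real (Suc m) ^ k"
  proof (rule R.samuel_devissage[where \<aa> = "{0}"])
    show "\<exists>k\<in>UNIV. R.samuel_bound p k" if "prime_ideal p" for p
      using samuel_bound_exists[OF that] unfolding R.samuel_bound_def samuel_bound_def by blast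
  qed auto
  then obtain k C where C: "\<And>m. rlength (*) UNIV (idl_set (I 0 ^ m)) \<le> C * real (Suc m) ^ k"
    by (auto simp: ring_act_UNIV)
  have "samuel_bound p k" if p: "prime_ideal p" for p
    unfolding samuel_bound_def
  proof (intro exI[of _ C] allI)
    fix m
    have "rlength (*) UNIV (idl_set (I 0 ^ m) \<oplus> p) \<le> rlength (*) UNIV (idl_set (I 0 ^ m))"
      using ring_finite_length[of "{0}" m] ring.sum_sets_upper1[OF prime_idealD(1)[OF p]]
      by (intro rlength_mono_enat ring.mod_length_mono) auto
    then show "rlength (*) UNIV (idl_set (I 0 ^ m) \<oplus> p) \<le> C * real (Suc m) ^ k" using C[of m] by linarith
  qed
  then show ?thesis by blast
qed

lemma mpow_first: "mpow I d (\<lambda>i. if i = 0 then m else 0) = I 0 ^ m"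
proof -
  have "mpow I d (\<lambda>i. if i = 0 then m else 0) = I 0 ^ m * (\<Prod>i\<in>{..d} - {0}. I i ^ (if i = 0 then m else 0))"
    unfolding mpow_def by (subst prod.remove[of _ 0]) auto
  also have "(\<Prod>i\<in>{..d} - {0}. I i ^ (if i = 0 then m else 0)) = 1" by (rule prod.neutral) auto
  finally show ?thesis by simp
qed

text \<open>For \<open>x\<close> in q but not in p, Artin-Rees gives, up to an index shift
  \<open>c\<close>, that the Samuel function \<open>g\<close> of R/p increases over \<open>c\<close>
  steps by at least the value \<open>g1\<close> of R/q. Iterating this as often as the argument is
  large gains a full power, so \<open>g1\<close> grows with exponent one less.\<close>

lemma samuel_bound_drop:
  assumes p: "prime_ideal p" and q: "prime_ideal q" and pq: "p \<subset> q" and bd: "samuel_bound p k"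
  shows "\<exists>j. k = Suc j \<and> samuel_bound q j"
proof -
  obtain x where x: "x \<in> q" "x \<notin> p" using pq by blast
  define X where "X = range (\<lambda>r. x * r)"
  have X: "ring.subspace X" unfolding X_def by (rule ring_range_mult)
  note sp = prime_idealD(1)[OF p] and sq = prime_idealD(1)[OF q]
  interpret h: module_hom "(*)" "(*)" "\<lambda>r. x * r" by (rule ring.module_hom_scale_self)
  have Xp: "ring.subspace (X \<oplus> p)" by (intro ring.subspace_sum_sets X sp)
  define g g1 where "g m = rlength (*) UNIV (idl_set (I 0 ^ m) \<oplus> p)"
    and "g1 m = rlength (*) UNIV (idl_set (I 0 ^ m) \<oplus> q)" for m
  define A where "A n = R.rees UNIV n \<inter> (X \<oplus> p)" for n
  have famA: "R.family A" unfolding A_def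
    by (rule R.family_le[OF R.family_rees[OF ring.subspace_UNIV]
          R.graded_Int[OF R.graded_rees R.graded_const[OF Xp]] Int_lower1])
  obtain c0 where c0: "\<And>n i. i \<le> d \<Longrightarrow> c0 \<le> n i \<Longrightarrow> A (n + unit_exp i) = ring.act (I i) (A n)"
    using R.artin_rees[OF famA] by blast
  \<comment> \<open>The successor ensures \<open>c \<ge> 1\<close>, so that multiples of
    \<open>c\<close> exceed every index.\<close>
  define c where "c = Suc c0"
  define e where "e m = (\<lambda>i::nat. if i = 0 then m else 0 :: nat)" for m
  have e_Suc: "e (Suc m) = e m + unit_exp 0" for m
    by (auto simp: e_def unit_exp_def plus_fun_apply fun_eq_iff)
  have A_e: "A (e m) = idl_set (I 0 ^ m) \<inter> (X \<oplus> p)" for m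
    unfolding A_def R.rees_def e_def mpow_first ring_act_UNIV ..
  have A_pow: "A (e (c + j)) = ring.act (I 0 ^ j) (A (e c))" for j
  proof (induction j)
    case 0
    then show ?case using ring.act_one[OF R.subspace_family[OF famA]] by simp
  next
    case (Suc j)
    have "A (e (c + Suc j)) = ring.act (I 0) (A (e (c + j)))"
      unfolding add_Suc_right e_Suc by (rule c0) (auto simp: e_def c_def)
    then show ?case by (simp add: Suc ring.act_mult)
  qed
  \<comment> \<open>The Artin-Rees form of cancellation: dividing by \<open>x\<close> modulo p loses
    at most \<open>c\<close> powers of \<open>I 0\<close>, because \<open>x\<close> is a
    nonzerodivisor modulo p.\<close>
  have colon: "y \<in> idl_set (I 0 ^ j) \<oplus> p" if xy: "x * y \<in> idl_set (I 0 ^ (c + j)) \<oplus> p" for y j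
  proof -
    obtain u v where uv: "u \<in> idl_set (I 0 ^ (c + j))" "v \<in> p" "x * y = u + v" using xy by (auto elim: sum_setsE)
    have "u = x * y + (- v)" using uv(3) by simp
    also have "\<dots> \<in> X \<oplus> p" using uv(2) ring.subspace_neg[OF sp] by (intro sum_setsI) (auto simp: X_def)
    finally have "u \<in> A (e (c + j))" unfolding A_e using uv(1) by simp
    also have "\<dots> \<subseteq> ring.act (I 0 ^ j) (X \<oplus> p)"
      unfolding A_pow by (rule ring.act_mono) (simp add: A_def)
    also have "\<dots> = ring.act (I 0 ^ j) X \<oplus> ring.act (I 0 ^ j) p" by (rule ring.act_sum[OF X sp])
    also have "ring.act (I 0 ^ j) X = (\<lambda>r. x * r) ` idl_set (I 0 ^ j)"
      unfolding X_def using h.act_image[of UNIV "I 0 ^ j"] by (simp add: ring_act_UNIV)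
    finally obtain w z where wz: "w \<in> idl_set (I 0 ^ j)" "z \<in> ring.act (I 0 ^ j) p" "u = x * w + z"
      by (auto elim!: sum_setsE)
    have "z \<in> p" using wz(2) ring.act_subset[OF sp] by blast
    have "x * (y - w) = z + v" using uv(3) wz(3) by (simp add: algebra_simps)
    then have "x * (y - w) \<in> p" using ring.subspace_add[OF sp \<open>z \<in> p\<close> uv(2)] by simp
    then have "y - w \<in> p" using prime_idealD(3)[OF p] x(2) by blast
    then have "w + (y - w) \<in> idl_set (I 0 ^ j) \<oplus> p" by (rule sum_setsI[OF wz(1)])
    then show ?thesis by simp
  qed
  have step: "g1 (c + j) + g j \<le> g (c + j)" for j
  proof -
    let ?D = "idl_set (I 0 ^ (c + j)) \<oplus> p"
    have D: "ring.subspace ?D" by (intro ring.subspace_sum_sets sp) simp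
    have eq: "mod_length (*) UNIV ?D = mod_length (*) UNIV (X \<oplus> ?D) + mod_length (*) (X \<oplus> ?D) ?D"
      by (intro ring.mod_length_add ring.subspace_UNIV ring.subspace_sum_sets X D ring.sum_sets_upper2) auto
    define Y where "Y = {y. x * y \<in> ?D}"
    have Y: "ring.subspace Y"
      unfolding Y_def using ring.subspace_conductor[OF D, of x] by (simp only: mult.commute)
    have "mod_length (*) ((\<lambda>r. x * r) ` UNIV \<oplus> ?D) ((\<lambda>r. x * r) ` Y \<oplus> ?D) = mod_length (*) UNIV Y"
      by (intro h.mod_length_image ring.subspace_UNIV Y D) (auto simp: Y_def)
    moreover have "(\<lambda>r. x * r) ` Y \<oplus> ?D = ?D"
      by (intro ring.sum_sets_absorb1 D h.subspace_image Y) (auto simp: Y_def)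
    ultimately have "mod_length (*) (X \<oplus> ?D) ?D = mod_length (*) UNIV Y" by (simp add: X_def)
    moreover have "mod_length (*) UNIV (idl_set (I 0 ^ j) \<oplus> p) \<le> mod_length (*) UNIV Y"
      using colon by (intro ring.mod_length_mono) (auto simp: Y_def)
    ultimately have le: "mod_length (*) UNIV (idl_set (I 0 ^ j) \<oplus> p) \<le> mod_length (*) (X \<oplus> ?D) ?D" by simp
    have fin: "mod_length (*) UNIV ?D \<noteq> \<infinity>" by (rule ring_finite_length[OF sp])
    then have fin2: "mod_length (*) UNIV (X \<oplus> ?D) \<noteq> \<infinity>" "mod_length (*) (X \<oplus> ?D) ?D \<noteq> \<infinity>"
      unfolding eq by (auto simp: plus_enat_def split: enat.splits)
    have "x * r \<in> q" for r using ring.subspace_scale[OF sq x(1), of r] by (simp only: mult.commute)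
    then have "X \<subseteq> q" by (auto simp: X_def)
    then have "X \<oplus> ?D \<subseteq> idl_set (I 0 ^ (c + j)) \<oplus> q"
      using pq ring.sum_sets_upper2[OF subspace_idl_set, of q "I 0 ^ (c + j)"]
      by (intro ring.sum_sets_least sum_sets_mono ring.subspace_sum_sets sq) auto
    then have "mod_length (*) UNIV (idl_set (I 0 ^ (c + j)) \<oplus> q) \<le> mod_length (*) UNIV (X \<oplus> ?D)"
      by (intro ring.mod_length_mono) auto
    then have "g1 (c + j) \<le> rlength (*) UNIV (X \<oplus> ?D)" unfolding g1_def by (rule rlength_mono_enat[OF _ fin2(1)])
    moreover have "g j \<le> rlength (*) (X \<oplus> ?D) ?D" unfolding g_def by (rule rlength_mono_enat[OF le fin2(2)])
    ultimately show ?thesis using rlength_add_enat[OF eq fin] unfolding g_def by linarith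
  qed
  have pow_anti: "idl_set (I 0 ^ (a + b)) \<subseteq> idl_set (I 0 ^ a)" for a b
    unfolding power_add ring_act_UNIV[symmetric] ring.act_mult by (intro ring.act_mono) auto
  have g1_mono: "g1 m \<le> g1 l" if "m \<le> l" for m l
    unfolding g1_def using pow_anti[of m "l - m"] that
    by (intro rlength_mono_enat ring.mod_length_mono sum_sets_mono ring_finite_length sq) auto
  \<comment> \<open>With both \<open>t\<close> and \<open>i\<close> equal to \<open>Suc m\<close>
    the left side is \<open>Suc m\<close> times a value at least \<open>g1 m\<close>, whereas the
    right side has an argument linear in \<open>m\<close>.\<close>
  have growth: "real i * g1 (c * t) \<le> g (c * (t + i))" for t i
  proof (induction i)
    case 0
    then show ?case by (simp add: g_def)
  next
    case (Suc i)
    have "g1 (c * t) \<le> g1 (c + c * (t + i))" by (rule g1_mono) (simp add: algebra_simps)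
    then have "g1 (c * t) + g (c * (t + i)) \<le> g (c + c * (t + i))" using step[of "c * (t + i)"] by linarith
    moreover have "c + c * (t + i) = c * (t + Suc i)" by simp
    ultimately show ?case using Suc by (simp add: algebra_simps)
  qed
  obtain C where C: "0 \<le> C" "\<And>m. g m \<le> C * real (Suc m) ^ k"
    using samuel_boundD[OF bd] unfolding g_def by blast
  \<comment> \<open>The constant 3 comes from
    \<open>Suc (2 * c * Suc m) \<le> 3 * c * Suc m\<close>.\<close>
  define C' where "C' = C * (3 * real c) ^ k"
  have main: "real (Suc m) * g1 m \<le> C' * real (Suc m) ^ k" for m
  proof -
    have "m \<le> c * Suc m" unfolding c_def by simp
    then have "real (Suc m) * g1 m \<le> real (Suc m) * g1 (c * Suc m)" by (intro mult_left_mono g1_mono) auto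
    also have "\<dots> \<le> g (c * (Suc m + Suc m))" by (rule growth)
    also have "\<dots> \<le> C * real (Suc (c * (Suc m + Suc m))) ^ k" by (rule C)
    also have "\<dots> \<le> C * (3 * real c * real (Suc m)) ^ k"
    proof (intro mult_left_mono power_mono C)
      have "1 \<le> c * Suc m" by (simp add: c_def)
      then have "Suc (c * (Suc m + Suc m)) \<le> 3 * c * Suc m" by (simp only: distrib_left)
      then have "real (Suc (c * (Suc m + Suc m))) \<le> real (3 * c * Suc m)" by (rule of_nat_mono)
      then show "real (Suc (c * (Suc m + Suc m))) \<le> 3 * real c * real (Suc m)"
        by (simp only: of_nat_mult of_nat_numeral)
    qed simp
    also have "\<dots> = C' * real (Suc m) ^ k" by (simp add: C'_def power_mult_distrib)
    finally show ?thesis .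
  qed
  show ?thesis
  proof (cases k)
    case 0
    have one: "1 \<le> g1 m" if "1 \<le> m" for m
    proof -
      have "idl_set (I 0 ^ m) \<subseteq> idl_set (I 0 ^ 1)" using pow_anti[of 1 "m - 1"] that by simp
      then have "idl_set (I 0 ^ m) \<oplus> q \<subseteq> \<nn>"
        using I0_le_max prime_le_max[OF q] ideal_max by (intro ring.sum_sets_least) auto
      then have ne: "idl_set (I 0 ^ m) \<oplus> q \<subset> UNIV" using ideal_max by auto
      have sub: "ring.subspace (idl_set (I 0 ^ m) \<oplus> q)" by (intro ring.subspace_sum_sets sq) simp
      have "enat 1 \<le> mod_length (*) UNIV (idl_set (I 0 ^ m) \<oplus> q)"
        unfolding mod_length_def
        by (rule chain_len_ge[where C = "\<lambda>i. if i = 0 then idl_set (I 0 ^ m) \<oplus> q else UNIV"]) (use ne sub in auto)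
      then show ?thesis using ring_finite_length[OF sq, of m] unfolding g1_def rlength_def
        by (cases "mod_length (*) UNIV (idl_set (I 0 ^ m) \<oplus> q)") auto
    qed
    obtain N where N: "C' < real N" using reals_Archimedean2 by blast
    have "real (Suc (Suc N)) * 1 \<le> real (Suc (Suc N)) * g1 (Suc N)" by (intro mult_left_mono one) auto
    also have "\<dots> \<le> C'" using main[of "Suc N"] 0 by simp
    finally show ?thesis using N by simp
  next
    case (Suc j)
    have "g1 m \<le> C' * real (Suc m) ^ j" for m
    proof -
      have "real (Suc m) * g1 m \<le> real (Suc m) * (C' * real (Suc m) ^ j)"
        using main[of m] unfolding Suc power_Suc by (simp only: mult_ac)
      then show ?thesis by (rule mult_left_le_imp_le) simp
    qed
    then show ?thesis using Suc unfolding samuel_bound_def g1_def by blast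
  qed
qed

text \<open>Every strict inclusion of primes costs one unit of the exponent.\<close>

lemma prime_chain_le:
  fixes C :: "nat \<Rightarrow> 'a set"
  assumes "\<forall>i\<le>s. prime_ideal (C i)" "\<forall>i<s. C i \<subset> C (Suc i)" "samuel_bound (C 0) k"
  shows "s \<le> k"
  using assms
proof (induction s arbitrary: C k)
  case (Suc s)
  have "prime_ideal (C 0)" "prime_ideal (C 1)" "C 0 \<subset> C 1" using Suc.prems by auto
  then obtain j where "k = Suc j" "samuel_bound (C 1) j" using samuel_bound_drop Suc.prems(3) by blast
  then show ?case using Suc.IH[of "\<lambda>i. C (Suc i)" j] Suc.prems by auto
qed simp

lemma krull_dim_finite: "krull_dim_above (X :: 'a set) \<noteq> \<infinity>"
proof -
  obtain k where k: "\<And>p. prime_ideal p \<Longrightarrow> samuel_bound p k" using samuel_bound_uniform by blast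
  have "krull_dim_above X \<le> enat k"
    unfolding krull_dim_above_def
  proof (rule chain_len_leI)
    fix s C assume "\<forall>i\<le>s. prime_ideal (C i) \<and> X \<subseteq> C i" "\<forall>i<s. C i \<subset> C (Suc i)"
    then show "enat s \<le> enat k" using prime_chain_le[of s C k] k by simp
  qed
  then show ?thesis by (cases "krull_dim_above X") auto
qed

lemma krull_dim_drop:
  assumes p: "prime_ideal p" and q: "p \<subset> q" and X: "X \<subseteq> p" and k: "krull_dim_above X \<le> enat k"
    and q': "prime_ideal q"
  shows "\<exists>j. k = Suc j \<and> krull_dim_above q \<le> enat j"
proof -
  have ext: "Suc s \<le> k" if C: "\<forall>i\<le>s. prime_ideal (C i) \<and> q \<subseteq> C i" "\<forall>i<s. C i \<subset> C (Suc i)" for s C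
  proof -
    have pC: "p \<subset> C i" "X \<subseteq> C i" if "i \<le> s" for i using C(1) q X that by blast+
    have "enat (Suc s) \<le> krull_dim_above X"
      unfolding krull_dim_above_def
    proof (rule chain_len_ge[where C = "\<lambda>i. case i of 0 \<Rightarrow> p | Suc i \<Rightarrow> C i"]; intro allI impI)
      fix i assume "i \<le> Suc s"
      then show "prime_ideal (case i of 0 \<Rightarrow> p | Suc i \<Rightarrow> C i) \<and> X \<subseteq> (case i of 0 \<Rightarrow> p | Suc i \<Rightarrow> C i)"
        using p X C(1) pC by (cases i) auto
    next
      fix i assume "i < Suc s"
      then show "(case i of 0 \<Rightarrow> p | Suc i \<Rightarrow> C i) \<subset> (case Suc i of 0 \<Rightarrow> p | Suc i \<Rightarrow> C i)"
        using C(2) pC(1)[of 0] by (cases i) auto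
    qed
    also have "\<dots> \<le> enat k" by (rule k)
    finally show ?thesis by simp
  qed
  have "Suc 0 \<le> k" by (rule ext[of 0 "\<lambda>_. q"]) (use q' in auto)
  then obtain j where j: "k = Suc j" by (cases k) auto
  have "krull_dim_above q \<le> enat j"
    unfolding krull_dim_above_def by (rule chain_len_leI) (use ext j in fastforce)
  then show ?thesis using j by blast
qed

text \<open>Noetherian induction on p: all strictly larger primes have dimension at most k-1, and
  \<open>samuel_bound_step\<close> adds the missing one.\<close>

lemma samuel_bound_krull_dim:
  "prime_ideal p \<Longrightarrow> krull_dim_above p \<le> enat k \<Longrightarrow> samuel_bound p k"
proof (induction p arbitrary: k rule: wf_induct_rule[OF R.wf_subspaces])
  case (1 p)
  show ?case
  proof (cases "p = \<nn>")
    case True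
    have "samuel_bound \<nn> k"
    proof -
      obtain C where C: "0 \<le> C" "\<And>m. rlength (*) UNIV (idl_set (I 0 ^ m) \<oplus> \<nn>) \<le> C * real (Suc m) ^ 0"
        using samuel_boundD[OF samuel_bound_maximal] by blast
      have "C * real (Suc m) ^ 0 \<le> C * real (Suc m) ^ k" for m
        by (intro mult_left_mono power_increasing C) auto
      then show ?thesis unfolding samuel_bound_def using C(2) order_trans by blast
    qed
    then show ?thesis using True by simp
  next
    case False
    then obtain x where x: "x \<in> idl_set (I 0)" "x \<notin> p" using nonmaximal_prime_witness[OF 1(2)] by blast
    have primes: "\<exists>j. k = Suc j \<and> samuel_bound q j" if q: "prime_ideal q" "p \<subset> q" for q
    proof -
      obtain j where j: "k = Suc j" "krull_dim_above q \<le> enat j"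
        using krull_dim_drop[OF 1(2) q(2) order_refl 1(3) q(1)] by blast
      have "samuel_bound q j"
        by (rule 1(1)[OF _ q(1) j(2)]) (use q 1(2) prime_idealD(1) in auto)
      then show ?thesis using j by blast
    qed
    have "\<nn> \<noteq> p" "p \<subseteq> \<nn>" using False prime_le_max[OF 1(2)] by auto
    \<comment> \<open>Primality of the maximal ideal supplies one prime strictly above p, which
      shows that \<open>k\<close> is a successor before any exponent is chosen.\<close>
    moreover have "prime_ideal \<nn>"
    proof (rule ccontr)
      assume "\<not> ?thesis"
      then obtain a b where ab: "a * b \<in> \<nn>" "a \<notin> \<nn>" "b \<notin> \<nn>"
        using ideal_max by (auto simp: prime_ideal_def ideal_def)
      have "range (\<lambda>r. a * r) = UNIV"
        using proper_ideal_le[of "range (\<lambda>r. a * r)"] ring_range_mult[of a] ab(2)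
        by (metis UNIV_I ideal_def mult.right_neutral rangeI subsetD)
      then obtain r where "a * r = 1" by (metis UNIV_I imageE)
      then have "b = r * (a * b)" by (metis mult.assoc mult.commute mult_1)
      then show False using ab ring.subspace_scale[OF ideal_max(1) ab(1), of r] by simp
    qed
    ultimately obtain j where j: "k = Suc j" using primes[of \<nn>] by blast
    have "\<exists>k\<in>{j}. samuel_bound p (Suc k)"
      by (rule samuel_bound_step[OF 1(2) x]) (use primes j in auto)
    then show ?thesis using j by simp
  qed
qed

lemma samuel_length_bound:
  assumes A: "subspace A" and B: "subspace B" "B \<subseteq> A"
    and ann: "\<And>r a. r \<in> \<aa> \<Longrightarrow> a \<in> A \<Longrightarrow> scale r a \<in> B" and k: "krull_dim_above \<aa> \<le> enat k"
  shows "\<exists>C\<ge>0. \<forall>m. rlength scale A (act (I 0 ^ m) A \<oplus> B) \<le> C * real (Suc m) ^ k"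
proof -
  have "\<exists>k\<in>{k}. \<exists>C\<ge>0. \<forall>m. rlength scale A (act (I 0 ^ m) A \<oplus> B) \<le> C * real (Suc m) ^ k"
  proof (rule samuel_devissage[OF A B ann])
    fix p assume p: "prime_ideal p" "\<aa> \<subseteq> p"
    have "krull_dim_above p \<le> krull_dim_above \<aa>"
      unfolding krull_dim_above_def by (rule chain_len_mono) (use p in auto)
    then show "\<exists>k\<in>{k}. samuel_bound p k" using samuel_bound_krull_dim[OF p(1)] k by (auto intro: order_trans)
  qed auto
  then show ?thesis by simp
qed

end

section \<open>Growth of Hilbert functions\<close>

definition first_exp :: "nat \<Rightarrow> nat \<Rightarrow> nat" where
  "first_exp j = (\<lambda>i. if i = 0 then j else 0)"

lemma first_exp_Suc: "n + first_exp (Suc j) = n + first_exp j + unit_exp 0"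
  by (auto simp: first_exp_def unit_exp_def plus_fun_apply fun_eq_iff)

lemma first_exp_0 [simp]: "n + first_exp 0 = n"
  by (auto simp: first_exp_def plus_fun_apply fun_eq_iff)

lemma first_exp_1: "first_exp (Suc 0) = unit_exp 0"
  by (auto simp: first_exp_def unit_exp_def fun_eq_iff)

lemma ray_first_exp: "ray t a j = ray t a 0 + first_exp j"
  by (auto simp: ray_def first_exp_def plus_fun_apply fun_eq_iff)

context ideal_family
begin

lemma artin_rees_mpow:
  assumes A: "family A"
  shows "\<exists>c. \<forall>n k. (\<forall>i\<le>d. c \<le> n i) \<longrightarrow> A (n + k) = act (mpow I d k) (A n)"
proof -
  obtain c where c: "\<And>n i. i \<le> d \<Longrightarrow> c \<le> n i \<Longrightarrow> A (n + unit_exp i) = act (I i) (A n)"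
    using artin_rees[OF A] by blast
  have main: "A (n + k) = act (mpow I d k) (A n)" if n: "\<forall>i\<le>d. c \<le> n i" and k: "\<forall>i>d. k i = 0" for n k
    using k
  proof (induction "tdeg d k" arbitrary: k)
    case 0
    then have "k i = 0" for i by (cases "i \<le> d") (auto simp: tdeg_def)
    then have "k = 0" by (auto simp: zero_fun_apply)
    then show ?case using act_one[OF subspace_family[OF A]] by (simp only: mpow_zero add_0_right)
  next
    case (Suc s)
    have "\<exists>i\<le>d. k i \<noteq> 0"
    proof (rule ccontr)
      assume "\<not> ?thesis"
      then have "tdeg d k = 0" by (auto simp: tdeg_def)
      then show False using Suc by simp
    qed
    then obtain i where i: "i \<le> d" "k i \<noteq> 0" by blast
    define l where "l = k(i := k i - 1)"
    have k: "k = l + unit_exp i" using i by (auto simp: l_def unit_exp_def fun_eq_iff plus_fun_apply)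
    have "tdeg d (unit_exp i) = 1" using i by (simp add: tdeg_def unit_exp_def)
    then have "s = tdeg d l" using Suc(2) by (simp add: k tdeg_def sum.distrib plus_fun_apply)
    then have "A (n + l) = act (mpow I d l) (A n)" using Suc by (intro Suc.hyps(1)) (auto simp: l_def)
    moreover have "A (n + l + unit_exp i) = act (I i) (A (n + l))"
      using n i by (intro c) (auto simp: plus_fun_apply intro: trans_le_add1)
    ultimately show ?case by (simp only: k mpow_Suc[OF i(1)] act_mult add.assoc)
  qed
  have "A (n + k) = act (mpow I d k) (A n)" if n: "\<forall>i\<le>d. c \<le> n i" for n k
  proof -
    define l where "l = (\<lambda>i. if i \<le> d then k i else 0)"
    have "mpow I d k = mpow I d l" by (rule mpow_cong) (simp add: l_def)
    moreover have "A (n + k) = A (n + l)"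
      by (rule graded_cong[OF family_graded[OF A]]) (simp add: l_def plus_fun_apply)
    ultimately show ?thesis using main[OF n, of l] by (simp add: l_def)
  qed
  then show ?thesis by blast
qed

section \<open>An Artin-Rees estimate linear in the multi-index\<close>

lemma graded_zero_first: "graded A \<Longrightarrow> graded (\<lambda>n. A (n(0 := 0)))"
proof (rule gradedI)
  assume A: "graded A"
  show "subspace (A (n(0 := 0)))" for n by (rule subspace_graded[OF A])
  show "A (n(0 := 0)) = A (m(0 := 0))" if "\<forall>i\<le>d. n i = m i" for n m
    using graded_cong[OF A, of "n(0 := 0)" "m(0 := 0)"] that by simp
  fix n i x a assume i: "i \<le> d" and x: "x \<in> idl_set (I i)" and a: "a \<in> A (n(0 := 0))"
  show "scale x a \<in> A ((n + unit_exp i)(0 := 0))"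
  proof (cases "i = 0")
    case True
    then have "(n + unit_exp i)(0 := 0) = n(0 := 0)" by (auto simp: unit_exp_def fun_eq_iff plus_fun_apply)
    then show ?thesis using subspace_scale[OF subspace_graded[OF A] a] by (simp only:)
  next
    case False
    then have "(n + unit_exp i)(0 := 0) = n(0 := 0) + unit_exp i" by (auto simp: unit_exp_def fun_eq_iff plus_fun_apply)
    then show ?thesis using graded_elem[OF A, OF i x a] by (simp only:)
  qed
qed

lemma rees_first: "rees L (n + first_exp j) = act (I 0 ^ j) (rees L n)"
proof -
  have "mpow I d (first_exp j) = I 0 ^ j * (\<Prod>i\<in>{..d} - {0}. I i ^ first_exp j i)"
    unfolding mpow_def by (subst prod.remove[of _ 0]) (auto simp: first_exp_def)
  also have "(\<Prod>i\<in>{..d} - {0}. I i ^ first_exp j i) = 1" by (rule prod.neutral) (auto simp: first_exp_def)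
  finally show ?thesis by (simp add: rees_def mpow_add act_mult act_commute)
qed

text \<open>Artin-Rees in direction 0 for the family of elements of J^n0 I^n L that lie in I_i I^n L
  + B. Treating all \<open>n\<close> as one multigraded family is what makes the loss
  \<open>c\<close> independent of \<open>n\<close>.\<close>

lemma linear_artin_rees_step:
  assumes L: "subspace L" and B: "subspace B" and i: "i \<le> d"
  shows "\<exists>c. \<forall>n s. c \<le> s \<longrightarrow> s \<le> n 0 \<longrightarrow>
    rees L n \<inter> (rees L (n(0 := 0) + unit_exp i) \<oplus> B) \<subseteq> rees L (n(0 := n 0 - s) + unit_exp i) \<oplus> B"
proof -
  define H where "H n = rees L (n(0 := 0) + unit_exp i) \<oplus> B" for n
  have gH: "graded H"
    unfolding H_def by (rule graded_sum[OF graded_zero_first[OF graded_shift[OF graded_rees]] graded_const[OF B]])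
  define A where "A n = rees L n \<inter> H n" for n
  have fA: "family A" unfolding A_def
    by (rule family_le[OF family_rees[OF L] graded_Int[OF graded_rees gH] Int_lower1])
  obtain c where c: "\<And>n. c \<le> n 0 \<Longrightarrow> A (n + unit_exp 0) = act (I 0) (A n)"
    using artin_rees[OF fA] by blast
  have pow: "A (n + first_exp j) = act (I 0 ^ j) (A n)" if "c \<le> n 0" for n j
  proof (induction j)
    case 0
    then show ?case using act_one[OF subspace_family[OF fA]] by simp
  next
    case (Suc j)
    have "A (n + first_exp (Suc j)) = act (I 0) (A (n + first_exp j))"
      unfolding first_exp_Suc by (rule c) (simp add: plus_fun_apply trans_le_add1 that)
    then show ?case by (simp add: Suc act_mult)
  qed
  have "rees L n \<inter> H n \<subseteq> rees L (n(0 := n 0 - s) + unit_exp i) \<oplus> B" if s: "c \<le> s" "s \<le> n 0" for n s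
  proof -
    \<comment> \<open>The exponent of J is cut down to \<open>s\<close>; the remaining
      \<open>n 0 - s\<close> powers factor out and are all that is kept.\<close>
    define m where "m = n(0 := s)"
    have n: "n = m + first_exp (n 0 - s)" using s by (auto simp: m_def first_exp_def fun_eq_iff plus_fun_apply)
    have "rees L n \<inter> H n = A (m + first_exp (n 0 - s))" by (simp only: A_def flip: n)
    also have "\<dots> = act (I 0 ^ (n 0 - s)) (A m)" by (rule pow) (simp add: m_def s)
    also have "\<dots> \<subseteq> act (I 0 ^ (n 0 - s)) (rees L (m(0 := 0) + unit_exp i) \<oplus> B)"
      by (rule act_mono) (simp add: A_def H_def)
    also have "\<dots> = rees L (m(0 := 0) + unit_exp i + first_exp (n 0 - s)) \<oplus> act (I 0 ^ (n 0 - s)) B"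
      by (simp only: act_sum[OF subspace_rees B] rees_first)
    also have "\<dots> \<subseteq> rees L (m(0 := 0) + unit_exp i + first_exp (n 0 - s)) \<oplus> B"
      by (intro sum_sets_mono act_subset B) auto
    also have "m(0 := 0) + unit_exp i + first_exp (n 0 - s) = n(0 := n 0 - s) + unit_exp i"
      by (auto simp: m_def first_exp_def fun_eq_iff plus_fun_apply)
    finally show ?thesis .
  qed
  then show ?thesis unfolding H_def by blast
qed

text \<open>The factors I_i are introduced one at a time, each at the price of \<open>s\<close>
  powers of J, so the total loss is \<open>s\<close> times the degree of \<open>n\<close>.\<close>

lemma linear_artin_rees:
  assumes L: "subspace L" and B: "subspace B"
  shows "\<exists>s. \<forall>n M. n 0 = 0 \<longrightarrow> (\<forall>i>d. n i = 0) \<longrightarrow>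
    (act (I 0 ^ (M + s * tdeg d n)) L \<oplus> B) \<inter> (rees L n \<oplus> B) \<subseteq> rees L (n + first_exp M) \<oplus> B"
proof -
  obtain c where c: "\<And>i n s. i \<le> d \<Longrightarrow> c i \<le> s \<Longrightarrow> s \<le> n 0 \<Longrightarrow>
    rees L n \<inter> (rees L (n(0 := 0) + unit_exp i) \<oplus> B) \<subseteq> rees L (n(0 := n 0 - s) + unit_exp i) \<oplus> B"
    using linear_artin_rees_step[OF L B] by metis
  define s where "s = (\<Sum>i\<le>d. c i)"
  have cs: "c i \<le> s" if "i \<le> d" for i using member_le_sum[of i "{..d}" c] that by (simp add: s_def)
  have "(act (I 0 ^ (M + s * tdeg d n)) L \<oplus> B) \<inter> (rees L n \<oplus> B) \<subseteq> rees L (n + first_exp M) \<oplus> B"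
    if "n 0 = 0" "\<forall>i>d. n i = 0" for n M
    using that
  proof (induction "tdeg d n" arbitrary: n M)
    case 0
    then have "n i = 0" for i by (cases "i \<le> d") (auto simp: tdeg_def)
    then have "n = 0" by (auto simp: zero_fun_apply)
    moreover have "rees L (0 + first_exp M) = act (I 0 ^ M) L" using rees_first[of L 0 M] rees_zero[OF L] by simp
    ultimately show ?case using 0(1) by simp
  next
    case (Suc t)
    have "\<exists>i\<le>d. n i \<noteq> 0"
    proof (rule ccontr)
      assume "\<not> ?thesis"
      then have "tdeg d n = 0" by (auto simp: tdeg_def)
      then show False using Suc by simp
    qed
    then obtain i where i: "i \<le> d" "n i \<noteq> 0" by blast
    define m where "m = n(i := n i - 1)"
    have n: "n = m + unit_exp i" using i by (auto simp: m_def unit_exp_def fun_eq_iff plus_fun_apply)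
    have "tdeg d (unit_exp i) = 1" using i by (simp add: tdeg_def unit_exp_def)
    then have td: "tdeg d n = Suc (tdeg d m)" by (simp add: n tdeg_def sum.distrib plus_fun_apply)
    have m0: "m 0 = 0" "\<forall>i>d. m i = 0" using Suc.prems i by (auto simp: m_def)
    have IH: "(act (I 0 ^ (M + s + s * tdeg d m)) L \<oplus> B) \<inter> (rees L m \<oplus> B) \<subseteq> rees L (m + first_exp (M + s)) \<oplus> B"
      using Suc(1)[of m "M + s"] Suc(2) td m0 by simp
    show ?case
    proof
      fix z assume z: "z \<in> (act (I 0 ^ (M + s * tdeg d n)) L \<oplus> B) \<inter> (rees L n \<oplus> B)"
      have "rees L n \<oplus> B \<subseteq> rees L m \<oplus> B"
        unfolding n by (rule sum_sets_mono) (simp_all add: rees_antimono add.commute[of m])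
      then have "z \<in> rees L (m + first_exp (M + s)) \<oplus> B" using z IH by (auto simp: td add.assoc)
      then obtain u b where ub: "u \<in> rees L (m + first_exp (M + s))" "b \<in> B" "z = u + b" by (auto elim: sum_setsE)
      obtain v b' where vb: "v \<in> rees L n" "b' \<in> B" "z = v + b'" using z by (auto elim: sum_setsE)
      have "u = v + (b' - b)" using ub(3) vb(3) by (simp add: algebra_simps)
      then have "u \<in> rees L n \<oplus> B" using vb ub subspace_diff[OF B] by (auto intro: sum_setsI)
      \<comment> \<open>The induction hypothesis is invoked with \<open>M + s\<close>, leaving
        exactly the \<open>s\<close> powers consumed by the last factor I_i.\<close>
      moreover define k where "k = m + first_exp (M + s)"
      have k: "k(0 := 0) + unit_exp i = n" "k 0 = M + s" "k(0 := k 0 - s) + unit_exp i = n + first_exp M"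
        using m0 by (auto simp: k_def n first_exp_def fun_eq_iff plus_fun_apply)
      ultimately have "u \<in> rees L k \<inter> (rees L (k(0 := 0) + unit_exp i) \<oplus> B)" using ub(1) by (simp only: k_def[symmetric] k Int_iff)
      also have "\<dots> \<subseteq> rees L (k(0 := k 0 - s) + unit_exp i) \<oplus> B" using k(2) by (intro c i cs) auto
      finally have "u \<in> rees L (n + first_exp M) \<oplus> B" by (simp only: k(3))
      then obtain w b'' where "w \<in> rees L (n + first_exp M)" "b'' \<in> B" "u = w + b''" by (auto elim: sum_setsE)
      then have "z = w + (b'' + b)" "b'' + b \<in> B" using ub subspace_add[OF B] by (auto simp: add.assoc)
      then show "z \<in> rees L (n + first_exp M) \<oplus> B" using \<open>w \<in> _\<close> by (auto intro: sum_setsI)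
    qed
  qed
  then show ?thesis by blast
qed

end

context local_family
begin

text \<open>A block of \<open>t\<close> layers at \<open>n\<close> embeds, modulo \<open>B\<close>,
  into L modulo J^M L with M linear in the size of \<open>n\<close> plus \<open>t\<close>, so the
  Hilbert-Samuel bound for L modulo \<open>B\<close> carries over.\<close>

lemma rees_growth:
  assumes L: "subspace L" and B: "subspace B" and ann: "\<And>r a. r \<in> \<aa> \<Longrightarrow> a \<in> L \<Longrightarrow> scale r a \<in> B"
    and k: "krull_dim_above \<aa> \<le> enat k"
  shows "\<exists>C\<ge>0. \<forall>n t. rlength scale (rees L n \<oplus> B) (rees L (n + first_exp t) \<oplus> B) \<le> C * (esize d n + real t) ^ k"
proof -
  have LB: "subspace (L \<oplus> B)" by (intro subspace_sum_sets L B)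
  have BLB: "B \<subseteq> L \<oplus> B" by (rule sum_sets_upper2[OF L])
  have annLB: "scale r a \<in> B" if r: "r \<in> \<aa>" and a: "a \<in> L \<oplus> B" for r a
  proof -
    obtain x b where "x \<in> L" "b \<in> B" "a = x + b" using a by (auto elim: sum_setsE)
    then show ?thesis using ann[OF r] subspace_add[OF B] subspace_scale[OF B] by (simp add: scale_right_distrib)
  qed
  obtain C where C: "C \<ge> 0" "\<And>m. rlength scale (L \<oplus> B) (act (I 0 ^ m) (L \<oplus> B) \<oplus> B) \<le> C * real (Suc m) ^ k"
    using samuel_length_bound[OF LB B BLB annLB k] by blast
  have actLB: "act (I 0 ^ m) (L \<oplus> B) \<oplus> B = act (I 0 ^ m) L \<oplus> B" for m
    unfolding act_sum[OF L B] sum_sets_assoc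
    using sum_sets_absorb1[OF B act_subset[OF B]] by simp
  obtain s where s: "\<And>n M. n 0 = 0 \<Longrightarrow> (\<forall>i>d. n i = 0) \<Longrightarrow>
    (act (I 0 ^ (M + s * tdeg d n)) L \<oplus> B) \<inter> (rees L n \<oplus> B) \<subseteq> rees L (n + first_exp M) \<oplus> B"
    using linear_artin_rees[OF L B] by blast
  define C' where "C' = C * (1 + real s) ^ k"
  have "rlength scale (rees L n \<oplus> B) (rees L (n + first_exp t) \<oplus> B) \<le> C' * (esize d n + real t) ^ k" for n t
  proof -
    \<comment> \<open>The exponent of J is separated from those of the I_i, as
      \<open>linear_artin_rees\<close> requires; coordinates beyond \<open>d\<close> are
      cleared.\<close>
    define m where "m = (\<lambda>i. if i = 0 \<or> d < i then 0 else n i)"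
    have m: "m 0 = 0" "\<forall>i>d. m i = 0" by (auto simp: m_def)
    \<comment> \<open>The J-exponent of the smaller module plus the linear Artin-Rees loss: then the
      trace of J^M L on the block lies in its bottom.\<close>
    define M where "M = n 0 + t + s * tdeg d m"
    define P P' Q where "P = rees L n \<oplus> B" and "P' = rees L (n + first_exp t) \<oplus> B" and "Q = act (I 0 ^ M) L \<oplus> B"
    have sub: "subspace P" "subspace P'" "subspace Q"
      unfolding P_def P'_def Q_def using B by (auto intro: subspace_sum_sets)
    have nm: "rees L n = rees L (m + first_exp (n 0))"
      by (rule rees_cong) (auto simp: m_def first_exp_def plus_fun_apply)
    have "rees L (m + first_exp (n 0 + t)) = rees L (n + first_exp t)"
      by (rule rees_cong) (auto simp: m_def first_exp_def plus_fun_apply)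
    moreover have "rees L n \<subseteq> rees L m" unfolding nm by (simp only: rees_antimono add.commute[of m])
    then have "P \<subseteq> rees L m \<oplus> B" unfolding P_def by (intro sum_sets_mono) auto
    ultimately have "P \<inter> Q \<subseteq> P'" using s[OF m, of "n 0 + t"] unfolding Q_def P'_def M_def by auto
    then have "mod_length scale P P' \<le> mod_length scale P (P \<inter> Q)" by (intro mod_length_mono) auto
    also have "\<dots> = mod_length scale (P \<oplus> Q) Q" by (rule mod_length_second_iso[OF sub(1,3), symmetric])
    also have "\<dots> \<le> mod_length scale (L \<oplus> B) (act (I 0 ^ M) (L \<oplus> B) \<oplus> B)"
    proof (rule mod_length_mono)
      show "act (I 0 ^ M) (L \<oplus> B) \<oplus> B \<subseteq> Q" by (simp only: actLB Q_def)
      show "P \<oplus> Q \<subseteq> L \<oplus> B"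
        unfolding P_def Q_def by (intro sum_sets_least[OF LB] sum_sets_mono rees_subset act_subset L) auto
    qed
    finally have "rlength scale P P' \<le> rlength scale (L \<oplus> B) (act (I 0 ^ M) (L \<oplus> B) \<oplus> B)"
      by (rule rlength_mono_enat[OF _ samuel_finite_length[OF LB B BLB]])
    also have "\<dots> \<le> C * real (Suc M) ^ k" by (rule C)
    also have "\<dots> \<le> C * ((1 + real s) * (esize d n + real t)) ^ k"
    proof (intro mult_left_mono power_mono C)
      have n0: "n 0 + tdeg d m \<le> (\<Sum>i\<le>d. n i)"
      proof -
        have "(\<Sum>i\<le>d. n i) = n 0 + (\<Sum>i\<in>{..d} - {0}. n i)" by (rule sum.remove) auto
        moreover have "tdeg d m = m 0 + (\<Sum>i\<in>{..d} - {0}. m i)" unfolding tdeg_def by (rule sum.remove) auto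
        moreover have "(\<Sum>i\<in>{..d} - {0}. m i) = (\<Sum>i\<in>{..d} - {0}. n i)" by (rule sum.cong) (auto simp: m_def)
        ultimately show ?thesis by (simp add: m_def)
      qed
      define S where "S = (\<Sum>i\<le>d. n i)"
      have "s * tdeg d m \<le> s * S" using n0 unfolding S_def by (intro mult_le_mono2) linarith
      then have "M \<le> S + t + s * S" using n0 unfolding M_def S_def[symmetric] by linarith
      also have "\<dots> + 1 \<le> (1 + s) * (1 + S + t)" by (simp add: algebra_simps)
      finally have "Suc M \<le> (1 + s) * (1 + S + t)" by simp
      then have "real (Suc M) \<le> real ((1 + s) * (1 + S + t))" by (rule of_nat_mono)
      also have "\<dots> = (1 + real s) * (1 + real S + real t)" by (simp only: of_nat_mult of_nat_add of_nat_1)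
      also have "1 + real S = esize d n" by (simp add: esize_def S_def)
      finally show "real (Suc M) \<le> (1 + real s) * (esize d n + real t)" .
    qed simp
    finally show ?thesis unfolding P_def P'_def C'_def by (simp add: power_mult_distrib mult.assoc)
  qed
  moreover have "0 \<le> C'" using C by (simp add: C'_def)
  ultimately show ?thesis by blast
qed

section \<open>Blocks of layers in direction e_0\<close>

definition filtered :: "((nat \<Rightarrow> nat) \<Rightarrow> 'b set) \<Rightarrow> bool" where
  "filtered E \<longleftrightarrow> (\<forall>n. subspace (E n) \<and> E (n + unit_exp 0) \<subseteq> E n \<and> act (I 0) (E n) \<subseteq> E (n + unit_exp 0))"

definition hilbert_fun :: "((nat \<Rightarrow> nat) \<Rightarrow> 'b set) \<Rightarrow> (nat \<Rightarrow> nat) \<Rightarrow> real" where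
  "hilbert_fun E n = rlength scale (E n) (E (n + unit_exp 0))"

text \<open>A bound on blocks of \<open>t\<close> layers and not on single layers. It is imposed for
  large \<open>n\<close> only, because torsion disappears only there.\<close>

definition growth :: "nat \<Rightarrow> ((nat \<Rightarrow> nat) \<Rightarrow> 'b set) \<Rightarrow> bool" where
  "growth k E \<longleftrightarrow> (\<exists>C\<ge>0. \<exists>M. \<forall>n t. (\<forall>i\<le>d. M \<le> n i) \<longrightarrow>
     rlength scale (E n) (E (n + first_exp t)) \<le> C * (esize d n + real t) ^ k)"

lemma filtered_subspace: "filtered E \<Longrightarrow> subspace (E n)"
  by (simp add: filtered_def)

lemma filtered_antimono: "filtered E \<Longrightarrow> E (n + first_exp t) \<subseteq> E n"
proof (induction t)
  case (Suc t)
  then have "E (n + first_exp t + unit_exp 0) \<subseteq> E (n + first_exp t)" by (simp add: filtered_def)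
  then show ?case using Suc unfolding first_exp_Suc by blast
qed simp

lemma filtered_act: "filtered E \<Longrightarrow> act (I 0 ^ t) (E n) \<subseteq> E (n + first_exp t)"
proof (induction t)
  case 0
  then show ?case using act_one[OF filtered_subspace] by simp
next
  case (Suc t)
  have "act (I 0 ^ Suc t) (E n) = act (I 0) (act (I 0 ^ t) (E n))" by (simp add: act_mult)
  also have "\<dots> \<subseteq> act (I 0) (E (n + first_exp t))" by (rule act_mono[OF Suc.IH[OF Suc.prems]])
  also have "\<dots> \<subseteq> E (n + first_exp t + unit_exp 0)" using Suc.prems by (simp add: filtered_def)
  finally show ?case unfolding first_exp_Suc .
qed

lemma filtered_finite_length: "filtered E \<Longrightarrow> mod_length scale (E n) (E (n + first_exp t)) \<noteq> \<infinity>"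
  using finite_length[of "E n" "E (n + first_exp t)" t] filtered_subspace[of E] filtered_antimono[of E n t]
    filtered_act[of E t n] by blast

lemma hilbert_fun_sum:
  assumes E: "filtered E"
  shows "(\<Sum>j<t. hilbert_fun E (n + first_exp j)) = rlength scale (E n) (E (n + first_exp t))"
proof (induction t)
  case (Suc t)
  have "mod_length scale (E n) (E (n + first_exp (Suc t)))
      = mod_length scale (E n) (E (n + first_exp t)) + mod_length scale (E (n + first_exp t)) (E (n + first_exp (Suc t)))"
    using filtered_antimono[of E "n + first_exp t" "Suc 0"] filtered_antimono[of E n t] E
    by (intro mod_length_add filtered_subspace[of E]) (simp_all add: first_exp_Suc)
  from rlength_add_enat[OF this filtered_finite_length[of E, OF E]]
  show ?case using Suc by (simp add: hilbert_fun_def first_exp_Suc)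
qed simp

lemma hilbert_fun_poly:
  assumes "family E" "filtered E"
  shows "\<exists>c. eventually_poly d (hilbert_fun E) c"
  unfolding hilbert_fun_def[abs_def]
proof (rule family_length_poly[where m = 1])
  show "family (\<lambda>n. E (n + unit_exp 0))"
    using family_le[of E "\<lambda>n. E (n + unit_exp 0)"] graded_shift[of E "unit_exp 0"] family_graded[of E] assms
    by (auto simp: filtered_def)
qed (use assms in \<open>auto simp: filtered_def le_fun_def\<close>)

text \<open>A ray sum telescopes to the length of a block whose position and height are both
  proportional to \<open>t\<close>, so \<open>growth\<close> bounds it by a multiple of t^k.\<close>

lemma growth_deg_less:
  assumes E: "filtered E" and g: "growth k E" and c: "eventually_poly d (hilbert_fun E) c"
  shows "deg_less d c k"
proof (rule deg_less_of_ray_sums)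
  show "poly_coeffs d c" using c by (simp add: eventually_poly_def)
  obtain M where M: "\<And>n. (\<forall>i\<le>d. M \<le> n i) \<Longrightarrow> hilbert_fun E n = peval d c n"
    using c unfolding eventually_poly_def by blast
  obtain C L where C: "C \<ge> 0" "\<And>n t. (\<forall>i\<le>d. L \<le> n i) \<Longrightarrow> rlength scale (E n) (E (n + first_exp t)) \<le> C * (esize d n + real t) ^ k"
    using g unfolding growth_def by blast
  fix a :: "nat \<Rightarrow> nat" assume a: "\<forall>i. 1 \<le> a i"
  define K where "K = C * (esize d a + 2) ^ k"
  have "\<bar>\<Sum>j<t. peval d c (ray t a j)\<bar> \<le> K * real t ^ k" if t: "max (max M L) 1 \<le> t" for t
  proof -
    have ta: "t \<le> ray t a j i" for i j
    proof -
      have "t * 1 \<le> t * a i" using a by (intro mult_le_mono) auto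
      then show ?thesis by (simp add: ray_def trans_le_add1)
    qed
    have "(\<Sum>j<t. peval d c (ray t a j)) = (\<Sum>j<t. hilbert_fun E (ray t a 0 + first_exp j))"
      unfolding ray_first_exp[symmetric] using ta t M by (intro sum.cong refl) (metis max.bounded_iff order_trans)
    also have "\<dots> = rlength scale (E (ray t a 0)) (E (ray t a 0 + first_exp t))" by (rule hilbert_fun_sum[OF E])
    finally have eq: "(\<Sum>j<t. peval d c (ray t a j)) = rlength scale (E (ray t a 0)) (E (ray t a 0 + first_exp t))" .
    have "rlength scale (E (ray t a 0)) (E (ray t a 0 + first_exp t)) \<le> C * (esize d (ray t a 0) + real t) ^ k"
      using ta t by (intro C) (metis max.bounded_iff order_trans)
    also have "\<dots> \<le> C * ((esize d a + 2) * real t) ^ k"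
      using esize_ray_le[of 0 t d a] t esize_ge_1[of d "ray t a 0"] C(1)
      by (intro mult_left_mono power_mono) (auto simp: algebra_simps)
    also have "\<dots> = K * real t ^ k" by (simp add: K_def power_mult_distrib mult.assoc)
    finally show ?thesis using eq by simp
  qed
  then show "\<exists>C T. \<forall>t\<ge>T. \<bar>\<Sum>j<t. peval d c (ray t a j)\<bar> \<le> C * real t ^ k" by blast
qed

end

section \<open>Additivity of Hilbert functions up to lower order\<close>

lemma eventually_poly_diff:
  assumes "eventually_poly d f b" "eventually_poly d g c"
  shows "eventually_poly d (\<lambda>n. f n - g n) (\<lambda>\<alpha>. b \<alpha> + (-1) * c \<alpha>)"
  using eventually_poly_add[OF assms(1) eventually_poly_scale[OF assms(2), of "-1"]] by simp

context ideal_family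
begin

text \<open>By Artin-Rees the trace of L's Rees family on T is, for large exponents, I^m times an
  earlier trace, and I^m kills T.\<close>

lemma rees_torsion:
  assumes L: "subspace L" and T: "subspace T" and tor: "act (mpow I d m) T \<subseteq> {0}"
  shows "\<exists>c. \<forall>n. (\<forall>i\<le>d. c \<le> n i) \<longrightarrow> rees L n \<inter> T = {0}"
proof -
  define A where "A n = rees L n \<inter> T" for n
  have fA: "family A" unfolding A_def
    by (rule family_le[OF family_rees[OF L] graded_Int[OF graded_rees graded_const[OF T]] Int_lower1])
  obtain c where c: "\<And>n k. (\<forall>i\<le>d. c \<le> n i) \<Longrightarrow> A (n + k) = act (mpow I d k) (A n)"
    using artin_rees_mpow[OF fA] by blast
  have "A n = {0}" if n: "\<forall>i\<le>d. c + (\<Sum>i\<le>d. m i) \<le> n i" for n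
  proof -
    have mi: "c + m i \<le> n i" if "i \<le> d" for i
      using n that member_le_sum[of i "{..d}" m] by fastforce
    define l where "l = (\<lambda>i. n i - m i)"
    have "A n = A (l + m)"
      using mi by (intro graded_cong[OF family_graded[OF fA]]) (force simp: l_def plus_fun_apply)
    also have "\<dots> = act (mpow I d m) (A l)" by (rule c) (use mi in \<open>force simp: l_def\<close>)
    also have "\<dots> \<subseteq> act (mpow I d m) T" by (rule act_mono) (simp add: A_def)
    also have "\<dots> \<subseteq> {0}" by (rule tor)
    finally show ?thesis using subspace_0[OF subspace_family[OF fA], of n] by blast
  qed
  then show ?thesis unfolding A_def by blast
qed

end

context local_family
begin

lemma add_unit_shift: "n + unit_exp 0 + m = n + m + unit_exp 0"
  by (simp only: add.assoc add.commute[of m])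

lemma filtered_rees: "filtered (rees L)"
  unfolding filtered_def by (simp add: rees_Suc act_subset)

lemma filtered_Int: "filtered E \<Longrightarrow> subspace X \<Longrightarrow> filtered (\<lambda>n. E n \<inter> X)"
  unfolding filtered_def
proof (intro allI conjI)
  fix n assume E: "\<forall>n. subspace (E n) \<and> E (n + unit_exp 0) \<subseteq> E n \<and> act (I 0) (E n) \<subseteq> E (n + unit_exp 0)" and X: "subspace X"
  show "subspace (E n \<inter> X)" using E X by (simp add: subspace_inter)
  show "E (n + unit_exp 0) \<inter> X \<subseteq> E n \<inter> X" using E by blast
  have "act (I 0) (E n \<inter> X) \<subseteq> act (I 0) (E n)" "act (I 0) (E n \<inter> X) \<subseteq> act (I 0) X" by (rule act_mono; blast)+
  then show "act (I 0) (E n \<inter> X) \<subseteq> E (n + unit_exp 0) \<inter> X" using E act_subset[OF X, of "I 0"] by blast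
qed

lemma filtered_sum: "filtered E \<Longrightarrow> subspace X \<Longrightarrow> filtered (\<lambda>n. E n \<oplus> X)"
  unfolding filtered_def
proof (intro allI conjI)
  fix n assume E: "\<forall>n. subspace (E n) \<and> E (n + unit_exp 0) \<subseteq> E n \<and> act (I 0) (E n) \<subseteq> E (n + unit_exp 0)" and X: "subspace X"
  show "subspace (E n \<oplus> X)" using E X by (simp add: subspace_sum_sets)
  show "E (n + unit_exp 0) \<oplus> X \<subseteq> E n \<oplus> X" using E by (intro sum_sets_mono) auto
  have "act (I 0) (E n \<oplus> X) = act (I 0) (E n) \<oplus> act (I 0) X" using E X by (intro act_sum) auto
  also have "\<dots> \<subseteq> E (n + unit_exp 0) \<oplus> X" using E by (intro sum_sets_mono act_subset X) auto
  finally show "act (I 0) (E n \<oplus> X) \<subseteq> E (n + unit_exp 0) \<oplus> X" .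
qed

lemma filtered_shift: "filtered E \<Longrightarrow> filtered (\<lambda>n. E (n + m))"
  unfolding filtered_def add_unit_shift by blast

lemma family_Int_const: "family E \<Longrightarrow> subspace X \<Longrightarrow> family (\<lambda>n. E n \<inter> X)"
  using family_le[of E "\<lambda>n. E n \<inter> X"] graded_Int[of E "\<lambda>n. X"] graded_const[of X] family_graded[of E] by simp

lemma rlength_split:
  assumes E: "filtered E" and X: "subspace X"
  shows "rlength scale (E n) (E (n + first_exp t)) =
    rlength scale (E n \<oplus> X) (E (n + first_exp t) \<oplus> X) + rlength scale (E n \<inter> X) (E (n + first_exp t) \<inter> X)"
  by (rule rlength_add_enat[OF mod_length_split filtered_finite_length])
    (simp_all add: filtered_subspace[OF E] filtered_antimono[OF E] E X)

text \<open>Once the trace on T vanishes, the layers of L and of its image modulo T have the same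
  length, so the dimension modulo torsion governs the growth.\<close>

lemma growth_torsion:
  assumes L: "subspace L" and T: "subspace T" and tor: "act (mpow I d m) T \<subseteq> {0}"
    and ann: "\<And>r a. r \<in> \<aa> \<Longrightarrow> a \<in> L \<Longrightarrow> scale r a \<in> T" and k: "krull_dim_above \<aa> \<le> enat k"
  shows "growth k (rees L)"
proof -
  obtain c where c: "\<And>n. (\<forall>i\<le>d. c \<le> n i) \<Longrightarrow> rees L n \<inter> T = {0}" using rees_torsion[OF L T tor] by blast
  obtain C where C: "C \<ge> 0" "\<And>n t. rlength scale (rees L n \<oplus> T) (rees L (n + first_exp t) \<oplus> T) \<le> C * (esize d n + real t) ^ k"
    using rees_growth[OF L T ann k] by blast
  have "rlength scale (rees L n) (rees L (n + first_exp t)) \<le> C * (esize d n + real t) ^ k" if n: "\<forall>i\<le>d. c \<le> n i" for n t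
  proof -
    have "\<forall>i\<le>d. c \<le> (n + first_exp t) i" using n by (simp add: plus_fun_apply trans_le_add1)
    then have "rlength scale (rees L n \<inter> T) (rees L (n + first_exp t) \<inter> T) = 0" using c n by simp
    then show ?thesis using rlength_split[OF filtered_rees T, of L n t] C(2)[of n t] by simp
  qed
  then show ?thesis unfolding growth_def using C(1) by blast
qed

lemma growth_Int:
  assumes E: "filtered E" and X: "subspace X" and g: "growth k E"
  shows "growth k (\<lambda>n. E n \<inter> X)"
proof -
  obtain C M where C: "C \<ge> 0" "\<And>n t. (\<forall>i\<le>d. M \<le> n i) \<Longrightarrow> rlength scale (E n) (E (n + first_exp t)) \<le> C * (esize d n + real t) ^ k"
    using g unfolding growth_def by blast
  have "rlength scale (E n \<inter> X) (E (n + first_exp t) \<inter> X) \<le> C * (esize d n + real t) ^ k" if "\<forall>i\<le>d. M \<le> n i" for n t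
    using rlength_split[OF E X, of n t] C(2)[OF that, of t]
      rlength_nonneg[of scale "E n \<oplus> X" "E (n + first_exp t) \<oplus> X"] by linarith
  then show ?thesis unfolding growth_def using C(1) by blast
qed

lemma growth_shift:
  assumes g: "growth k E"
  shows "growth k (\<lambda>n. E (n + m))"
proof -
  obtain C M where C: "C \<ge> 0" "\<And>n t. (\<forall>i\<le>d. M \<le> n i) \<Longrightarrow> rlength scale (E n) (E (n + first_exp t)) \<le> C * (esize d n + real t) ^ k"
    using g unfolding growth_def by blast
  define K where "K = C * esize d m ^ k"
  have "rlength scale (E (n + m)) (E (n + first_exp t + m)) \<le> K * (esize d n + real t) ^ k" if n: "\<forall>i\<le>d. M \<le> n i" for n t
  proof -
    have "n + first_exp t + m = n + m + first_exp t" by (simp only: add.assoc add.commute[of m])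
    moreover have "\<forall>i\<le>d. M \<le> (n + m) i" using n by (simp add: plus_fun_apply trans_le_add1)
    ultimately have "rlength scale (E (n + m)) (E (n + first_exp t + m)) \<le> C * (esize d (n + m) + real t) ^ k"
      using C(2)[of "n + m" t] by simp
    also have "\<dots> \<le> C * (esize d m * (esize d n + real t)) ^ k"
    proof (intro mult_left_mono power_mono C)
      define x y where "x = esize d m - 1" and "y = esize d n + real t - 1"
      have xy: "0 \<le> x" "0 \<le> y" using esize_ge_1[of d m] esize_ge_1[of d n] by (simp_all add: x_def y_def)
      have "esize d (n + m) = esize d n + x"
        by (simp add: esize_def x_def plus_fun_apply sum.distrib)
      then have "esize d (n + m) + real t = 1 + x + y" by (simp add: y_def)
      also have "\<dots> \<le> (1 + x) * (1 + y)"
        using mult_nonneg_nonneg[OF xy] by (simp add: algebra_simps)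
      finally show "esize d (n + m) + real t \<le> esize d m * (esize d n + real t)" by (simp add: x_def y_def)
      show "0 \<le> esize d (n + m) + real t" using esize_ge_1[of d "n + m"] by simp
    qed
    finally show ?thesis by (simp add: K_def power_mult_distrib mult.assoc)
  qed
  moreover have "0 \<le> K" using C esize_ge_1[of d m] by (simp add: K_def)
  ultimately show ?thesis unfolding growth_def by blast
qed

lemma ray_coord_ge: "\<forall>i. 1 \<le> a i \<Longrightarrow> t \<le> ray t a j i"
proof -
  assume a: "\<forall>i. 1 \<le> a i"
  then have "t * 1 \<le> t * a i" by (intro mult_le_mono) auto
  then show ?thesis by (simp add: ray_def trans_le_add1)
qed

lemma ray_sum_hilbert_fun:
  assumes E: "filtered E" and c: "eventually_poly d (hilbert_fun E) c" and a: "\<forall>i. 1 \<le> a i"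
  shows "\<exists>T. \<forall>t\<ge>T. (\<Sum>j<t. peval d c (ray t a j)) = rlength scale (E (ray t a 0)) (E (ray t a 0 + first_exp t))"
proof -
  obtain M where M: "\<And>n. (\<forall>i\<le>d. M \<le> n i) \<Longrightarrow> hilbert_fun E n = peval d c n"
    using c unfolding eventually_poly_def by blast
  have "(\<Sum>j<t. peval d c (ray t a j)) = rlength scale (E (ray t a 0)) (E (ray t a 0 + first_exp t))" if t: "M \<le> t" for t
  proof -
    have "hilbert_fun E (ray t a j) = peval d c (ray t a j)" for j
      using M[of "ray t a j"] order_trans[OF t ray_coord_ge[OF a, of t j]] by blast
    then have "(\<Sum>j<t. peval d c (ray t a j)) = (\<Sum>j<t. hilbert_fun E (ray t a 0 + first_exp j))"
      by (simp only: flip: ray_first_exp)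
    then show ?thesis by (simp only: hilbert_fun_sum[OF E])
  qed
  then show ?thesis by blast
qed

text \<open>Comparing two filtered families \<open>G \<subseteq> E\<close>: the induced map between the layers between \<open>n\<close> and
  \<open>n + t e\<^sub>0\<close> has, by the ascending chain condition, its kernel in boundedly many layers of \<open>G\<close>.\<close>

lemma layers_kernel:
  assumes fE: "family E" and fG: "family G" and filG: "filtered G"
  shows "\<exists>c. \<forall>n t. c \<le> t \<longrightarrow> G n \<inter> E (n + first_exp t) \<subseteq> G (n + first_exp (t - c))"
proof -
  \<comment> \<open>The chain ascends in \<open>m\<close> because G descends in direction e_0, and
    it is bounded by E. Its stationary index is the number of layers in which the kernel can
    live.\<close>
  define K where "K m n = E n \<inter> G (n(0 := n 0 - m))" for m :: nat and n
  have gG: "graded G" by (rule family_graded[OF fG])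
  have Gdec: "G (n + unit_exp 0) \<subseteq> G n" for n using filG by (simp add: filtered_def)
  have gr: "graded (\<lambda>n. G (n(0 := n 0 - m)))" for m
  proof (rule gradedI)
    show "subspace (G (n(0 := n 0 - m)))" for n by (rule subspace_graded[OF gG])
    show "G (n(0 := n 0 - m)) = G (l(0 := l 0 - m))" if "\<forall>i\<le>d. n i = l i" for n l
      using graded_cong[OF gG, of "n(0 := n 0 - m)" "l(0 := l 0 - m)"] that by simp
    fix n i x b assume i: "i \<le> d" and x: "x \<in> idl_set (I i)" and b: "b \<in> G (n(0 := n 0 - m))"
    show "scale x b \<in> G ((n + unit_exp i)(0 := (n + unit_exp i) 0 - m))"
    \<comment> \<open>Where the subtraction is truncated at 0, raising coordinate 0 leaves the index
      unchanged, and closure under scalars takes the place of the graded step.\<close>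
    proof (cases "i = 0 \<and> n 0 < m")
      case True
      then have "(n + unit_exp i)(0 := (n + unit_exp i) 0 - m) = n(0 := n 0 - m)"
        by (auto simp: unit_exp_def fun_eq_iff plus_fun_apply)
      then show ?thesis using subspace_scale[OF subspace_graded[OF gG] b] by (simp only:)
    next
      case False
      then have "(n + unit_exp i)(0 := (n + unit_exp i) 0 - m) = n(0 := n 0 - m) + unit_exp i"
        by (auto simp: unit_exp_def fun_eq_iff plus_fun_apply)
      then show ?thesis using graded_elem[OF gG, OF i x b] by (simp only:)
    qed
  qed
  have fK: "family (K m)" for m
    unfolding K_def[abs_def] by (rule family_le[OF fE graded_Int[OF family_graded[OF fE] gr] Int_lower1])
  have inc: "K m n \<subseteq> K (Suc m) n" for m n
  proof (cases "n 0 \<le> m")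
    case False
    then have "n(0 := n 0 - m) = n(0 := n 0 - Suc m) + unit_exp 0"
      by (auto simp: unit_exp_def fun_eq_iff plus_fun_apply)
    then have "G (n(0 := n 0 - m)) \<subseteq> G (n(0 := n 0 - Suc m))" using Gdec[of "n(0 := n 0 - Suc m)"] by (simp only:)
    then show ?thesis unfolding K_def by blast
  qed (simp add: K_def)
  obtain c where c: "\<forall>m\<ge>c. K m = K c" using family_acc[of K, OF fK inc] ..
  have "G n \<inter> E (n + first_exp t) \<subseteq> G (n + first_exp (t - c))" if t: "c \<le> t" for n t
  proof -
    define l where "l = n + first_exp t"
    have "l(0 := l 0 - t) = n" "l(0 := l 0 - c) = n + first_exp (t - c)"
      using t by (auto simp: l_def first_exp_def fun_eq_iff plus_fun_apply)
    moreover have "K t l = K c l" using fun_cong[OF c[rule_format, OF t]] .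
    ultimately have "E l \<inter> G n = E l \<inter> G (n + first_exp (t - c))" by (simp only: K_def)
    then show ?thesis unfolding l_def by blast
  qed
  then show ?thesis by blast
qed

text \<open>The image of the G-block in the E-block costs at most the length of the latter. The
  kernel lies in the last \<open>c'\<close> layers of the G-block, and each of these has length of
  order t^k because the Hilbert polynomial of G has degree at most \<open>k\<close>.\<close>

lemma ray_length_lower:
  assumes fE: "family E" and filE: "filtered E" and fG: "family G" and filG: "filtered G"
    and GE: "\<And>n. G n \<subseteq> E n" and c: "eventually_poly d (hilbert_fun G) c" and deg: "deg_less d c (Suc k)"
    and a: "\<forall>i. 1 \<le> a i"
  shows "\<exists>C\<ge>0. \<exists>T. \<forall>t\<ge>T. rlength scale (G (ray t a 0)) (G (ray t a 0 + first_exp t))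
    \<le> rlength scale (E (ray t a 0)) (E (ray t a 0 + first_exp t)) + C * real t ^ k"
proof -
  obtain M where M: "\<And>n. (\<forall>i\<le>d. M \<le> n i) \<Longrightarrow> hilbert_fun G n = peval d c n" and pc: "poly_coeffs d c"
    using c unfolding eventually_poly_def by blast
  obtain B where B: "B \<ge> 0" "\<And>n. esize d n * \<bar>peval d c n\<bar> \<le> B * esize d n ^ Suc k"
    using peval_bound[OF pc deg] by blast
  have B': "peval d c n \<le> B * esize d n ^ k" for n
  proof -
    have "esize d n * \<bar>peval d c n\<bar> \<le> esize d n * (B * esize d n ^ k)" using B(2)[of n] by (simp add: mult_ac)
    then have "\<bar>peval d c n\<bar> \<le> B * esize d n ^ k" using esize_ge_1[of d n] by (simp add: mult_le_cancel_left)
    then show ?thesis by simp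
  qed
  obtain c' where c': "\<And>n t. c' \<le> t \<Longrightarrow> G n \<inter> E (n + first_exp t) \<subseteq> G (n + first_exp (t - c'))"
    using layers_kernel[OF fE fG filG] by blast
  define C where "C = real c' * (B * (esize d a + 1) ^ k)"
  have "rlength scale (G (ray t a 0)) (G (ray t a 0 + first_exp t))
    \<le> rlength scale (E (ray t a 0)) (E (ray t a 0 + first_exp t)) + C * real t ^ k" if t: "max (max M c') 1 \<le> t" for t
  proof -
    define n where "n = ray t a 0"
    define E' G' where "E' = E (n + first_exp t)" and "G' = G (n + first_exp t)"
    have sub: "subspace (E n)" "subspace (G n)" "subspace E'" "subspace G'"
      unfolding E'_def G'_def by (simp_all add: filtered_subspace[OF filE] filtered_subspace[OF filG])
    have incl: "G' \<subseteq> E'" "G' \<subseteq> G n" "E' \<subseteq> E n"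
      unfolding E'_def G'_def by (simp_all add: GE filtered_antimono[OF filE] filtered_antimono[OF filG])
    have finG: "mod_length scale (G n) G' \<noteq> \<infinity>" unfolding G'_def by (rule filtered_finite_length[of G, OF filG])
    have finE: "mod_length scale (E n) E' \<noteq> \<infinity>" unfolding E'_def by (rule filtered_finite_length[of E, OF filE])
    have eq: "mod_length scale (G n) G' = mod_length scale (G n) (G n \<inter> E') + mod_length scale (G n \<inter> E') G'"
      using incl by (intro mod_length_add sub subspace_inter) auto
    have fin2: "mod_length scale (G n \<inter> E') G' \<noteq> \<infinity>" using finG unfolding eq by (auto simp: plus_enat_def split: enat.splits)
    have "mod_length scale (G n) (G n \<inter> E') = mod_length scale (G n \<oplus> E') E'"
      by (rule mod_length_second_iso[OF sub(2,3), symmetric])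
    also have "\<dots> \<le> mod_length scale (E n) E'"
      using GE[of n] incl by (intro mod_length_mono sum_sets_least sub) auto
    finally have 1: "rlength scale (G n) (G n \<inter> E') \<le> rlength scale (E n) E'" by (rule rlength_mono_enat[OF _ finE])
    define l where "l = n + first_exp (t - c')"
    have l: "n + first_exp t = l + first_exp c'"
      using t by (auto simp: l_def first_exp_def fun_eq_iff plus_fun_apply)
    have "G n \<inter> E' \<subseteq> G l" unfolding E'_def l_def using t by (intro c') auto
    then have "mod_length scale (G n \<inter> E') G' \<le> mod_length scale (G l) (G (l + first_exp c'))"
      unfolding G'_def l by (intro mod_length_mono) auto
    then have "rlength scale (G n \<inter> E') G' \<le> rlength scale (G l) (G (l + first_exp c'))"
      by (rule rlength_mono_enat[OF _ filtered_finite_length[of G, OF filG]])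
    also have "\<dots> = (\<Sum>j<c'. hilbert_fun G (l + first_exp j))" by (rule hilbert_fun_sum[OF filG, symmetric])
    also have "\<dots> \<le> (\<Sum>j<c'. B * ((esize d a + 1) ^ k * real t ^ k))"
    proof (rule sum_mono)
      fix j assume j: "j \<in> {..<c'}"
      have lj: "l + first_exp j = ray t a (t - c' + j)"
        by (auto simp: l_def n_def ray_def first_exp_def fun_eq_iff plus_fun_apply)
      have "hilbert_fun G (l + first_exp j) = peval d c (ray t a (t - c' + j))"
        unfolding lj using t order_trans[OF _ ray_coord_ge[OF a, of t "t - c' + j"]] by (intro M) auto
      also have "\<dots> \<le> B * esize d (ray t a (t - c' + j)) ^ k" by (rule B')
      also have "\<dots> \<le> B * ((esize d a + 1) * real t) ^ k"
        using j t B(1) esize_ge_1[of d "ray t a (t - c' + j)"]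
        by (intro mult_left_mono power_mono esize_ray_le) auto
      finally show "hilbert_fun G (l + first_exp j) \<le> B * ((esize d a + 1) ^ k * real t ^ k)"
        by (simp add: power_mult_distrib)
    qed
    also have "\<dots> = C * real t ^ k" by (simp add: C_def mult_ac)
    finally have 2: "rlength scale (G n \<inter> E') G' \<le> C * real t ^ k" .
    show ?thesis using 1 2 rlength_add_enat[OF eq finG] unfolding n_def E'_def G'_def by linarith
  qed
  moreover have "0 \<le> C" using B(1) esize_ge_1[of d a] by (simp add: C_def)
  ultimately show ?thesis by blast
qed

text \<open>By Artin--Rees a shift of \<open>E = rees L \<inter> L'\<close> lies in \<open>rees L'\<close>, and shifting changes a Hilbert
  polynomial in lower degrees only.\<close>

lemma hilbert_fun_Int_rees:
  assumes L: "subspace L" and L': "subspace L'" "L' \<subseteq> L"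
    and gL: "growth (Suc k) (rees L)" and gL': "growth (Suc k) (rees L')"
    and cE: "eventually_poly d (hilbert_fun (\<lambda>n. rees L n \<inter> L')) cE"
    and cG: "eventually_poly d (hilbert_fun (rees L')) cG"
  shows "deg_less d (\<lambda>\<alpha>. cE \<alpha> + (-1) * cG \<alpha>) k"
proof -
  define E where "E n = rees L n \<inter> L'" for n
  define G where "G = rees L'"
  have fE: "family E" unfolding E_def[abs_def] by (rule family_Int_const[OF family_rees[OF L] L'(1)])
  have filE: "filtered E" unfolding E_def[abs_def] by (rule filtered_Int[OF filtered_rees L'(1)])
  have fG: "family G" unfolding G_def by (rule family_rees[OF L'(1)])
  have filG: "filtered G" unfolding G_def by (rule filtered_rees)
  have cE': "eventually_poly d (hilbert_fun E) cE" using cE by (simp only: E_def[abs_def])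
  have cG': "eventually_poly d (hilbert_fun G) cG" using cG by (simp only: G_def)
  have gE: "growth (Suc k) E" unfolding E_def[abs_def] by (rule growth_Int[OF filtered_rees L'(1) gL])
  have dE: "deg_less d cE (Suc k)" by (rule growth_deg_less[OF filE gE cE'])
  have dG: "deg_less d cG (Suc k)" by (rule growth_deg_less[OF filG gL'[folded G_def] cG'])
  have GE: "G n \<subseteq> E n" for n
    unfolding G_def E_def using rees_mono[OF L'(2), of n] rees_subset[OF L'(1), of n] by blast
  obtain c where c: "\<And>n k. (\<forall>i\<le>d. c \<le> n i) \<Longrightarrow> E (n + k) = act (mpow I d k) (E n)"
    using artin_rees_mpow[OF fE] by blast
  \<comment> \<open>From the index \<open>(c,...,c)\<close> on, E is generated by its component
    there, which lies in L'; so the shift of E by \<open>s\<close> lies in the Rees family of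
    L'.\<close>
  define s where "s = (\<lambda>i::nat. c)"
  define S where "S n = E (n + s)" for n
  have SG: "S n \<subseteq> G n" for n
  proof -
    have "E (n + s) = E (s + n)" by (simp only: add.commute)
    also have "\<dots> = act (mpow I d n) (E s)" by (rule c) (simp add: s_def)
    also have "\<dots> \<subseteq> act (mpow I d n) L'" by (rule act_mono) (simp add: E_def)
    finally show ?thesis by (simp add: S_def G_def rees_def)
  qed
  have filS: "filtered S" unfolding S_def[abs_def] by (rule filtered_shift[OF filE])
  have fS: "family S"
    by (rule family_le[OF fG _ SG]) (simp add: S_def[abs_def] graded_shift[OF family_graded[OF fE]])
  obtain cS where cS: "eventually_poly d (hilbert_fun S) cS" using hilbert_fun_poly[OF fS filS] by blast
  have gS: "growth (Suc k) S" unfolding S_def[abs_def] by (rule growth_shift[OF gE])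
  have dS: "deg_less d cS (Suc k)" by (rule growth_deg_less[OF filS gS cS])
  have pE: "poly_coeffs d cE" and pG: "poly_coeffs d cG" using cE cG by (auto simp: eventually_poly_def)
  show ?thesis
  proof (rule deg_less_of_ray_sums)
    show "poly_coeffs d (\<lambda>\<alpha>. cE \<alpha> + (-1) * cG \<alpha>)" by (intro poly_coeffs_add poly_coeffs_scale pE pG)
    fix a :: "nat \<Rightarrow> nat" assume a: "\<forall>i. 1 \<le> a i"
    \<comment> \<open>The block of G is sandwiched: \<open>RG\<close> exceeds \<open>RE\<close>, and
      \<open>RS\<close> exceeds \<open>RG\<close>, by at most order t^k, while \<open>RS\<close> and
      \<open>RE\<close> differ by order t^k since S is a shift of E.\<close>
    define RE RG RS where "RE t = rlength scale (E (ray t a 0)) (E (ray t a 0 + first_exp t))"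
      and "RG t = rlength scale (G (ray t a 0)) (G (ray t a 0 + first_exp t))"
      and "RS t = rlength scale (S (ray t a 0)) (S (ray t a 0 + first_exp t))" for t
    obtain TE where TE: "\<And>t. t \<ge> TE \<Longrightarrow> (\<Sum>j<t. peval d cE (ray t a j)) = RE t"
      using ray_sum_hilbert_fun[OF filE cE' a] unfolding RE_def by blast
    obtain TG where TG: "\<And>t. t \<ge> TG \<Longrightarrow> (\<Sum>j<t. peval d cG (ray t a j)) = RG t"
      using ray_sum_hilbert_fun[OF filG cG' a] unfolding RG_def by blast
    obtain C1 T1 where C1: "C1 \<ge> 0" "\<And>t. t \<ge> T1 \<Longrightarrow> RG t \<le> RE t + C1 * real t ^ k"
      using ray_length_lower[OF fE filE fG filG GE cG' dG a] unfolding RE_def RG_def by blast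
    obtain C2 T2 where C2: "C2 \<ge> 0" "\<And>t. t \<ge> T2 \<Longrightarrow> RS t \<le> RG t + C2 * real t ^ k"
      using ray_length_lower[OF fG filG fS filS SG cS dS a] unfolding RS_def RG_def by blast
    obtain B where B: "B \<ge> 0" "\<And>n. esize d n * \<bar>peval d cE (n + s) - peval d cE n\<bar> \<le> B * esize d n ^ k"
      using peval_shift_bound[OF pE dE, of s] by blast
    define C3 where "C3 = B * (esize d a + 1) ^ k"
    obtain M where M: "\<And>n. (\<forall>i\<le>d. M \<le> n i) \<Longrightarrow> hilbert_fun E n = peval d cE n"
      using cE' unfolding eventually_poly_def by blast
    have RS_eq: "RS t = (\<Sum>j<t. peval d cE (ray t a j + s))" if t: "t \<ge> M" for t
    proof -
      have "hilbert_fun S (ray t a j) = peval d cE (ray t a j + s)" for j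
      proof -
        have "hilbert_fun S (ray t a j) = hilbert_fun E (ray t a j + s)"
          unfolding hilbert_fun_def S_def add_unit_shift ..
        also have "\<dots> = peval d cE (ray t a j + s)"
          by (rule M) (use order_trans[OF t ray_coord_ge[OF a, of t j]] in \<open>auto simp: plus_fun_apply intro: trans_le_add1\<close>)
        finally show ?thesis .
      qed
      moreover have "RS t = (\<Sum>j<t. hilbert_fun S (ray t a j))"
        unfolding RS_def hilbert_fun_sum[OF filS, symmetric] by (simp only: flip: ray_first_exp)
      ultimately show ?thesis by simp
    qed
    have "\<bar>\<Sum>j<t. peval d (\<lambda>\<alpha>. cE \<alpha> + (-1) * cG \<alpha>) (ray t a j)\<bar> \<le> (C1 + C2 + C3) * real t ^ k"
      if t: "t \<ge> Max {TE, TG, T1, T2, M, 1}" for t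
    proof -
      have t': "t \<ge> TE" "t \<ge> TG" "t \<ge> T1" "t \<ge> T2" "t \<ge> M" "t \<ge> 1" using t by auto
      have "\<bar>\<Sum>j<t. peval d cE (ray t a j + s) - peval d cE (ray t a j)\<bar> \<le> C3 * real t ^ k"
        unfolding C3_def using a t' B by (intro ray_sum_bound) auto
      then have 3: "\<bar>RS t - RE t\<bar> \<le> C3 * real t ^ k"
        using RS_eq[OF t'(5)] TE[OF t'(1)] by (simp only: sum_subtractf)
      have "(\<Sum>j<t. peval d (\<lambda>\<alpha>. cE \<alpha> + (-1) * cG \<alpha>) (ray t a j)) = RE t - RG t"
        unfolding peval_add[OF pE poly_coeffs_scale[OF pG]] peval_scale[OF pG] sum.distrib
        using TE[OF t'(1)] TG[OF t'(2)] by (simp add: sum_negf)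
      moreover have "0 \<le> C1 * real t ^ k" "0 \<le> C2 * real t ^ k" "0 \<le> C3 * real t ^ k"
        using C1(1) C2(1) B(1) esize_ge_1[of d a] by (auto simp: C3_def)
      ultimately show ?thesis
        using 3 C1(2)[OF t'(3)] C2(2)[OF t'(4)] unfolding distrib_right by linarith
    qed
    then show "\<exists>C T. \<forall>t\<ge>T. \<bar>\<Sum>j<t. peval d (\<lambda>\<alpha>. cE \<alpha> + (-1) * cG \<alpha>) (ray t a j)\<bar> \<le> C * real t ^ k" by blast
  qed
qed

lemma hilbert_fun_split:
  assumes "subspace X"
  shows "hilbert_fun (rees L) n = hilbert_fun (\<lambda>n. rees L n \<oplus> X) n + hilbert_fun (\<lambda>n. rees L n \<inter> X) n"
  unfolding hilbert_fun_def
  using rlength_split[OF filtered_rees assms, of L n "Suc 0"] by (simp only: first_exp_1)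

lemma hilbert_fun_rees_poly: "subspace L \<Longrightarrow> \<exists>c. eventually_poly d (hilbert_fun (rees L)) c"
  by (rule hilbert_fun_poly[OF family_rees filtered_rees])

lemma hilbert_fun_Int_poly:
  assumes "subspace L" "subspace X"
  shows "\<exists>c. eventually_poly d (hilbert_fun (\<lambda>n. rees L n \<inter> X)) c"
  by (rule hilbert_fun_poly[OF family_Int_const[OF family_rees[OF assms(1)] assms(2)] filtered_Int[OF filtered_rees assms(2)]])

lemma hilbert_fun_quotient_poly:
  assumes "subspace L" "subspace X"
  shows "\<exists>c. eventually_poly d (hilbert_fun (\<lambda>n. rees L n \<oplus> X)) c"
proof -
  obtain b c where bc: "eventually_poly d (hilbert_fun (rees L)) b"
    "eventually_poly d (hilbert_fun (\<lambda>n. rees L n \<inter> X)) c"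
    using hilbert_fun_rees_poly[OF assms(1)] hilbert_fun_Int_poly[OF assms] by blast
  have "(\<lambda>n. hilbert_fun (rees L) n - hilbert_fun (\<lambda>n. rees L n \<inter> X) n) = hilbert_fun (\<lambda>n. rees L n \<oplus> X)"
    unfolding hilbert_fun_split[OF assms(2), of L] by simp
  then show ?thesis using eventually_poly_diff[OF bc] by auto
qed

lemma hilbert_fun_quotient_deg:
  assumes L: "subspace L" and X: "subspace X" and ann: "\<And>r a. r \<in> \<aa> \<Longrightarrow> a \<in> L \<Longrightarrow> scale r a \<in> X"
    and k: "krull_dim_above \<aa> \<le> enat k" and c: "eventually_poly d (hilbert_fun (\<lambda>n. rees L n \<oplus> X)) c"
  shows "deg_less d c k"
proof (rule growth_deg_less[OF filtered_sum[OF filtered_rees X] _ c])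
  show "growth k (\<lambda>n. rees L n \<oplus> X)"
    unfolding growth_def using rees_growth[OF L X ann k] by blast
qed

text \<open>Splitting along L' is exact for the trace filtration;
  \<open>hilbert_fun_Int_rees\<close> then replaces that filtration by the one of L' itself at the
  cost of lower degree.\<close>

theorem hilbert_fun_additive:
  assumes L: "subspace L" and L': "subspace L'" "L' \<subseteq> L"
    and "growth (Suc k) (rees L)" "growth (Suc k) (rees L')"
  shows "\<exists>c. eventually_poly d
      (\<lambda>n. hilbert_fun (rees L) n - (hilbert_fun (rees L') n + hilbert_fun (\<lambda>n. rees L n \<oplus> L') n)) c \<and> deg_less d c k"
proof -
  obtain cE cG where c: "eventually_poly d (hilbert_fun (\<lambda>n. rees L n \<inter> L')) cE"
    "eventually_poly d (hilbert_fun (rees L')) cG"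
    using hilbert_fun_rees_poly[OF L'(1)] hilbert_fun_Int_poly[OF L L'(1)] by blast
  have "(\<lambda>n. hilbert_fun (\<lambda>n. rees L n \<inter> L') n - hilbert_fun (rees L') n)
      = (\<lambda>n. hilbert_fun (rees L) n - (hilbert_fun (rees L') n + hilbert_fun (\<lambda>n. rees L n \<oplus> L') n))"
    unfolding hilbert_fun_split[OF L'(1), of L] by auto
  then show ?thesis using eventually_poly_diff[OF c] hilbert_fun_Int_rees[OF assms c] by auto
qed

end

section \<open>Lengths of localizations\<close>

lemma mult_closed_Compl_prime: "prime_ideal p \<Longrightarrow> mult_closed (- p)"
  unfolding mult_closed_def using prime_idealD(2,3) by blast

lemma chain_len_two:
  assumes "\<And>X. P X \<longleftrightarrow> X = A \<or> X = B" "A \<subset> B" shows "chain_len P = 1"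
proof (rule antisym)
  show "chain_len P \<le> 1"
  proof (rule chain_len_leI)
    fix k C assume C: "\<forall>i\<le>k. P (C i)" "\<forall>i<k. C i \<subset> C (Suc i)"
    have "\<not> 2 \<le> k"
    proof
      assume "2 \<le> k"
      then have "C 0 \<subset> C 1" "C 1 \<subset> C 2" "P (C 0)" "P (C 1)" "P (C 2)"
        using C(1) C(2)[rule_format, of 0] C(2)[rule_format, of 1] by (auto simp: numeral_2_eq_2)
      then show False
        using assms(1)[of "C 0"] assms(1)[of "C 1"] assms(1)[of "C 2"] assms(2) by auto
    qed
    then have "k \<le> 1" by linarith
    then show "enat k \<le> 1" by (simp add: one_enat_def)
  qed
  have "enat 1 \<le> chain_len P"
    by (rule chain_len_ge[where C = "\<lambda>i. if i = 0 then A else B"]) (use assms in auto)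
  then show "1 \<le> chain_len P" by (simp add: one_enat_def)
qed

context module
begin

lemma loc_submoduleD:
  assumes "loc_submodule scale p UNIV {0} U"
  shows "(0, 1) \<in> U" "(a, s) \<in> U \<Longrightarrow> (a', s') \<in> U \<Longrightarrow> (scale s' a + scale s a', s * s') \<in> U"
    "(a, s) \<in> U \<Longrightarrow> t \<notin> p \<Longrightarrow> (scale r a, t * s) \<in> U"
    "x \<in> U \<Longrightarrow> snd y \<notin> p \<Longrightarrow> loc_rel scale p {0} x y \<Longrightarrow> y \<in> U"
    "(a, s) \<in> U \<Longrightarrow> s \<notin> p"
proof -
  note U = assms[unfolded loc_submodule_def]
  show "(0, 1) \<in> U" using U by (elim conjE)
  show "(a, s) \<in> U \<Longrightarrow> (a', s') \<in> U \<Longrightarrow> (scale s' a + scale s a', s * s') \<in> U"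
    using U by (elim conjE) simp
  show "(a, s) \<in> U \<Longrightarrow> t \<notin> p \<Longrightarrow> (scale r a, t * s) \<in> U" using U by (elim conjE) simp
  have "\<forall>x y. x \<in> U \<and> y \<in> UNIV \<times> - p \<and> loc_rel scale p {0} x y \<longrightarrow> y \<in> U" using U by (elim conjE)
  moreover have "snd y \<notin> p \<Longrightarrow> y \<in> UNIV \<times> - p" by (cases y) simp
  ultimately show "x \<in> U \<Longrightarrow> snd y \<notin> p \<Longrightarrow> loc_rel scale p {0} x y \<Longrightarrow> y \<in> U"
    by blast
  have "U \<subseteq> UNIV \<times> - p" using U by (elim conjE)
  then show "(a, s) \<in> U \<Longrightarrow> s \<notin> p" by blast
qed

text \<open>Denominators are invertible, so a submodule of the localization is determined by its
  numerators over 1, and these form a saturated submodule. Both passages are strictly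
  monotone.\<close>

lemma loc_length_eq_sat_length:
  assumes p: "prime_ideal p"
  shows "loc_length scale p UNIV {0} = sat_length scale (- p) UNIV (saturation scale (- p) {0})"
  unfolding loc_length_def sat_length_def
proof (rule antisym; rule chain_len_map)
  fix U assume U: "loc_submodule scale p UNIV {0} U"
  have U0: "(0, 1) \<in> U" and Uadd: "\<And>a s a' s'. (a, s) \<in> U \<Longrightarrow> (a', s') \<in> U \<Longrightarrow> (scale s' a + scale s a', s * s') \<in> U"
    and Uscale: "\<And>a s r t. (a, s) \<in> U \<Longrightarrow> t \<notin> p \<Longrightarrow> (scale r a, t * s) \<in> U"
    and Urel: "\<And>x y. x \<in> U \<Longrightarrow> snd y \<notin> p \<Longrightarrow> loc_rel scale p {0} x y \<Longrightarrow> y \<in> U"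
    using loc_submoduleD[OF U] by blast+
  note p1 = prime_idealD(2)[OF p]
  have sat: "(a, 1) \<in> U" if "s \<notin> p" "(scale s a, 1) \<in> U" for s a
  proof -
    have "(scale s a, s) \<in> U" using Uscale[OF that(2,1), of 1] by simp
    moreover have "loc_rel scale p {0} (scale s a, s) (a, 1)"
      unfolding loc_rel_def using p1 by (intro exI[of _ 1]) simp
    ultimately show ?thesis using Urel p1 by simp
  qed
  have "subspace {a. (a, 1) \<in> U}"
  proof (rule subspaceI)
    show "x + y \<in> {a. (a, 1) \<in> U}" if "x \<in> {a. (a, 1) \<in> U}" "y \<in> {a. (a, 1) \<in> U}" for x y
      using Uadd[of x 1 y 1] that by simp
    show "scale c x \<in> {a. (a, 1) \<in> U}" if "x \<in> {a. (a, 1) \<in> U}" for c x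
      using Uscale[of x 1 1 c] that p1 by simp
  qed (use U0 in simp)
  moreover have "saturated scale (- p) {a. (a, 1) \<in> U}"
    unfolding saturated_def using sat by blast
  moreover have "saturation scale (- p) {0} \<subseteq> {a. (a, 1) \<in> U}"
    unfolding saturation_def using sat U0 by force
  ultimately show "subspace {a. (a, 1) \<in> U} \<and> saturated scale (- p) {a. (a, 1) \<in> U} \<and>
      saturation scale (- p) {0} \<subseteq> {a. (a, 1) \<in> U} \<and> {a. (a, 1) \<in> U} \<subseteq> UNIV" by simp
next
  fix U U' assume U: "loc_submodule scale p UNIV {0} U" and U': "loc_submodule scale p UNIV {0} U'" and UU': "U \<subset> U'"
  note p1 = prime_idealD(2)[OF p]
  obtain a s where as: "(a, s) \<in> U'" "(a, s) \<notin> U" using UU' by auto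
  have s: "s \<notin> p" by (rule loc_submoduleD(5)[OF U' as(1)])
  have "(scale s a, 1 * s) \<in> U'" by (rule loc_submoduleD(3)[OF U' as(1) p1])
  moreover have "loc_rel scale p {0} (scale s a, s) (a, 1)"
    unfolding loc_rel_def using p1 by (intro exI[of _ 1]) simp
  ultimately have "(a, 1) \<in> U'" using loc_submoduleD(4)[OF U', of "(scale s a, s)" "(a, 1)"] p1 by simp
  moreover have "(a, 1) \<notin> U"
  proof
    assume "(a, 1) \<in> U"
    then have "(scale 1 a, s * 1) \<in> U" by (rule loc_submoduleD(3)[OF U _ s])
    then show False using as(2) by simp
  qed
  ultimately show "{a. (a, 1) \<in> U} \<subset> {a. (a, 1) \<in> U'}" using UU' by blast
next
  fix X assume X: "subspace X \<and> saturated scale (- p) X \<and> saturation scale (- p) {0} \<subseteq> X \<and> X \<subseteq> UNIV"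
  then have sX: "subspace X" and satX: "\<And>s a. s \<notin> p \<Longrightarrow> scale s a \<in> X \<Longrightarrow> a \<in> X"
    by (auto simp: saturated_def)
  note p1 = prime_idealD(2)[OF p]
  have mult: "s \<notin> p \<Longrightarrow> t \<notin> p \<Longrightarrow> s * t \<notin> p" for s t using prime_idealD(3)[OF p] by blast
  have rel: "b \<in> X" if a: "a \<in> X" and s: "s \<notin> p" and rel: "loc_rel scale p {0} (a, s) (b, t)" for a s b t
  proof -
    obtain u where u: "u \<notin> p" "scale u (scale t a - scale s b) = 0" using rel by (auto simp: loc_rel_def)
    then have "scale (u * s) b = scale u (scale t a)" by (simp add: scale_right_diff_distrib)
    also have "\<dots> \<in> X" using a subspace_scale[OF sX] by simp
    finally show ?thesis by (rule satX[OF mult[OF u(1) s]])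
  qed
  show "loc_submodule scale p UNIV {0} (X \<times> - p)"
    unfolding loc_submodule_def using subspace_0[OF sX] p1 rel
    by (auto simp: mult subspace_add[OF sX] subspace_scale[OF sX])
next
  fix X Y :: "'b set" assume "X \<subset> Y"
  moreover have "1 \<in> - p" using prime_idealD(2)[OF p] by simp
  ultimately show "X \<times> - p \<subset> Y \<times> - p" by blast
qed

lemma saturation_UNIV [simp]: "1 \<in> S \<Longrightarrow> saturation scale S UNIV = UNIV"
  unfolding saturation_def by blast

text \<open>Localizing R/p at a prime \<open>p0\<close> not strictly above p gives the residue field
  if the two agree, and zero otherwise, since then some element of p outside \<open>p0\<close> moves
  \<open>a\<close> into M.\<close>

lemma sat_length_cyclic:
  assumes M: "subspace M" and p: "prime_ideal p" and p0: "prime_ideal p0" "p \<subseteq> p0 \<Longrightarrow> p = p0"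
    and a: "p = {r. scale r a \<in> M}"
  shows "sat_length scale (- p0) (saturation scale (- p0) (M \<oplus> range (\<lambda>r. scale r a))) (saturation scale (- p0) M)
    = (if p = p0 then 1 else 0)"
proof -
  define M' where "M' = M \<oplus> range (\<lambda>r. scale r a)"
  have S: "mult_closed (- p0)" by (rule mult_closed_Compl_prime[OF p0(1)])
  have sM': "subspace M'" unfolding M'_def by (intro subspace_sum_sets M subspace_range_scale)
  have MM': "M \<subseteq> M'" unfolding M'_def by (rule sum_sets_upper1[OF subspace_range_scale])
  have aM': "a \<in> M'" unfolding M'_def using sum_setsI[OF subspace_0[OF M] rangeI, of "\<lambda>r. scale r a" 1] by simp
  let ?s = "saturation scale (- p0)"
  have sub: "subspace (?s M)" "subspace (?s M')" by (intro subspace_saturation[OF S] M sM')+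
  have least: "?s M' \<subseteq> X" if X: "subspace X" "saturated scale (- p0) X" "M \<subseteq> X" "a \<in> X" for X
    unfolding M'_def using X subspace_scale[OF X(1) X(4)] by (intro saturation_least sum_sets_least) auto
  show ?thesis
  proof (cases "p = p0")
    case True
    have anot: "a \<notin> ?s M" using True a by (auto simp: saturation_def)
    have "a \<in> ?s M'" using saturation_superset[OF S, of M'] aM' by blast
    then have strict: "?s M \<subset> ?s M'" using anot saturation_mono[OF MM', of "- p0"] by blast
    have "sat_length scale (- p0) (?s M') (?s M) = 1"
      unfolding sat_length_def
    proof (rule chain_len_two[OF _ strict])
      fix X
      show "subspace X \<and> saturated scale (- p0) X \<and> ?s M \<subseteq> X \<and> X \<subseteq> ?s M' \<longleftrightarrow> X = ?s M \<or> X = ?s M'"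
      proof
        assume X: "subspace X \<and> saturated scale (- p0) X \<and> ?s M \<subseteq> X \<and> X \<subseteq> ?s M'"
        show "X = ?s M \<or> X = ?s M'"
        proof (rule disjCI)
          assume "X \<noteq> ?s M'"
          show "X = ?s M"
          proof (rule ccontr)
            assume "X \<noteq> ?s M"
            then obtain x where x: "x \<in> X" "x \<notin> ?s M" using X by blast
            then have "x \<in> ?s M'" using X by blast
            then obtain s where s: "s \<in> - p0" "scale s x \<in> M'" by (auto simp: saturation_def)
            then obtain m r where mr: "m \<in> M" "scale s x = m + scale r a" by (auto simp: M'_def elim!: sum_setsE)
            have "r \<notin> p0"
            proof
              assume "r \<in> p0"
              then have "scale r a \<in> M" using True a by blast
              then have "scale s x \<in> M" using mr subspace_add[OF M] by simp
              then show False using x(2) s(1) by (auto simp: saturation_def)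
            qed
            have MX: "M \<subseteq> X" using X saturation_superset[OF S, of M] by blast
            have "scale r a = scale s x - m" using mr(2) by simp
            moreover have "scale s x - m \<in> X" using X x(1) mr(1) MX by (blast intro: subspace_diff subspace_scale)
            ultimately have "a \<in> X" using X \<open>r \<notin> p0\<close> by (auto simp: saturated_def)
            then have "?s M' \<subseteq> X" using least X MX by blast
            then show False using X \<open>X \<noteq> ?s M'\<close> by blast
          qed
        qed
      next
        assume "X = ?s M \<or> X = ?s M'"
        then show "subspace X \<and> saturated scale (- p0) X \<and> ?s M \<subseteq> X \<and> X \<subseteq> ?s M'"
          using sub strict saturated_saturation[OF S] by auto
      qed
    qed
    then show ?thesis using True by (simp add: M'_def)
  next
    case False
    then obtain s where "s \<in> p" "s \<notin> p0" using p0(2) by blast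
    then have "a \<in> ?s M" using a by (auto simp: saturation_def)
    then have "?s M' \<subseteq> ?s M"
      by (intro least sub saturated_saturation[OF S] saturation_superset[OF S])
    then have "?s M' = ?s M" using saturation_mono[OF MM', of "- p0"] by blast
    then have "sat_length scale (- p0) (?s M') (?s M) = 0"
      unfolding sat_length_def by (intro chain_len_unique) auto
    then show ?thesis using False by (simp add: M'_def)
  qed
qed

end

text \<open>The primes met in a filtration form a finite set, and every prime over the annihilator
  contains one of them. Finiteness matters because a sum over an infinite set is 0 by
  convention.\<close>

lemma (in noetherian_module) finite_minimal_primes:
  assumes noeth: "noetherian_ring TYPE('a)" and T: "subspace T"
  shows "finite {p. minimal_prime_over (ann scale UNIV T) p}"
proof -
  define Q where "Q M \<longleftrightarrow> (\<exists>F. finite F \<and> (\<forall>p\<in>F. prime_ideal p \<and> ann scale UNIV T \<subseteq> p) \<and>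
    (\<forall>p. prime_ideal p \<longrightarrow> {r. \<forall>a\<in>M. scale r a \<in> T} \<subseteq> p \<longrightarrow> (\<exists>p'\<in>F. p' \<subseteq> p)))" for M
  have "Q UNIV"
  proof (rule prime_devissage[OF noeth subspace_UNIV T subset_UNIV])
    have "{r. \<forall>a\<in>T. scale r a \<in> T} = UNIV" using subspace_scale[OF T] by auto
    then show "Q T" unfolding Q_def using prime_idealD(2) by (intro exI[of _ "{}"]) auto
  next
    fix M a p
    assume M: "T \<subseteq> M" and p: "prime_ideal p" "p = {r. scale r a \<in> M}" and "Q M"
    then obtain F where F: "finite F" "\<forall>p\<in>F. prime_ideal p \<and> ann scale UNIV T \<subseteq> p"
      "\<And>p. prime_ideal p \<Longrightarrow> {r. \<forall>a\<in>M. scale r a \<in> T} \<subseteq> p \<Longrightarrow> \<exists>p'\<in>F. p' \<subseteq> p" unfolding Q_def by blast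
    have "ann scale UNIV T \<subseteq> p" using M p(2) by (auto simp: ann_def)
    moreover have "\<exists>p'\<in>insert p F. p' \<subseteq> q"
      if q: "prime_ideal q" "{r. \<forall>b\<in>M \<oplus> range (\<lambda>r. scale r a). scale r b \<in> T} \<subseteq> q" for q
    proof (rule ccontr)
      assume contra: "\<not> ?thesis"
      then obtain s where s: "s \<in> p" "s \<notin> q" by blast
      obtain r where r: "\<forall>b\<in>M. scale r b \<in> T" "r \<notin> q" using F(3)[OF q(1)] contra by blast
      have "scale (r * s) b \<in> T" if "b \<in> M \<oplus> range (\<lambda>r. scale r a)" for b
      proof -
        obtain m t where b: "m \<in> M" "b = m + scale t a" using \<open>b \<in> _\<close> by (auto elim!: sum_setsE)
        have "scale (r * s) b = scale s (scale r m) + scale t (scale r (scale s a))"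
          using b(2) by (simp add: scale_right_distrib mult_ac)
        moreover have "scale r m \<in> T" "scale r (scale s a) \<in> T" using r(1) b(1) s(1) p(2) by auto
        ultimately show ?thesis by (simp only: subspace_add[OF T] subspace_scale[OF T])
      qed
      then have "r * s \<in> q" using q(2) by blast
      then show False using prime_idealD(3)[OF q(1)] r s by blast
    qed
    ultimately show "Q (M \<oplus> range (\<lambda>r. scale r a))"
      unfolding Q_def using F(1,2) p(1) by (intro exI[of _ "insert p F"]) blast
  qed
  then obtain F where F: "finite F" "\<forall>p\<in>F. prime_ideal p \<and> ann scale UNIV T \<subseteq> p"
    "\<And>p. prime_ideal p \<Longrightarrow> ann scale UNIV T \<subseteq> p \<Longrightarrow> \<exists>p'\<in>F. p' \<subseteq> p"
    unfolding Q_def ann_def by blast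
  have "{p. minimal_prime_over (ann scale UNIV T) p} \<subseteq> F"
  proof
    fix p assume p: "p \<in> {p. minimal_prime_over (ann scale UNIV T) p}"
    then obtain p' where "p' \<in> F" "p' \<subseteq> p" using F(3) unfolding minimal_prime_over_def by blast
    moreover from this have "p' = p" using p F(2) unfolding minimal_prime_over_def by blast
    ultimately show "p \<in> F" by simp
  qed
  then show ?thesis using F(1) by (rule finite_subset)
qed

section \<open>Mixed multiplicities\<close>

definition join_exp :: "nat \<Rightarrow> (nat \<Rightarrow> nat) \<Rightarrow> nat \<Rightarrow> nat" where
  "join_exp n0 n = (\<lambda>i. if i = 0 then n0 else n i)"

lemma join_exp_cancel: "join_exp (\<alpha> 0) (\<alpha>(0 := 0)) = \<alpha>"
  by (auto simp: join_exp_def)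

lemma monomial_join: "monomial d (join_exp a0 a) (join_exp n0 n) = real n0 ^ a0 * (\<Prod>i=1..d. real (n i) ^ a i)"
proof -
  have "{..d} - {0} = {1..d}" by auto
  then have "monomial d (join_exp a0 a) (join_exp n0 n)
      = real n0 ^ a0 * (\<Prod>i\<in>{1..d}. real (join_exp n0 n i) ^ join_exp a0 a i)"
    unfolding monomial_def by (subst prod.remove[of _ 0]) (auto simp: join_exp_def)
  also have "(\<Prod>i\<in>{1..d}. real (join_exp n0 n i) ^ join_exp a0 a i) = (\<Prod>i\<in>{1..d}. real (n i) ^ a i)"
    by (rule prod.cong) (auto simp: join_exp_def)
  finally show ?thesis .
qed

lemma tdeg_join: "tdeg d (join_exp a0 a) = a0 + (\<Sum>i=1..d. a i)"
proof -
  have "{..d} - {0} = {1..d}" by auto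
  then have "tdeg d (join_exp a0 a) = a0 + (\<Sum>i\<in>{1..d}. join_exp a0 a i)"
    unfolding tdeg_def by (subst sum.remove[of _ 0]) (auto simp: join_exp_def)
  also have "(\<Sum>i\<in>{1..d}. join_exp a0 a i) = (\<Sum>i\<in>{1..d}. a i)"
    by (rule sum.cong) (auto simp: join_exp_def)
  finally show ?thesis .
qed

lemma poly_monos_iff: "(a0, a) \<in> poly_monos d q \<longleftrightarrow> (\<forall>i. i \<notin> {1..d} \<longrightarrow> a i = 0) \<and> tdeg d (join_exp a0 a) < q"
  unfolding poly_monos_def mono_exps_def tdeg_join by auto

lemma finite_poly_monos: "finite (poly_monos d q)"
proof -
  let ?F = "{f :: nat \<Rightarrow> nat. \<forall>i. (i \<in> {1..d} \<longrightarrow> f i \<in> {..q}) \<and> (i \<notin> {1..d} \<longrightarrow> f i = 0)}"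
  have "poly_monos d q \<subseteq> {..q} \<times> ?F"
  proof
    fix x assume x: "x \<in> poly_monos d q"
    obtain a0 a where [simp]: "x = (a0, a)" by fastforce
    have a: "\<forall>i. i \<notin> {1..d} \<longrightarrow> a i = 0" "a0 + (\<Sum>i=1..d. a i) < q"
      using x by (auto simp: poly_monos_iff tdeg_join)
    have "a i \<le> q" if "i \<in> {1..d}" for i
      using a(2) member_le_sum[of i "{1..d}" a] that by fastforce
    then show "x \<in> {..q} \<times> ?F" using a by auto
  qed
  moreover have "finite ?F" by (rule finite_set_of_finite_funs) auto
  ultimately show ?thesis by (meson finite_SigmaI finite_atMost finite_subset)
qed

text \<open>Passage from a pair (n0, n), where \<open>n\<close> is indexed from 1, to a single
  multi-index carrying n0 at position 0. The condition that \<open>a i = 0\<close> outside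
  \<open>{1..d}\<close> makes it injective on monomials.\<close>

lemma eval_mpoly_peval:
  assumes c: "\<And>\<alpha>. \<alpha> \<notin> poly_monos d q \<Longrightarrow> c \<alpha> = 0"
  defines "c' \<equiv> \<lambda>\<alpha>. c (\<alpha> 0, \<alpha>(0 := 0))"
  shows "poly_coeffs d c'" "deg_less d c' q" "eval_mpoly d q c n0 n = peval d c' (join_exp n0 n)"
proof -
  let ?J = "\<lambda>(a0, a). join_exp a0 a"
  have mem: "(\<alpha> 0, \<alpha>(0 := 0)) \<in> poly_monos d q" if "c' \<alpha> \<noteq> 0" for \<alpha>
    using that c unfolding c'_def by blast
  have sub: "{\<alpha>. c' \<alpha> \<noteq> 0} \<subseteq> ?J ` poly_monos d q"
  proof
    fix \<alpha> assume "\<alpha> \<in> {\<alpha>. c' \<alpha> \<noteq> 0}"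
    then have "(\<alpha> 0, \<alpha>(0 := 0)) \<in> poly_monos d q" using mem by simp
    then show "\<alpha> \<in> ?J ` poly_monos d q" by (rule rev_image_eqI) (simp add: join_exp_cancel)
  qed
  have fin: "finite (?J ` poly_monos d q)" by (intro finite_imageI finite_poly_monos)
  show "poly_coeffs d c'" unfolding poly_coeffs_def
  proof (intro conjI allI impI)
    show "finite {\<alpha>. c' \<alpha> \<noteq> 0}" by (rule finite_subset[OF sub fin])
    fix \<alpha> i assume "c' \<alpha> \<noteq> 0" "d < i"
    then have "(\<alpha>(0 := 0)) i = 0" using mem[of \<alpha>] unfolding poly_monos_iff by (metis atLeastAtMost_iff linorder_not_le)
    then show "\<alpha> i = 0" using \<open>d < i\<close> by simp
  qed
  show "deg_less d c' q" unfolding deg_less_def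
    using mem unfolding poly_monos_iff by (simp add: join_exp_cancel)
  have inj: "inj_on ?J (poly_monos d q)"
  proof (rule inj_onI)
    fix x y assume x: "x \<in> poly_monos d q" and y: "y \<in> poly_monos d q" and xy: "?J x = ?J y"
    obtain a0 a b0 b where [simp]: "x = (a0, a)" "y = (b0, b)" by fastforce
    have "a i = b i" for i
      using fun_cong[OF xy, of i] x y by (cases "i = 0") (auto simp: join_exp_def poly_monos_iff)
    moreover have "a0 = b0" using fun_cong[OF xy, of 0] by (simp add: join_exp_def)
    ultimately show "x = y" by auto
  qed
  have "peval d c' (join_exp n0 n) = (\<Sum>\<alpha>\<in>?J ` poly_monos d q. c' \<alpha> * monomial d \<alpha> (join_exp n0 n))"
    using sub by (intro peval_superset fin) auto
  also have "\<dots> = (\<Sum>x\<in>poly_monos d q. c' (?J x) * monomial d (?J x) (join_exp n0 n))"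
    by (rule sum.reindex_cong[OF inj]) auto
  also have "\<dots> = eval_mpoly d q c n0 n"
    unfolding eval_mpoly_def
  proof (rule sum.cong[OF refl])
    fix x assume x: "x \<in> poly_monos d q"
    obtain a0 a where [simp]: "x = (a0, a)" by fastforce
    have "a 0 = 0" using x by (auto simp: poly_monos_iff)
    then have "c' (?J x) = c x" by (auto simp: c'_def join_exp_def intro!: arg_cong[of _ _ c])
    then show "c' (?J x) * monomial d (?J x) (join_exp n0 n)
        = c x * real n0 ^ fst x * (\<Prod>i=1..d. real (n i) ^ snd x i)"
      by (simp add: monomial_join)
  qed
  finally show "eval_mpoly d q c n0 n = peval d c' (join_exp n0 n)" by simp
qed

lemma ideal_pow_idl: "ideal_pow (idl_set K) m = idl_set (K ^ m)"
  by (induction m) (simp_all add: idl_set_one idl_set_mult mult.commute[of K])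

lemma ideal_prod_upto_idl: "\<forall>i\<in>{1..m}. A i = idl_set (B i) \<Longrightarrow> ideal_prod_upto A m = idl_set (\<Prod>i\<in>{1..m}. B i)"
proof (induction m)
  case (Suc m)
  have "ideal_prod_upto A m = idl_set (\<Prod>i\<in>{1..m}. B i)" using Suc by auto
  then show ?case using Suc.prems by (simp add: idl_set_mult mult.commute[of "B (Suc m)"])
qed (simp add: idl_set_one)

context local_family
begin

lemma mpow_join: "mpow I d (join_exp n0 n) = I 0 ^ n0 * (\<Prod>i\<in>{1..d}. I i ^ n i)"
proof -
  have "{..d} - {0} = {1..d}" by auto
  then have "mpow I d (join_exp n0 n) = I 0 ^ n0 * (\<Prod>i\<in>{1..d}. I i ^ join_exp n0 n i)"
    unfolding mpow_def by (subst prod.remove[of _ 0]) (auto simp: join_exp_def)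
  also have "(\<Prod>i\<in>{1..d}. I i ^ join_exp n0 n i) = (\<Prod>i\<in>{1..d}. I i ^ n i)"
    by (rule prod.cong) (auto simp: join_exp_def)
  finally show ?thesis .
qed

context
  fixes Is :: "nat \<Rightarrow> 'a set"
  assumes Is: "\<forall>i\<in>{1..d}. Is i = idl_set (I i)"
begin

lemma hilb_eq: "hilb scale A B (idl_set (I 0)) Is d n0 n =
    mod_length scale (rees A (join_exp n0 n) \<oplus> B) (rees A (join_exp n0 n + unit_exp 0) \<oplus> B)"
proof -
  have "ideal_mult (ideal_pow (idl_set (I 0)) m) (multi_pow Is d n) = idl_set (mpow I d (join_exp m n))" for m
  proof -
    have "multi_pow Is d n = idl_set (\<Prod>i\<in>{1..d}. I i ^ n i)"
      unfolding multi_pow_def by (rule ideal_prod_upto_idl) (use Is in \<open>auto simp: ideal_pow_idl\<close>)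
    then show ?thesis by (simp only: mpow_join ideal_pow_idl idl_set_mult)
  qed
  moreover have "join_exp (Suc n0) n = join_exp n0 n + unit_exp 0"
    by (auto simp: join_exp_def unit_exp_def plus_fun_apply fun_eq_iff)
  ultimately show ?thesis by (simp only: hilb_def rees_def act_def)
qed

text \<open>The description in \<open>mixed_mult\<close> admits only monomials of degree below
  \<open>q_L\<close>, so \<open>deg\<close> provides existence; uniqueness is that of the
  coefficients of an eventual polynomial.\<close>

lemma mixed_mult_eq:
  assumes B: "subspace B" and c: "eventually_poly d (hilbert_fun (\<lambda>n. rees A n \<oplus> B)) c"
    and deg: "deg_less d c (q_L scale A B Is d)"
  shows "mixed_mult scale A B (idl_set (I 0)) Is d k0 k
    = c (join_exp k0 (\<lambda>i. if i \<in> {1..d} then k i else 0)) * fact k0 * (\<Prod>i=1..d. fact (k i))"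
proof -
  define q where "q = q_L scale A B Is d"
  define H where "H = hilbert_fun (\<lambda>n. rees A n \<oplus> B)"
  let ?hilb = "hilb scale A B (idl_set (I 0)) Is d"
  have Hh: "real (the_enat (?hilb n0 n)) = H (join_exp n0 n)" for n0 n
    unfolding hilb_eq H_def hilbert_fun_def rlength_def ..
  have fin: "?hilb n0 n \<noteq> \<infinity>" for n0 n
    unfolding hilb_eq using filtered_finite_length[OF filtered_sum[OF filtered_rees B], of A "join_exp n0 n" "Suc 0"]
    by (simp only: first_exp_1 not_False_eq_True)
  define k' where "k' = (\<lambda>i. if i \<in> {1..d} then k i else 0)"
  define F where "F = fact k0 * (\<Prod>i=1..d. fact (k i) :: real)"
  define good where "good b \<longleftrightarrow> (\<forall>\<alpha>. \<alpha> \<notin> poly_monos d q \<longrightarrow> b \<alpha> = 0) \<and>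
      (\<exists>M. \<forall>n0 n. M \<le> n0 \<and> (\<forall>i\<in>{1..d}. M \<le> n i) \<longrightarrow> ?hilb n0 n \<noteq> \<infinity> \<and>
        real (the_enat (?hilb n0 n)) = eval_mpoly d q b n0 n)" for b
  have mm: "mixed_mult scale A B (idl_set (I 0)) Is d k0 k = (THE e. \<exists>b. good b \<and> e = b (k0, k') * F)"
    unfolding mixed_mult_def good_def F_def k'_def q_def by (simp only: conj_assoc mult.assoc)
  have uniq: "b (k0, k') = c (join_exp k0 k')" if b: "good b" for b
  proof -
    define b' where "b' = (\<lambda>\<alpha>. b (\<alpha> 0, \<alpha>(0 := 0)))"
    have z: "\<And>\<alpha>. \<alpha> \<notin> poly_monos d q \<Longrightarrow> b \<alpha> = 0" using b unfolding good_def by blast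
    have bp: "poly_coeffs d b'" unfolding b'_def by (rule eval_mpoly_peval(1)[OF z])
    obtain M where M': "\<forall>n0 n. M \<le> n0 \<and> (\<forall>i\<in>{1..d}. M \<le> n i) \<longrightarrow> ?hilb n0 n \<noteq> \<infinity> \<and>
        real (the_enat (?hilb n0 n)) = eval_mpoly d q b n0 n"
      using b unfolding good_def by (elim conjE exE)
    have M: "H (join_exp n0 n) = peval d b' (join_exp n0 n)" if "M \<le> n0" "\<forall>i\<in>{1..d}. M \<le> n i" for n0 n
    proof -
      have "H (join_exp n0 n) = eval_mpoly d q b n0 n" using M' that unfolding Hh[symmetric] by simp
      also have "\<dots> = peval d b' (join_exp n0 n)" unfolding b'_def by (rule eval_mpoly_peval(3)[OF z])
      finally show ?thesis .
    qed
    have "H n = peval d b' n" if "\<forall>i\<le>d. M \<le> n i" for n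
      using M[of "n 0" "n(0 := 0)"] that by (simp add: join_exp_cancel)
    then have "eventually_poly d H b'" unfolding eventually_poly_def using bp by blast
    then have "b' = c" using c unfolding H_def by (rule eventually_poly_unique)
    moreover have "b' (join_exp k0 k') = b (k0, k')"
      unfolding b'_def by (rule arg_cong[of _ _ b]) (auto simp: join_exp_def k'_def)
    ultimately show ?thesis by simp
  qed
  have "\<exists>b. good b"
  proof -
    \<comment> \<open>\<open>join_exp\<close> overwrites position 0 of \<open>a\<close>, so pairs
      with \<open>a 0 \<noteq> 0\<close> must get the value 0 to avoid counting a monomial
      repeatedly.\<close>
    define b where "b = (\<lambda>(a0, a). if a 0 = 0 then c (join_exp a0 a) else 0)"
    have pc: "poly_coeffs d c" using c by (simp add: eventually_poly_def)
    have z: "b \<alpha> = 0" if \<alpha>: "\<alpha> \<notin> poly_monos d q" for \<alpha>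
    proof (rule ccontr)
      obtain a0 a where [simp]: "\<alpha> = (a0, a)" by fastforce
      assume "b \<alpha> \<noteq> 0"
      then have a: "a 0 = 0" "c (join_exp a0 a) \<noteq> 0" by (auto simp: b_def split: if_splits)
      have "a i = 0" if "i \<notin> {1..d}" for i
        using a pc that unfolding poly_coeffs_def by (cases "i = 0") (auto simp: join_exp_def)
      moreover have "tdeg d (join_exp a0 a) < q" using deg a(2) by (simp add: deg_less_def q_def)
      ultimately show False using \<alpha> by (simp add: poly_monos_iff)
    qed
    have bc: "(\<lambda>\<alpha>. b (\<alpha> 0, \<alpha>(0 := 0))) = c" by (simp add: b_def join_exp_cancel)
    have ev: "eval_mpoly d q b n0 n = peval d c (join_exp n0 n)" for n0 n
      using eval_mpoly_peval(3)[of d q b, OF z] unfolding bc by blast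
    obtain M where M: "\<And>n. (\<forall>i\<le>d. M \<le> n i) \<Longrightarrow> H n = peval d c n"
      using c unfolding eventually_poly_def H_def by blast
    have "H (join_exp n0 n) = peval d c (join_exp n0 n)" if "M \<le> n0" "\<forall>i\<in>{1..d}. M \<le> n i" for n0 n
      using that by (intro M) (auto simp: join_exp_def)
    then have "good b" unfolding good_def Hh ev using z fin by blast
    then show ?thesis by blast
  qed
  then obtain b where b: "good b" by blast
  have "(THE e. \<exists>b. good b \<and> e = b (k0, k') * F) = c (join_exp k0 k') * F"
  proof (rule the_equality)
    show "\<exists>b. good b \<and> c (join_exp k0 k') * F = b (k0, k') * F" using b uniq[OF b] by auto
    show "e = c (join_exp k0 k') * F" if "\<exists>b. good b \<and> e = b (k0, k') * F" for e
      using that uniq by auto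
  qed
  then show ?thesis unfolding mm by (simp only: k'_def F_def mult.assoc)
qed

end

end

section \<open>Counting prime factors in a filtration of N\<close>

context local_family
begin

interpretation R: local_family "(*)" I d \<nn>
  by (rule ring_local_family)

definition prod_ideal :: "'a idl" where
  "prod_ideal = (\<Prod>i\<in>{1..d}. I i)"

lemma prod_ideal_power: "prod_ideal ^ m = mpow I d (join_exp 0 (\<lambda>_. m))"
  unfolding mpow_join prod_ideal_def by (induction m) (simp_all add: prod.distrib)

lemma idl_power_antimono: "m \<le> l \<Longrightarrow> idl_set (K ^ l) \<subseteq> idl_set (K ^ m)"
proof -
  assume "m \<le> l"
  then have "K ^ l = K ^ m * K ^ (l - m)" by (simp flip: power_add)
  then show ?thesis unfolding ring_act_UNIV[symmetric] by (simp add: ring.act_mult) (rule ring.act_mono, simp)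
qed

definition torsion :: "'b set" where
  "torsion = colon_inf scale (idl_set prod_ideal) UNIV {0}"

lemma torsion_iff: "a \<in> torsion \<longleftrightarrow> (\<exists>m. \<forall>r\<in>idl_set (prod_ideal ^ m). scale r a = 0)"
  unfolding torsion_def colon_inf_def ideal_pow_idl by simp

lemma subspace_torsion: "subspace torsion"
proof (rule subspaceI)
  show "0 \<in> torsion" unfolding torsion_iff by simp
  fix x y assume "x \<in> torsion" "y \<in> torsion"
  then obtain m l where ml: "\<forall>r\<in>idl_set (prod_ideal ^ m). scale r x = 0" "\<forall>r\<in>idl_set (prod_ideal ^ l). scale r y = 0"
    unfolding torsion_iff by blast
  have "\<forall>r\<in>idl_set (prod_ideal ^ max m l). scale r (x + y) = 0"
    using ml idl_power_antimono[of m "max m l" prod_ideal] idl_power_antimono[of l "max m l" prod_ideal]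
    by (auto simp: scale_right_distrib subset_iff)
  then show "x + y \<in> torsion" unfolding torsion_iff by blast
next
  fix c x assume "x \<in> torsion"
  then obtain m where "\<forall>r\<in>idl_set (prod_ideal ^ m). scale r x = 0" unfolding torsion_iff by blast
  then have "\<forall>r\<in>idl_set (prod_ideal ^ m). scale r (scale c x) = 0"
    by (simp add: scale_left_commute[of _ c] del: scale_scale)
  then show "scale c x \<in> torsion" unfolding torsion_iff by blast
qed

text \<open>The torsion is finitely generated, so the sum of the exponents killing the generators
  kills all of it.\<close>

lemma torsion_killed: "\<exists>m. act (mpow I d m) torsion \<subseteq> {0}"
proof -
  obtain G where G: "finite G" "G \<subseteq> torsion" "span G = torsion" using finite_generators[OF subspace_torsion] by blast
  have "\<forall>g\<in>G. \<exists>m. \<forall>r\<in>idl_set (prod_ideal ^ m). scale r g = 0" using G(2) torsion_iff by blast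
  then obtain m where m: "\<And>g r. g \<in> G \<Longrightarrow> r \<in> idl_set (prod_ideal ^ m g) \<Longrightarrow> scale r g = 0" by metis
  define M where "M = (\<Sum>g\<in>G. m g)"
  have "act (prod_ideal ^ M) torsion \<subseteq> {0}"
  proof (rule act_leI)
    fix r a assume r: "r \<in> idl_set (prod_ideal ^ M)" and a: "a \<in> torsion"
    have "span G \<subseteq> {a. scale r a = 0}"
    proof (rule span_minimal)
      have "m g \<le> M" if "g \<in> G" for g unfolding M_def using G(1) that by (intro member_le_sum) auto
      then show "G \<subseteq> {a. scale r a = 0}" using m r idl_power_antimono by blast
      show "subspace {a. scale r a = 0}"
      proof (rule subspaceI)
        show "scale c x \<in> {a. scale r a = 0}" if "x \<in> {a. scale r a = 0}" for c x
          using that scale_left_commute[of r c x] by (simp del: scale_scale)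
      qed (auto simp: scale_right_distrib)
    qed
    then show "scale r a \<in> {0}" using a G(3) by auto
  qed simp
  then show ?thesis unfolding prod_ideal_power by blast
qed

abbreviation quot_ann :: "'a set" where
  "quot_ann \<equiv> ann scale UNIV torsion"

lemma growth_rees:
  assumes "subspace L" "krull_dim_above quot_ann \<le> enat k" shows "growth k (rees L)"
proof -
  obtain m where "act (mpow I d m) torsion \<subseteq> {0}" using torsion_killed by blast
  then show ?thesis
    by (rule growth_torsion[OF assms(1) subspace_torsion _ _ assms(2)]) (simp add: ann_def)
qed

definition hilbert_prime :: "'a set \<Rightarrow> (nat \<Rightarrow> nat) \<Rightarrow> real" where
  "hilbert_prime p = R.hilbert_fun (\<lambda>n. R.rees UNIV n \<oplus> p)"

lemma hilbert_fun_cyclic: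
  assumes M: "subspace M"
  shows "hilbert_fun (\<lambda>n. rees (M \<oplus> range (\<lambda>r. scale r a)) n \<oplus> M) n = hilbert_prime {r. scale r a \<in> M} n"
proof -
  interpret h: module_hom "(*)" scale "\<lambda>r. scale r a" by (rule module_hom_orbit)
  have eq: "rees (M \<oplus> range (\<lambda>r. scale r a)) n \<oplus> M = (\<lambda>r. scale r a) ` idl_set (mpow I d n) \<oplus> M" for n
  proof -
    have "act (mpow I d n) (range (\<lambda>r. scale r a)) = (\<lambda>r. scale r a) ` idl_set (mpow I d n)"
      using h.act_image[of UNIV "mpow I d n"] by (simp add: ring_act_UNIV)
    then have "rees (M \<oplus> range (\<lambda>r. scale r a)) n \<oplus> M
        = (act (mpow I d n) M \<oplus> M) \<oplus> (\<lambda>r. scale r a) ` idl_set (mpow I d n)"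
      unfolding rees_def act_sum[OF M subspace_range_scale]
      by (simp only: sum_sets_assoc sum_sets_commute[of M])
    also have "act (mpow I d n) M \<oplus> M = M" by (intro sum_sets_absorb1 act_subset M subspace_act)
    finally show ?thesis by (simp only: sum_sets_commute)
  qed
  have R: "R.rees UNIV n = idl_set (mpow I d n)" for n
    unfolding R.rees_def by (rule ring_act_UNIV)
  have sub: "idl_set (mpow I d (n + unit_exp 0)) \<subseteq> idl_set (mpow I d n)"
    unfolding R[symmetric] R.rees_Suc[OF le0] by (rule ring.act_subset) simp
  show ?thesis
    unfolding hilbert_prime_def hilbert_fun_def R.hilbert_fun_def R eq rlength_def
    unfolding mod_length_cyclic[OF M subspace_idl_set subspace_idl_set sub] ..
qed

text \<open>The two kinds of primes that can occur as factors: those containing I, with zero Hilbert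
  polynomial, and those over the annihilator of N modulo torsion, with dimension at most that of N
  modulo torsion.\<close>

definition relevant :: "'a set \<Rightarrow> bool" where
  "relevant p \<longleftrightarrow> prime_ideal p \<and> (idl_set prod_ideal \<subseteq> p \<or> quot_ann \<subseteq> p)"

lemma relevant_conductor:
  assumes M: "subspace M" and p: "prime_ideal p" "p = {r. scale r a \<in> M}"
  shows "relevant p"
proof -
  have "quot_ann \<subseteq> p" if "\<not> idl_set prod_ideal \<subseteq> p"
  proof
    fix r assume "r \<in> quot_ann"
    then have "scale r a \<in> torsion" by (simp add: ann_def)
    then obtain m where m: "\<forall>s\<in>idl_set (prod_ideal ^ m). scale s (scale r a) = 0" unfolding torsion_iff by blast
    obtain y where y: "y \<in> idl_set prod_ideal" "y \<notin> p" using \<open>\<not> _\<close> by blast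
    have "scale (y ^ m * r) a = 0" using m power_mem_idl[OF y(1)] by simp
    then have "y ^ m * r \<in> p" using p(2) subspace_0[OF M] by simp
    then show "r \<in> p" using prime_idealD(3)[OF p(1)] prime_ideal_power[OF p(1)] y(2) by blast
  qed
  then show ?thesis using p(1) by (auto simp: relevant_def)
qed

text \<open>One list of primes serves two purposes: its Hilbert functions add up to that of N modulo
  lower degree, and its multiplicities are the local lengths. The factors are kept as a list because
  a prime may occur repeatedly.\<close>

lemma hilbert_devissage:
  assumes k: "krull_dim_above quot_ann \<le> enat (Suc k)"
  shows "\<exists>ps. (\<forall>p\<in>set ps. relevant p) \<and>
    (\<exists>c. eventually_poly d (\<lambda>n. hilbert_fun (rees UNIV) n - (\<Sum>p\<leftarrow>ps. hilbert_prime p n)) c \<and> deg_less d c k) \<and>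
    (\<forall>p. minimal_prime_over quot_ann p \<longrightarrow> \<not> idl_set prod_ideal \<subseteq> p \<longrightarrow>
      loc_length scale p UNIV {0} = enat (count_list ps p))"
proof -
  define Q where "Q M \<longleftrightarrow> (\<exists>ps. (\<forall>p\<in>set ps. relevant p) \<and>
    (\<exists>c. eventually_poly d (\<lambda>n. hilbert_fun (rees M) n - (\<Sum>p\<leftarrow>ps. hilbert_prime p n)) c \<and> deg_less d c k) \<and>
    (\<forall>p. minimal_prime_over quot_ann p \<longrightarrow> \<not> idl_set prod_ideal \<subseteq> p \<longrightarrow>
      sat_length scale (- p) (saturation scale (- p) M) (saturation scale (- p) {0}) = enat (count_list ps p)))" for M
  have "Q UNIV"
  proof (rule prime_devissage[OF noeth_ring subspace_UNIV subspace_single_0 subset_UNIV])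
    have "rees {0} n = {0}" for n
      using rees_subset[OF subspace_single_0, of n] subspace_0[OF subspace_rees[of "{0}" n]] by blast
    then have "eventually_poly d (\<lambda>n. hilbert_fun (rees {0}) n - (\<Sum>p\<leftarrow>[]. hilbert_prime p n)) (\<lambda>_. 0)"
      by (simp add: eventually_poly_def hilbert_fun_def)
    moreover have "sat_length scale (- p) (saturation scale (- p) {0}) (saturation scale (- p) {0}) = enat (count_list [] p)" for p
      unfolding sat_length_def using chain_len_unique[of "\<lambda>X. subspace X \<and> saturated scale (- p) X \<and> saturation scale (- p) {0} \<subseteq> X \<and> X \<subseteq> saturation scale (- p) {0}"]
      by (auto simp: zero_enat_def)
    ultimately show "Q {0}"
      unfolding Q_def by (intro exI[of _ "[]"]) (auto simp: deg_less_def)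
  next
    fix M a p
    assume M: "subspace M" and p: "prime_ideal p" "p = {r. scale r a \<in> M}" and "Q M"
    then obtain ps c where ps: "\<forall>p\<in>set ps. relevant p"
      and c: "eventually_poly d (\<lambda>n. hilbert_fun (rees M) n - (\<Sum>p\<leftarrow>ps. hilbert_prime p n)) c" "deg_less d c k"
      and len: "\<And>p. minimal_prime_over quot_ann p \<Longrightarrow> \<not> idl_set prod_ideal \<subseteq> p \<Longrightarrow>
        sat_length scale (- p) (saturation scale (- p) M) (saturation scale (- p) {0}) = enat (count_list ps p)"
      unfolding Q_def by blast
    define M' where "M' = M \<oplus> range (\<lambda>r. scale r a)"
    have M': "subspace M'" unfolding M'_def by (intro subspace_sum_sets M subspace_range_scale)
    have MM': "M \<subseteq> M'" unfolding M'_def by (rule sum_sets_upper1[OF subspace_range_scale])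
    have rel: "relevant p" by (rule relevant_conductor[OF M p])
    obtain e where e: "eventually_poly d
      (\<lambda>n. hilbert_fun (rees M') n - (hilbert_fun (rees M) n + hilbert_fun (\<lambda>n. rees M' n \<oplus> M) n)) e" "deg_less d e k"
      using hilbert_fun_additive[OF M' M MM' growth_rees[OF M' k] growth_rees[OF M k]] by blast
    have "hilbert_fun (\<lambda>n. rees M' n \<oplus> M) n = hilbert_prime p n" for n
      unfolding M'_def p(2) by (rule hilbert_fun_cyclic[OF M])
    then have sum_eq: "(hilbert_fun (rees M') n - (hilbert_fun (rees M) n + hilbert_fun (\<lambda>n. rees M' n \<oplus> M) n))
        + (hilbert_fun (rees M) n - (\<Sum>p\<leftarrow>ps. hilbert_prime p n))
        = hilbert_fun (rees M') n - (\<Sum>p\<leftarrow>p # ps. hilbert_prime p n)" for n by simp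
    have "eventually_poly d (\<lambda>n. hilbert_fun (rees M') n - (\<Sum>p\<leftarrow>p # ps. hilbert_prime p n)) (\<lambda>\<alpha>. e \<alpha> + c \<alpha>)"
      using eventually_poly_add[OF e(1) c(1)] by (simp only: sum_eq)
    moreover have "deg_less d (\<lambda>\<alpha>. e \<alpha> + c \<alpha>) k" by (rule deg_less_add[OF e(2) c(2)])
    moreover have "sat_length scale (- p0) (saturation scale (- p0) M') (saturation scale (- p0) {0})
        = enat (count_list (p # ps) p0)"
      if p0: "minimal_prime_over quot_ann p0" "\<not> idl_set prod_ideal \<subseteq> p0" for p0
    proof -
      have p0': "prime_ideal p0" using p0(1) by (simp add: minimal_prime_over_def)
      have S: "mult_closed (- p0)" by (rule mult_closed_Compl_prime[OF p0'])
      \<comment> \<open>A prime inside \<open>p0\<close> cannot contain I, so being relevant it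
        contains \<open>quot_ann\<close>, and minimality of \<open>p0\<close> applies.\<close>
      have "p = p0" if "p \<subseteq> p0"
      proof -
        have "quot_ann \<subseteq> p" using rel that p0(2) by (auto simp: relevant_def)
        then show ?thesis using p0(1) p(1) that unfolding minimal_prime_over_def by blast
      qed
      note cyc = sat_length_cyclic[OF M p(1) p0' this p(2)]
      have "sat_length scale (- p0) (saturation scale (- p0) M') (saturation scale (- p0) {0})
        = sat_length scale (- p0) (saturation scale (- p0) M') (saturation scale (- p0) M)
          + sat_length scale (- p0) (saturation scale (- p0) M) (saturation scale (- p0) {0})"
        using subspace_0[OF M]
        by (intro sat_length_add S subspace_saturation saturated_saturation saturation_mono MM' M M' subspace_single_0) auto
      also have "\<dots> = (if p = p0 then 1 else 0) + enat (count_list ps p0)"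
        using cyc len[OF p0] by (simp add: M'_def)
      also have "\<dots> = enat (count_list (p # ps) p0)" by (simp add: one_enat_def zero_enat_def)
      finally show ?thesis .
    qed
    ultimately have "Q M'" unfolding Q_def using ps rel by (intro exI[of _ "p # ps"]) auto
    then show "Q (M \<oplus> range (\<lambda>r. scale r a))" by (simp only: M'_def)
  qed
  then obtain ps where ps: "(\<forall>p\<in>set ps. relevant p) \<and>
    (\<exists>c. eventually_poly d (\<lambda>n. hilbert_fun (rees UNIV) n - (\<Sum>p\<leftarrow>ps. hilbert_prime p n)) c \<and> deg_less d c k) \<and>
    (\<forall>p. minimal_prime_over quot_ann p \<longrightarrow> \<not> idl_set prod_ideal \<subseteq> p \<longrightarrow>
      sat_length scale (- p) (saturation scale (- p) UNIV) (saturation scale (- p) {0}) = enat (count_list ps p))"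
    unfolding Q_def ..
  note len = ps[THEN conjunct2, THEN conjunct2]
  have "loc_length scale p UNIV {0} = sat_length scale (- p) (saturation scale (- p) UNIV) (saturation scale (- p) {0})"
    if "minimal_prime_over quot_ann p" for p
  proof -
    have p: "prime_ideal p" using that by (simp add: minimal_prime_over_def)
    have "1 \<in> - p" using prime_idealD(2)[OF p] by simp
    then show ?thesis by (simp only: loc_length_eq_sat_length[OF p] saturation_UNIV)
  qed
  then have "\<forall>p. minimal_prime_over quot_ann p \<longrightarrow> \<not> idl_set prod_ideal \<subseteq> p \<longrightarrow>
      loc_length scale p UNIV {0} = enat (count_list ps p)"
    using len by simp
  with ps[THEN conjunct1] ps[THEN conjunct2, THEN conjunct1] show ?thesis by (intro exI[of _ ps] conjI)
qed

lemma hilbert_prime_poly: "prime_ideal p \<Longrightarrow> \<exists>c. eventually_poly d (hilbert_prime p) c"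
  unfolding hilbert_prime_def by (intro R.hilbert_fun_quotient_poly ring.subspace_UNIV prime_idealD(1))

lemma hilbert_prime_deg:
  assumes p: "prime_ideal p" and k: "krull_dim_above p \<le> enat k" and c: "eventually_poly d (hilbert_prime p) c"
  shows "deg_less d c k"
proof (rule R.hilbert_fun_quotient_deg[OF ring.subspace_UNIV prime_idealD(1)[OF p] _ k c[unfolded hilbert_prime_def]])
  fix r a assume "r \<in> p"
  then have "a * r \<in> p" by (rule ring.subspace_scale[OF prime_idealD(1)[OF p]])
  then show "r * a \<in> p" by (simp only: mult.commute)
qed

text \<open>As soon as all exponents are positive, I^n lies in I and hence in p, so consecutive
  layers coincide modulo p.\<close>

lemma hilbert_prime_zero:
  assumes p: "prime_ideal p" and P: "idl_set prod_ideal \<subseteq> p" and c: "eventually_poly d (hilbert_prime p) c"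
  shows "c = (\<lambda>_. 0)"
proof -
  have "hilbert_prime p n = 0" if n: "\<forall>i\<le>d. 1 \<le> n i" for n
  proof -
    have "R.rees UNIV m \<oplus> p = p" if m: "\<forall>i\<le>d. 1 \<le> m i" for m
    proof (rule ring.sum_sets_absorb1[OF prime_idealD(1)[OF p]])
      \<comment> \<open>The exponent \<open>u\<close> is (0,1,...,1), whose power is I
        itself.\<close>
      define u l where "u = join_exp 0 (\<lambda>_. 1)" and "l = (\<lambda>i. m i - u i)"
      have "R.rees UNIV m = R.rees UNIV (l + u)"
        using m by (intro R.rees_cong) (auto simp: l_def u_def join_exp_def plus_fun_apply)
      also have "\<dots> \<subseteq> R.rees UNIV u" by (rule R.rees_antimono)
      also have "\<dots> = idl_set prod_ideal"
        unfolding R.rees_def ring_act_UNIV u_def prod_ideal_power[symmetric] by simp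
      finally show "R.rees UNIV m \<subseteq> p" using P by blast
    qed simp
    moreover have "\<forall>i\<le>d. 1 \<le> (n + unit_exp 0) i" using n by (simp add: plus_fun_apply trans_le_add1)
    ultimately show ?thesis using n unfolding hilbert_prime_def R.hilbert_fun_def by simp
  qed
  then have "eventually_poly d (hilbert_prime p) (\<lambda>_. 0)" unfolding eventually_poly_def by auto
  then show ?thesis by (rule eventually_poly_unique[OF c])
qed

theorem mixed_mult_associativity:
  assumes Is: "\<forall>i\<in>{1..d}. Is i = idl_set (I i)"
    and k_sum: "k0 + (\<Sum>i=1..d. k i) + 1 = the_enat (mod_dim scale UNIV torsion)"
  shows "mixed_mult scale UNIV {0} (idl_set (I 0)) Is d k0 k =
    (\<Sum>p\<in>{p. minimal_prime_over quot_ann p \<and> krull_dim_above p = mod_dim scale UNIV torsion}.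
       real (the_enat (loc_length scale p UNIV {0})) * mixed_mult (*) UNIV p (idl_set (I 0)) Is d k0 k)"
proof -
  \<comment> \<open>Here \<open>q\<close> is the total degree of the relevant coefficient, one less
    than the dimension of N modulo torsion.\<close>
  define q where "q = k0 + (\<Sum>i=1..d. k i)"
  define \<kappa> where "\<kappa> = join_exp k0 (\<lambda>i. if i \<in> {1..d} then k i else 0)"
  have tdeg_\<kappa>: "tdeg d \<kappa> = q" by (simp add: \<kappa>_def tdeg_join q_def)
  have dim_fin: "mod_dim scale UNIV torsion \<noteq> \<infinity>" unfolding mod_dim_def by (rule krull_dim_finite)
  then have dim: "mod_dim scale UNIV torsion = enat (Suc q)" using k_sum by (auto simp: q_def)
  have kd: "krull_dim_above quot_ann = enat (Suc q)" using dim by (simp add: mod_dim_def)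
  have Pset: "ideal_prod_upto Is d = idl_set prod_ideal"
    unfolding prod_ideal_def by (rule ideal_prod_upto_idl[OF Is])
  define F where "F = fact k0 * (\<Prod>i=1..d. fact (k i) :: real)"
  obtain cp where cp: "\<And>p. prime_ideal p \<Longrightarrow> eventually_poly d (hilbert_prime p) (cp p)"
    using hilbert_prime_poly by metis
  define \<Pi> where "\<Pi> = {p. minimal_prime_over quot_ann p \<and> krull_dim_above p = mod_dim scale UNIV torsion}"
  have fin: "finite \<Pi>"
    unfolding \<Pi>_def by (rule finite_subset[OF _ finite_minimal_primes[OF noeth_ring subspace_torsion]]) blast
  obtain ps e where ps: "\<forall>p\<in>set ps. relevant p"
    and e: "eventually_poly d (\<lambda>n. hilbert_fun (rees UNIV) n - (\<Sum>p\<leftarrow>ps. hilbert_prime p n)) e" "deg_less d e q"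
    and len: "\<And>p. minimal_prime_over quot_ann p \<Longrightarrow> \<not> idl_set prod_ideal \<subseteq> p \<Longrightarrow>
      loc_length scale p UNIV {0} = enat (count_list ps p)"
    using hilbert_devissage[of q] kd by auto
  have sum_poly: "eventually_poly d (\<lambda>n. \<Sum>p\<leftarrow>qs. hilbert_prime p n) (\<lambda>\<alpha>. \<Sum>p\<leftarrow>qs. cp p \<alpha>)"
    if "\<forall>p\<in>set qs. relevant p" for qs
    using that
  proof (induction qs)
    case Nil
    then show ?case by (simp add: eventually_poly_def)
  next
    case (Cons p qs)
    then show ?case using eventually_poly_add[OF cp] by (auto simp: relevant_def)
  qed
  obtain c where c: "eventually_poly d (hilbert_fun (rees UNIV)) c" using hilbert_fun_rees_poly[OF subspace_UNIV] by blast
  have "eventually_poly d (hilbert_fun (rees UNIV)) (\<lambda>\<alpha>. e \<alpha> + (\<Sum>p\<leftarrow>ps. cp p \<alpha>))"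
    using eventually_poly_add[OF e(1) sum_poly[OF ps]] by simp
  then have "c = (\<lambda>\<alpha>. e \<alpha> + (\<Sum>p\<leftarrow>ps. cp p \<alpha>))" by (rule eventually_poly_unique[OF c])
  moreover have "e \<kappa> = 0" using e(2) tdeg_\<kappa> unfolding deg_less_def by (metis less_irrefl)
  ultimately have c_\<kappa>: "c \<kappa> = (\<Sum>p\<leftarrow>ps. cp p \<kappa>)" by simp
  have "deg_less d c (Suc q)"
    by (rule growth_deg_less[OF filtered_rees growth_rees[OF subspace_UNIV] c]) (simp add: kd)
  moreover have "q_L scale UNIV {0} Is d = Suc q"
    unfolding q_L_def Pset torsion_def[symmetric] dim by simp
  ultimately have lhs: "mixed_mult scale UNIV {0} (idl_set (I 0)) Is d k0 k = c \<kappa> * F"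
    unfolding \<kappa>_def F_def using mixed_mult_eq[OF Is subspace_single_0, of UNIV c] c by (simp add: mult.assoc)
  \<comment> \<open>A factor outside \<Pi> either contains I or has dimension at most
    \<open>q\<close>; a relevant prime of full dimension is automatically minimal over
    \<open>quot_ann\<close>.\<close>
  have vanish: "cp p \<kappa> = 0" if p: "p \<in> set ps" "p \<notin> \<Pi>" for p
  proof (cases "idl_set prod_ideal \<subseteq> p")
    case True
    then show ?thesis using hilbert_prime_zero[OF _ True cp] ps p(1) by (simp add: relevant_def)
  next
    case False
    then have p': "prime_ideal p" "quot_ann \<subseteq> p" using ps p(1) by (auto simp: relevant_def)
    have le: "krull_dim_above p \<le> enat (Suc q)"
      unfolding kd[symmetric] krull_dim_above_def by (rule chain_len_mono) (use p' in auto)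
    have "krull_dim_above p \<noteq> enat (Suc q)"
    proof
      assume eq: "krull_dim_above p = enat (Suc q)"
      have "minimal_prime_over quot_ann p"
        unfolding minimal_prime_over_def
      proof (intro conjI allI impI p')
        fix p1 assume p1: "prime_ideal p1 \<and> quot_ann \<subseteq> p1 \<and> p1 \<subseteq> p"
        show "p1 = p"
        proof (rule ccontr)
          assume "p1 \<noteq> p"
          then obtain j where "Suc q = Suc j" "krull_dim_above p \<le> enat j"
            using krull_dim_drop[of p1 p quot_ann "Suc q"] p1 kd p'(1) by auto
          then show False using eq by simp
        qed
      qed
      then show False using p(2) eq dim by (simp add: \<Pi>_def)
    qed
    then have "krull_dim_above p \<le> enat q" using le by (cases "krull_dim_above p") auto
    then have "deg_less d (cp p) q" using hilbert_prime_deg[OF p'(1) _ cp[OF p'(1)]] by blast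
    then show ?thesis using tdeg_\<kappa> unfolding deg_less_def by (metis less_irrefl)
  qed
  have "(\<Sum>p\<leftarrow>ps. cp p \<kappa>) = (\<Sum>p\<in>set ps. real (count_list ps p) * cp p \<kappa>)"
  proof (induction ps)
    case (Cons p ps)
    have "(\<Sum>x\<in>set (p # ps). real (count_list (p # ps) x) * cp x \<kappa>)
        = (\<Sum>x\<in>set (p # ps). real (count_list ps x) * cp x \<kappa> + (if x = p then cp x \<kappa> else 0))"
      by (rule sum.cong) (auto simp: algebra_simps)
    also have "\<dots> = (\<Sum>x\<in>set (p # ps). real (count_list ps x) * cp x \<kappa>) + cp p \<kappa>"
      by (simp add: sum.distrib)
    also have "(\<Sum>x\<in>set (p # ps). real (count_list ps x) * cp x \<kappa>) = (\<Sum>x\<in>set ps. real (count_list ps x) * cp x \<kappa>)"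
      by (rule sum.mono_neutral_right) (auto simp: count_list_0_iff)
    finally show ?case using Cons by simp
  qed simp
  also have "\<dots> = (\<Sum>p\<in>set ps \<union> \<Pi>. real (count_list ps p) * cp p \<kappa>)"
    by (rule sum.mono_neutral_left) (auto simp: fin count_list_0_iff)
  also have "\<dots> = (\<Sum>p\<in>\<Pi>. real (count_list ps p) * cp p \<kappa>)"
    by (rule sum.mono_neutral_right) (use vanish fin in auto)
  finally have "c \<kappa> * F = (\<Sum>p\<in>\<Pi>. real (count_list ps p) * (cp p \<kappa> * F))"
    unfolding c_\<kappa> by (simp add: sum_distrib_right mult.assoc)
  also have "\<dots> = (\<Sum>p\<in>\<Pi>. real (the_enat (loc_length scale p UNIV {0})) * mixed_mult (*) UNIV p (idl_set (I 0)) Is d k0 k)"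
  proof (rule sum.cong[OF refl])
    fix p assume p: "p \<in> \<Pi>"
    then have p': "prime_ideal p" "minimal_prime_over quot_ann p" "krull_dim_above p = enat (Suc q)"
      using dim by (auto simp: \<Pi>_def minimal_prime_over_def)
    have c': "eventually_poly d (R.hilbert_fun (\<lambda>n. R.rees UNIV n \<oplus> p)) (cp p)"
      using cp[OF p'(1)] by (simp only: hilbert_prime_def)
    have mm: "mixed_mult (*) UNIV p (idl_set (I 0)) Is d k0 k = cp p \<kappa> * F"
      if "deg_less d (cp p) (q_L (*) UNIV p Is d)"
      using R.mixed_mult_eq[OF Is prime_idealD(1)[OF p'(1)] c' that] unfolding \<kappa>_def F_def by (simp add: mult.assoc)
    show "real (count_list ps p) * (cp p \<kappa> * F)
        = real (the_enat (loc_length scale p UNIV {0})) * mixed_mult (*) UNIV p (idl_set (I 0)) Is d k0 k"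
    \<comment> \<open>If p contains I, the coefficient function is zero and meets every degree
      bound, so both sides vanish whatever the multiplicity.\<close>
    proof (cases "idl_set prod_ideal \<subseteq> p")
      case True
      then have "cp p = (\<lambda>_. 0)" by (rule hilbert_prime_zero[OF p'(1) _ cp[OF p'(1)]])
      then show ?thesis using mm by (simp add: deg_less_def)
    next
      case False
      \<comment> \<open>A prime not containing I has no I-power torsion modulo itself, so
        \<open>q_L\<close> for R/p is the dimension of R/p, the same as for N.\<close>
      have "colon_inf (*) (idl_set prod_ideal) UNIV p = p"
      proof (intro subset_antisym subsetI)
        fix a assume "a \<in> colon_inf (*) (idl_set prod_ideal) UNIV p"
        then obtain m where m: "\<forall>r\<in>idl_set (prod_ideal ^ m). r * a \<in> p" by (auto simp: colon_inf_def ideal_pow_idl)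
        obtain y where y: "y \<in> idl_set prod_ideal" "y \<notin> p" using False by blast
        have "y ^ m * a \<in> p" using m power_mem_idl[OF y(1)] by blast
        then show "a \<in> p" using prime_idealD(3)[OF p'(1)] prime_ideal_power[OF p'(1)] y(2) by blast
      next
        fix a assume "a \<in> p"
        then show "a \<in> colon_inf (*) (idl_set prod_ideal) UNIV p"
          using ring.subspace_scale[OF prime_idealD(1)[OF p'(1)]] by (auto simp: colon_inf_def)
      qed
      moreover have "ann (*) UNIV p = p"
      proof (intro subset_antisym subsetI)
        fix a assume "a \<in> ann (*) UNIV p"
        then have "a * 1 \<in> p" by (simp only: ann_def mem_Collect_eq UNIV_I ball_UNIV)
        then show "a \<in> p" by simp
      next
        fix a assume "a \<in> p"
        then show "a \<in> ann (*) UNIV p"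
          using ring.subspace_scale[OF prime_idealD(1)[OF p'(1)]] by (auto simp: ann_def mult.commute[of a])
      qed
      ultimately have "q_L (*) UNIV p Is d = Suc q"
        unfolding q_L_def Pset mod_dim_def using p'(3) by simp
      moreover have "deg_less d (cp p) (Suc q)" by (rule hilbert_prime_deg[OF p'(1) _ cp[OF p'(1)]]) (simp add: p'(3))
      ultimately show ?thesis using mm len[OF p'(2) False] by simp
    qed
  qed
  finally show ?thesis using lhs by (simp only: \<Pi>_def)
qed

end

theorem theorem3p2:
  fixes scale :: "'a::comm_ring_1 \<Rightarrow> 'b::ab_group_add \<Rightarrow> 'b"
    and \<n> J :: "'a set" and Is :: "nat \<Rightarrow> 'a set" and d k0 :: nat and k :: "nat \<Rightarrow> nat"
  assumes noeth: "noetherian_ring TYPE('a)"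
    and local: "local_ring_with_max \<n>"
    and residue: "infinite_residue_field \<n>"
    and ideals: "\<forall>i\<in>{1..d}. ideal (Is i)"
    and J_primary: "primary_to J \<n>"
    and N_module: "module scale"
    and N_fg: "\<exists>S. finite S \<and> module.span scale S = UNIV"
    and I_not_in_rad: "\<not> ideal_prod_upto Is d \<subseteq> radical (ann scale UNIV {0})"
    and k_sum: "k0 + (\<Sum>i=1..d. k i) + 1
                  = the_enat (mod_dim scale UNIV (colon_inf scale (ideal_prod_upto Is d) UNIV {0}))"
  shows "mixed_mult scale UNIV {0} J Is d k0 k =
    (\<Sum>p\<in>{p. minimal_prime_over (ann scale UNIV (colon_inf scale (ideal_prod_upto Is d) UNIV {0})) p
              \<and> krull_dim_above p = mod_dim scale UNIV (colon_inf scale (ideal_prod_upto Is d) UNIV {0})}.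
       real (the_enat (loc_length scale p UNIV {0})) * mixed_mult (*) UNIV p J Is d k0 k)"
proof -
  \<comment> \<open>Position 0 of the family carries \<open>J\<close>, so that J and the I_i are
    treated as one multi-index.\<close>
  define I where "I i = (if i = 0 then Abs_idl J else Abs_idl (Is i))" for i
  have "ideal J" using J_primary by (simp add: primary_to_def primary_ideal_def)
  then have J: "idl_set (I 0) = J" by (simp add: I_def Abs_idl_inverse)
  have Is: "\<forall>i\<in>{1..d}. Is i = idl_set (I i)" using ideals by (auto simp: I_def Abs_idl_inverse)
  obtain S where "finite S" "module.span scale S = UNIV" using N_fg by blast
  then have "noetherian_module scale" by (rule module.noetherian_module_finite_span[OF N_module noeth])
  then interpret local_family scale I d \<n>
    using noeth local J_primary
    by (intro local_family.intro ideal_family.intro ideal_family_axioms.intro local_family_axioms.intro) (simp_all add: J)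
  have "colon_inf scale (ideal_prod_upto Is d) UNIV {0} = torsion"
    unfolding torsion_def prod_ideal_def ideal_prod_upto_idl[OF Is] ..
  then show ?thesis using mixed_mult_associativity[OF Is, of k0 k] k_sum by (simp only: J)
qed

end
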